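(* For $j\in\mathbb Z_{>0}$ and $\nu\in\mathbb C\smallsetminus\mathbb Z$, $$W_{2j+2}(\nu)=\sum_{m=0}^\infty\left[\frac{\Gamma\left(\frac{\nu}{2}+1\right)}{\Gamma(m+1)\,\Gamma\left(\frac{\nu}{2}-m+1\right)}\right]^2W_{2j+1}(\nu-2m).$$ Moreover, this formula extends to all $\nu\in\mathbb C\smallsetminus(2\mathbb Z_{<0})$ by continuity. When $\nu/2\in\mathbb Z_{\ge0}$, the series on the right-hand side truncates to a finite sum, due to the poles of $\Gamma\left(\frac{\nu}{2}-m+1\right)$.
   Context: For an integer $n\ge2$, Pearson's $n$-step ramble integral is $$W_n(s)=\int_0^1dt_1\cdots\int_0^1dt_n\left|\sum_{k=1}^n e^{2\pi i t_k}\right|^s,$$ convergent for $\operatorname{Re}s>0$; $W_n(s)$ also denotes its meromorphic continuation to the complex plane, whose only possible singularities are poles at certain negative integers. $\Gamma$ is Euler's gamma function, and $2\mathbb Z_{<0}=\{-2,-4,-6,\dots\}$.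
   Formalization: The series diverges for nonintegral ν with Re ν ≤ −(j+1) (e.g. j=1, ν=−5/2). Convergence to W_{2j+2}(ν) is proved for Re ν > −(j+1), and for odd ν<0 if j is odd, always off 2Z_{<0}; for other ν the right side means its meromorphic continuation in ν (value 0 at poles). *)

theory Defs
  imports "HOL-Complex_Analysis.Complex_Analysis" "HOL-Probability.Probability"
begin

text \<open>
  A nicely meromorphic function takes the value 0 at its poles and is continuous elsewhere, so a
  meromorphic function on the plane extending \<open>f\<close> from the right half-plane is unique once it is
  required to be nicely meromorphic.
\<close>
definition meromorphic_continuation :: "(complex \<Rightarrow> complex) \<Rightarrow> complex \<Rightarrow> complex" where
  "meromorphic_continuation f =
     (THE g. g nicely_meromorphic_on UNIV \<and> (\<forall>s. Re s > 0 \<longrightarrow> g s = f s))"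

definition ramble_integral :: "nat \<Rightarrow> complex \<Rightarrow> complex" where
  "ramble_integral n s =
     (LINT t | Pi\<^sub>M {1..n} (\<lambda>_. restrict_space lborel {0..1}).
        complex_of_real (norm (\<Sum>k = 1..n. exp (2 * of_real pi * \<i> * complex_of_real (t k)))) powr s)"

definition ramble :: "nat \<Rightarrow> complex \<Rightarrow> complex" where
  "ramble n = meromorphic_continuation (ramble_integral n)"

text \<open>
  \<open>rGamma\<close> is the entire function \<open>1 / Gamma\<close>: it vanishes at the poles of \<open>Gamma\<close>. When \<open>\<nu> / 2\<close>
  is a natural number and \<open>m > \<nu> / 2\<close>, its square cancels the pole of \<open>ramble (2 * j + 1)\<close> at
  \<open>\<nu> - 2 * m\<close>, so the term extends continuously with value 0 there.
\<close>
definition ramble_term :: "nat \<Rightarrow> complex \<Rightarrow> nat \<Rightarrow> complex" where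
  "ramble_term j \<nu> m =
     (Gamma (\<nu> / 2 + 1) * (rGamma (of_nat m + 1) * rGamma (\<nu> / 2 - of_nat m + 1)))\<^sup>2
       * ramble (2 * j + 1) (\<nu> - 2 * of_nat m)"

definition neg_even :: "complex set" where
  "neg_even = {- 2 * of_nat k |k. k > 0}"

text \<open>
  For generic \<open>\<nu>\<close> the terms of the series behave like a nonzero multiple of
  \<open>m powr (- \<nu> - j - 2)\<close>, so the series converges for \<open>Re \<nu> > - (j + 1)\<close> and in general
  diverges to the left of this half-plane. The exception is odd \<open>j\<close> and odd \<open>\<nu>\<close>, where the
  coefficients of all such power-type contributions vanish and the terms decay exponentially.
\<close>
definition ramble_series_domain :: "nat \<Rightarrow> complex set" where
  "ramble_series_domain j =
     {\<nu>. Re \<nu> > - (real j + 1) \<or> (odd j \<and> (\<exists>k::nat. \<nu> = - of_nat (2 * k + 1)))} - neg_even"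

end

theory Submission
  imports Defs "HOL-Real_Asymp.Real_Asymp"
begin

text \<open>
  The proof rests on Mellin transforms. Let \<open>J\<close> be the Bessel function of order 0. Averaging over the
  directions of independent unit steps gives the expectation \<open>J(y)^n\<close> for \<open>J(|S| * y)\<close>, where \<open>S\<close>
  is the sum of \<open>n\<close> steps. Integrating against \<open>y powr (- s - 1)\<close> therefore turns the moments of
  \<open>|S|\<close> into the Mellin transform of \<open>J^n - 1\<close>, up to the explicit factor \<open>mellin_factor\<close>
  (\<open>ramble_integral_mellin\<close>).

  On the negative imaginary axis the modified Bessel function \<open>I\<close> restricts to \<open>J\<close>, and there it is
  the sum of \<open>X\<close>, a multiple of the modified Bessel function \<open>K\<close>, and the conjugate of \<open>X\<close>
  (\<open>besselI_eq_besselK_imaginary\<close>). In the binomial expansion of the odd power \<open>J^(2j + 1)\<close> one half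
  of the terms contains more factors \<open>X\<close> than conjugates, and the other half is conjugate to it. The
  first half decays in the fourth quadrant, even after multiplication by one more factor \<open>I\<close>. So its
  integral can be rotated to the positive axis (\<open>mellin_besselJ_power_rotated\<close>). In this way the left
  half plane values for \<open>2j + 1\<close> and \<open>2j + 2\<close> steps become Mellin integrals of the same kernel, in
  the second case with the additional factor \<open>I(y)\<close>.

  Expanding this factor into its power series with terms \<open>(y / 2)^(2m) / (fact m)^2\<close> and integrating
  termwise shifts the argument by \<open>2m\<close> and yields the series of the theorem; the squared binomial
  coefficient is what remains of the quotient of the factors at \<open>\<nu> - 2m\<close> and \<open>\<nu>\<close>
  (\<open>ramble_term_eq\<close>, \<open>ramble_term_tail_sums\<close>). The terms of the power series are positive, so
  convergence of the series is convergence of one integral. To the right of the imaginary axis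
  finitely many terms are split off and the identity theorem is applied (\<open>ramble_term_sums\<close>).

  It remains to know \<open>ramble (2 * j + 2)\<close> as a meromorphic function on the whole plane. The integrand
  of the rotated integral is a power of \<open>I(y) * K(y)\<close> with a phase, plus an exponentially small
  remainder. The function \<open>y * I(y) * K(y)\<close> has an asymptotic expansion in powers of \<open>1 / y^2\<close>
  (\<open>even_asym_besselv\<close>), which continues the integral with poles at \<open>- (j + 1) - 2l\<close> only
  (\<open>ramble_even\<close>). For odd \<open>j\<close> and odd negative \<open>\<nu>\<close> the phases of the leading part cancel
  (\<open>even_phase_cancels\<close>), which explains the isolated points of the domain of convergence.
\<close>

section \<open>Holomorphic dependence of exponential integrals\<close>

text \<open>The quadratic remainder is what bounds the difference quotient of an exponential integral by an
  integrable function.\<close>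
lemma exp_sub_linear_bound:
  fixes z :: complex
  shows "norm (exp z - 1 - z) \<le> (norm z)\<^sup>2 * exp (norm z)"
proof -
  have "norm (exp z - (\<Sum>k\<le>1. z ^ k / fact k)) \<le> exp \<bar>Re z\<bar> * (norm z ^ Suc 1) / fact 1"
    by (rule Taylor_exp)
  also have "\<dots> = (norm z)\<^sup>2 * exp \<bar>Re z\<bar>" by (simp add: power2_eq_square)
  also have "\<dots> \<le> (norm z)\<^sup>2 * exp (norm z)"
    by (intro mult_left_mono) (auto simp: abs_Re_le_cmod)
  finally show ?thesis by (simp add: algebra_simps)
qed

text \<open>Between the two abscissae the integrand is dominated by the sum of its absolute values at both
  ends, with room to spare on either side. The spare exponential absorbs the factor \<open>l
  x\<close> and the second-order remainder of the difference quotient, so one argument gives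
  convergence and differentiation under the integral. Mellin integrals and the integral
  representations of Bessel functions are instances.\<close>
theorem exp_integral:
  fixes g :: "'a \<Rightarrow> complex" and l :: "'a \<Rightarrow> real"
  assumes g [measurable]: "g \<in> borel_measurable M" and l [measurable]: "l \<in> borel_measurable M"
    and a: "integrable M (\<lambda>x. norm (g x) * exp (a * l x))"
    and b: "integrable M (\<lambda>x. norm (g x) * exp (b * l x))"
    and s: "a < Re s" "Re s < b"
  shows exp_integral_integrable: "integrable M (\<lambda>x. g x * exp (s * of_real (l x)))" (is ?I)
    and exp_integral_integrable_deriv: "integrable M (\<lambda>x. g x * of_real (l x) * exp (s * of_real (l x)))" (is ?J)
    and exp_integral_has_derivative:
      "((\<lambda>s. LINT x|M. g x * exp (s * of_real (l x))) has_field_derivative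
         (LINT x|M. g x * of_real (l x) * exp (s * of_real (l x)))) (at s)" (is ?D)
proof -
  define d where "d = min (Re s - a) (b - Re s) / 2"
  have d: "d > 0" "a + 2 * d \<le> Re s" "Re s + 2 * d \<le> b"
    using s by (auto simp: d_def min_def)
  define D where "D x = norm (g x) * exp (a * l x) + norm (g x) * exp (b * l x)" for x
  have D: "integrable M D" unfolding D_def using a b by simp
  have D0: "D x \<ge> 0" for x by (simp add: D_def)
  have dom: "norm (g x) * exp (t * l x + u * \<bar>l x\<bar>) \<le> D x"
    if "t = Re s" "u \<le> 2 * d" for x t u
  proof -
    have "t * l x + u * \<bar>l x\<bar> \<le> (if l x \<ge> 0 then b * l x else a * l x)"
    proof (cases "l x \<ge> 0")
      case True
      have "t * l x + u * \<bar>l x\<bar> = (t + u) * l x" using True by (simp add: algebra_simps)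
      also have "\<dots> \<le> b * l x" using True that d by (intro mult_right_mono) auto
      finally show ?thesis using True by simp
    next
      case False
      have "t * l x + u * \<bar>l x\<bar> = (t - u) * l x" using False by (simp add: algebra_simps)
      also have "\<dots> \<le> a * l x" using False that d by (intro mult_right_mono_neg) auto
      finally show ?thesis using False by simp
    qed
    hence "exp (t * l x + u * \<bar>l x\<bar>) \<le> exp (a * l x) + exp (b * l x)"
      by (smt (verit, best) exp_gt_zero exp_le_cancel_iff)
    thus ?thesis unfolding D_def
      by (metis distrib_left mult_left_mono norm_ge_zero)
  qed
  have nexp: "norm (exp (z * of_real t)) = exp (Re z * t)" for z :: complex and t :: real
    by (simp add: norm_exp_eq_Re)
  have I: "integrable M (\<lambda>x. g x * exp (z * of_real (l x)))"
    if z: "norm (z - s) \<le> d" for z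
  proof (rule Bochner_Integration.integrable_bound[OF D])
    show "AE x in M. norm (g x * exp (z * of_real (l x))) \<le> norm (D x)"
    proof (intro AE_I2)
      fix x
      have "\<bar>Re z - Re s\<bar> \<le> d" using z abs_Re_le_cmod[of "z - s"] by simp
      hence "\<bar>Re z - Re s\<bar> * \<bar>l x\<bar> \<le> d * \<bar>l x\<bar>" by (rule mult_right_mono) simp
      moreover have "(Re z - Re s) * l x \<le> \<bar>Re z - Re s\<bar> * \<bar>l x\<bar>"
        by (metis abs_ge_self abs_mult)
      ultimately have "Re z * l x \<le> Re s * l x + d * \<bar>l x\<bar>" by (simp add: algebra_simps)
      hence "norm (g x * exp (z * of_real (l x))) \<le> norm (g x) * exp (Re s * l x + d * \<bar>l x\<bar>)"
        by (simp add: norm_mult nexp mult_left_mono)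
      also have "\<dots> \<le> D x" using d by (intro dom) auto
      finally show "norm (g x * exp (z * of_real (l x))) \<le> norm (D x)" using D0[of x] by simp
    qed
  qed measurable
  show ?I using I[of s] d by simp
  have l1: "\<bar>l x\<bar> \<le> exp (d * \<bar>l x\<bar>) / d" for x
  proof -
    have "d * \<bar>l x\<bar> \<le> exp (d * \<bar>l x\<bar>)" using exp_ge_add_one_self[of "d * \<bar>l x\<bar>"] by linarith
    thus ?thesis using d by (simp add: field_simps)
  qed
  show ?J
  proof (rule Bochner_Integration.integrable_bound[of M "\<lambda>x. D x / d"])
    show "AE x in M. norm (g x * of_real (l x) * exp (s * of_real (l x))) \<le> norm (D x / d)"
    proof (intro AE_I2)
      fix x
      have "norm (g x * of_real (l x) * exp (s * of_real (l x))) = norm (g x) * \<bar>l x\<bar> * exp (Re s * l x)"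
        by (simp add: norm_mult nexp)
      also have "\<dots> \<le> norm (g x) * (exp (d * \<bar>l x\<bar>) / d) * exp (Re s * l x)"
        by (intro mult_right_mono mult_left_mono l1) auto
      also have "\<dots> = norm (g x) * exp (Re s * l x + d * \<bar>l x\<bar>) / d"
        by (simp add: exp_add)
      also have "\<dots> \<le> D x / d" using d by (intro divide_right_mono dom) auto
      finally show "norm (g x * of_real (l x) * exp (s * of_real (l x))) \<le> norm (D x / d)"
        using D0[of x] d by simp
    qed
  qed (use D in simp_all)
  define F where "F z = (LINT x|M. g x * exp (z * of_real (l x)))" for z
  define F' where "F' = (LINT x|M. g x * of_real (l x) * exp (s * of_real (l x)))"
  have est: "norm ((F (s + h) - F s) / h - F') \<le> norm h * (2 * (LINT x|M. D x) / d\<^sup>2)"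
    if h: "h \<noteq> 0" "norm h < d" for h
  proof -
    have "F (s + h) - F s - h * F' =
      (LINT x|M. g x * exp (s * of_real (l x)) * (exp (h * of_real (l x)) - 1 - h * of_real (l x)))"
    proof -
      have "(LINT x|M. g x * exp ((s+h) * of_real (l x)) - g x * exp (s * of_real (l x))
             - h * (g x * of_real (l x) * exp (s * of_real (l x)))) = F (s + h) - F s - h * F'"
        unfolding F_def F'_def using I[of "s+h"] I[of s] h d \<open>?J\<close>
        by (subst Bochner_Integration.integral_diff; (subst Bochner_Integration.integral_diff)?) auto
      also have "(\<lambda>x. g x * exp ((s+h) * of_real (l x)) - g x * exp (s * of_real (l x))
             - h * (g x * of_real (l x) * exp (s * of_real (l x)))) =
           (\<lambda>x. g x * exp (s * of_real (l x)) * (exp (h * of_real (l x)) - 1 - h * of_real (l x)))"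
        by (auto simp: algebra_simps exp_add)
      finally show ?thesis by simp
    qed
    also have "norm \<dots> \<le> (LINT x|M. norm (g x * exp (s * of_real (l x)) * (exp (h * of_real (l x)) - 1 - h * of_real (l x))))"
      by (rule integral_norm_bound)
    also have "\<dots> \<le> (LINT x|M. (norm h)\<^sup>2 * (2 * D x / d\<^sup>2))"
    proof (rule integral_mono')
      show "integrable M (\<lambda>x. (norm h)\<^sup>2 * (2 * D x / d\<^sup>2))" using D by simp
      show "norm (g x * exp (s * of_real (l x)) * (exp (h * of_real (l x)) - 1 - h * of_real (l x)))
              \<le> (norm h)\<^sup>2 * (2 * D x / d\<^sup>2)" for x
      proof -
        let ?q = "d * \<bar>l x\<bar>"
        have q: "0 \<le> ?q" using d by simp
        have "norm (exp (h * of_real (l x)) - 1 - h * of_real (l x)) \<le>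
               (norm (h * of_real (l x)))\<^sup>2 * exp (norm (h * of_real (l x)))"
          by (rule exp_sub_linear_bound)
        also have "\<dots> \<le> (norm h * \<bar>l x\<bar>)\<^sup>2 * exp ?q"
          using h by (auto simp: norm_mult intro!: mult_left_mono mult_right_mono)
        also have "\<dots> = (norm h)\<^sup>2 / d\<^sup>2 * (?q\<^sup>2 * exp ?q)" using d by (simp add: power_mult_distrib)
        also have "?q\<^sup>2 \<le> 2 * exp ?q"
          using exp_lower_Taylor_quadratic[OF q] q by (simp add: power2_eq_square)
        hence "(norm h)\<^sup>2 / d\<^sup>2 * (?q\<^sup>2 * exp ?q) \<le> (norm h)\<^sup>2 / d\<^sup>2 * ((2 * exp ?q) * exp ?q)"
          by (intro mult_left_mono mult_right_mono) auto
        also have "\<dots> = 2 * (norm h)\<^sup>2 / d\<^sup>2 * exp (2 * d * \<bar>l x\<bar>)"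
          by (simp add: mult_exp_exp)
        finally have e: "norm (exp (h * of_real (l x)) - 1 - h * of_real (l x)) \<le> 
            2 * (norm h)\<^sup>2 / d\<^sup>2 * exp (2 * d * \<bar>l x\<bar>)" .
        have "norm (g x * exp (s * of_real (l x)) * (exp (h * of_real (l x)) - 1 - h * of_real (l x)))
           \<le> norm (g x) * exp (Re s * l x) * (2 * (norm h)\<^sup>2 / d\<^sup>2 * exp (2 * d * \<bar>l x\<bar>))"
          unfolding norm_mult nexp by (intro mult_left_mono e) auto
        also have "\<dots> = (norm h)\<^sup>2 * (2 * (norm (g x) * exp (Re s * l x + (2 * d) * \<bar>l x\<bar>))) / d\<^sup>2"
          by (simp add: exp_add)
        also have "\<dots> \<le> (norm h)\<^sup>2 * (2 * D x) / d\<^sup>2"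
          by (intro divide_right_mono mult_left_mono dom) auto
        finally show ?thesis by simp
      qed
    qed (simp add: D0)
    finally have "norm (F (s + h) - F s - h * F') \<le> norm h * (norm h * (2 * (LINT x|M. D x) / d\<^sup>2))"
      using D by (simp add: power2_eq_square field_simps)
    moreover have "(F (s + h) - F s) / h - F' = (F (s + h) - F s - h * F') / h"
      using h by (simp add: field_simps)
    ultimately show ?thesis using h by (simp add: norm_divide field_simps)
  qed
  have "(\<lambda>h. (F (s + h) - F s) / h - F') \<midarrow>0\<rightarrow> 0"
  proof (rule Lim_null_comparison)
    show "\<forall>\<^sub>F h in at 0. norm ((F (s + h) - F s) / h - F') \<le> norm h * (2 * (LINT x|M. D x) / d\<^sup>2)"
      unfolding eventually_at using d by (intro exI[of _ d]) (use est in \<open>auto simp: field_simps\<close>)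
    show "(\<lambda>h::complex. norm h * (2 * (LINT x|M. D x) / d\<^sup>2)) \<midarrow>0\<rightarrow> 0"
      using d by (auto intro!: tendsto_eq_intros)
  qed
  hence "(F has_field_derivative F') (at s)"
    unfolding DERIV_def by (rule LIM_zero_cancel)
  thus ?D unfolding F_def F'_def .
qed

section \<open>Mellin transforms\<close>

text \<open>The sign of the exponent is chosen so that \<open>s\<close> is the exponent of the moments
  \<open>|z| powr s\<close> and not its negative.\<close>
definition mellin :: "(real \<Rightarrow> complex) \<Rightarrow> complex \<Rightarrow> complex" where
  "mellin f s = (LINT y:{0<..}|lborel. f y * of_real y powr (- s - 1))"

text \<open>Convergence is absolute and depends only on the real part \<open>\<sigma>\<close> of the
  argument. Measurability is asked of \<open>f\<close> itself so that the integrand is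
  measurable at every complex argument with that real part.\<close>
definition mellin_conv :: "(real \<Rightarrow> complex) \<Rightarrow> real \<Rightarrow> bool" where
  "mellin_conv f \<sigma> \<longleftrightarrow> set_borel_measurable lborel {0<..} f \<and>
     set_integrable lborel {0<..} (\<lambda>y. norm (f y) * y powr (- \<sigma> - 1))"

lemma set_integrable_powr_0_1:
  assumes "e > (-1::real)"
  shows "set_integrable lborel {0<..1} (\<lambda>y. y powr e)"
proof -
  have "(\<lambda>y. y powr e) absolutely_integrable_on {0..1}"
    using assms by (intro nonnegative_absolutely_integrable_1 integrable_on_powr_from_0) auto
  hence "(\<lambda>y. y powr e) absolutely_integrable_on {0<..1}"
    by (rule set_integrable_subset) auto
  thus ?thesis unfolding set_integrable_def
    by (subst (asm) integrable_completion) auto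
qed

lemma set_integrable_powr_at_top:
  assumes "e < (-1::real)"
  shows "set_integrable lborel {1..} (\<lambda>y. y powr e)"
proof -
  have "(\<lambda>y. y powr e) absolutely_integrable_on {1..}"
    using has_integral_powr_to_inf[of e 1] assms
    by (intro nonnegative_absolutely_integrable_1) (auto simp: integrable_on_def)
  thus ?thesis unfolding set_integrable_def
    by (subst (asm) integrable_completion) auto
qed

lemma set_integrable_two_powr_bound:
  fixes f :: "real \<Rightarrow> 'b :: {banach, second_countable_topology}"
  assumes m: "set_borel_measurable lborel {0<..} f"
    and 0: "\<And>y. 0 < y \<Longrightarrow> y \<le> 1 \<Longrightarrow> norm (f y) \<le> C * y powr p"
    and 1: "\<And>y. y \<ge> 1 \<Longrightarrow> norm (f y) \<le> C' * y powr q"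
    and "q < -1" "-1 < p"
  shows "set_integrable lborel {0<..} f"
proof -
  have "set_integrable lborel {0<..1} (\<lambda>y. C * y powr p)"
    using set_integrable_powr_0_1[of p] assms by simp
  hence i0: "set_integrable lborel {0<..1} f"
    by (rule set_integrable_bound)
       (use 0 in \<open>auto simp: intro: set_borel_measurable_subset[OF m] order.trans[OF _ abs_ge_self]\<close>)
  have "set_integrable lborel {1..} (\<lambda>y. C' * y powr q)"
    using set_integrable_powr_at_top[of q] assms by simp
  hence "set_integrable lborel {1..} f"
    by (rule set_integrable_bound)
       (use 1 in \<open>auto simp: intro: set_borel_measurable_subset[OF m] order.trans[OF _ abs_ge_self]\<close>)
  with i0 have "set_integrable lborel ({0<..1} \<union> {1..}) f"
    by (rule set_integrable_Un) auto
  also have "{0<..1} \<union> {1..} = {0::real<..}" by auto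
  finally show ?thesis .
qed

lemma set_borel_measurable_times:
  fixes f g :: "real \<Rightarrow> 'b :: {real_normed_algebra, second_countable_topology}"
  assumes "set_borel_measurable M A f" "set_borel_measurable M A g"
  shows "set_borel_measurable M A (\<lambda>x. f x * g x)"
proof -
  have "(\<lambda>x. (indicator A x *\<^sub>R f x) * (indicator A x *\<^sub>R g x)) \<in> borel_measurable M"
    using assms unfolding set_borel_measurable_def by measurable
  also have "(\<lambda>x. (indicator A x *\<^sub>R f x) * (indicator A x *\<^sub>R g x)) = (\<lambda>x. indicator A x *\<^sub>R (f x * g x))"
    by (auto simp: indicator_def fun_eq_iff)
  finally show ?thesis unfolding set_borel_measurable_def .
qed

lemma set_borel_measurable_norm:
  fixes f :: "real \<Rightarrow> 'b :: {real_normed_vector, second_countable_topology}"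
  assumes "set_borel_measurable M A f"
  shows "set_borel_measurable M A (\<lambda>x. norm (f x))"
proof -
  have "(\<lambda>x. norm (indicator A x *\<^sub>R f x)) \<in> borel_measurable M"
    using assms unfolding set_borel_measurable_def by measurable
  thus ?thesis unfolding set_borel_measurable_def by simp
qed

lemma set_borel_measurable_cont:
  fixes f :: "real \<Rightarrow> 'b :: real_normed_vector"
  assumes "continuous_on A f" "A \<in> sets borel"
  shows "set_borel_measurable lborel A f"
  using borel_measurable_continuous_on_indicator[OF assms(2,1)] 
  unfolding set_borel_measurable_def by simp

text \<open>A power bound with exponent above \<open>\<sigma>\<close> controls the integral at 0, one with
  exponent below \<open>\<sigma>\<close> controls it at infinity. All convergence statements
  below are reduced to two such bounds.\<close>
lemma mellin_conv_bound:
  assumes m: "set_borel_measurable lborel {0<..} f"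
    and 0: "\<And>y. 0 < y \<Longrightarrow> y \<le> 1 \<Longrightarrow> norm (f y) \<le> C * y powr p"
    and 1: "\<And>y. y \<ge> 1 \<Longrightarrow> norm (f y) \<le> C' * y powr q"
    and "q < \<sigma>" "\<sigma> < p"
  shows "mellin_conv f \<sigma>"
  unfolding mellin_conv_def
proof (intro conjI m set_integrable_two_powr_bound[where C = C and C' = C' and p = "p - \<sigma> - 1" and q = "q - \<sigma> - 1"])
  have "set_borel_measurable lborel {0<..} (\<lambda>y. norm (f y))"
    by (rule set_borel_measurable_norm[OF m])
  moreover have "set_borel_measurable lborel {0<..} (\<lambda>y::real. y powr (- \<sigma> - 1))"
    by (intro set_borel_measurable_cont continuous_intros) auto
  ultimately show "set_borel_measurable lborel {0<..} (\<lambda>y. norm (f y) * y powr (- \<sigma> - 1))"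
    by (rule set_borel_measurable_times)
next
  fix y :: real assume y: "0 < y" "y \<le> 1"
  have "norm (f y) * y powr (-\<sigma>-1) \<le> C * y powr p * y powr (-\<sigma>-1)"
    using 0[OF y] by (rule mult_right_mono) simp
  also have "\<dots> = C * y powr (p - \<sigma> - 1)"
    by (simp add: mult.assoc flip: powr_add) (simp add: algebra_simps)
  finally show "norm (norm (f y) * y powr (-\<sigma>-1)) \<le> C * y powr (p - \<sigma> - 1)" by simp
next
  fix y :: real assume y: "1 \<le> y"
  have "norm (f y) * y powr (-\<sigma>-1) \<le> C' * y powr q * y powr (-\<sigma>-1)"
    using 1[OF y] by (rule mult_right_mono) simp
  also have "\<dots> = C' * y powr (q - \<sigma> - 1)"
    by (simp add: mult.assoc flip: powr_add) (simp add: algebra_simps)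
  finally show "norm (norm (f y) * y powr (-\<sigma>-1)) \<le> C' * y powr (q - \<sigma> - 1)" by simp
qed (use assms in auto)

lemma mellin_integrand_measurable:
  assumes "set_borel_measurable lborel {0<..} f"
  shows "set_borel_measurable lborel {0<..} (\<lambda>y. f y * of_real y powr (- s - 1) :: complex)"
  by (intro set_borel_measurable_times assms set_borel_measurable_cont continuous_intros) 
     (auto simp: complex_nonpos_Reals_iff)

lemma mellin_integrable:
  assumes "mellin_conv f (Re s)"
  shows "set_integrable lborel {0<..} (\<lambda>y. f y * of_real y powr (- s - 1))"
proof (rule set_integrable_bound)
  show "set_integrable lborel {0<..} (\<lambda>y. norm (f y) * y powr (- Re s - 1))"
    using assms by (simp add: mellin_conv_def)
  show "set_borel_measurable lborel {0<..} (\<lambda>y. f y * of_real y powr (- s - 1))"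
    using assms by (intro mellin_integrand_measurable) (simp add: mellin_conv_def)
  show "AE x in lborel. x \<in> {0<..} \<longrightarrow> norm (f x * of_real x powr (- s - 1)) \<le> norm (norm (f x) * x powr (- Re s - 1))"
    by (auto simp: norm_mult norm_powr_real_powr)
qed

text \<open>In the variable \<open>ln y\<close> the Mellin integral is an exponential integral.\<close>
lemma mellin_holomorphic:
  assumes "mellin_conv f a" "mellin_conv f b"
  shows "mellin f holomorphic_on {s. a < Re s \<and> Re s < b}"
proof -
  define g where "g y = indicator {0<..} y *\<^sub>R f y / of_real y" for y :: real
  define l where "l y = (if y > 0 then - ln y else 0)" for y :: real
  have [measurable]: "l \<in> borel_measurable lborel" unfolding l_def by measurable
  have m: "set_borel_measurable lborel {0<..} f" using assms by (simp add: mellin_conv_def)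
  have [measurable]: "g \<in> borel_measurable lborel"
    unfolding g_def using m[unfolded set_borel_measurable_def] by measurable
  have i: "integrable lborel (\<lambda>x. norm (g x) * exp (t * l x))" if "mellin_conv f t" for t
  proof -
    have "integrable lborel (\<lambda>y. indicator {0<..} y *\<^sub>R (norm (f y) * y powr (- t - 1)))"
      using that unfolding mellin_conv_def set_integrable_def by simp
    also have "(\<lambda>y. indicator {0<..} y *\<^sub>R (norm (f y) * y powr (- t - 1))) = (\<lambda>x. norm (g x) * exp (t * l x))"
      by (auto simp: fun_eq_iff g_def l_def indicator_def norm_divide powr_diff powr_minus field_simps exp_minus)
         (auto simp: powr_def)
    finally show ?thesis .
  qed
  have eq: "mellin f s = (LINT x|lborel. g x * exp (s * of_real (l x)))" for s
    unfolding mellin_def set_lebesgue_integral_def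
  proof (intro Bochner_Integration.integral_cong refl)
    fix y :: real
    show "indicat_real {0<..} y *\<^sub>R (f y * complex_of_real y powr (- s - 1)) = g y * exp (s * of_real (l y))"
      by (auto simp: g_def l_def indicator_def powr_diff powr_minus field_simps exp_minus)
         (auto simp: powr_def Ln_of_real)
  qed
  show ?thesis
    unfolding holomorphic_on_def eq
  proof safe
    fix s assume "a < Re s" "Re s < b"
    hence "((\<lambda>s. LINT x|lborel. g x * exp (s * of_real (l x))) has_field_derivative
        (LINT x|lborel. g x * of_real (l x) * exp (s * of_real (l x)))) (at s)"
      by (intro exp_integral_has_derivative[OF _ _ i[OF assms(1)] i[OF assms(2)]]) measurable
    thus "(\<lambda>s. LINT x|lborel. g x * exp (s * of_real (l x))) field_differentiable
        at s within {s. a < Re s \<and> Re s < b}"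
      using field_differentiable_def field_differentiable_at_within by blast
  qed
qed

lemma mellin_add:
  assumes "mellin_conv f (Re s)" "mellin_conv g (Re s)"
  shows "mellin (\<lambda>y. f y + g y) s = mellin f s + mellin g s"
  using set_integral_add(2)[OF mellin_integrable[OF assms(1)] mellin_integrable[OF assms(2)]]
  by (simp add: mellin_def algebra_simps)

lemma mellin_cmult: "mellin (\<lambda>y. c * f y) s = c * mellin f s"
  unfolding mellin_def mult.assoc by (rule set_integral_mult_right)

lemma mellin_conv_cmult: "mellin_conv f t \<Longrightarrow> mellin_conv (\<lambda>y. c * f y) t"
  unfolding mellin_conv_def
proof safe
  assume "set_borel_measurable lborel {0<..} f"
  thus "set_borel_measurable lborel {0<..} (\<lambda>y. c * f y)"
    by (intro set_borel_measurable_times) (auto simp: set_borel_measurable_def)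
qed (simp add: norm_mult mult.assoc)

lemma mellin_conv_add:
  assumes "mellin_conv f t" "mellin_conv g t"
  shows "mellin_conv (\<lambda>y. f y + g y) t"
  unfolding mellin_conv_def
proof
  show m: "set_borel_measurable lborel {0<..} (\<lambda>y. f y + g y)"
    using assms unfolding mellin_conv_def set_borel_measurable_def
    by (simp add: scaleR_add_right borel_measurable_add)
  have m2: "set_borel_measurable lborel {0<..} (\<lambda>y. norm (f y + g y))"
    by (rule set_borel_measurable_norm[OF m])
  have "set_integrable lborel {0<..} (\<lambda>y. norm (f y) * y powr (- t - 1) + norm (g y) * y powr (- t - 1))"
    using assms by (intro set_integral_add) (auto simp: mellin_conv_def)
  thus "set_integrable lborel {0<..} (\<lambda>y. norm (f y + g y) * y powr (- t - 1))"
  proof (rule set_integrable_bound)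
    show "set_borel_measurable lborel {0<..} (\<lambda>y. norm (f y + g y) * y powr (- t - 1))"
      by (intro set_borel_measurable_times m2 set_borel_measurable_cont continuous_intros) auto
    have "norm (f x + g x) * x powr (- t - 1) \<le> norm (f x) * x powr (- t - 1) + norm (g x) * x powr (- t - 1)" for x
      using mult_right_mono[OF norm_triangle_ineq[of "f x" "g x"] powr_ge_zero[of x "-t-1"]]
      by (simp add: distrib_right)
    thus "AE x in lborel. x \<in> {0<..} \<longrightarrow> norm (norm (f x + g x) * x powr (- t - 1))
          \<le> norm (norm (f x) * x powr (- t - 1) + norm (g x) * x powr (- t - 1))"
      by (intro AE_I2 impI) simp
  qed
qed

lemma mellin_conv_minus: "mellin_conv f t \<Longrightarrow> mellin_conv (\<lambda>y. - f y) t"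
  using mellin_conv_cmult[of f t "-1"] by simp

text \<open>This shift turns the power series of a factor of the integrand into a series of Mellin
  transforms at shifted arguments.\<close>
lemma mellin_shift:
  "mellin (\<lambda>y. f y * of_real y ^ k) s = mellin f (s - of_nat k)"
  unfolding mellin_def
proof (rule set_lebesgue_integral_cong)
  show "\<forall>x. x \<in> {0<..} \<longrightarrow> f x * of_real x ^ k * of_real x powr (- s - 1) =
     f x * of_real x powr (- (s - of_nat k) - 1)"
  proof safe
    fix x :: real assume "x > 0"
    hence "complex_of_real x ^ k = of_real x powr (of_nat k)" by (simp add: powr_nat')
    thus "f x * of_real x ^ k * of_real x powr (- s - 1) = f x * of_real x powr (- (s - of_nat k) - 1)"
      by (simp add: mult.assoc flip: powr_add) (simp add: algebra_simps)
  qed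
qed auto

section \<open>Rotation of a ray of integration\<close>

text \<open>The directions 1 and \<open>u\<close> enclose at most a right angle, so points of the cone
  cannot be small by cancellation.\<close>
lemma norm_cone_ge:
  assumes "norm u = 1" "Re u \<ge> 0" "a \<ge> 0" "b \<ge> 0"
  shows "norm (of_real a + of_real b * u) \<ge> (a + b) / 2"
proof -
  have u: "(Re u)\<^sup>2 + (Im u)\<^sup>2 = 1" using assms(1) by (simp add: cmod_def)
  have "((a + b) / 2)\<^sup>2 \<le> a\<^sup>2 + b\<^sup>2"
  proof -
    have "(a + b)\<^sup>2 \<le> 2 * (a\<^sup>2 + b\<^sup>2)" using sum_squares_bound[of a b] by (simp add: power2_sum)
    hence "(a + b)\<^sup>2 / 4 \<le> 2 * (a\<^sup>2 + b\<^sup>2) / 4" by (rule divide_right_mono) simp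
    also have "2 * (a\<^sup>2 + b\<^sup>2) / 4 \<le> a\<^sup>2 + b\<^sup>2" by simp
    finally show ?thesis by (simp add: power_divide)
  qed
  also have "\<dots> \<le> a\<^sup>2 + b\<^sup>2 + 2 * a * b * Re u" using assms by simp
  also have "\<dots> = a\<^sup>2 + b\<^sup>2 * ((Re u)\<^sup>2 + (Im u)\<^sup>2) + 2 * a * b * Re u" using u by simp
  also have "\<dots> = (norm (of_real a + of_real b * u))\<^sup>2"
    unfolding cmod_power2 by (simp add: power2_eq_square algebra_simps)
  finally show ?thesis by (rule power2_le_imp_le) simp
qed

text \<open>The integrand has a primitive on the convex domain. Its values at distance \<open>R\<close> on
  the two rays differ by the integral over a chord, and this tends to 0 for small and for large
  \<open>R\<close>, because the integrand is \<open>O(|w| powr -\<beta>)\<close> with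
  \<open>\<beta> < 1\<close> at 0 and \<open>O(|w| powr -\<alpha>)\<close> with \<open>\<alpha>
  > 1\<close> at infinity.\<close>
theorem ray_rotation:
  fixes f :: "complex \<Rightarrow> complex" and u :: complex
  assumes S: "convex S" "open S" "f holomorphic_on S"
    and u: "norm u = 1" "Re u \<ge> 0"
    and cone: "\<And>a b. a \<ge> 0 \<Longrightarrow> b \<ge> 0 \<Longrightarrow> a + b > 0 \<Longrightarrow> of_real a + of_real b * u \<in> S"
    and infty: "\<And>a b. a \<ge> 0 \<Longrightarrow> b \<ge> 0 \<Longrightarrow> norm (of_real a + of_real b * u) \<ge> 1 \<Longrightarrow>
       norm (f (of_real a + of_real b * u)) \<le> C * norm (of_real a + of_real b * u) powr (-\<alpha>)"
    and zero: "\<And>a b. a \<ge> 0 \<Longrightarrow> b \<ge> 0 \<Longrightarrow> a + b > 0 \<Longrightarrow> norm (of_real a + of_real b * u) \<le> 1 \<Longrightarrow>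
       norm (f (of_real a + of_real b * u)) \<le> C * norm (of_real a + of_real b * u) powr (-\<beta>)"
    and \<alpha>: "\<alpha> > 1" and \<beta>: "0 \<le> \<beta>" "\<beta> < 1"
  shows "set_integrable lborel {0<..} (\<lambda>x. f (of_real x))"
    and "set_integrable lborel {0<..} (\<lambda>x. f (u * of_real x))"
    and "(LINT x:{0<..}|lborel. f (of_real x)) = u * (LINT x:{0<..}|lborel. f (u * of_real x))"
proof -
  define ok where "ok v \<longleftrightarrow> (v = 1 \<or> v = u)" for v
  have onray: "v * of_real x \<in> S" if "ok v" "x > 0" for v x
    using that cone[of x 0] cone[of 0 x] by (auto simp: ok_def mult.commute)
  have nv: "norm v = 1" if "ok v" for v using that u by (auto simp: ok_def)
  have cont: "continuous_on {0<..} (\<lambda>x. f (v * of_real x))" if "ok v" for v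
    by (intro continuous_on_compose2[OF holomorphic_on_imp_continuous_on[OF S(3)]] continuous_intros)
       (use onray[OF that] in auto)
  have int: "set_integrable lborel {0<..} (\<lambda>x. f (v * of_real x))" if "ok v" for v
  proof (rule set_integrable_two_powr_bound)
    show "set_borel_measurable lborel {0<..} (\<lambda>x. f (v * of_real x))"
      by (intro set_borel_measurable_cont cont that) auto
    show "norm (f (v * of_real y)) \<le> C * y powr (-\<beta>)" if "0 < y" "y \<le> 1" for y
      using zero[of y 0] zero[of 0 y] that \<open>ok v\<close> nv[OF \<open>ok v\<close>] u
      by (auto simp: ok_def norm_mult mult.commute)
    show "norm (f (v * of_real y)) \<le> C * y powr (-\<alpha>)" if "y \<ge> 1" for y
      using infty[of y 0] infty[of 0 y] that \<open>ok v\<close> nv[OF \<open>ok v\<close>] u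
      by (auto simp: ok_def norm_mult mult.commute)
  qed (use \<alpha> \<beta> in auto)
  show "set_integrable lborel {0<..} (\<lambda>x. f (of_real x))" using int[of 1] by (simp add: ok_def)
  show "set_integrable lborel {0<..} (\<lambda>x. f (u * of_real x))" using int[of u] by (simp add: ok_def)
  obtain g where "\<And>x. x \<in> S \<Longrightarrow> (g has_field_derivative f x) (at x within S)"
    using holomorphic_convex_primitive'[OF S] by metis
  hence g: "(g has_field_derivative f x) (at x)" if "x \<in> S" for x
    using that S(2) by (metis at_within_open)
  have C: "C \<ge> 0" using zero[of 1 0] order.trans[OF norm_ge_zero[of "f 1"]] by simp
  have chord: "norm (g (of_real R) - g (u * of_real R)) \<le> B * (2 * R)"
    if "R > 0" and B: "\<And>a b. a \<ge> 0 \<Longrightarrow> b \<ge> 0 \<Longrightarrow> a + b = R \<Longrightarrow> norm (f (of_real a + of_real b * u)) \<le> B" for R B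
  proof -
    have seg: "\<exists>a b. z = of_real a + of_real b * u \<and> a \<ge> 0 \<and> b \<ge> 0 \<and> a + b = R"
      if "z \<in> closed_segment (of_real R) (u * of_real R)" for z
    proof -
      from that obtain t where t: "0 \<le> t" "t \<le> 1" "z = (1 - t) *\<^sub>R of_real R + t *\<^sub>R (u * of_real R)"
        by (auto simp: in_segment)
      show ?thesis using t \<open>R > 0\<close>
        by (intro exI[of _ "(1 - t) * R"] exI[of _ "t * R"]) (auto simp: scaleR_conv_of_real algebra_simps)
    qed
    have "norm (g (of_real R) - g (u * of_real R)) \<le> B * norm (of_real R - u * of_real R)"
    proof (rule field_differentiable_bound[OF convex_closed_segment])
      fix z assume "z \<in> closed_segment (of_real R) (u * of_real R)"
      from seg[OF this] obtain a b where ab: "z = of_real a + of_real b * u" "a \<ge> 0" "b \<ge> 0" "a + b = R" by auto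
      show "norm (f z) \<le> B" using B[of a b] ab by simp
      show "(g has_field_derivative f z) (at z within closed_segment (of_real R) (u * of_real R))"
        using g[of z] cone[of a b] ab \<open>R > 0\<close> by (auto intro: has_field_derivative_at_within)
    qed auto
    also have "norm (of_real R - u * of_real R) \<le> 2 * R"
      using norm_triangle_ineq4[of "of_real R" "u * of_real R"] u \<open>R > 0\<close> by (simp add: norm_mult)
    hence "B * norm (of_real R - u * of_real R) \<le> B * (2 * R)"
      by (rule mult_left_mono) (use B[of R 0] \<open>R > 0\<close> in \<open>auto intro: order.trans[OF norm_ge_zero]\<close>)
    finally show ?thesis .
  qed
  define h where "h x = g (of_real x) - g (u * of_real x)" for x
  have h_infty: "norm (h R) \<le> C * (R / 2) powr (-\<alpha>) * (2 * R)" if "R \<ge> 2" for R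
    unfolding h_def
  proof (rule chord)
    fix a b :: real assume ab: "a \<ge> 0" "b \<ge> 0" "a + b = R"
    let ?z = "of_real a + of_real b * u"
    have z: "norm ?z \<ge> R / 2" using norm_cone_ge[OF u ab(1,2)] ab by simp
    have "norm (f ?z) \<le> C * norm ?z powr (-\<alpha>)" using infty[of a b] ab z that by simp
    also have "\<dots> \<le> C * (R / 2) powr (-\<alpha>)"
      using C z \<alpha> that by (intro mult_left_mono powr_mono2') auto
    finally show "norm (f ?z) \<le> C * (R / 2) powr (-\<alpha>)" .
  qed (use that in auto)
  have h_zero: "norm (h R) \<le> C * (R / 2) powr (-\<beta>) * (2 * R)" if "R > 0" "R \<le> 1" for R
    unfolding h_def
  proof (rule chord)
    fix a b :: real assume ab: "a \<ge> 0" "b \<ge> 0" "a + b = R"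
    let ?z = "of_real a + of_real b * u"
    have z: "norm ?z \<ge> R / 2" using norm_cone_ge[OF u ab(1,2)] ab by simp
    have "norm ?z \<le> norm (complex_of_real a) + norm (of_real b * u)" by (rule norm_triangle_ineq)
    also have "\<dots> = R" using ab u by (simp add: norm_mult)
    finally have z2: "norm ?z \<le> 1" using that by simp
    have "norm (f ?z) \<le> C * norm ?z powr (-\<beta>)" using zero[of a b] ab z2 that by simp
    also have "\<dots> \<le> C * (R / 2) powr (-\<beta>)"
      using C z \<beta> that by (intro mult_left_mono powr_mono2') auto
    finally show "norm (f ?z) \<le> C * (R / 2) powr (-\<beta>)" .
  qed (use that in auto)
  have h1: "(h \<longlongrightarrow> 0) at_top"
  proof (rule Lim_null_comparison)
    show "\<forall>\<^sub>F R in at_top. norm (h R) \<le> 2 * C * 2 powr \<alpha> * (R powr (1 - \<alpha>))"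
      using eventually_ge_at_top[of "2::real"]
    proof eventually_elim
      case (elim R)
      have "R > 0" using elim by simp
      hence "C * (R / 2) powr (-\<alpha>) * (2 * R) = 2 * C * 2 powr \<alpha> * (R powr (1 - \<alpha>))"
        by (simp add: powr_divide powr_minus powr_diff field_simps)
      thus ?case using h_infty[OF elim] by metis
    qed
    show "((\<lambda>R. 2 * C * 2 powr \<alpha> * (R powr (1 - \<alpha>))) \<longlongrightarrow> 0) at_top"
      using \<alpha> tendsto_neg_powr[of "1 - \<alpha>" "\<lambda>x. x"] by (intro tendsto_mult_right_zero) (auto simp: filterlim_ident)
  qed
  have h0: "(h \<longlongrightarrow> 0) (at_right 0)"
  proof (rule Lim_null_comparison)
    show "\<forall>\<^sub>F R in at_right 0. norm (h R) \<le> 2 * C * 2 powr \<beta> * (R powr (1 - \<beta>))"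
      using eventually_at_right_real[of 0 1, simplified]
    proof eventually_elim
      case (elim R)
      have "C * (R / 2) powr (-\<beta>) * (2 * R) = 2 * C * 2 powr \<beta> * (R powr (1 - \<beta>))"
        using elim by (simp add: powr_divide powr_minus powr_diff field_simps)
      moreover have "norm (h R) \<le> C * (R / 2) powr (-\<beta>) * (2 * R)" using h_zero[of R] elim by simp
      ultimately show ?case by metis
    qed
    have "((\<lambda>R. R powr (1 - \<beta>)) \<longlongrightarrow> 0 powr (1 - \<beta>)) (at_right 0)"
      using \<beta> by (intro tendsto_powr' tendsto_intros) (auto simp: eventually_at_filter)
    thus "((\<lambda>R. 2 * C * 2 powr \<beta> * (R powr (1 - \<beta>))) \<longlongrightarrow> 0) (at_right 0)"
      using \<beta> by (intro tendsto_mult_right_zero) simp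
  qed
  define A where "A n = {1 / real (Suc n) .. real (Suc n)}" for n
  have UA: "(\<Union>n. A n) = {0<..}"
  proof safe
    fix x :: real assume "x > 0"
    obtain m where m: "max x (1 / x) < real m" using reals_Archimedean2 by blast
    have "1 / x \<le> real (Suc m)" using m by simp
    hence "x \<in> A m" using m \<open>x > 0\<close> by (auto simp: A_def field_simps)
    thus "x \<in> (\<Union>n. A n)" by blast
  next
    fix x n assume "x \<in> A n" thus "x > 0"
      unfolding A_def using order.strict_trans2[of 0 "1 / real (Suc n)" x] by auto
  qed
  have lim: "(\<lambda>n. LINT x:A n|lborel. f (v * of_real x)) \<longlonglongrightarrow> (LINT x:{0<..}|lborel. f (v * of_real x))"
    if "ok v" for v
    unfolding UA[symmetric]
  proof (rule set_integral_cont_up)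
    show "incseq A" unfolding A_def incseq_def
      by (auto intro: order.trans[rotated] simp: field_simps frac_le)
    show "set_integrable lborel (\<Union> (range A)) (\<lambda>x. f (v * of_real x))" using int[OF that] UA by simp
  qed (auto simp: A_def)
  have FTC: "(LINT x:A n|lborel. v * f (v * of_real x)) = g (v * of_real (real (Suc n))) - g (v * of_real (1 / real (Suc n)))"
    if "ok v" for v n
    unfolding A_def set_lebesgue_integral_def
  proof (rule integral_FTC_Icc)
    show "1 / real (Suc n) \<le> real (Suc n)" by (simp add: field_simps)
    fix x assume x: "1 / real (Suc n) \<le> x"
    hence "x > 0" by (meson divide_pos_pos of_nat_0_less_iff order_less_le_trans zero_less_Suc zero_less_one)
    have "((\<lambda>x. g (v * of_real x)) has_vector_derivative (v * f (v * of_real x))) (at x)"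
    proof -
      have "((\<lambda>z. g (v * z)) has_field_derivative f (v * of_real x) * v) (at (of_real x))"
        by (rule DERIV_chain2[where f = g and g = "\<lambda>z. v * z", OF g[OF onray[OF that \<open>x > 0\<close>]]])
           (auto intro!: derivative_eq_intros)
      from has_vector_derivative_real_field[OF this] show ?thesis by (simp add: mult.commute)
    qed
    thus "((\<lambda>x. g (v * of_real x)) has_vector_derivative (v * f (v * of_real x))) (at x within {1 / real (Suc n)..real (Suc n)})"
      by (rule has_vector_derivative_at_within)
  next
    show "continuous_on {1 / real (Suc n)..real (Suc n)} (\<lambda>x. v * f (v * of_real x))"
      by (intro continuous_intros continuous_on_subset[OF cont[OF that]]) 
         (auto intro: order.strict_trans2[rotated])
  qed
  have lim1: "(\<lambda>n. (LINT x:A n|lborel. f (of_real x)) - u * (LINT x:A n|lborel. f (u * of_real x))) \<longlonglongrightarrow>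
     (LINT x:{0<..}|lborel. f (of_real x)) - u * (LINT x:{0<..}|lborel. f (u * of_real x))"
    using lim[of 1] lim[of u] by (intro tendsto_intros) (auto simp: ok_def)
  have eqn: "(LINT x:A n|lborel. f (of_real x)) - u * (LINT x:A n|lborel. f (u * of_real x)) =
     h (real (Suc n)) - h (1 / real (Suc n))" for n
  proof -
    have a: "(LINT x:A n|lborel. f (of_real x)) = g (of_real (real (Suc n))) - g (of_real (1 / real (Suc n)))"
      using FTC[of 1 n] unfolding ok_def by (simp only: mult_1) simp
    have b: "u * (LINT x:A n|lborel. f (u * of_real x)) = g (u * of_real (real (Suc n))) - g (u * of_real (1 / real (Suc n)))"
      using FTC[of u n] unfolding ok_def by (subst set_integral_mult_right[symmetric]) simp
    show ?thesis unfolding a b h_def by algebra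
  qed
  have lim0: "(\<lambda>n. h (real (Suc n)) - h (1 / real (Suc n))) \<longlonglongrightarrow> 0 - 0"
  proof (intro tendsto_diff)
    show "(\<lambda>n. h (real (Suc n))) \<longlonglongrightarrow> 0"
      by (rule filterlim_compose[OF h1]) (rule filterlim_compose[OF filterlim_real_sequentially filterlim_Suc])
    have "(\<lambda>n. 1 / real (Suc n)) \<longlonglongrightarrow> 0" using LIMSEQ_inverse_real_of_nat by (simp only: inverse_eq_divide)
    hence "filterlim (\<lambda>n. 1 / real (Suc n)) (at_right 0) sequentially"
      unfolding filterlim_at by (simp add: always_eventually del: of_nat_Suc)
    thus "(\<lambda>n. h (1 / real (Suc n))) \<longlonglongrightarrow> 0" by (rule filterlim_compose[OF h0])
  qed
  from LIMSEQ_unique[OF lim1[unfolded eqn] lim0]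
  show "(LINT x:{0<..}|lborel. f (of_real x)) = u * (LINT x:{0<..}|lborel. f (u * of_real x))" by simp
qed

section \<open>Uniqueness of meromorphic continuation\<close>

lemma eventually_at_notin_Ints_subset:
  fixes z :: complex
  assumes "P \<subseteq> \<int>"
  shows "eventually (\<lambda>w. w \<notin> P) (at z)"
proof -
  have "closed (P - {z})" using assms by (intro closed_subset_Ints) auto
  hence "open (- (P - {z}))" by (rule open_Compl)
  hence "eventually (\<lambda>w. w \<in> - (P - {z})) (nhds z)" by (rule eventually_nhds_in_open) auto
  thus ?thesis unfolding eventually_at_filter by eventually_elim auto
qed

text \<open>After removal of its singularities the difference of the two functions is nicely meromorphic,
  and such a function with a non-isolated zero vanishes on a connected domain.\<close>
lemma meromorphic_identity:
  assumes f: "f meromorphic_on A" and g: "g meromorphic_on A" and A: "open A" "connected A"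
    and z0: "z0 \<in> A" "frequently (\<lambda>w. f w = g w) (at z0)" and z: "z \<in> A"
  shows "eventually (\<lambda>w. f w = g w) (at z)"
proof -
  let ?d = "\<lambda>w. f w - g w"
  have d: "?d meromorphic_on A" by (intro meromorphic_intros f g)
  have iso: "isolated_singularity_at ?d w" if "w \<in> A" for w
    using d that by (simp add: meromorphic_on_altdef)
  have "frequently (\<lambda>w. remove_sings ?d w = 0) (at z0)"
    using frequently_eventually_frequently[OF z0(2) eventually_remove_sings_eq_at[OF iso[OF z0(1)]]]
    by (rule frequently_elim1) auto
  hence 0: "remove_sings ?d w = 0" if "w \<in> A" for w
    using frequently_eq_meromorphic_imp_constant[OF _ remove_sings_nicely_meromorphic[OF d] A z0(1) that]
    by blast
  have "eventually (\<lambda>w. w \<in> A) (at z)"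
    using A z eventually_at_in_open' by blast
  with eventually_remove_sings_eq_at[OF iso[OF z]] show ?thesis
    by eventually_elim (use 0 in auto)
qed

lemma eventually_eq_analytic_imp_eq:
  assumes "eventually (\<lambda>w. f w = g w) (at z)" "f analytic_on {z}" "g analytic_on {z}"
  shows "f z = g z"
  using assms by (metis remove_sings_at_analytic remove_sings_cong)

lemma remove_sings_nicely:
  assumes "g nicely_meromorphic_on A" "z \<in> A"
  shows "remove_sings g z = g z"
  using assms unfolding nicely_meromorphic_on_def by force

text \<open>A nicely meromorphic function is determined by its values near, but off, each point. So the
  identity theorem makes it unique everywhere, poles included.\<close>
lemma nicely_meromorphic_continuation_unique:
  assumes "f nicely_meromorphic_on UNIV" "g nicely_meromorphic_on UNIV"
    and "\<And>s. Re s > 0 \<Longrightarrow> f s = g s"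
  shows "f = g"
proof
  fix z
  have "eventually (\<lambda>w. w \<in> {w. Re w > 0}) (at 1)"
    by (rule eventually_at_in_open') (auto simp: open_halfspace_Re_gt)
  hence "eventually (\<lambda>w. f w = g w) (at 1)" by eventually_elim (use assms(3) in auto)
  hence "frequently (\<lambda>w. f w = g w) (at 1)" by (intro eventually_frequently) auto
  hence "eventually (\<lambda>w. f w = g w) (at z)"
    using assms by (intro meromorphic_identity[of f UNIV g 1]) (auto simp: nicely_meromorphic_on_def)
  hence "remove_sings f z = remove_sings g z" by (rule remove_sings_cong) simp
  thus "f z = g z" using assms by (simp add: remove_sings_nicely[of _ UNIV])
qed

text \<open>Any meromorphic extension will do: repairing its removable singularities and its values at poles
  yields the normalized one. This is the way in which explicit formulas enter.\<close>
lemma meromorphic_continuation_eqI: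
  assumes "f meromorphic_on UNIV" "F holomorphic_on {s. Re s > 0}" "\<And>s. Re s > 0 \<Longrightarrow> f s = F s"
  shows "meromorphic_continuation F = remove_sings f"
  unfolding meromorphic_continuation_def
proof (rule the_equality)
  have o: "open {s. Re s > 0}" by (rule open_halfspace_Re_gt)
  have "f holomorphic_on {s. Re s > 0}"
    by (rule holomorphic_transform[OF assms(2)]) (use assms(3) in auto)
  hence an: "f analytic_on {s. Re s > 0}" using o by (simp add: analytic_on_open)
  have *: "remove_sings f s = F s" if "Re s > 0" for s
    using analytic_on_subset[OF an, of "{s}"] that assms(3) by simp
  thus "remove_sings f nicely_meromorphic_on UNIV \<and> (\<forall>s. Re s > 0 \<longrightarrow> remove_sings f s = F s)"
    using assms(1) by (auto intro: remove_sings_nicely_meromorphic)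
  show "g = remove_sings f" if "g nicely_meromorphic_on UNIV \<and> (\<forall>s. Re s > 0 \<longrightarrow> g s = F s)" for g
    using that * assms(1)
    by (intro nicely_meromorphic_continuation_unique) (auto intro: remove_sings_nicely_meromorphic)
qed

section \<open>Continuation of Mellin integrals by even asymptotic expansions\<close>

text \<open>The function has an asymptotic expansion at infinity in the even powers of \<open>1 / y\<close>
  up to an error \<open>O(y^(-2L))\<close>. Odd powers are excluded because the continued Mellin
  integral has its poles at the negated exponents, and the parity of the poles decides which
  arguments are regular.\<close>
definition even_asym :: "nat \<Rightarrow> (real \<Rightarrow> complex) \<Rightarrow> bool" where
  "even_asym L f \<longleftrightarrow> (\<exists>p::complex poly. \<exists>C. \<forall>y\<ge>1. norm (f y - poly p (of_real (1 / y\<^sup>2))) \<le> C / y ^ (2 * L))"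

lemma even_asymI:
  "(\<And>y. y \<ge> 1 \<Longrightarrow> norm (f y - poly p (of_real (1 / y\<^sup>2))) \<le> C / y ^ (2 * L)) \<Longrightarrow> even_asym L f"
  unfolding even_asym_def by blast

lemma poly_bounded_inv_square:
  fixes p :: "complex poly"
  obtains B where "B \<ge> 0" "\<And>y. y \<ge> 1 \<Longrightarrow> norm (poly p (of_real (1 / y\<^sup>2))) \<le> B"
proof -
  have "compact ((\<lambda>x. poly p (of_real x)) ` {0..1::real})"
    by (intro compact_continuous_image continuous_intros) auto
  then obtain B where B: "\<And>x. x \<in> {0..1::real} \<Longrightarrow> norm (poly p (of_real x)) \<le> B"
    by (meson bounded_iff compact_imp_bounded imageI)
  show ?thesis
  proof (rule that[of B])
    show "B \<ge> 0" using B[of 0] by (auto intro: order.trans[OF norm_ge_zero])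
    show "norm (poly p (of_real (1 / y\<^sup>2))) \<le> B" if "y \<ge> 1" for y
      using that by (intro B) (auto simp: field_simps)
  qed
qed

lemma even_asym_bounded:
  assumes "even_asym L f"
  obtains B where "B \<ge> 0" "\<And>y. y \<ge> 1 \<Longrightarrow> norm (f y) \<le> B"
proof -
  obtain p C where pC: "\<And>y. y \<ge> 1 \<Longrightarrow> norm (f y - poly p (of_real (1 / y\<^sup>2))) \<le> C / y ^ (2 * L)"
    using assms unfolding even_asym_def by blast
  obtain B where B: "B \<ge> 0" "\<And>y. y \<ge> 1 \<Longrightarrow> norm (poly p (of_real (1 / y\<^sup>2))) \<le> B"
    using poly_bounded_inv_square by blast
  have C: "C \<ge> 0" using pC[of 1] by (auto intro: order.trans[OF norm_ge_zero])
  show ?thesis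
  proof (rule that[of "C + B"])
    fix y :: real assume y: "y \<ge> 1"
    have "C / y ^ (2 * L) \<le> C / 1" using C y by (intro divide_left_mono) auto
    moreover have "norm (f y) \<le> norm (f y - poly p (of_real (1 / y\<^sup>2))) + norm (poly p (of_real (1 / y\<^sup>2)))"
      using norm_triangle_ineq[of "f y - poly p (of_real (1 / y\<^sup>2))" "poly p (of_real (1 / y\<^sup>2))"] by simp
    ultimately show "norm (f y) \<le> C + B" using pC[OF y] B(2)[OF y] by simp
  qed (use B C in auto)
qed

lemma even_asym_0: "(\<And>y. y \<ge> 1 \<Longrightarrow> norm (f y) \<le> B) \<Longrightarrow> even_asym 0 f"
  by (rule even_asymI[of _ 0 B]) auto

lemma even_asym_const: "even_asym L (\<lambda>_. c)"
  by (rule even_asymI[of _ "[:c:]" 0]) auto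

lemma even_asym_add:
  assumes "even_asym L f" "even_asym L g"
  shows "even_asym L (\<lambda>y. f y + g y)"
proof -
  obtain p C where pC: "\<And>y. y \<ge> 1 \<Longrightarrow> norm (f y - poly p (of_real (1 / y\<^sup>2))) \<le> C / y ^ (2 * L)"
    using assms(1) unfolding even_asym_def by blast
  obtain q D where qD: "\<And>y. y \<ge> 1 \<Longrightarrow> norm (g y - poly q (of_real (1 / y\<^sup>2))) \<le> D / y ^ (2 * L)"
    using assms(2) unfolding even_asym_def by blast
  show ?thesis
  proof (rule even_asymI[of _ "p + q" "C + D"])
    fix y :: real assume y: "y \<ge> 1"
    have "norm (f y + g y - poly (p + q) (of_real (1 / y\<^sup>2))) \<le>
      norm (f y - poly p (of_real (1 / y\<^sup>2))) + norm (g y - poly q (of_real (1 / y\<^sup>2)))"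
      using norm_triangle_ineq[of "f y - poly p (of_real (1 / y\<^sup>2))" "g y - poly q (of_real (1 / y\<^sup>2))"]
      by (simp add: algebra_simps)
    thus "norm (f y + g y - poly (p + q) (of_real (1 / y\<^sup>2))) \<le> (C + D) / y ^ (2 * L)"
      using pC[OF y] qD[OF y] by (simp add: add_divide_distrib)
  qed
qed

lemma even_asym_mult:
  assumes "even_asym L f" "even_asym L g"
  shows "even_asym L (\<lambda>y. f y * g y)"
proof -
  obtain p C where pC: "\<And>y. y \<ge> 1 \<Longrightarrow> norm (f y - poly p (of_real (1 / y\<^sup>2))) \<le> C / y ^ (2 * L)"
    using assms(1) unfolding even_asym_def by blast
  obtain q D where qD: "\<And>y. y \<ge> 1 \<Longrightarrow> norm (g y - poly q (of_real (1 / y\<^sup>2))) \<le> D / y ^ (2 * L)"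
    using assms(2) unfolding even_asym_def by blast
  obtain B where B: "B \<ge> 0" "\<And>y. y \<ge> 1 \<Longrightarrow> norm (f y) \<le> B" using even_asym_bounded[OF assms(1)] by blast
  obtain B' where B': "B' \<ge> 0" "\<And>y. y \<ge> 1 \<Longrightarrow> norm (poly q (of_real (1 / y\<^sup>2))) \<le> B'"
    using poly_bounded_inv_square by blast
  show ?thesis
  proof (rule even_asymI[of _ "p * q" "B * D + C * B'"])
    fix y :: real assume y: "y \<ge> 1"
    let ?P = "poly p (of_real (1 / y\<^sup>2))" and ?Q = "poly q (of_real (1 / y\<^sup>2))"
    have "f y * g y - poly (p * q) (of_real (1 / y\<^sup>2)) = f y * (g y - ?Q) + (f y - ?P) * ?Q"
      by (simp add: algebra_simps)
    also have "norm \<dots> \<le> norm (f y) * norm (g y - ?Q) + norm (f y - ?P) * norm ?Q"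
      by (metis norm_mult norm_triangle_ineq)
    also have "\<dots> \<le> B * (D / y ^ (2 * L)) + (C / y ^ (2 * L)) * B'"
      using B B' pC[OF y] qD[OF y] y
      by (intro add_mono mult_mono) (auto intro: order.trans[OF norm_ge_zero])
    also have "\<dots> = (B * D + C * B') / y ^ (2 * L)" by (simp add: add_divide_distrib)
    finally show "norm (f y * g y - poly (p * q) (of_real (1 / y\<^sup>2))) \<le> (B * D + C * B') / y ^ (2 * L)" .
  qed
qed

lemma even_asym_cmult: "even_asym L f \<Longrightarrow> even_asym L (\<lambda>y. c * f y)"
  using even_asym_mult[OF even_asym_const] by blast

lemma even_asym_power: "even_asym L f \<Longrightarrow> even_asym L (\<lambda>y. f y ^ k)"
  by (induction k) (auto intro: even_asym_const even_asym_mult)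

lemma even_asym_cong: "(\<And>y. y \<ge> 1 \<Longrightarrow> f y = g y) \<Longrightarrow> even_asym L f = even_asym L g"
  unfolding even_asym_def by auto

lemma even_asym_div_square:
  assumes "even_asym L f"
  shows "even_asym (Suc L) (\<lambda>y. f y / of_real (y\<^sup>2))"
proof -
  obtain p C where pC: "\<And>y. y \<ge> 1 \<Longrightarrow> norm (f y - poly p (of_real (1 / y\<^sup>2))) \<le> C / y ^ (2 * L)"
    using assms(1) unfolding even_asym_def by blast
  show ?thesis
  proof (rule even_asymI[of _ "pCons 0 p" C])
    fix y :: real assume y: "y \<ge> 1"
    have "f y / of_real (y\<^sup>2) - poly (pCons 0 p) (of_real (1 / y\<^sup>2)) = (f y - poly p (of_real (1 / y\<^sup>2))) / of_real (y\<^sup>2)"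
      by (simp add: diff_divide_distrib)
    hence "norm (f y / of_real (y\<^sup>2) - poly (pCons 0 p) (of_real (1 / y\<^sup>2))) = norm (f y - poly p (of_real (1 / y\<^sup>2))) / y\<^sup>2"
      by (simp add: norm_divide norm_power)
    also have "\<dots> \<le> (C / y ^ (2 * L)) / y\<^sup>2" using pC[OF y] by (intro divide_right_mono) auto
    also have "\<dots> = C / y ^ (2 * Suc L)" by (simp add: power2_eq_square mult.commute)
    finally show "norm (f y / of_real (y\<^sup>2) - poly (pCons 0 p) (of_real (1 / y\<^sup>2))) \<le> C / y ^ (2 * Suc L)" .
  qed
qed

lemma pderiv_sum: "pderiv (\<Sum>i\<in>A. f i) = (\<Sum>i\<in>A. pderiv (f i))"
  by (induction A rule: infinite_finite_induct) (auto simp: pderiv_add)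

lemma poly_antiderivative:
  fixes p :: "'a :: field_char_0 poly"
  obtains q where "pderiv q = p"
proof
  show "pderiv (\<Sum>i\<le>degree p. monom (coeff p i / of_nat (Suc i)) (Suc i)) = p"
  proof -
    have "pderiv (\<Sum>i\<le>degree p. monom (coeff p i / of_nat (Suc i)) (Suc i)) = (\<Sum>i\<le>degree p. monom (coeff p i) i)"
      by (simp add: pderiv_sum pderiv_monom del: of_nat_Suc)
    thus ?thesis by (simp add: poly_as_sum_of_monoms)
  qed
qed

text \<open>The derivative is integrable at infinity, so the function is Cauchy there; the rate of
  convergence is the integral of the bound.\<close>
lemma derivative_decay_imp_limit:
  fixes d d' :: "real \<Rightarrow> complex"
  assumes d: "\<And>y. y \<ge> 1 \<Longrightarrow> (d has_vector_derivative d' y) (at y)"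
    and b: "\<And>y. y \<ge> 1 \<Longrightarrow> norm (d' y) \<le> C / y ^ (Suc k)" and k: "k > 0"
  obtains c where "\<And>y. y \<ge> 1 \<Longrightarrow> norm (d y - c) \<le> (C / of_nat k) / y ^ k"
proof -
  have C: "C \<ge> 0" using b[of 1] by (auto intro: order.trans[OF norm_ge_zero])
  have cont: "continuous_on {1..} d"
    by (intro continuous_at_imp_continuous_on ballI has_vector_derivative_continuous[OF d]) auto
  have *: "norm (d b - d a) \<le> (C / of_nat k) / a ^ k" if "1 \<le> a" "a \<le> b" for a b
  proof (cases "a = b")
    case False
    have "norm (d b - d a) \<le> (- (C / of_nat k) / b ^ k) - (- (C / of_nat k) / a ^ k)"
    proof (rule differentiable_bound_general)
      show "a < b" using that False by simp
      show "continuous_on {a..b} d" using that by (intro continuous_on_subset[OF cont]) auto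
      show "continuous_on {a..b} (\<lambda>x. - (C / of_nat k) / x ^ k)"
        using that by (intro continuous_intros) auto
      fix x assume x: "a < x" "x < b"
      show "(d has_vector_derivative d' x) (at x)" using d x that by simp
      show "norm (d' x) \<le> C / x ^ Suc k" using b x that by simp
      have "((\<lambda>x. - (C / of_nat k) / x ^ k) has_real_derivative (C / x ^ Suc k)) (at x)"
      proof -
        have x0: "x > 0" using x that by simp
        obtain m where m: "k = Suc m" using k by (cases k) auto
        have "((\<lambda>x. x ^ k) has_real_derivative real k * x ^ m) (at x)"
          using DERIV_pow[of k x UNIV] m by simp
        from DERIV_cmult[OF DERIV_inverse_fun[OF this], of "- (C / of_nat k)"] x0
        have "((\<lambda>x. - (C / of_nat k) * inverse (x ^ k)) has_real_derivative
          - (C / of_nat k) * - (inverse (x ^ k) * (real k * x ^ m) * inverse (x ^ k))) (at x)"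
          by (simp add: mult_ac)
        also have "- (C / of_nat k) * - (inverse (x ^ k) * (real k * x ^ m) * inverse (x ^ k)) =
           C * (inverse (x ^ k) * (x ^ m * inverse (x ^ k)))" using k by simp
        also have "x ^ m * inverse (x ^ k) = inverse x" using x0 m by simp
        also have "C * (inverse (x ^ k) * inverse x) = C / x ^ Suc k" using x0 by (simp add: field_simps)
        finally show ?thesis by (simp add: divide_inverse)
      qed
      thus "((\<lambda>x. - (C / of_nat k) / x ^ k) has_vector_derivative C / x ^ Suc k) (at x)"
        by (simp add: has_real_derivative_iff_has_vector_derivative)
    qed
    also have "\<dots> \<le> (C / of_nat k) / a ^ k" using C that by simp
    finally show ?thesis .
  qed (use that C in simp)
  have cl: "\<exists>M. \<forall>m\<ge>M. (C / of_nat k) / (1 + of_nat m) ^ k < e" if "e > 0" for e :: real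
  proof -
    have "(\<lambda>m. (C / of_nat k) / (1 + real m) ^ k) \<longlonglongrightarrow> 0"
      by (rule real_tendsto_divide_at_top[OF tendsto_const])
         (intro filterlim_pow_at_top k filterlim_tendsto_add_at_top[OF tendsto_const] filterlim_real_sequentially)
    from order_tendstoD(2)[OF this that] show ?thesis by (simp add: eventually_sequentially)
  qed
  have "Cauchy (\<lambda>n. d (1 + real n))"
  proof (rule CauchyI')
    fix e :: real assume e: "e > 0"
    from cl[OF e] obtain M where M: "\<And>m. m \<ge> M \<Longrightarrow> (C / of_nat k) / (1 + of_nat m) ^ k < e" by blast
    show "\<exists>M. \<forall>m\<ge>M. \<forall>n>m. dist (d (1 + real m)) (d (1 + real n)) < e"
    proof (intro exI allI impI)
      fix m n assume "M \<le> m" "m < n"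
      thus "dist (d (1 + real m)) (d (1 + real n)) < e"
        using *[of "1 + real m" "1 + real n"] M[of m] by (simp add: dist_norm norm_minus_commute)
    qed
  qed
  then obtain c where c: "(\<lambda>n. d (1 + real n)) \<longlonglongrightarrow> c" using Cauchy_convergent_iff convergent_def by blast
  show ?thesis
  proof (rule that)
    fix y :: real assume y: "y \<ge> 1"
    have "(\<lambda>n. norm (d y - d (1 + real n))) \<longlonglongrightarrow> norm (d y - c)" by (intro tendsto_intros c)
    moreover have "eventually (\<lambda>n. norm (d y - d (1 + real n)) \<le> (C / of_nat k) / y ^ k) sequentially"
      using eventually_ge_at_top[of "nat \<lceil>y\<rceil>"]
      by eventually_elim (use *[OF y] norm_minus_commute[of "d y"] in \<open>auto simp: nat_le_iff ceiling_le_iff\<close>)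
    ultimately show "norm (d y - c) \<le> (C / of_nat k) / y ^ k" by (intro tendsto_upperbound) auto
  qed
qed

text \<open>Integrating \<open>1 / y^(2i + 3)\<close> gives a multiple of \<open>1 / y^(2i + 2)\<close>, so
  integration stays within even powers, improves the error by two orders and leaves one unknown
  constant. An expansion of all orders can therefore be bootstrapped from boundedness alone.\<close>
lemma even_asym_integrate:
  assumes d: "\<And>y. y \<ge> 1 \<Longrightarrow> (f has_vector_derivative (u y / of_real (y ^ 3))) (at y)"
    and u: "even_asym L u"
  shows "even_asym (Suc L) f"
proof -
  obtain p C where pC: "\<And>y. y \<ge> 1 \<Longrightarrow> norm (u y - poly p (of_real (1 / y\<^sup>2))) \<le> C / y ^ (2 * L)"
    using u unfolding even_asym_def by blast
  obtain q where q: "pderiv q = smult (-1/2) p" using poly_antiderivative by blast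
  define d where "d y = f y - poly q (of_real (1 / y\<^sup>2))" for y :: real
  have dd: "(d has_vector_derivative ((u y - poly p (of_real (1 / y\<^sup>2))) / of_real (y ^ 3))) (at y)" if y: "y \<ge> 1" for y
  proof -
    have "((\<lambda>z. poly q (1 / z\<^sup>2)) has_field_derivative (poly (pderiv q) (1 / (of_real y)\<^sup>2) * (- 2 / of_real y ^ 3))) (at (of_real y))"
      by (rule DERIV_chain2[OF poly_DERIV])
         (use y in \<open>auto intro!: derivative_eq_intros simp: field_simps power2_eq_square power3_eq_cube power4_eq_xxxx\<close>)
    from has_vector_derivative_real_field[OF this]
    have "((\<lambda>y. poly q (of_real (1 / y\<^sup>2))) has_vector_derivative (poly p (of_real (1 / y\<^sup>2)) / of_real (y ^ 3))) (at y)"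
      by (simp add: q)
    from has_vector_derivative_diff[OF d[OF y] this] show ?thesis
      unfolding d_def by (simp add: diff_divide_distrib)
  qed
  have "norm ((u y - poly p (of_real (1 / y\<^sup>2))) / of_real (y ^ 3)) \<le> C / y ^ Suc (2 * L + 2)" if y: "y \<ge> 1" for y
  proof -
    have "norm ((u y - poly p (of_real (1 / y\<^sup>2))) / of_real (y ^ 3)) = norm (u y - poly p (of_real (1 / y\<^sup>2))) / y ^ 3"
      using y by (simp add: norm_divide norm_power)
    also have "\<dots> \<le> (C / y ^ (2 * L)) / y ^ 3" using pC[OF y] y by (intro divide_right_mono) auto
    also have "\<dots> = C / y ^ Suc (2 * L + 2)" by (simp add: power_add power3_eq_cube mult.commute power2_eq_square)
    finally show ?thesis .
  qed
  from derivative_decay_imp_limit[OF dd this] obtain c where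
    c: "\<And>y. y \<ge> 1 \<Longrightarrow> norm (d y - c) \<le> (C / of_nat (2 * L + 2)) / y ^ (2 * L + 2)" by auto
  show ?thesis
  proof (rule even_asymI[of _ "q + [:c:]"])
    fix y :: real assume "y \<ge> 1"
    from c[OF this] show "norm (f y - poly (q + [:c:]) (of_real (1 / y\<^sup>2))) \<le> (C / of_nat (2 * L + 2)) / y ^ (2 * Suc L)"
      by (simp add: d_def algebra_simps)
  qed
qed


lemma mellin_tail_powr:
  assumes s: "Re s > - real k"
  shows "mellin (\<lambda>y. if y \<ge> 1 then 1 / of_real (y ^ k) else 0) s = 1 / (s + of_nat k)"
proof -
  have s0: "s + of_nat k \<noteq> 0"
  proof
    assume "s + of_nat k = 0"
    hence "Re (s + of_nat k) = 0" by simp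
    with s show False by simp
  qed
  let ?F = "\<lambda>y::real. - (of_real y powr (- (s + of_nat k))) / (s + of_nat k)"
  let ?f = "\<lambda>y::real. of_real y powr (- (s + of_nat k) - 1)"
  have int: "set_integrable lborel {1<..} ?f"
  proof (rule set_integrable_bound)
    have "set_integrable lborel {1..} (\<lambda>y. y powr (- Re s - real k - 1))"
      using s by (intro set_integrable_powr_at_top) auto
    thus "set_integrable lborel {1<..} (\<lambda>y. y powr (- Re s - real k - 1))"
      by (rule set_integrable_subset) auto
    show "set_borel_measurable lborel {1<..} ?f"
      by (intro set_borel_measurable_cont continuous_intros) (auto simp: complex_nonpos_Reals_iff)
  qed (auto simp: norm_powr_real_powr)
  have "(LBINT y=ereal 1..\<infinity>. ?f y) = 0 - ?F 1"
  proof (rule interval_integral_FTC_integrable)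
    fix x :: real assume "ereal 1 < ereal x"
    hence x: "x > 1" by simp
    have "((\<lambda>z. - (z powr (- (s + of_nat k))) / (s + of_nat k)) has_field_derivative ?f x) (at (of_real x))"
    proof -
      define c where "c = s + of_nat k"
      have "((\<lambda>z. z powr (- c)) has_field_derivative (- c) * of_real x powr (- c - 1)) (at (of_real x))"
        using x by (intro has_field_derivative_powr) (auto simp: complex_nonpos_Reals_iff)
      from DERIV_cdivide[OF DERIV_minus[OF this], of c]
      have "((\<lambda>z. - (z powr (- c)) / c) has_field_derivative - (- c * of_real x powr (- c - 1)) / c) (at (of_real x))" .
      also have "- (- c * of_real x powr (- c - 1)) / c = of_real x powr (- c - 1)" using s0 unfolding c_def[symmetric] by simp
      finally show ?thesis unfolding c_def .
    qed
    from has_vector_derivative_real_field[OF this] show "(?F has_vector_derivative ?f x) (at x)" by simp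
    show "isCont ?f x"
      using x by (intro continuous_intros) (auto simp: complex_nonpos_Reals_iff)
  next
    have "einterval (ereal 1) \<infinity> = {1<..}" by (auto simp: einterval_def)
    thus "set_integrable lborel (einterval (ereal 1) \<infinity>) ?f" using int by simp
    have "isCont ?F 1" using s0 by (intro continuous_intros) (auto simp: complex_nonpos_Reals_iff)
    hence "(?F \<longlongrightarrow> ?F 1) (at_right 1)" by (rule filterlim_mono[OF isContD]) (auto simp: at_le)
    thus "((?F \<circ> real_of_ereal) \<longlongrightarrow> ?F 1) (at_right (ereal 1))"
      unfolding ereal_tendsto_simps .
    have "(?F \<longlongrightarrow> 0) at_top"
    proof (rule Lim_null_comparison)
      show "\<forall>\<^sub>F y in at_top. norm (?F y) \<le> (1 / norm (s + of_nat k)) * y powr (- Re s - real k)"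
        using eventually_gt_at_top[of "0::real"]
        by eventually_elim (simp add: norm_divide norm_powr_real_powr)
      show "((\<lambda>y. (1 / norm (s + of_nat k)) * y powr (- Re s - real k)) \<longlongrightarrow> 0) at_top"
        using s by (intro tendsto_mult_right_zero tendsto_neg_powr filterlim_ident) auto
    qed
    thus "((?F \<circ> real_of_ereal) \<longlongrightarrow> 0) (at_left \<infinity>)"
      unfolding ereal_tendsto_simps .
  qed simp
  also have "(LBINT y=ereal 1..\<infinity>. ?f y) = (LINT y:{1<..}|lborel. ?f y)"
    by (simp add: interval_lebesgue_integral_def einterval_def greaterThan_def)
  also have "\<dots> = mellin (\<lambda>y. if y \<ge> 1 then 1 / of_real (y ^ k) else 0) s"
    unfolding mellin_def set_lebesgue_integral_def
  proof (rule Bochner_Integration.integral_cong_AE)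
    show "AE x in lborel. indicat_real {1<..} x *\<^sub>R ?f x =
      indicat_real {0<..} x *\<^sub>R ((if 1 \<le> x then 1 / complex_of_real (x ^ k) else 0) * complex_of_real x powr (- s - 1))"
      using AE_lborel_singleton[of "1::real"]
    proof eventually_elim
      case (elim x)
      have "of_real x powr (- (s + of_nat k) - 1) = of_real x powr (- s - 1) / complex_of_real x ^ k" if "x > 1"
        using that by (simp add: powr_diff powr_minus powr_add powr_nat' field_simps)
      thus ?case using elim by (auto simp: indicator_def)
    qed
  next
    show "(\<lambda>x. indicat_real {1<..} x *\<^sub>R ?f x) \<in> borel_measurable lborel" using int 
      by (auto simp: set_integrable_def)
    have "set_borel_measurable lborel {0<..} (\<lambda>x::real. (if 1 \<le> x then 1 / complex_of_real (x ^ k) else 0) * complex_of_real x powr (- s - 1))"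
      by (rule mellin_integrand_measurable) (auto simp: set_borel_measurable_def)
    thus "(\<lambda>x::real. indicat_real {0<..} x *\<^sub>R ((if 1 \<le> x then 1 / complex_of_real (x ^ k) else 0) * complex_of_real x powr (- s - 1)))
       \<in> borel_measurable lborel" by (simp add: set_borel_measurable_def)
  qed
  finally show ?thesis using s0 by simp
qed

lemma mellin_sum:
  assumes "\<And>i. i \<in> A \<Longrightarrow> mellin_conv (f i) (Re s)"
  shows "mellin (\<lambda>y. \<Sum>i\<in>A. f i y) s = (\<Sum>i\<in>A. mellin (f i) s) \<and> mellin_conv (\<lambda>y. \<Sum>i\<in>A. f i y) (Re s)"
  using assms
proof (induction A rule: infinite_finite_induct)
  case (insert a A)
  thus ?case by (auto simp: mellin_add mellin_conv_add)
qed (auto simp: mellin_def mellin_conv_def set_borel_measurable_def set_integrable_def)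

text \<open>Subtracting a polynomial in \<open>1 / y^2\<close> leaves a tail whose Mellin integral converges
  for \<open>Re s > -2L\<close>, and the subtracted terms have the elementary transforms
  \<open>1 / (s + 2i)\<close>. The extensions for different \<open>L\<close> agree by the
  identity theorem and patch together.\<close>
theorem even_asym_tail_continuation:
  fixes G :: "real \<Rightarrow> complex"
  assumes m: "set_borel_measurable lborel {0<..} G" and G: "\<And>L. even_asym L G"
  obtains T where "T meromorphic_on UNIV" "T analytic_on - {- (2 * of_nat l) |l. True}"
    "\<And>s. Re s > 0 \<Longrightarrow> T s = mellin (\<lambda>y. if y \<ge> 1 then G y else 0) s"
proof -
  define P :: "complex set" where "P = {- (2 * of_nat l) |l. True}"
  have PZ: "P \<subseteq> \<int>" unfolding P_def by auto
  define H where "H L = {s::complex. Re s > - (2 * real L)}" for L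
  have H: "open (H L)" "convex (H L)" for L
    unfolding H_def by (simp_all add: open_halfspace_Re_gt convex_halfspace_Re_gt)
  have cutm: "set_borel_measurable lborel {0<..} (\<lambda>y. if y \<ge> 1 then f y else 0)"
    if "set_borel_measurable lborel {0<..} f" for f :: "real \<Rightarrow> complex"
  proof -
    have "(\<lambda>y. indicator {1..} y *\<^sub>R (indicator {0<..} y *\<^sub>R f y)) \<in> borel_measurable lborel"
      using that unfolding set_borel_measurable_def by measurable
    also have "(\<lambda>y. indicator {1..} y *\<^sub>R (indicator {0<..} y *\<^sub>R f y)) =
       (\<lambda>y. indicator {0<..} y *\<^sub>R (if y \<ge> 1 then f y else 0))" by (auto simp: fun_eq_iff indicator_def)
    finally show ?thesis unfolding set_borel_measurable_def .
  qed
  have "\<exists>T. T meromorphic_on (H L) \<and> T analytic_on (H L - P) \<and>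
     (\<forall>s. Re s > 0 \<longrightarrow> T s = mellin (\<lambda>y. if y \<ge> 1 then G y else 0) s)" for L
  proof -
    obtain p C where pC: "\<And>y. y \<ge> 1 \<Longrightarrow> norm (G y - poly p (of_real (1 / y\<^sup>2))) \<le> C / y ^ (2 * L)"
      using G[of L] unfolding even_asym_def by blast
    define r where "r y = (if y \<ge> 1 then G y - poly p (of_real (1 / y\<^sup>2)) else 0)" for y :: real
    have rm: "set_borel_measurable lborel {0<..} r"
      unfolding r_def
    proof (rule cutm)
      have "set_borel_measurable lborel {0<..} (\<lambda>y::real. poly p (of_real (1 / y\<^sup>2)))"
        by (intro set_borel_measurable_cont continuous_intros) auto
      with m show "set_borel_measurable lborel {0<..} (\<lambda>y. G y - poly p (complex_of_real (1 / y\<^sup>2)))"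
        unfolding set_borel_measurable_def by (simp add: scaleR_diff_right)
    qed
    have rc: "mellin_conv r \<sigma>" if "\<sigma> > - (2 * real L)" for \<sigma>
    proof (rule mellin_conv_bound[OF rm, where C = "\<bar>C\<bar>" and C' = "\<bar>C\<bar>" and p = "\<sigma> + 1" and q = "- (2 * real L)"])
      show "norm (r y) \<le> \<bar>C\<bar> * y powr (- (2 * real L))" if "y \<ge> 1" for y
      proof -
        have "norm (r y) \<le> C / y ^ (2 * L)" using pC[OF that] that by (simp add: r_def)
        also have "\<dots> \<le> \<bar>C\<bar> / y ^ (2 * L)" using that by (intro divide_right_mono) auto
        also have "y ^ (2 * L) = y powr (2 * real L)"
          using that powr_realpow[of y "2 * L"] by simp
        finally show ?thesis by (simp add: powr_minus divide_inverse)
      qed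
      show "norm (r y) \<le> \<bar>C\<bar> * y powr (\<sigma> + 1)" if "0 < y" "y \<le> 1" for y
      proof (cases "y = 1")
        case True thus ?thesis using pC[of 1] by (simp add: r_def)
      qed (use that in \<open>simp add: r_def\<close>)
    qed (use that in auto)
    have rhol: "mellin r analytic_on H L"
    proof -
      have "mellin r analytic_on {s}" if "s \<in> H L" for s
      proof -
        have s: "- (2 * real L) < Re s" using that by (simp add: H_def)
        then obtain a where a: "- (2 * real L) < a" "a < Re s" using dense by blast
        have "mellin r holomorphic_on {z. a < Re z \<and> Re z < Re s + 1}"
          using a by (intro mellin_holomorphic rc) auto
        moreover have "open {z. a < Re z \<and> Re z < Re s + 1}"
          by (intro open_Collect_conj open_halfspace_Re_gt open_halfspace_Re_lt)
        ultimately show ?thesis using a unfolding analytic_at by force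
      qed
      thus ?thesis by (subst analytic_on_analytic_at) blast
    qed
    define T where "T s = mellin r s + (\<Sum>i\<le>degree p. coeff p i * (1 / (s + of_nat (2 * i))))" for s
    have "T s = mellin (\<lambda>y. if y \<ge> 1 then G y else 0) s" if s: "Re s > 0" for s
    proof -
      define t where "t i y = coeff p i * (if y \<ge> 1 then 1 / of_real (y ^ (2 * i)) else 0)" for i and y :: real
      have tc: "mellin_conv (t i) (Re s)" for i
        unfolding t_def
      proof (rule mellin_conv_cmult, rule mellin_conv_bound)
        show "set_borel_measurable lborel {0<..} (\<lambda>y. if 1 \<le> y then 1 / complex_of_real (y ^ (2 * i)) else 0)"
          by (auto simp: set_borel_measurable_def)
        show "norm (if 1 \<le> y then 1 / complex_of_real (y ^ (2 * i)) else 0) \<le> 1 * y powr 0" if "y \<ge> 1" for y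
          using that by (auto simp: norm_divide norm_power)
        show "norm (if 1 \<le> y then 1 / complex_of_real (y ^ (2 * i)) else 0) \<le> 1 * y powr (Re s + 1)" if "0 < y" "y \<le> 1" for y
          using that by (cases "y = 1") auto
      qed (use s in auto)
      have "T s = mellin r s + (\<Sum>i\<le>degree p. mellin (t i) s)"
        unfolding T_def t_def mellin_cmult using s by (subst mellin_tail_powr) auto
      also have "\<dots> = mellin (\<lambda>y. r y + (\<Sum>i\<le>degree p. t i y)) s"
        using s mellin_sum[of "{..degree p}" t s] tc rc[of "Re s"] by (subst mellin_add) auto
      also have "(\<lambda>y. r y + (\<Sum>i\<le>degree p. t i y)) = (\<lambda>y. if y \<ge> 1 then G y else 0)"
        by (auto simp: fun_eq_iff r_def t_def poly_altdef power_divide power_mult)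
      finally show ?thesis .
    qed
    moreover have "T analytic_on (H L - P)"
      unfolding T_def
    proof (intro analytic_intros)
      show "mellin r analytic_on H L - P"
        using rhol by (rule analytic_on_subset) blast
      fix s i assume "s \<in> H L - P"
      hence "s \<noteq> - (2 * of_nat i)" by (auto simp: P_def)
      thus "s + of_nat (2 * i) \<noteq> 0" by (simp add: add_eq_0_iff2)
    qed
    moreover have "T meromorphic_on H L"
      unfolding T_def
      by (intro meromorphic_intros analytic_on_imp_meromorphic_on[OF rhol])
    ultimately show ?thesis by blast
  qed
  then obtain T where T: "\<And>L. T L meromorphic_on (H L)" "\<And>L. T L analytic_on (H L - P)"
     "\<And>L s. Re s > 0 \<Longrightarrow> T L s = mellin (\<lambda>y. if y \<ge> 1 then G y else 0) s" by metis
  have Hmono: "H L \<subseteq> H L'" if "L \<le> L'" for L L' using that by (auto simp: H_def)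
  have eq: "T L s = T L' s" if "s \<in> H L" "s \<in> H L'" "s \<notin> P" for L L' s
    using that
  proof (induction L L' rule: linorder_wlog)
    case (le L L')
    have "eventually (\<lambda>w. w \<in> {w. Re w > 0}) (at 1)"
      by (rule eventually_at_in_open') (auto simp: open_halfspace_Re_gt)
    hence "eventually (\<lambda>w. T L w = T L' w) (at 1)" by eventually_elim (use T(3) in auto)
    hence "frequently (\<lambda>w. T L w = T L' w) (at 1)" by (intro eventually_frequently) auto
    hence "eventually (\<lambda>w. T L w = T L' w) (at s)"
      using T(1) meromorphic_on_subset[OF T(1)[of L'] Hmono[OF le(1)]] H[of L] le
      by (intro meromorphic_identity[of "T L" "H L" "T L'" 1]) (auto simp: convex_connected H_def)
    thus ?case using le by (intro eventually_eq_analytic_imp_eq[of "T L" "T L'"] analytic_on_subset[OF T(2)]) auto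
  qed auto
  define L where "L s = nat \<lceil>\<bar>Re s\<bar>\<rceil> + 1" for s :: complex
  have LH: "s \<in> H (L s)" for s unfolding L_def H_def by (simp add: abs_le_iff) linarith
  define T' where "T' s = (if s \<in> P then 0 else T (L s) s)" for s
  have ev: "eventually (\<lambda>w. w \<notin> P \<longrightarrow> T' w = T (L z) w) (nhds z)" for z
  proof -
    have "eventually (\<lambda>w. w \<in> H (L z)) (nhds z)" using LH H by (intro eventually_nhds_in_open) auto
    thus ?thesis by eventually_elim (auto simp: T'_def intro!: eq LH)
  qed
  have ev': "eventually (\<lambda>w. T' w = T (L z) w) (at z)" for z
    using ev[of z, THEN filter_leD[OF at_within_le_nhds]] eventually_at_notin_Ints_subset[OF PZ, of z]
    by eventually_elim auto
  show ?thesis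
  proof (rule that[of T'])
    show "T' meromorphic_on UNIV"
    proof (subst meromorphic_on_meromorphic_at, safe)
      fix z have "T (L z) meromorphic_on {z}" using T(1)[of "L z"] by (rule meromorphic_on_subset) (use LH in auto)
      thus "T' meromorphic_on {z}" using ev' by (subst meromorphic_on_cong[of _ _ "T (L z)"]) auto
    qed
    show "T' analytic_on - {- (2 * of_nat l) |l. True}"
      unfolding P_def[symmetric]
    proof (subst analytic_on_analytic_at, safe)
      fix z assume z: "z \<notin> P"
      have "eventually (\<lambda>w. w \<notin> P) (nhds z)"
        using eventually_at_notin_Ints_subset[OF PZ, of z] unfolding eventually_at_filter
        by (rule eventually_mono) (use z in auto)
      with ev[of z] have "eventually (\<lambda>w. T' w = T (L z) w) (nhds z)" by eventually_elim auto
      thus "T' analytic_on {z}" using T(2)[of "L z"] LH[of z] z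
        by (subst analytic_at_cong) (auto intro: analytic_on_subset)
    qed
    show "T' s = mellin (\<lambda>y. if y \<ge> 1 then G y else 0) s" if "Re s > 0" for s
      using that T(3) by (auto simp: T'_def P_def)
  qed
qed

section \<open>The modified Bessel function of the first kind\<close>

abbreviation unit_interval :: "real measure" where
  "unit_interval \<equiv> restrict_space lborel {0..1}"

lemma unit_interval_integral:
  fixes f :: "real \<Rightarrow> 'b :: {banach, second_countable_topology}"
  shows "(LINT t|unit_interval. f t) = (LINT t:{0..1}|lborel. f t)"
  by (subst integral_restrict_space) (auto simp: set_lebesgue_integral_def)

lemma prob_space_unit_interval: "prob_space unit_interval"
  by (intro prob_spaceI) (simp add: emeasure_restrict_space space_restrict_space)

text \<open>Integrals over a period are evaluated through an entire primitive. This avoids any discussion of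
  paths.\<close>
lemma unit_interval_FTC:
  fixes F f :: "complex \<Rightarrow> complex"
  assumes d: "\<And>z. (F has_field_derivative f z) (at z)" and c: "continuous_on UNIV f"
  shows "(LINT t|unit_interval. f (of_real t)) = F 1 - F 0"
proof -
  have "(LINT t|unit_interval. f (of_real t)) = F (of_real 1) - F (of_real 0)"
    unfolding unit_interval_integral set_lebesgue_integral_def
  proof (rule integral_FTC_Icc)
    show "((\<lambda>t. F (of_real t)) has_vector_derivative f (of_real t)) (at t within {0..1})" for t :: real
      by (rule has_vector_derivative_at_within[OF has_vector_derivative_real_field[OF d]])
    show "continuous_on {0..1} (\<lambda>t. f (complex_of_real t))"
      by (intro continuous_on_compose2[OF c] continuous_intros) auto
  qed auto
  thus ?thesis by simp
qed

lemma sin_sq_complex: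
  "complex_of_real (sin x) * of_real (sin x) = 1 - of_real (cos x) * of_real (cos x)"
proof -
  have "sin x * sin x = 1 - cos x * cos x" using sin_squared_eq[of x] by (simp add: power2_eq_square)
  hence "complex_of_real (sin x * sin x) = of_real (1 - cos x * cos x)" by (rule arg_cong)
  thus ?thesis by simp
qed

lemma trig_2pi_of_real:
  "cos (2 * of_real pi * of_real t) = complex_of_real (cos (2 * pi * t))"
  "sin (2 * of_real pi * of_real t) = complex_of_real (sin (2 * pi * t))"
  by (simp_all flip: cos_of_real sin_of_real)

lemma unit_interval_integrable:
  fixes f :: "real \<Rightarrow> 'b :: {banach, second_countable_topology}"
  assumes "continuous_on UNIV f"
  shows "integrable unit_interval f"
proof -
  have "set_integrable lborel {0..1} f"
    by (intro borel_integrable_atLeastAtMost' continuous_on_subset[OF assms]) auto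
  thus ?thesis by (subst integrable_restrict_space) (auto simp: set_integrable_def)
qed

lemma unit_interval_measurable:
  "f \<in> borel_measurable borel \<Longrightarrow> f \<in> borel_measurable unit_interval"
  by (simp add: measurable_restrict_space1)

text \<open>This is the modified Bessel function of the first kind of order 0, as the average of a plane
  wave over a uniformly distributed direction.\<close>
definition besselI :: "complex \<Rightarrow> complex" where
  "besselI w = (LINT t|unit_interval. exp (w * of_real (cos (2 * pi * t))))"

definition besselI' :: "complex \<Rightarrow> complex" where
  "besselI' w = (LINT t|unit_interval. of_real (cos (2 * pi * t)) * exp (w * of_real (cos (2 * pi * t))))"

lemma besselI_deriv: "(besselI has_field_derivative besselI' w) (at w)"
proof -
  have "((\<lambda>w. LINT t|unit_interval. 1 * exp (w * of_real (cos (2 * pi * t)))) has_field_derivative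
         (LINT t|unit_interval. 1 * of_real (cos (2 * pi * t)) * exp (w * of_real (cos (2 * pi * t))))) (at w)"
    by (rule exp_integral_has_derivative[where a = "Re w - 1" and b = "Re w + 1"])
       (auto intro!: unit_interval_integrable unit_interval_measurable continuous_intros)
  thus ?thesis unfolding besselI_def besselI'_def by simp
qed

text \<open>This is the modified Bessel equation. It comes from integrating by parts the exact derivative of
  \<open>sin t * exp (w * cos t)\<close>.\<close>
lemma besselI'_deriv:
  assumes "w \<noteq> 0"
  shows "(besselI' has_field_derivative (besselI w - besselI' w / w)) (at w)"
proof -
  let ?c = "\<lambda>t::real. complex_of_real (cos (2 * pi * t))"
  let ?s = "\<lambda>t::real. complex_of_real (sin (2 * pi * t))"
  let ?e = "\<lambda>t::real. exp (w * ?c t)"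
  have "((\<lambda>w. LINT t|unit_interval. ?c t * exp (w * ?c t)) has_field_derivative
         (LINT t|unit_interval. ?c t * ?c t * ?e t)) (at w)"
    by (rule exp_integral_has_derivative[where a = "Re w - 1" and b = "Re w + 1"])
       (auto intro!: unit_interval_integrable unit_interval_measurable continuous_intros)
  moreover have "(LINT t|unit_interval. ?c t * ?c t * ?e t) = besselI w - besselI' w / w"
  proof -
    let ?F = "\<lambda>z::complex. sin (2 * of_real pi * z) * exp (w * cos (2 * of_real pi * z)) / of_real (2 * pi)"
    let ?f = "\<lambda>z::complex. (cos (2 * of_real pi * z) - w * sin (2 * of_real pi * z) ^ 2) * exp (w * cos (2 * of_real pi * z))"
    have "(?F has_field_derivative ?f z) (at z)" for z
      by (rule derivative_eq_intros refl | simp)+ (simp add: field_simps power2_eq_square)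
    moreover have "continuous_on UNIV ?f" by (intro continuous_intros)
    ultimately have "(LINT t|unit_interval. ?f (of_real t)) = ?F 1 - ?F 0" by (rule unit_interval_FTC)
    hence "(LINT t|unit_interval. (?c t - w * ?s t ^ 2) * ?e t) = 0"
      using trig_2pi_of_real[of 1] by (simp add: trig_2pi_of_real)
    also have "(\<lambda>t. (?c t - w * ?s t ^ 2) * ?e t) = (\<lambda>t. ?c t * ?e t + w * (?c t * ?c t * ?e t) - w * ?e t)"
    proof
      fix t
      have sq: "?s t ^ 2 = 1 - ?c t * ?c t" unfolding power2_eq_square by (rule sin_sq_complex)
      show "(?c t - w * ?s t ^ 2) * ?e t = ?c t * ?e t + w * (?c t * ?c t * ?e t) - w * ?e t"
        unfolding sq by (simp add: algebra_simps)
    qed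
    also have "(LINT t|unit_interval. ?c t * ?e t + w * (?c t * ?c t * ?e t) - w * ?e t) =
      besselI' w + w * (LINT t|unit_interval. ?c t * ?c t * ?e t) - w * besselI w"
      unfolding besselI_def besselI'_def
      by (subst Bochner_Integration.integral_diff; (subst Bochner_Integration.integral_add)?)
         (auto intro!: unit_interval_integrable continuous_intros)
    finally show ?thesis using assms by (simp add: field_simps)
  qed
  ultimately show ?thesis unfolding besselI'_def by simp
qed

text \<open>Integration by parts relates the moments of orders \<open>k + 2\<close> and \<open>k\<close>
  with the factor \<open>(k + 1) / (k + 2)\<close>, the quotient of consecutive central binomial
  coefficients divided by 4 when \<open>k\<close> is even.\<close>
lemma cos_moments:
  "(LINT t|unit_interval. complex_of_real (cos (2 * pi * t)) ^ (2 * m)) = fact (2 * m) / (4 ^ m * (fact m)\<^sup>2)" (is ?A)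
  "(LINT t|unit_interval. complex_of_real (cos (2 * pi * t)) ^ (2 * m + 1)) = 0" (is ?B)
proof -
  let ?c = "\<lambda>t::real. complex_of_real (cos (2 * pi * t))"
  let ?s = "\<lambda>t::real. complex_of_real (sin (2 * pi * t))"
  define M where "M k = (LINT t|unit_interval. ?c t ^ k)" for k
  have rec: "of_nat (k + 2) * M (k + 2) = of_nat (k + 1) * M k" for k
  proof -
    let ?F = "\<lambda>z::complex. sin (2 * of_real pi * z) * cos (2 * of_real pi * z) ^ (k + 1) / of_real (2 * pi)"
    let ?f = "\<lambda>z::complex. cos (2 * of_real pi * z) * cos (2 * of_real pi * z) ^ (k + 1)
           - of_nat (k + 1) * cos (2 * of_real pi * z) ^ k * (sin (2 * of_real pi * z) * sin (2 * of_real pi * z))"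
    have "(?F has_field_derivative ?f z) (at z)" for z
      by (rule derivative_eq_intros refl | simp)+ (simp add: divide_simps, simp add: algebra_simps)
    moreover have "continuous_on UNIV ?f" by (intro continuous_intros)
    ultimately have "(LINT t|unit_interval. ?f (of_real t)) = ?F 1 - ?F 0" by (rule unit_interval_FTC)
    hence "(LINT t|unit_interval. ?c t * ?c t ^ (k + 1) - of_nat (k + 1) * ?c t ^ k * (?s t * ?s t)) = 0"
      using trig_2pi_of_real[of 1] by (simp add: trig_2pi_of_real)
    also have "(\<lambda>t. ?c t * ?c t ^ (k + 1) - of_nat (k + 1) * ?c t ^ k * (?s t * ?s t)) =
          (\<lambda>t. of_nat (k + 2) * ?c t ^ (k + 2) - of_nat (k + 1) * ?c t ^ k)"
    proof
      fix t
      have sq: "?s t * ?s t = 1 - ?c t * ?c t" by (rule sin_sq_complex)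
      show "?c t * ?c t ^ (k + 1) - of_nat (k + 1) * ?c t ^ k * (?s t * ?s t) =
          of_nat (k + 2) * ?c t ^ (k + 2) - of_nat (k + 1) * ?c t ^ k"
        unfolding sq by (simp add: algebra_simps)
    qed
    also have "(LINT t|unit_interval. of_nat (k + 2) * ?c t ^ (k + 2) - of_nat (k + 1) * ?c t ^ k) =
       of_nat (k + 2) * M (k + 2) - of_nat (k + 1) * M k"
      unfolding M_def
      by (subst Bochner_Integration.integral_diff) (auto intro!: unit_interval_integrable continuous_intros)
    finally show ?thesis by simp
  qed
  have M0: "M 0 = 1"
    unfolding M_def unit_interval_integral set_lebesgue_integral_def by simp
  have M1: "M 1 = 0"
  proof -
    let ?F = "\<lambda>z::complex. sin (2 * of_real pi * z) / of_real (2 * pi)"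
    have "(?F has_field_derivative cos (2 * of_real pi * z)) (at z)" for z
      by (rule derivative_eq_intros refl | simp)+
    from unit_interval_FTC[OF this] show ?thesis
      using trig_2pi_of_real[of 1] by (simp add: M_def trig_2pi_of_real continuous_intros)
  qed
  have "M (2 * m) = fact (2 * m) / (4 ^ m * (fact m)\<^sup>2)"
  proof (induction m)
    case (Suc m)
    have "M (2 * Suc m) = of_nat (2 * m + 1) * M (2 * m) / of_nat (2 * m + 2)"
      using rec[of "2 * m"] by (simp add: field_simps del: of_nat_Suc of_nat_add)
    also have "\<dots> = of_nat (2 * m + 1) * (fact (2 * m) / (4 ^ m * (fact m)\<^sup>2)) / of_nat (2 * m + 2)"
      by (simp only: Suc)
    also have "\<dots> = fact (2 * Suc m) / (4 ^ Suc m * (fact (Suc m))\<^sup>2)"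
    proof -
      have "complex_of_nat (2 * m + 2) \<noteq> 0" "complex_of_nat (m + 1) \<noteq> 0"
        by (metis add_is_0 of_nat_eq_0_iff zero_neq_numeral, metis add_is_0 of_nat_eq_0_iff one_neq_zero)
      moreover have "complex_of_nat (2 * m + 2) = 2 * of_nat (m + 1)" by simp
      moreover have "fact (2 * Suc m) = of_nat (2 * m + 2) * (of_nat (2 * m + 1) * (fact (2 * m) :: complex))"
        by (simp add: algebra_simps)
      moreover have "fact (Suc m) = of_nat (m + 1) * (fact m :: complex)" by simp
      ultimately show ?thesis
        by (simp only: power_mult_distrib) (simp add: field_simps power2_eq_square del: of_nat_add of_nat_Suc)
    qed
    finally show ?case .
  qed (simp add: M0)
  thus ?A unfolding M_def .
  have "M (2 * m + 1) = 0"
  proof (induction m)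
    case (Suc m)
    have "of_nat (2 * m + 1 + 2) * M (2 * m + 1 + 2) = 0" using rec[of "2 * m + 1"] by (simp only: Suc) simp
    moreover have "complex_of_nat (2 * m + 1 + 2) \<noteq> 0" unfolding of_nat_eq_0_iff by simp
    ultimately have "M (2 * m + 1 + 2) = 0" by (metis mult_eq_0_iff)
    moreover have "2 * Suc m + 1 = 2 * m + 1 + 2" by simp
    ultimately show ?case by metis
  qed (simp add: M1[simplified])
  thus ?B unfolding M_def .
qed

lemma besselI_sums: "(\<lambda>m. (w / 2) ^ (2 * m) / (fact m)\<^sup>2) sums besselI w"
proof -
  let ?c = "\<lambda>t::real. complex_of_real (cos (2 * pi * t))"
  have le: "norm ((w * ?c t) ^ k /\<^sub>R fact k) \<le> norm w ^ k /\<^sub>R fact k" for k t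
    by (auto simp: norm_mult norm_power power_mult_distrib intro!: divide_right_mono mult_left_le power_le_one)
  have smn: "summable (\<lambda>k. norm w ^ k /\<^sub>R fact k)" by (rule summable_exp_generic)
  have "(\<lambda>k. LINT t|unit_interval. (w * ?c t) ^ k /\<^sub>R fact k) sums (LINT t|unit_interval. (\<Sum>k. (w * ?c t) ^ k /\<^sub>R fact k))"
  proof (rule sums_integral)
    show int: "integrable unit_interval (\<lambda>t. (w * ?c t) ^ k /\<^sub>R fact k)" for k
      by (intro unit_interval_integrable continuous_intros)
    show "AE t in unit_interval. summable (\<lambda>k. norm ((w * ?c t) ^ k /\<^sub>R fact k))"
      by (intro AE_I2 summable_norm_exp)
    show "summable (\<lambda>k. LINT t|unit_interval. norm ((w * ?c t) ^ k /\<^sub>R fact k))"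
    proof (rule summable_comparison_test[OF _ smn], intro exI allI impI)
      fix k
      have "(LINT t|unit_interval. norm ((w * ?c t) ^ k /\<^sub>R fact k)) \<le> (LINT t|unit_interval. norm w ^ k /\<^sub>R fact k)"
        by (intro integral_mono integrable_norm int unit_interval_integrable continuous_intros le)
      also have "\<dots> = norm w ^ k /\<^sub>R fact k" using prob_space.prob_space[OF prob_space_unit_interval] by simp
      finally show "norm (LINT t|unit_interval. norm ((w * ?c t) ^ k /\<^sub>R fact k)) \<le> norm w ^ k /\<^sub>R fact k" by simp
    qed
  qed
  also have "(LINT t|unit_interval. (\<Sum>k. (w * ?c t) ^ k /\<^sub>R fact k)) = besselI w"
    by (simp add: besselI_def exp_def)
  finally have s: "(\<lambda>k. w ^ k * (LINT t|unit_interval. ?c t ^ k) / fact k) sums besselI w"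
    by (simp add: power_mult_distrib scaleR_conv_of_real divide_inverse mult.commute)
  have "(\<lambda>m. w ^ (2 * m) * (LINT t|unit_interval. ?c t ^ (2 * m)) / fact (2 * m)) sums besselI w"
  proof (subst sums_mono_reindex[of "\<lambda>m. 2 * m" "\<lambda>k. w ^ k * (LINT t|unit_interval. ?c t ^ k) / fact k"])
    fix k :: nat assume "k \<notin> range (\<lambda>m. 2 * m)"
    hence "odd k" by (auto elim!: evenE)
    then obtain m where m: "k = 2 * m + 1" by (rule oddE)
    show "w ^ k * (LINT t|unit_interval. ?c t ^ k) / fact k = 0" unfolding m cos_moments(2) by simp
  qed (use s in \<open>auto simp: strict_mono_def\<close>)
  thus ?thesis by (simp only: cos_moments(1)) (simp add: power_divide power_mult)
qed

lemma norm_besselI_le: "norm (besselI w) \<le> exp \<bar>Re w\<bar>"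
proof -
  have "norm (besselI w) \<le> (LINT t|unit_interval. norm (exp (w * complex_of_real (cos (2 * pi * t)))))"
    unfolding besselI_def by (rule integral_norm_bound)
  also have "\<dots> \<le> (LINT t|unit_interval. exp \<bar>Re w\<bar>)"
  proof (intro integral_mono unit_interval_integrable continuous_intros)
    fix t
    have "Re w * cos (2 * pi * t) \<le> \<bar>Re w\<bar> * \<bar>cos (2 * pi * t)\<bar>" by (metis abs_ge_self abs_mult)
    also have "\<dots> \<le> \<bar>Re w\<bar> * 1" by (intro mult_left_mono) auto
    finally show "norm (exp (w * complex_of_real (cos (2 * pi * t)))) \<le> exp \<bar>Re w\<bar>"
      by (simp add: norm_exp_eq_Re)
  qed
  also have "\<dots> = exp \<bar>Re w\<bar>" using prob_space.prob_space[OF prob_space_unit_interval] by simp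
  finally show ?thesis .
qed

lemma set_integral_scale:
  fixes f :: "real \<Rightarrow> 'b :: {banach, second_countable_topology}"
  assumes "c > 0"
  shows "(LINT x:{0<..}|lborel. f (c * x)) = (LINT x:{0<..}|lborel. f x) /\<^sub>R c"
    and "set_integrable lborel {0<..} f \<Longrightarrow> set_integrable lborel {0<..} (\<lambda>x. f (c * x))"
proof -
  have i: "indicator {0<..} x = (indicator {0<..} (0 + c * x) :: real)" for x
    using assms by (auto simp: indicator_def zero_less_mult_iff)
  show "(LINT x:{0<..}|lborel. f (c * x)) = (LINT x:{0<..}|lborel. f x) /\<^sub>R c"
    unfolding set_lebesgue_integral_def
    using lborel_integral_real_affine[of c "\<lambda>x. indicator {0<..} x *\<^sub>R f x" 0] assms i by simp
  assume "set_integrable lborel {0<..} f"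
  thus "set_integrable lborel {0<..} (\<lambda>x. f (c * x))"
    unfolding set_integrable_def
    using lborel_integrable_real_affine[of "\<lambda>x. indicator {0<..} x *\<^sub>R f x" c 0] assms i by simp
qed

definition gauss_moment :: "real \<Rightarrow> real" where
  "gauss_moment e = (LINT r:{0<..}|lborel. exp (- r\<^sup>2) * r powr (2 * e - 1))"

lemma gauss_moment:
  assumes e: "0 < e" "e \<le> 1/2" and p: "p > 0"
  shows "set_integrable lborel {0<..} (\<lambda>r. exp (- p * r\<^sup>2) * r powr (2 * e - 1))"
    and "(LINT r:{0<..}|lborel. exp (- p * r\<^sup>2) * r powr (2 * e - 1)) = gauss_moment e * p powr (- e)"
proof -
  let ?f = "\<lambda>r::real. exp (- r\<^sup>2) * r powr (2 * e - 1)"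
  have int: "set_integrable lborel {0<..} ?f"
  proof (rule set_integrable_two_powr_bound)
    show "set_borel_measurable lborel {0<..} ?f"
      by (intro set_borel_measurable_cont continuous_intros) auto
    show "norm (?f y) \<le> 1 * y powr (2 * e - 1)" if "0 < y" for y
      using that by (auto simp: abs_mult intro!: mult_right_mono)
    show "norm (?f y) \<le> 1 * y powr (2 * e - 3)" if "y \<ge> 1" for y
    proof -
      have "y\<^sup>2 \<le> exp (y\<^sup>2)" using exp_ge_add_one_self[of "y\<^sup>2"] by linarith
      hence "exp (- y\<^sup>2) \<le> 1 / y\<^sup>2" using that by (simp add: exp_minus field_simps)
      hence "?f y \<le> 1 / y\<^sup>2 * y powr (2 * e - 1)" by (intro mult_right_mono) auto
      also have "1 / y\<^sup>2 = y powr (-2)" using that by (simp add: powr_minus powr_numeral divide_inverse)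
      finally show ?thesis by (simp add: abs_mult flip: powr_add)
    qed
  qed (use e in auto)
  define c where "c = sqrt p"
  have c: "c > 0" "p = c\<^sup>2" using p by (auto simp: c_def)
  have eq: "exp (- p * r\<^sup>2) * r powr (2 * e - 1) = ?f (c * r) * c powr (1 - 2 * e)" if "r > 0" for r
  proof -
    have "c powr (2 * e - 1) * c powr (1 - 2 * e) = 1" using c by (simp flip: powr_add)
    thus ?thesis using that c by (simp add: powr_mult power_mult_distrib)
  qed
  have "set_integrable lborel {0<..} (\<lambda>r. ?f (c * r) * c powr (1 - 2 * e))"
    using set_integral_scale(2)[OF c(1) int] by simp
  thus "set_integrable lborel {0<..} (\<lambda>r. exp (- p * r\<^sup>2) * r powr (2 * e - 1))"
    by (rule set_integrable_cong[THEN iffD1, rotated -1]) (use eq in auto)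
  have "(LINT r:{0<..}|lborel. exp (- p * r\<^sup>2) * r powr (2 * e - 1)) =
        (LINT r:{0<..}|lborel. ?f (c * r) * c powr (1 - 2 * e))"
    by (rule set_lebesgue_integral_cong) (use eq in auto)
  also have "\<dots> = gauss_moment e / c * c powr (1 - 2 * e)"
    using set_integral_scale(1)[OF c(1), of ?f] by (simp add: gauss_moment_def divide_inverse mult.commute)
  also have "c powr (1 - 2 * e) = c * c powr (- (2 * e))" using c by (simp add: powr_diff powr_minus divide_inverse)
  also have "c powr (- (2 * e)) = p powr (- e)" 
    unfolding c using c by (simp add: powr_powr flip: powr_numeral)
  finally show "(LINT r:{0<..}|lborel. exp (- p * r\<^sup>2) * r powr (2 * e - 1)) = gauss_moment e * p powr (- e)"
    using c by simp
qed

lemma gauss_moment_nonneg: "gauss_moment e \<ge> 0"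
  unfolding gauss_moment_def set_lebesgue_integral_def by (intro integral_nonneg_AE) auto

section \<open>The modified Bessel function of the second kind\<close>

lemma half_line_FTC:
  fixes F f :: "real \<Rightarrow> complex"
  assumes "\<And>x. x > 0 \<Longrightarrow> (F has_vector_derivative f x) (at x)" "\<And>x. x > 0 \<Longrightarrow> isCont f x"
    and "set_integrable lborel {0<..} f" "(F \<longlongrightarrow> A) (at_right 0)" "(F \<longlongrightarrow> B) at_top"
  shows "(LINT x:{0<..}|lborel. f x) = B - A"
proof -
  have e: "einterval (ereal 0) \<infinity> = {0<..}" by (auto simp: einterval_def)
  have "(LBINT x=ereal 0..\<infinity>. f x) = B - A"
  proof (rule interval_integral_FTC_integrable)
    show "((F \<circ> real_of_ereal) \<longlongrightarrow> A) (at_right (ereal 0))"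
      using assms(4) unfolding ereal_tendsto_simps .
    show "((F \<circ> real_of_ereal) \<longlongrightarrow> B) (at_left \<infinity>)"
      using assms(5) unfolding ereal_tendsto_simps .
  qed (use assms e in auto)
  thus ?thesis by (simp add: interval_lebesgue_integral_def e)
qed

text \<open>The modified Bessel function of the second kind of order 0, from \<open>\<integral> exp (- w *
  cosh u) du\<close> over the positive half line by the substitution \<open>cosh u = 1 +
  r^2\<close>. The substitution makes the integral Gaussian in \<open>r\<close>.\<close>
definition besselK_right :: "complex \<Rightarrow> complex" where
  "besselK_right w = (LINT r:{0<..}|lborel. of_real (2 / sqrt (2 + r\<^sup>2)) * exp (- w * of_real (1 + r\<^sup>2)))"

text \<open>The same function after the ray of integration has been turned by the direction \<open>exp (\<i>
  pi / 4)\<close>, for which \<open>r^2\<close> becomes \<open>\<i> * r^2\<close>. The integral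
  then converges in the whole lower half plane, in particular on the negative imaginary axis,
  where the unrotated one loses absolute convergence.\<close>
definition besselK_lower :: "complex \<Rightarrow> complex" where
  "besselK_lower w = of_real (sqrt 2) * (1 + \<i>) * exp (- w) *
     (LINT r:{0<..}|lborel. exp (- \<i> * w * of_real (r\<^sup>2)) / csqrt (2 + \<i> * of_real (r\<^sup>2)))"

text \<open>The two representations agree where both converge, so this gluing is holomorphic on the union of
  the two half planes. The fourth quadrant without its corner is all that the rotation argument
  needs.\<close>
definition besselK :: "complex \<Rightarrow> complex" where
  "besselK w = (if Im w < 0 then besselK_lower w else besselK_right w)"

definition besselK' :: "complex \<Rightarrow> complex" where
  "besselK' w = (LINT r:{0<..}|lborel. of_real (- (1 + r\<^sup>2)) * of_real (2 / sqrt (2 + r\<^sup>2)) * exp (- w * of_real (1 + r\<^sup>2)))"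

lemma integrable_gauss: "p > 0 \<Longrightarrow> set_integrable lborel {0<..} (\<lambda>r::real. exp (- p * r\<^sup>2))"
  using gauss_moment(1)[of "1/2" p] by (rule set_integrable_cong[THEN iffD1, rotated -1]) auto

text \<open>As for the first kind, the differential equation follows from an integrand that is an exact
  derivative; the boundary terms vanish because of the exponential decay.\<close>
lemma besselK_right_derivs:
  assumes w: "Re w > 0"
  shows "(besselK_right has_field_derivative besselK' w) (at w)"
    and "(besselK' has_field_derivative (besselK_right w - besselK' w / w)) (at w)"
proof -
  define g where "g r = (indicator {0<..} r *\<^sub>R complex_of_real (2 / sqrt (2 + r\<^sup>2)))" for r :: real
  define l where "l r = - (1 + r\<^sup>2)" for r :: real
  have gm [measurable]: "g \<in> borel_measurable lborel"
  proof -
    have "set_borel_measurable lborel {0<..} (\<lambda>r. complex_of_real (2 / sqrt (2 + r\<^sup>2)))"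
      by (intro set_borel_measurable_cont continuous_intros) (auto simp: add_nonneg_eq_0_iff)
    thus ?thesis unfolding g_def set_borel_measurable_def .
  qed
  have lm [measurable]: "l \<in> borel_measurable lborel" unfolding l_def by measurable
  have i0: "integrable lborel (\<lambda>r. norm (g r) * exp (a * l r))" if "a > 0" for a
  proof (rule Bochner_Integration.integrable_bound)
    show "integrable lborel (\<lambda>r. indicator {0<..} r *\<^sub>R (2 * exp (- a * r\<^sup>2)))"
      using set_integrable_mult_right[of 2, OF integrable_gauss[OF that]] unfolding set_integrable_def by simp
    have "norm (g r) * exp (a * l r) \<le> indicator {0<..} r * (2 * exp (- a * r\<^sup>2))" for r
    proof (cases "r > 0")
      case True
      have q1: "1 \<le> sqrt (2 + r\<^sup>2)" by simp
      have "2 / sqrt (2 + r\<^sup>2) \<le> 2 / 1" by (rule divide_left_mono[OF q1]) (simp_all add: add_pos_nonneg)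
      moreover have "exp (a * l r) \<le> exp (- a * r\<^sup>2)" using that by (simp add: l_def algebra_simps)
      ultimately have "2 / sqrt (2 + r\<^sup>2) * exp (a * l r) \<le> 2 * exp (- a * r\<^sup>2)"
        by (intro mult_mono) auto
      thus ?thesis using True by (simp add: g_def norm_divide)
    qed (simp add: g_def)
    thus "AE r in lborel. norm (norm (g r) * exp (a * l r)) \<le> norm (indicator {0<..} r *\<^sub>R (2 * exp (- a * r\<^sup>2)))"
      by (intro AE_I2) (simp add: abs_mult)
  qed measurable
  have i1: "integrable lborel (\<lambda>r. norm (g r * of_real (l r)) * exp (a * l r))" if "a > 0" for a
  proof -
    have "integrable lborel (\<lambda>r. g r * of_real (l r) * exp (of_real a * of_real (l r)))"
      by (rule exp_integral_integrable_deriv[OF gm lm i0[of "a/2"] i0[of "a+1"]]) (use that in auto)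
    from integrable_norm[OF this] show ?thesis by (simp add: norm_mult norm_exp_eq_Re)
  qed
  define R where "R = Re w"
  have R: "R / 2 > 0" "R + 1 > 0" using w by (auto simp: R_def)
  have d0: "((\<lambda>s. LINT r|lborel. g r * exp (s * of_real (l r))) has_field_derivative
           (LINT r|lborel. g r * of_real (l r) * exp (w * of_real (l r)))) (at w)"
    by (rule exp_integral_has_derivative[OF gm lm i0[OF R(1)] i0[OF R(2)]]) (use w in \<open>auto simp: R_def\<close>)
  have d1: "((\<lambda>s. LINT r|lborel. (g r * of_real (l r)) * exp (s * of_real (l r))) has_field_derivative
           (LINT r|lborel. (g r * of_real (l r)) * of_real (l r) * exp (w * of_real (l r)))) (at w)"
    by (rule exp_integral_has_derivative[OF _ lm i1[OF R(1)] i1[OF R(2)]]) (use w in \<open>auto simp: R_def\<close>)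
  have int0: "integrable lborel (\<lambda>r. g r * exp (w * of_real (l r)))"
    by (rule exp_integral_integrable[OF gm lm i0[OF R(1)] i0[OF R(2)]]) (use w in \<open>auto simp: R_def\<close>)
  have int1: "integrable lborel (\<lambda>r. g r * of_real (l r) * exp (w * of_real (l r)))"
    by (rule exp_integral_integrable_deriv[OF gm lm i0[OF R(1)] i0[OF R(2)]]) (use w in \<open>auto simp: R_def\<close>)
  have int2: "integrable lborel (\<lambda>r. (g r * of_real (l r)) * of_real (l r) * exp (w * of_real (l r)))"
    by (rule exp_integral_integrable_deriv[OF _ lm i1[OF R(1)] i1[OF R(2)]]) (use w in \<open>auto simp: R_def\<close>)
  have el: "exp (- s * of_real (1 + r\<^sup>2)) = exp (s * of_real (l r))" for s r
    by (simp add: l_def algebra_simps)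
  have e0: "besselK_right = (\<lambda>s. LINT r|lborel. g r * exp (s * of_real (l r)))"
    unfolding besselK_right_def el set_lebesgue_integral_def g_def by simp
  have e1: "besselK' = (\<lambda>s. LINT r|lborel. (g r * of_real (l r)) * exp (s * of_real (l r)))"
    unfolding besselK'_def el l_def[symmetric] set_lebesgue_integral_def g_def
    by (simp only: scaleR_conv_of_real mult_ac)
  show "(besselK_right has_field_derivative besselK' w) (at w)" using d0 unfolding e0 e1 .
  let ?e = "\<lambda>r::real. exp (- w * (1 + (of_real r)\<^sup>2))"
  let ?q = "\<lambda>r::real. complex_of_real (sqrt (2 + r\<^sup>2))"
  define F where "F r = - (of_real r * ?q r * ?e r) / w" for r :: real
  define f where "f r = of_real (2 / sqrt (2 + r\<^sup>2)) * (of_real (l r) * of_real (l r) - 1 + of_real (l r) / w) * ?e r" for r :: real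
  have w0: "w \<noteq> 0" using w by auto
  have F_deriv: "(F has_vector_derivative f r) (at r)" for r
  proof -
    have s: "((\<lambda>r. sqrt (2 + r\<^sup>2)) has_real_derivative r / sqrt (2 + r\<^sup>2)) (at r)"
    proof -
      have pos: "2 + r\<^sup>2 > 0" by (simp add: add_pos_nonneg)
      have "((\<lambda>r. 2 + r\<^sup>2) has_real_derivative 2 * r) (at r)"
        by (auto intro!: derivative_eq_intros)
      from DERIV_chain2[OF DERIV_real_sqrt[OF pos] this]
      have "((\<lambda>r. sqrt (2 + r\<^sup>2)) has_real_derivative inverse (sqrt (2 + r\<^sup>2)) / 2 * (2 * r)) (at r)" .
      moreover have "inverse q / 2 * (2 * r) = r / q" for q :: real
        by (metis divide_inverse mult.assoc mult.commute nonzero_mult_div_cancel_right times_divide_eq_left zero_neq_numeral)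
      ultimately show ?thesis by metis
    qed
    have 1: "(?q has_vector_derivative of_real (r / sqrt (2 + r\<^sup>2))) (at r)"
      by (rule has_vector_derivative_of_real[OF s])
    have 2: "(?e has_vector_derivative (- w * (2 * of_real r) * ?e r)) (at r)"
    proof -
      have "((\<lambda>z. exp (- w * (1 + z\<^sup>2))) has_field_derivative (- w * (2 * z) * exp (- w * (1 + z\<^sup>2)))) (at z)" for z
        by (rule derivative_eq_intros refl | simp)+
      from has_vector_derivative_real_field[OF this] show ?thesis .
    qed
    have 3: "((\<lambda>r. complex_of_real r) has_vector_derivative 1) (at r)"
      using has_vector_derivative_of_real[OF DERIV_ident[where F = "at r"]] by simp
    define qr where "qr = ?q r"
    have sqpos: "sqrt (2 + r\<^sup>2) > 0" by (simp add: add_pos_nonneg)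
    have q1: "qr \<noteq> 0" unfolding qr_def of_real_eq_0_iff using sqpos by linarith
    have "sqrt (2 + r\<^sup>2) * sqrt (2 + r\<^sup>2) = 2 + r\<^sup>2"
      unfolding real_sqrt_mult_self by (rule abs_of_nonneg) simp
    hence "qr * qr = of_real (2 + r\<^sup>2)" unfolding qr_def of_real_mult[symmetric] by (rule arg_cong)
    hence q: "qr \<noteq> 0" "qr * qr = 2 + (of_real r)\<^sup>2" using q1 by simp_all
    have d: "(F has_vector_derivative (- ((of_real r * ?q r) * (- w * (2 * of_real r) * ?e r) + 
         (of_real r * of_real (r / sqrt (2 + r\<^sup>2)) + 1 * ?q r) * ?e r) / w)) (at r)"
      unfolding F_def
      by (intro has_vector_derivative_divide has_vector_derivative_minus has_vector_derivative_mult 1 2 3)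
    also have "(- ((of_real r * ?q r) * (- w * (2 * of_real r) * ?e r) + 
         (of_real r * of_real (r / sqrt (2 + r\<^sup>2)) + 1 * ?q r) * ?e r) / w) = f r"
    proof -
      define x where "x = complex_of_real r"
      have "of_real (r / sqrt (2 + r\<^sup>2)) = x / qr" "of_real (2 / sqrt (2 + r\<^sup>2)) = 2 / qr"
        "complex_of_real (l r) = - (1 + x\<^sup>2)"
        by (simp_all add: x_def qr_def l_def)
      moreover have "- ((x * qr) * (- w * (2 * x) * e) + (x * (x / qr) + 1 * qr) * e) / w =
        2 / qr * (- (1 + x\<^sup>2) * - (1 + x\<^sup>2) - 1 + - (1 + x\<^sup>2) / w) * e" for e
      proof -
        have "- ((x * qr) * (- w * (2 * x) * e) + (x * (x / qr) + 1 * qr) * e) / w * (qr * w) =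
              (2 * w * (x\<^sup>2 * (qr * qr)) - (x\<^sup>2 + qr * qr)) * e"
          using q(1) w0 by (simp add: field_simps power2_eq_square)
        also have "\<dots> = 2 / qr * (- (1 + x\<^sup>2) * - (1 + x\<^sup>2) - 1 + - (1 + x\<^sup>2) / w) * e * (qr * w)"
          unfolding q(2)[folded x_def] using q(1) w0 by (simp add: field_simps power2_eq_square)
        finally have E: "- ((x * qr) * (- w * (2 * x) * e) + (x * (x / qr) + 1 * qr) * e) / w * (qr * w) =
          2 / qr * (- (1 + x\<^sup>2) * - (1 + x\<^sup>2) - 1 + - (1 + x\<^sup>2) / w) * e * (qr * w)" .
        show ?thesis by (rule mult_right_cancel[THEN iffD1, OF _ E]) (use q(1) w0 in simp)
      qed
      ultimately show ?thesis unfolding f_def x_def[symmetric] qr_def[symmetric] by (simp only:)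
    qed
    finally show ?thesis .
  qed
  have fint_eq: "(\<lambda>r. indicator {0<..} r *\<^sub>R f r) = (\<lambda>r. (g r * of_real (l r)) * of_real (l r) * exp (w * of_real (l r))
       - g r * exp (w * of_real (l r)) + (g r * of_real (l r) * exp (w * of_real (l r))) / w)"
    by (auto simp: fun_eq_iff f_def g_def l_def indicator_def algebra_simps diff_divide_distrib add_divide_distrib)
  have fint: "set_integrable lborel {0<..} f"
    unfolding set_integrable_def fint_eq using int0 int1 int2 by auto
  have "(LINT r:{0<..}|lborel. f r) = 0 - 0"
  proof (rule half_line_FTC[OF F_deriv _ fint])
    show "isCont f r" for r
      unfolding f_def l_def using w0 
      by (intro continuous_intros) (auto simp: add_nonneg_eq_0_iff)
    have "isCont F 0" unfolding F_def using w0 by (intro continuous_intros) auto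
    hence "(F \<longlongrightarrow> F 0) (at_right 0)" by (rule filterlim_mono[OF isContD]) (auto simp: at_le)
    thus "(F \<longlongrightarrow> 0) (at_right 0)" by (simp add: F_def)
    show "(F \<longlongrightarrow> 0) at_top"
    proof (rule Lim_null_comparison)
      show "\<forall>\<^sub>F r in at_top. norm (F r) \<le> r * sqrt (2 + r\<^sup>2) * exp (- R * (1 + r\<^sup>2)) / norm w"
        using eventually_ge_at_top[of "0::real"]
        by eventually_elim (simp add: F_def norm_divide norm_mult norm_exp_eq_Re R_def power2_eq_square)
      have "R > 0" using R by simp
      hence "((\<lambda>r. r * sqrt (2 + r\<^sup>2) * exp (- R * (1 + r\<^sup>2))) \<longlongrightarrow> 0) at_top"
        by real_asymp
      thus "((\<lambda>r. r * sqrt (2 + r\<^sup>2) * exp (- R * (1 + r\<^sup>2)) / norm w) \<longlongrightarrow> 0) at_top"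
        by (rule tendsto_divide_zero)
    qed
  qed
  hence "(LINT r|lborel. (g r * of_real (l r)) * of_real (l r) * exp (w * of_real (l r)))
       - besselK_right w + besselK' w / w = 0"
    unfolding set_lebesgue_integral_def fint_eq e0 e1 using int0 int1 int2
    by (subst (asm) Bochner_Integration.integral_add; (subst (asm) Bochner_Integration.integral_diff)?) auto
  hence "(LINT r|lborel. (g r * of_real (l r)) * of_real (l r) * exp (w * of_real (l r))) = besselK_right w - besselK' w / w"
    by (simp add: algebra_simps add_eq_0_iff)
  with d1 show "(besselK' has_field_derivative (besselK_right w - besselK' w / w)) (at w)"
    unfolding e1 by simp
qed

lemma csqrt_half_plane: 
  assumes "Re z \<ge> 2"
  shows "z \<notin> \<real>\<^sub>\<le>\<^sub>0" "norm (csqrt z) \<ge> 1" "csqrt z \<noteq> 0"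
proof -
  show "z \<notin> \<real>\<^sub>\<le>\<^sub>0" using assms by (auto simp: complex_nonpos_Reals_iff)
  have "1 \<le> sqrt (norm z)" using assms complex_Re_le_cmod[of z] by simp
  thus "norm (csqrt z) \<ge> 1" by simp
  thus "csqrt z \<noteq> 0" by auto
qed

lemma besselK_lower_deriv:
  assumes w: "Im w < 0"
  shows "besselK_lower field_differentiable (at w)"
proof -
  define g where "g r = (indicator {0<..} r *\<^sub>R (1 / csqrt (2 + \<i> * of_real (r\<^sup>2))))" for r :: real
  define l where "l r = r\<^sup>2" for r :: real
  have gm [measurable]: "g \<in> borel_measurable lborel"
  proof -
    have "continuous_on (- \<real>\<^sub>\<le>\<^sub>0) csqrt" by (intro holomorphic_on_imp_continuous_on holomorphic_on_csqrt)
    moreover have "2 + \<i> * of_real (r\<^sup>2) \<in> - \<real>\<^sub>\<le>\<^sub>0" for r by (rule ComplI, rule csqrt_half_plane(1)[THEN notE]) simp_all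
    ultimately have "continuous_on {0<..} (\<lambda>r. csqrt (2 + \<i> * of_real (r\<^sup>2)))"
      by (intro continuous_on_compose2[where g = csqrt and t = "- \<real>\<^sub>\<le>\<^sub>0" and f = "\<lambda>r::real. 2 + \<i> * of_real (r\<^sup>2)"]
           image_subsetI) (auto intro!: continuous_intros)
    moreover have "csqrt (2 + \<i> * of_real (r\<^sup>2)) \<noteq> 0" for r by (rule csqrt_half_plane) simp
    ultimately have "set_borel_measurable lborel {0<..} (\<lambda>r. 1 / csqrt (2 + \<i> * of_real (r\<^sup>2)))"
      by (intro set_borel_measurable_cont continuous_intros) auto
    thus ?thesis unfolding g_def set_borel_measurable_def .
  qed
  have lm [measurable]: "l \<in> borel_measurable lborel" unfolding l_def by measurable
  have i0: "integrable lborel (\<lambda>r. norm (g r) * exp (a * l r))" if "a < 0" for a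
  proof (rule Bochner_Integration.integrable_bound)
    show "integrable lborel (\<lambda>r. indicator {0<..} r *\<^sub>R (exp (- (-a) * r\<^sup>2)))"
      using integrable_gauss[of "-a"] that unfolding set_integrable_def by simp
    have "norm (g r) * exp (a * l r) \<le> indicator {0<..} r * (exp (- (-a) * r\<^sup>2))" for r
    proof (cases "r > 0")
      case True
      have "1 \<le> norm (csqrt (2 + \<i> * of_real (r\<^sup>2)))" by (rule csqrt_half_plane) simp
      hence "1 / norm (csqrt (2 + \<i> * of_real (r\<^sup>2))) \<le> 1" by (simp only: divide_le_eq_1) simp
      hence "1 / norm (csqrt (2 + \<i> * of_real (r\<^sup>2))) * exp (a * l r) \<le> 1 * exp (a * l r)"
        by (rule mult_right_mono) simp
      thus ?thesis using True unfolding g_def l_def by (simp add: norm_divide)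
    qed (simp add: g_def)
    thus "AE r in lborel. norm (norm (g r) * exp (a * l r)) \<le> norm (indicator {0<..} r *\<^sub>R (exp (- (-a) * r\<^sup>2)))"
      by (intro AE_I2) (simp add: abs_mult)
  qed measurable
  define G where "G s = (LINT r|lborel. g r * exp (s * of_real (l r)))" for s
  have "(G has_field_derivative (LINT r|lborel. g r * of_real (l r) * exp ((- \<i> * w) * of_real (l r)))) (at (- \<i> * w))"
    unfolding G_def by (rule exp_integral_has_derivative[OF gm lm i0[of "2 * Im w"] i0[of "Im w / 2"]]) (use w in auto)
  hence "((\<lambda>w. G (- \<i> * w)) has_field_derivative
     (LINT r|lborel. g r * of_real (l r) * exp ((- \<i> * w) * of_real (l r))) * (- \<i>)) (at w)"
    by (rule DERIV_chain2[where g = "\<lambda>w. - \<i> * w"]) (auto intro!: derivative_eq_intros)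
  then obtain D where D: "((\<lambda>w. G (- \<i> * w)) has_field_derivative D) (at w)" by blast
  have "((\<lambda>w. of_real (sqrt 2) * (1 + \<i>) * exp (- w) * G (- \<i> * w)) has_field_derivative
     (of_real (sqrt 2) * (1 + \<i>) * (exp (- w) * (- 1))) * G (- \<i> * w) +
      D * (of_real (sqrt 2) * (1 + \<i>) * exp (- w))) (at w)"
    by (intro DERIV_mult D DERIV_cmult) (auto intro!: derivative_eq_intros)
  moreover have "besselK_lower = (\<lambda>w. of_real (sqrt 2) * (1 + \<i>) * exp (- w) * G (- \<i> * w))"
    unfolding besselK_lower_def G_def g_def l_def set_lebesgue_integral_def
    by (auto simp: fun_eq_iff intro!: Bochner_Integration.integral_cong)
  ultimately show ?thesis unfolding field_differentiable_def by metis
qed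

text \<open>In the open fourth quadrant the Gaussian factor decays along the real ray and along the ray of
  direction \<open>1 + \<i>\<close> alike, so the ray of integration can be rotated.\<close>
lemma besselK_right_eq_lower:
  assumes w: "Re w > 0" "Im w < 0"
  shows "besselK_right w = besselK_lower w"
proof -
  define u where "u = (1 + \<i>) / of_real (sqrt 2)"
  have sq2: "complex_of_real (sqrt 2) * of_real (sqrt 2) = 2" by (simp flip: of_real_mult)
  have u2: "u * u = \<i>" unfolding u_def by (simp add: sq2 algebra_simps)
  have nu: "norm u = 1" unfolding u_def by (simp add: norm_divide cmod_def power_divide)
  have Ru: "Re u > 0" "Im u = Re u" unfolding u_def by (simp_all add: Re_divide_of_real Im_divide_of_real)
  define f where "f z = exp (- w * z\<^sup>2) / csqrt (2 + z\<^sup>2)" for z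
  define m where "m = min (Re w) (- Im w)"
  have m: "m > 0" "m \<le> Re w" "m \<le> - Im w" using w by (auto simp: m_def)
  have cone_sq: "Re (z\<^sup>2) \<ge> 0 \<and> Im (z\<^sup>2) \<ge> 0" if "z = of_real a + of_real b * u" "a \<ge> 0" "b \<ge> 0" for a b z
  proof -
    have "z\<^sup>2 = of_real (a\<^sup>2) + of_real (b\<^sup>2) * (u * u) + 2 * of_real (a * b) * u"
      using that by (simp add: power2_eq_square algebra_simps)
    thus ?thesis using that Ru by (simp add: u2)
  qed
  have fb: "norm (f z) \<le> exp (- m * (norm z)\<^sup>2)" if "z = of_real a + of_real b * u" "a \<ge> 0" "b \<ge> 0" for a b z
  proof -
    have sq: "Re (z\<^sup>2) \<ge> 0" "Im (z\<^sup>2) \<ge> 0" using cone_sq[OF that] by auto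
    have "m * (norm z)\<^sup>2 = m * norm (z\<^sup>2)" by (simp add: norm_power)
    also have "\<dots> \<le> m * (Re (z\<^sup>2) + Im (z\<^sup>2))" using cmod_le[of "z\<^sup>2"] sq m by (intro mult_left_mono) auto
    also have "\<dots> \<le> Re w * Re (z\<^sup>2) + (- Im w) * Im (z\<^sup>2)"
      unfolding distrib_left using sq m by (intro add_mono mult_right_mono) auto
    also have "\<dots> = Re (w * z\<^sup>2)" by simp
    finally have "exp (- Re (w * z\<^sup>2)) \<le> exp (- m * (norm z)\<^sup>2)" by simp
    moreover have "norm (f z) \<le> exp (- Re (w * z\<^sup>2))"
    proof -
      have "norm (csqrt (2 + z\<^sup>2)) \<ge> 1" using sq by (intro csqrt_half_plane) simp
      hence "exp (- Re (w * z\<^sup>2)) / norm (csqrt (2 + z\<^sup>2)) \<le> exp (- Re (w * z\<^sup>2)) / 1"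
        by (intro divide_left_mono) auto
      thus ?thesis unfolding f_def norm_divide norm_exp_eq_Re by simp
    qed
    ultimately show ?thesis by linarith
  qed
  have rot: "(LINT x:{0<..}|lborel. f (of_real x)) = u * (LINT x:{0<..}|lborel. f (u * of_real x))"
  proof (rule ray_rotation(3)[where S = "{z. Re z > 0}" and C = "max 1 (1 / m)" and \<alpha> = 2 and \<beta> = 0])
    show "convex {z. Re z > 0}" "open {z. Re z > 0}" by (simp_all add: convex_halfspace_Re_gt open_halfspace_Re_gt)
    show "f holomorphic_on {z. Re z > 0}"
      unfolding f_def
    proof (intro holomorphic_intros)
      fix z assume "z \<in> {z. Re z > 0}"
      hence z: "Re z > 0" by simp
      have nn: "2 + z\<^sup>2 \<notin> \<real>\<^sub>\<le>\<^sub>0"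
      proof
        assume "2 + z\<^sup>2 \<in> \<real>\<^sub>\<le>\<^sub>0"
        hence 1: "2 + (Re z * Re z - Im z * Im z) \<le> 0" "Re z * Im z = 0"
          by (auto simp: complex_nonpos_Reals_iff power2_eq_square)
        hence "Im z = 0" using z by simp
        with 1 have "2 + Re z * Re z \<le> 0" by simp
        moreover have "Re z * Re z \<ge> 0" by simp
        ultimately show False by linarith
      qed
      show "2 + z\<^sup>2 \<notin> \<real>\<^sub>\<le>\<^sub>0" by (rule nn)
      show "csqrt (2 + z\<^sup>2) \<noteq> 0" using nn by auto
    qed
    fix a b :: real assume ab: "a \<ge> 0" "b \<ge> 0"
    let ?z = "complex_of_real a + of_real b * u"
    show "?z \<in> {z. Re z > 0}" if "a + b > 0"
    proof (cases "a > 0")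
      case True thus ?thesis using ab Ru by (simp add: add_pos_nonneg)
    qed (use ab that Ru in simp)
    show "norm (f ?z) \<le> max 1 (1 / m) * norm ?z powr - 2" if "norm ?z \<ge> 1"
    proof -
      let ?x = "m * (norm ?z)\<^sup>2"
      have x: "?x > 0" using m that by (smt (verit) mult_pos_pos zero_less_power)
      have "?x \<le> exp ?x" using exp_ge_add_one_self[of ?x] by linarith
      hence "exp (- ?x) \<le> 1 / ?x" using x by (simp add: exp_minus field_simps)
      hence "norm (f ?z) \<le> (1 / m) * (1 / (norm ?z)\<^sup>2)" using fb[OF refl ab] by simp
      also have "\<dots> \<le> max 1 (1 / m) * (1 / (norm ?z)\<^sup>2)" by (intro mult_right_mono) auto
      also have "1 / (norm ?z)\<^sup>2 = norm ?z powr - 2" using that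
        by (subst powr_minus, subst powr_numeral) (auto simp: divide_inverse)
      finally show ?thesis .
    qed
    show "norm (f ?z) \<le> max 1 (1 / m) * norm ?z powr - 0" if "a + b > 0" "norm ?z \<le> 1"
    proof -
      have "?z \<noteq> 0" using norm_cone_ge[OF nu _ ab] Ru that(1) by auto
      moreover have "exp (- m * (norm ?z)\<^sup>2) \<le> 1" using m by simp
      hence "norm (f ?z) \<le> 1" using fb[OF refl ab] by linarith
      ultimately show ?thesis by simp
    qed
  qed (use nu Ru in auto)
  have "besselK_right w = 2 * exp (- w) * (LINT x:{0<..}|lborel. f (of_real x))"
    unfolding besselK_right_def set_integral_mult_right[symmetric]
  proof (rule set_lebesgue_integral_cong; safe?)
    fix r :: real
    have "csqrt (2 + (of_real r)\<^sup>2) = of_real (sqrt (2 + r\<^sup>2))"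
      using csqrt_of_real[of "2 + r\<^sup>2"] by simp
    thus "of_real (2 / sqrt (2 + r\<^sup>2)) * exp (- w * of_real (1 + r\<^sup>2)) = 2 * exp (- w) * f (of_real r)"
      by (simp add: f_def ring_distribs exp_add exp_diff exp_minus field_simps)
  qed simp
  also have "\<dots> = 2 * u * exp (- w) * (LINT x:{0<..}|lborel. f (u * of_real x))" by (simp add: rot)
  also have "2 * u = of_real (sqrt 2) * (1 + \<i>)" unfolding u_def by (subst sq2[symmetric]) simp
  also have "(\<lambda>x::real. f (u * of_real x)) = (\<lambda>r. exp (- \<i> * w * of_real (r\<^sup>2)) / csqrt (2 + \<i> * of_real (r\<^sup>2)))"
    by (auto simp: f_def fun_eq_iff power2_eq_square u2 mult_ac) (metis u2 mult.assoc)+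
  finally show ?thesis unfolding besselK_lower_def .
qed


text \<open>Replacing the weight \<open>1 / m\<close> by a power of \<open>r\<close> trades decay at
  infinity for an arbitrarily mild singularity at 0. This interpolation gives one bound that
  serves for small and for large arguments.\<close>
lemma powr_weight_le:
  fixes e r m :: real
  assumes "0 < e" "e \<le> 1/2" "r > 0" "m \<ge> 1" "m \<ge> r"
  shows "1 / m \<le> r powr (2 * e - 1)"
proof -
  have "r powr (1 - 2 * e) \<le> m"
  proof (cases "r \<le> 1")
    case True
    hence "r powr (1 - 2 * e) \<le> 1" using assms by (intro powr_le1) auto
    thus ?thesis using assms by linarith
  next
    case False
    hence "r powr (1 - 2 * e) \<le> r powr 1" using assms by (intro powr_mono) auto
    thus ?thesis using assms by simp
  qed
  moreover have "r powr (1 - 2 * e) > 0" using assms by simp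
  ultimately have "1 / m \<le> 1 / r powr (1 - 2 * e)" using assms by (intro divide_left_mono mult_pos_pos) auto
  also have "\<dots> = r powr (2 * e - 1)" using powr_minus_divide[of r "1 - 2 * e"] by simp
  finally show ?thesis .
qed

lemma gauss_weight_bound:
  fixes h :: "real \<Rightarrow> complex"
  assumes e: "0 < e" "e \<le> 1/2" "p > 0" and h: "\<And>r. r > 0 \<Longrightarrow> norm (h r) \<le> exp (- p * r\<^sup>2) * r powr (2 * e - 1)"
  shows "norm (LINT r:{0<..}|lborel. h r) \<le> gauss_moment e * p powr (- e)"
proof -
  have "norm (LINT r:{0<..}|lborel. h r) \<le> (LINT r:{0<..}|lborel. norm (h r))"
    unfolding set_lebesgue_integral_def using integral_norm_bound[of lborel "\<lambda>r. indicator {0<..} r *\<^sub>R h r"] by simp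
  also have "\<dots> \<le> (LINT r:{0<..}|lborel. exp (- p * r\<^sup>2) * r powr (2 * e - 1))"
    unfolding set_lebesgue_integral_def
    using gauss_moment(1)[OF e] h unfolding set_integrable_def
    by (intro integral_mono') (auto simp: indicator_def)
  finally show ?thesis using gauss_moment(2)[OF e] by simp
qed

lemma norm_besselK_right_le:
  assumes e: "0 < e" "e \<le> 1/2" and w: "Re w > 0"
  shows "norm (besselK_right w) \<le> 2 * gauss_moment e * exp (- Re w) * Re w powr (- e)"
proof -
  have "besselK_right w = 2 * exp (- w) * (LINT r:{0<..}|lborel. of_real (1 / sqrt (2 + r\<^sup>2)) * exp (- w * of_real (r\<^sup>2)))"
    unfolding besselK_right_def set_integral_mult_right[symmetric]
  proof (rule set_lebesgue_integral_cong; safe?)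
    fix r :: real
    have "exp (- w * of_real (1 + r\<^sup>2)) = exp (- w) * exp (- w * of_real (r\<^sup>2))"
      unfolding exp_add[symmetric] by (simp add: algebra_simps)
    thus "of_real (2 / sqrt (2 + r\<^sup>2)) * exp (- w * of_real (1 + r\<^sup>2)) =
      2 * exp (- w) * (of_real (1 / sqrt (2 + r\<^sup>2)) * exp (- w * of_real (r\<^sup>2)))" by simp
  qed simp
  also have "norm \<dots> \<le> 2 * exp (- Re w) * (gauss_moment e * Re w powr (- e))"
    unfolding norm_mult
  proof (intro mult_mono gauss_weight_bound e w)
    fix r :: real assume r: "r > 0"
    have "1 / sqrt (2 + r\<^sup>2) \<le> r powr (2 * e - 1)"
      using r e by (intro powr_weight_le) (auto intro: real_le_rsqrt)
    hence "exp (- Re w * r\<^sup>2) * (1 / sqrt (2 + r\<^sup>2)) \<le> exp (- Re w * r\<^sup>2) * r powr (2 * e - 1)"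
      by (rule mult_left_mono) simp
    moreover have "norm (of_real (1 / sqrt (2 + r\<^sup>2)) * exp (- w * of_real (r\<^sup>2))) = exp (- Re w * r\<^sup>2) * (1 / sqrt (2 + r\<^sup>2))"
      unfolding norm_mult norm_exp_eq_Re norm_of_real by simp
    ultimately show "norm (of_real (1 / sqrt (2 + r\<^sup>2)) * exp (- w * of_real (r\<^sup>2))) \<le> exp (- Re w * r\<^sup>2) * r powr (2 * e - 1)"
      by simp
  qed (auto simp: norm_exp_eq_Re)
  finally show ?thesis by (simp add: mult_ac)
qed

lemma norm_besselK_lower_le:
  assumes e: "0 < e" "e \<le> 1/2" and w: "Im w < 0"
  shows "norm (besselK_lower w) \<le> 2 * gauss_moment e * exp (- Re w) * (- Im w) powr (- e)"
proof -
  have c: "norm (of_real (sqrt 2) * (1 + \<i>)) = 2" by (simp add: norm_mult cmod_def)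
  have "norm (besselK_lower w) \<le> 2 * exp (- Re w) * (gauss_moment e * (- Im w) powr (- e))"
    unfolding besselK_lower_def norm_mult[of "of_real (sqrt 2) * (1 + \<i>) * exp (- w)"] 
      norm_mult[of "of_real (sqrt 2) * (1 + \<i>)"] c
  proof (intro mult_mono gauss_weight_bound e)
    fix r :: real assume r: "r > 0"
    have n: "norm (2 + \<i> * of_real (r\<^sup>2)) = sqrt (4 + (r\<^sup>2)\<^sup>2)" by (simp add: cmod_def)
    have "1 \<le> sqrt (4 + (r\<^sup>2)\<^sup>2)" by simp
    moreover have "r\<^sup>2 \<le> sqrt (4 + (r\<^sup>2)\<^sup>2)" by (rule real_le_rsqrt) simp
    ultimately have "1 / norm (csqrt (2 + \<i> * of_real (r\<^sup>2))) \<le> r powr (2 * e - 1)"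
      using r e by (intro powr_weight_le) (auto simp: n simp del: of_real_power intro: real_le_rsqrt)
    hence "exp (Im w * r\<^sup>2) * (1 / norm (csqrt (2 + \<i> * of_real (r\<^sup>2)))) \<le> exp (Im w * r\<^sup>2) * r powr (2 * e - 1)"
      by (rule mult_left_mono) simp
    thus "norm (exp (- \<i> * w * of_real (r\<^sup>2)) / csqrt (2 + \<i> * of_real (r\<^sup>2))) \<le> exp (- (- Im w) * r\<^sup>2) * r powr (2 * e - 1)"
      unfolding norm_divide norm_exp_eq_Re by simp
  qed (use w in \<open>auto simp: norm_exp_eq_Re\<close>)
  thus ?thesis by (simp add: mult_ac)
qed

lemma besselK_eq_right: "Re w > 0 \<Longrightarrow> besselK w = besselK_right w"
  using besselK_right_eq_lower by (simp add: besselK_def)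

text \<open>The function has a logarithmic singularity at 0 and decays like \<open>exp (- w) / sqrt
  w\<close> at infinity. Letting the exponent \<open>e\<close> vary covers both: small
  \<open>e\<close> near 0 and \<open>e = 1/2\<close> at infinity. Depending on whether the real
  or the imaginary part of \<open>w\<close> dominates, the first or the second integral
  representation gives the estimate.\<close>
lemma norm_besselK_le:
  assumes e: "0 < e" "e \<le> 1/2" and w: "Re w \<ge> 0" "Im w \<le> 0" "w \<noteq> 0"
  shows "norm (besselK w) \<le> 4 * gauss_moment e * exp (- Re w) * norm w powr (- e)"
proof -
  define q where "q = (if - Im w \<ge> norm w / 2 then - Im w else Re w)"
  have nw: "norm w > 0" using w by simp
  have q: "q \<ge> norm w / 2" using cmod_le[of w] w by (auto simp: q_def)
  have q0: "q > 0" using q nw by linarith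
  have "norm (besselK w) \<le> 2 * gauss_moment e * exp (- Re w) * q powr (- e)"
  proof (cases "- Im w \<ge> norm w / 2")
    case True
    hence "Im w < 0" using nw by linarith
    thus ?thesis using True norm_besselK_lower_le[OF e] by (simp add: besselK_def q_def)
  next
    case False
    thus ?thesis using q0 norm_besselK_right_le[OF e, of w] by (simp add: besselK_eq_right q_def)
  qed
  also have "\<dots> \<le> 2 * gauss_moment e * exp (- Re w) * (2 * norm w powr (- e))"
  proof (intro mult_left_mono)
    have "q powr (- e) \<le> (norm w / 2) powr (- e)" using q nw e by (intro powr_mono2') auto
    also have "\<dots> = norm w powr (- e) * 2 powr e" using nw by (simp add: powr_divide powr_minus field_simps)
    also have "2 powr e \<le> 2 powr (1::real)" using e by (intro powr_mono) auto
    hence "norm w powr (- e) * 2 powr e \<le> norm w powr (- e) * 2" by (intro mult_left_mono) auto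
    finally show "q powr (- e) \<le> 2 * norm w powr (- e)" by simp
  qed (use gauss_moment_nonneg in auto)
  finally show ?thesis by (simp add: mult_ac)
qed

lemma besselK_holomorphic: "besselK holomorphic_on ({w. Re w > 0} \<union> {w. Im w < 0})"
proof (rule holomorphic_on_Un)
  have "besselK_right holomorphic_on {w. Re w > 0}"
    unfolding holomorphic_on_def using besselK_right_derivs(1)
    by (auto simp: field_differentiable_def intro: has_field_derivative_at_within)
  thus "besselK holomorphic_on {w. Re w > 0}"
    by (rule holomorphic_transform) (simp add: besselK_eq_right)
  have "besselK_lower holomorphic_on {w. Im w < 0}"
    unfolding holomorphic_on_def using besselK_lower_deriv
    by (auto intro: field_differentiable_at_within)
  thus "besselK holomorphic_on {w. Im w < 0}"
    by (rule holomorphic_transform) (simp add: besselK_def)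
qed (simp_all add: open_halfspace_Re_gt open_halfspace_Im_lt)

lemma besselK_real: "y > 0 \<Longrightarrow> besselK (of_real y) \<in> \<real>"
proof -
  assume "y > 0"
  have "besselK (of_real y) = (LINT r:{0<..}|lborel. complex_of_real (2 / sqrt (2 + r\<^sup>2) * exp (- y * (1 + r\<^sup>2))))"
    using \<open>y > 0\<close> by (simp add: besselK_eq_right besselK_right_def exp_of_real[symmetric])
  also have "\<dots> = complex_of_real (LINT r:{0<..}|lborel. 2 / sqrt (2 + r\<^sup>2) * exp (- y * (1 + r\<^sup>2)))"
    by (rule set_integral_complex_of_real)
  finally show ?thesis by simp
qed

section \<open>Hankel splitting on the imaginary axis\<close>

lemma continuous_csqrt_imaginary_square:
  "continuous_on UNIV (\<lambda>r::real. csqrt (2 + \<i> * of_real (r\<^sup>2)))"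
proof (rule continuous_on_compose2[where g = csqrt and t = "- \<real>\<^sub>\<le>\<^sub>0" and f = "\<lambda>r::real. 2 + \<i> * of_real (r\<^sup>2)"])
  show "continuous_on (- \<real>\<^sub>\<le>\<^sub>0) csqrt" by (intro holomorphic_on_imp_continuous_on holomorphic_on_csqrt)
  show "(\<lambda>r::real. 2 + \<i> * of_real (r\<^sup>2)) ` UNIV \<subseteq> - \<real>\<^sub>\<le>\<^sub>0"
  proof (rule image_subsetI)
    fix r :: real
    have "2 + \<i> * of_real (r\<^sup>2) \<notin> \<real>\<^sub>\<le>\<^sub>0" by (rule csqrt_half_plane(1)) simp
    thus "2 + \<i> * of_real (r\<^sup>2) \<in> - \<real>\<^sub>\<le>\<^sub>0" by blast
  qed
qed (intro continuous_intros)

text \<open>Symmetries of an integrand become identities between values of one primitive.\<close>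
lemma entire_primitives_differ_by_constant:
  fixes F G g :: "complex \<Rightarrow> complex"
  assumes "\<And>z. (F has_field_derivative g z) (at z)" "\<And>z. (G has_field_derivative g z) (at z)"
  shows "F a - G a = F b - G b"
proof -
  have "((\<lambda>z. F z - G z) has_field_derivative 0) (at z within UNIV)" for z
    using DERIV_diff[OF assms(1) assms(2), of z] by simp
  then obtain c where "\<And>z. F z - G z = c"
    using has_field_derivative_zero_constant[of UNIV "\<lambda>z. F z - G z"] by auto
  thus ?thesis by metis
qed

lemma besselI_even: "besselI (- w) = besselI w"
proof -
  have "(\<lambda>m. (w / 2) ^ (2 * m) / (fact m)\<^sup>2) sums besselI (- w)"
    using besselI_sums[of "- w"] by (simp add: power_mult power2_eq_square)
  thus ?thesis using besselI_sums[of w] by (rule sums_unique2)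
qed

text \<open>The integral over a full period folds onto a quarter period: \<open>z\<close> to \<open>2 pi -
  z\<close> fixes the integrand and \<open>z\<close> to \<open>pi - z\<close> conjugates it.\<close>
lemma besselI_imaginary_axis_primitive:
  fixes F :: "complex \<Rightarrow> complex"
  assumes F: "\<And>z. (F has_field_derivative exp (\<i> * of_real x * cos z)) (at z)"
  shows "of_real pi * besselI (\<i> * of_real x) = of_real (2 * Re (F (of_real (pi / 2)) - F 0))"
proof -
  let ?g = "\<lambda>z. exp (\<i> * of_real x * cos z)"
  have "((\<lambda>z. F (2 * of_real pi * z) / (2 * of_real pi)) has_field_derivative ?g (2 * of_real pi * z)) (at z)" for z
  proof -
    have "((\<lambda>z. F (2 * of_real pi * z)) has_field_derivative ?g (2 * of_real pi * z) * (2 * of_real pi)) (at z)"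
      by (rule DERIV_chain2[where g = "\<lambda>z. 2 * of_real pi * z", OF F]) (auto intro!: derivative_eq_intros)
    from DERIV_cdivide[OF this, of "2 * of_real pi"] show ?thesis by simp
  qed
  from unit_interval_FTC[OF this]
  have "besselI (\<i> * of_real x) = (F (2 * of_real pi) - F 0) / (2 * of_real pi)"
    unfolding besselI_def by (simp add: trig_2pi_of_real continuous_intros diff_divide_distrib)
  moreover have "F (2 * of_real pi) - F 0 = 2 * (F (of_real pi) - F 0)"
  proof -
    have "((\<lambda>z. - F (2 * of_real pi - z)) has_field_derivative ?g z) (at z)" for z
    proof -
      have "((\<lambda>z. F (2 * of_real pi - z)) has_field_derivative ?g (2 * of_real pi - z) * (- 1)) (at z)"
        by (rule DERIV_chain2[where g = "\<lambda>z. 2 * of_real pi - z", OF F]) (auto intro!: derivative_eq_intros)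
      from DERIV_minus[OF this] show ?thesis by (simp add: cos_diff)
    qed
    from entire_primitives_differ_by_constant[OF F this, of "of_real pi" 0] show ?thesis
      by (simp add: algebra_simps)
  qed
  moreover have "F (of_real pi) - F (of_real (pi / 2)) = cnj (F (of_real (pi / 2)) - F 0)"
  proof -
    have 1: "((\<lambda>z. - F (of_real pi - z)) has_field_derivative exp (- \<i> * of_real x * cos z)) (at z)" for z
    proof -
      have "((\<lambda>z. F (of_real pi - z)) has_field_derivative ?g (of_real pi - z) * (- 1)) (at z)"
        by (rule DERIV_chain2[where g = "\<lambda>z. of_real pi - z", OF F]) (auto intro!: derivative_eq_intros)
      from DERIV_minus[OF this] show ?thesis by (simp add: cos_diff)
    qed
    have 2: "((cnj \<circ> F \<circ> cnj) has_field_derivative exp (- \<i> * of_real x * cos z)) (at z)" for z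
      using has_field_derivative_cnj_cnj[OF F[of "cnj z"]] by (simp add: exp_cnj cnj_cos)
    have "of_real pi - complex_of_real (pi / 2) = of_real (pi / 2)"
      by (metis add_diff_cancel_left' field_sum_of_halves of_real_diff)
    with entire_primitives_differ_by_constant[OF 2 1, of 0 "of_real (pi / 2)"] show ?thesis
      by (simp add: algebra_simps)
  qed
  moreover have "complex_of_real pi \<noteq> 0" by simp
  ultimately have "of_real pi * besselI (\<i> * of_real x) = F (of_real pi) - F 0" by simp
  also have "\<dots> = (F (of_real (pi / 2)) - F 0) + (F (of_real pi) - F (of_real (pi / 2)))" by simp
  also have "F (of_real pi) - F (of_real (pi / 2)) = cnj (F (of_real (pi / 2)) - F 0)" by fact
  finally have "of_real pi * besselI (\<i> * of_real x) = (F (of_real (pi / 2)) - F 0) + cnj (F (of_real (pi / 2)) - F 0)" .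
  thus ?thesis unfolding complex_add_cnj .
qed

lemma cos_Re_pos: "Re (cos z) > 0 \<Longrightarrow> cos (Re z) > 0"
  using zero_less_mult_pos2[of "cos (Re z)" "(exp (Im z) + exp (- Im z)) / 2"]
  by (simp add: Re_cos add_pos_pos)

lemma sin_Re_pos: "Re (sin z) > 0 \<Longrightarrow> sin (Re z) > 0"
  using zero_less_mult_pos2[of "sin (Re z)" "(exp (Im z) + exp (- Im z)) / 2"]
  by (simp add: Re_sin add_pos_pos)

text \<open>The curve \<open>2 * Arcsin ((1 - \<i>) / 2 * R)\<close> is the path along which \<open>\<i> * x
  * cos z\<close> equals \<open>\<i> * x - x * R^2\<close>, that is, the path of steepest
  descent from 0 for the integrand of the Bessel function.\<close>
lemma Arcsin_diagonal:
  assumes R: "R > 0"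
  defines "A \<equiv> Arcsin ((1 - \<i>) / 2 * of_real R)"
  shows "cos (2 * A) = 1 + \<i> * of_real (R\<^sup>2)"
    and "cos A = csqrt (2 + \<i> * of_real (R\<^sup>2)) / of_real (sqrt 2)"
    and "0 < Re (2 * A)" "Re (2 * A) < pi / 2"
proof -
  let ?z = "(1 - \<i>) / 2 * of_real R"
  have z2: "?z\<^sup>2 = - \<i> * of_real (R\<^sup>2) / 2" by (simp add: power2_eq_square field_simps)
  have s: "sin A = ?z" unfolding A_def by simp
  show c2: "cos (2 * A) = 1 + \<i> * of_real (R\<^sup>2)"
    using z2 by (simp add: cos_double_sin s)
  have Rz: "Re ?z = R / 2" by simp
  have "cos A = csqrt (1 - ?z\<^sup>2)" unfolding A_def using R by (intro cos_Arcsin) simp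
  also have "\<dots> = csqrt (2 + \<i> * of_real (R\<^sup>2)) / of_real (sqrt 2)" (is "_ = ?w")
  proof (rule csqrt_unique)
    have "complex_of_real (sqrt 2) ^ 2 = 2" by (simp flip: of_real_power)
    thus "?w\<^sup>2 = 1 - ?z\<^sup>2" unfolding z2 by (simp add: power_divide add_divide_distrib)
    show "0 < Re ?w \<or> Re ?w = 0 \<and> 0 \<le> Im ?w"
      using csqrt_principal[of "2 + \<i> * of_real (R\<^sup>2)"] unfolding Re_divide_of_real Im_divide_of_real by force
  qed
  finally show ca: "cos A = ?w" .
  have "Re (csqrt (2 + \<i> * of_real (R\<^sup>2))) > 0" by (simp add: add_nonneg_pos)
  hence cpos: "Re (cos A) > 0" by (simp add: ca Re_divide_of_real)
  hence ca0: "cos (Re A) > 0"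
    by (rule cos_Re_pos)
  have "Re (sin A) > 0" unfolding s Rz using R by simp
  hence sa0: "sin (Re A) > 0"
    by (rule sin_Re_pos)
  have b: "- pi < Re A" "Re A \<le> pi" using Re_Arcsin_bounds[of ?z] by (auto simp: A_def)
  have a0: "0 < Re A"
  proof (rule ccontr)
    assume "\<not> 0 < Re A"
    hence "sin (- Re A) \<ge> 0" using b by (intro sin_ge_zero) auto
    thus False using sa0 by simp
  qed
  have a1: "Re A < pi / 2"
  proof (rule ccontr)
    assume "\<not> Re A < pi / 2"
    hence "cos (Re A) \<le> cos (pi / 2)" using b by (intro cos_monotone_0_pi_le) auto
    thus False using ca0 by simp
  qed
  show "0 < Re (2 * A)" using a0 by simp
  have "Re (cos (2 * A)) > 0" using c2 by simp
  hence c2a: "cos (Re (2 * A)) > 0"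
    by (rule cos_Re_pos)
  show "Re (2 * A) < pi / 2"
  proof (rule ccontr)
    assume "\<not> Re (2 * A) < pi / 2"
    hence "cos (Re (2 * A)) \<le> cos (pi / 2)" using a1 by (intro cos_monotone_0_pi_le) auto
    thus False using c2a by simp
  qed
qed

text \<open>The oscillating integral over the quarter period from 0 to \<open>pi / 2\<close> is deformed:
  along the path of steepest descent from 0 it becomes a Gaussian integral, which is the rotated
  representation of the second Bessel function; the remaining vertical line over \<open>pi /
  2\<close> contributes an imaginary amount, which the real part removes.\<close>
theorem besselI_eq_besselK_imaginary:
  assumes x: "x > 0"
  defines "X \<equiv> - \<i> * besselK (- \<i> * of_real x) / of_real pi"
  shows "besselI (- \<i> * of_real x) = X + cnj X"
proof -
  let ?g = "\<lambda>z. exp (\<i> * of_real x * cos z)"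
  have "?g holomorphic_on UNIV" by (intro holomorphic_intros)
  then obtain F where "\<And>z. (F has_field_derivative ?g z) (at z)"
    using holomorphic_convex_primitive'[of UNIV ?g] by auto
  note F = this
  define c where "c = (1 - \<i>) / 2"
  define \<gamma> where "\<gamma> r = 2 * Arcsin (c * of_real r)" for r :: real
  define h where "h r = of_real (sqrt 2) * (1 - \<i>) * exp (\<i> * of_real x) * (exp (of_real (- x * r\<^sup>2)) / csqrt (2 + \<i> * of_real (r\<^sup>2)))" for r :: real
  have h_int: "set_integrable lborel {0<..} h"
  proof (rule set_integrable_bound)
    show "set_integrable lborel {0<..} (\<lambda>r. 2 * exp (- x * r\<^sup>2))"
      using integrable_gauss[OF x] by (rule set_integrable_mult_right)
    have "continuous_on {0<..} (\<lambda>r::real. csqrt (2 + \<i> * of_real (r\<^sup>2)))"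
      using continuous_csqrt_imaginary_square by (rule continuous_on_subset) simp
    moreover have "csqrt (2 + \<i> * of_real (r\<^sup>2)) \<noteq> 0" for r by (rule csqrt_half_plane) simp
    ultimately have "continuous_on {0<..} h" unfolding h_def
      by (intro continuous_intros) auto
    thus "set_borel_measurable lborel {0<..} h" by (intro set_borel_measurable_cont) auto
    have "norm (h r) \<le> 2 * exp (- x * r\<^sup>2)" for r
    proof -
      have cn: "norm (of_real (sqrt 2) * (1 - \<i>)) = 2" by (simp add: norm_mult cmod_def)
      have "1 \<le> norm (csqrt (2 + \<i> * of_real (r\<^sup>2)))" by (rule csqrt_half_plane) simp
      hence "exp (- x * r\<^sup>2) / norm (csqrt (2 + \<i> * of_real (r\<^sup>2))) \<le> exp (- x * r\<^sup>2) / 1"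
        by (intro divide_left_mono) auto
      thus ?thesis
        unfolding h_def norm_mult[of "of_real (sqrt 2) * (1 - \<i>) * exp (\<i> * of_real x)"] 
          norm_mult[of "of_real (sqrt 2) * (1 - \<i>)"] cn norm_divide norm_exp_eq_Re by simp
    qed
    thus "AE r in lborel. r \<in> {0<..} \<longrightarrow> norm (h r) \<le> norm (2 * exp (- x * r\<^sup>2))" by simp
  qed
  have leg: "((\<lambda>r. F (\<gamma> r)) has_vector_derivative h r) (at r)" if r: "r > 0" for r
  proof -
    let ?A = "Arcsin (c * of_real r)"
    let ?q = "csqrt (2 + \<i> * of_real (r\<^sup>2))"
    have q0: "?q \<noteq> 0" by (rule csqrt_half_plane) simp
    have dA: "((\<lambda>z. 2 * Arcsin (c * z)) has_field_derivative 2 * (inverse (cos ?A) * c)) (at (of_real r))"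
      using r by (intro DERIV_cmult DERIV_chain2[where f = Arcsin and g = "\<lambda>z. c * z"] has_field_derivative_Arcsin)
         (auto simp: c_def intro!: derivative_eq_intros)
    have "((\<lambda>z. F (2 * Arcsin (c * z))) has_field_derivative ?g (2 * ?A) * (2 * (inverse (cos ?A) * c))) (at (of_real r))"
      by (rule DERIV_chain2[where f = F, OF F dA])
    from has_vector_derivative_real_field[OF this]
    have "((\<lambda>r. F (\<gamma> r)) has_vector_derivative ?g (2 * ?A) * (2 * (inverse (cos ?A) * c))) (at r)"
      unfolding \<gamma>_def .
    also have "?g (2 * ?A) = exp (\<i> * of_real x) * exp (of_real (- x * r\<^sup>2))"
      unfolding Arcsin_diagonal(1)[OF r, folded c_def] exp_add[symmetric]
      by (simp add: algebra_simps)
    also have "2 * (inverse (cos ?A) * c) = of_real (sqrt 2) * (1 - \<i>) / ?q"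
      unfolding Arcsin_diagonal(2)[OF r, folded c_def] using q0 by (simp add: c_def field_simps)
    finally show ?thesis unfolding h_def by (simp add: mult_ac)
  qed
  have start: "((\<lambda>r. F (\<gamma> r)) \<longlongrightarrow> F 0) (at_right 0)"
  proof -
    have "isCont (\<lambda>r. F (\<gamma> r)) 0"
      unfolding \<gamma>_def
      by (intro isCont_o2[where g = F, OF _ DERIV_isCont[OF F]] continuous_intros isCont_Arcsin') auto
    hence "((\<lambda>r. F (\<gamma> r)) \<longlongrightarrow> F (\<gamma> 0)) (at_right 0)"
      by (rule filterlim_mono[OF isContD]) (auto simp: at_le)
    thus ?thesis by (simp add: \<gamma>_def)
  qed
  define d where "d r = F (of_real (pi / 2) + \<i> * of_real (Im (\<gamma> r))) - F (\<gamma> r)" for r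
  have vert: "Re (F (of_real (pi / 2) + \<i> * of_real b)) = Re (F (of_real (pi / 2)))" for b
  proof -
    have "((\<lambda>b. Re (F (of_real (pi / 2) + \<i> * of_real b))) has_real_derivative 0) (at b)" for b
    proof -
      let ?z = "of_real (pi / 2) + \<i> * of_real b"
      have "((\<lambda>z. F (of_real (pi / 2) + \<i> * z)) has_field_derivative ?g ?z * \<i>) (at (of_real b))"
        by (rule DERIV_chain2[where f = F and g = "\<lambda>z. of_real (pi / 2) + \<i> * z", OF F]) (auto intro!: derivative_eq_intros)
      from has_vector_derivative_real_field[OF this]
      have "((\<lambda>b. Re (F (of_real (pi / 2) + \<i> * of_real b))) has_vector_derivative Re (?g ?z * \<i>)) (at b)"
        by (rule bounded_linear.has_vector_derivative[OF bounded_linear_Re])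
      moreover have "Re (?g ?z * \<i>) = 0" by (simp add: Im_exp Re_cos Im_cos)
      ultimately show ?thesis by (simp add: has_real_derivative_iff_has_vector_derivative)
    qed
    from DERIV_isconst_all[of "\<lambda>b. Re (F (of_real (pi / 2) + \<i> * of_real b))" b 0] this show ?thesis by auto
  qed
  have d_bound: "norm (d r) \<le> exp (- x * r\<^sup>2) * 2" if r: "r > 0" for r
  proof -
    define a b where "a = Re (\<gamma> r)" and "b = Im (\<gamma> r)"
    have a: "0 < a" "a < pi / 2" using Arcsin_diagonal(3,4)[OF r] by (simp_all add: a_def \<gamma>_def c_def)
    have gz: "\<gamma> r = of_real a + \<i> * of_real b" by (simp add: a_def b_def complex_eq_iff)
    have "Im (cos (\<gamma> r)) = r\<^sup>2" using Arcsin_diagonal(1)[OF r] by (simp add: \<gamma>_def c_def)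
    hence Im: "sin a * ((exp (- b) - exp b) / 2) = r\<^sup>2" by (simp add: Im_cos a_def b_def)
    have sa: "sin a > 0" using a by (intro sin_gt_zero) auto
    have eb: "(exp (- b) - exp b) / 2 > 0"
    proof (rule ccontr)
      assume "\<not> ?thesis"
      hence "sin a * ((exp (- b) - exp b) / 2) \<le> 0" using sa by (simp add: mult_nonneg_nonpos)
      thus False using Im r by simp
    qed
    have "norm (F (of_real (pi / 2) + \<i> * of_real b) - F (\<gamma> r)) \<le>
       exp (- x * r\<^sup>2) * norm (of_real (pi / 2) + \<i> * of_real b - \<gamma> r)"
    proof (rule field_differentiable_bound[OF convex_closed_segment])
      fix z assume z: "z \<in> closed_segment (\<gamma> r) (of_real (pi / 2) + \<i> * of_real b)"
      show "(F has_field_derivative ?g z) (at z within closed_segment (\<gamma> r) (of_real (pi / 2) + \<i> * of_real b))"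
        by (rule has_field_derivative_at_within[OF F])
      from z obtain t where t: "0 \<le> t" "t \<le> 1" "z = (1 - t) *\<^sub>R (\<gamma> r) + t *\<^sub>R (of_real (pi / 2) + \<i> * of_real b)"
        by (auto simp: in_segment)
      have "Im z = (1 - t) * b + t * b" "Re z = (1 - t) * a + t * (pi / 2)" unfolding t(3) gz by simp_all
      hence Imz: "Im z = b" and Rez: "Re z = a + t * (pi / 2 - a)" by (simp_all add: algebra_simps)
      have t1: "t * (pi / 2 - a) \<ge> 0" using t a by simp
      have t2: "t * (pi / 2 - a) \<le> 1 * (pi / 2 - a)" using t a by (intro mult_right_mono) auto
      have "a \<le> Re z" unfolding Rez using t1 by linarith
      moreover have "Re z \<le> pi / 2" unfolding Rez using t2 unfolding mult_1 le_diff_eq by (simp only: add.commute)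
      moreover have "- (pi / 2) \<le> a" using a by linarith
      ultimately have "sin a \<le> sin (Re z)" by (intro sin_monotone_2pi_le)
      hence "sin a * ((exp (- b) - exp b) / 2) \<le> sin (Re z) * ((exp (- b) - exp b) / 2)"
        using eb by (intro mult_right_mono) auto
      hence "r\<^sup>2 \<le> Im (cos z)" using Im by (simp add: Im_cos Imz)
      thus "norm (?g z) \<le> exp (- x * r\<^sup>2)" using x by (simp add: norm_exp_eq_Re)
    qed auto
    also have "\<dots> \<le> exp (- x * r\<^sup>2) * 2"
    proof (rule mult_left_mono)
      have "of_real (pi / 2) + \<i> * of_real b - \<gamma> r = of_real (pi / 2 - a)" by (simp add: gz)
      hence "norm (of_real (pi / 2) + \<i> * of_real b - \<gamma> r) = \<bar>pi / 2 - a\<bar>" by (simp only: norm_of_real)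
      thus "norm (of_real (pi / 2) + \<i> * of_real b - \<gamma> r) \<le> 2" using a pi_less_4 by simp
    qed simp
    finally show ?thesis by (simp add: d_def b_def)
  qed
  have d_lim: "(d \<longlongrightarrow> 0) at_top"
  proof (rule Lim_null_comparison)
    show "\<forall>\<^sub>F r in at_top. norm (d r) \<le> exp (- x * r\<^sup>2) * 2"
      using eventually_gt_at_top[of 0] by eventually_elim (rule d_bound)
    show "((\<lambda>r. exp (- x * r\<^sup>2) * 2) \<longlongrightarrow> 0) at_top" using x by real_asymp
  qed
  define H where "H r = (LINT s:{0<..r}|lborel. h s)" for r
  define P where "P = F (of_real (pi / 2)) - F 0"
  have re_lim: "((\<lambda>r. Re (F (\<gamma> r))) \<longlongrightarrow> Re (F (of_real (pi / 2)))) at_top"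
  proof -
    have "((\<lambda>r. Re (F (of_real (pi / 2))) - Re (d r)) \<longlongrightarrow> Re (F (of_real (pi / 2))) - Re 0) at_top"
      by (intro tendsto_intros d_lim)
    moreover have "Re (F (of_real (pi / 2))) - Re (d r) = Re (F (\<gamma> r))" for r
      unfolding d_def minus_complex.simps vert by simp
    ultimately show ?thesis by (simp only: zero_complex.simps diff_zero)
  qed
  have "Re (LINT r:{0<..}|lborel. h r) = Re P"
  proof -
    have "(LINT r:{0<..}|lborel. of_real (Re (h r))) = complex_of_real (Re (F (of_real (pi / 2)))) - complex_of_real (Re (F 0))"
    proof (rule half_line_FTC[where F = "\<lambda>r. of_real (Re (F (\<gamma> r)))"])
      show "((\<lambda>r. complex_of_real (Re (F (\<gamma> r)))) has_vector_derivative complex_of_real (Re (h r))) (at r)" if "r > 0" for r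
      proof -
        have "((\<lambda>r. Re (F (\<gamma> r))) has_vector_derivative Re (h r)) (at r)"
          by (rule bounded_linear.has_vector_derivative[OF bounded_linear_Re leg[OF that]])
        thus ?thesis by (intro has_vector_derivative_of_real) (simp add: has_real_derivative_iff_has_vector_derivative)
      qed
      show "isCont (\<lambda>r. complex_of_real (Re (h r))) r" for r
      proof -
        have "isCont (\<lambda>r::real. csqrt (2 + \<i> * of_real (r\<^sup>2))) r"
          using continuous_csqrt_imaginary_square by (simp add: continuous_on_eq_continuous_at)
        moreover have "csqrt (2 + \<i> * of_real (r\<^sup>2)) \<noteq> 0" by (rule csqrt_half_plane) simp
        ultimately show ?thesis unfolding h_def by (intro continuous_intros) auto
      qed
      show "set_integrable lborel {0<..} (\<lambda>r. complex_of_real (Re (h r)))"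
      proof -
        have "integrable lborel (\<lambda>r. complex_of_real (Re (indicator {0<..} r *\<^sub>R h r)))"
          using h_int unfolding set_integrable_def by (intro integrable_of_real integrable_Re)
        thus ?thesis unfolding set_integrable_def by (simp add: scaleR_conv_of_real)
      qed
      show "((\<lambda>r. complex_of_real (Re (F (\<gamma> r)))) \<longlongrightarrow> complex_of_real (Re (F 0))) (at_right 0)"
        by (intro tendsto_intros start)
      show "((\<lambda>r. complex_of_real (Re (F (\<gamma> r)))) \<longlongrightarrow> complex_of_real (Re (F (of_real (pi / 2))))) at_top"
        by (intro tendsto_intros re_lim)
    qed
    also have "(LINT r:{0<..}|lborel. of_real (Re (h r))) = complex_of_real (LINT r:{0<..}|lborel. Re (h r))"
      by (rule set_integral_complex_of_real)
    also have "(LINT r:{0<..}|lborel. Re (h r)) = Re (LINT r:{0<..}|lborel. h r)"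
      using integral_Re[OF h_int[unfolded set_integrable_def]] by (simp add: set_lebesgue_integral_def)
    finally show ?thesis unfolding P_def by (simp flip: of_real_diff)
  qed
  moreover have "(LINT r:{0<..}|lborel. h r) = - \<i> * besselK (- \<i> * of_real x)"
  proof -
    have "of_real (sqrt 2) * (1 - \<i>) = - \<i> * (of_real (sqrt 2) * (1 + \<i>))" by (simp add: algebra_simps)
    moreover have "exp (- \<i> * (- \<i> * of_real x) * of_real (r\<^sup>2)) = exp (of_real (- x * r\<^sup>2))" for r
      by (simp add: mult.assoc[symmetric])
    ultimately show ?thesis using x
      unfolding h_def set_integral_mult_right besselK_def besselK_lower_def by (simp add: mult.assoc)
  qed
  ultimately have "Re P = pi * Re X" unfolding X_def by (simp add: Re_divide_of_real)
  moreover have "of_real pi * besselI (\<i> * of_real x) = of_real (2 * Re P)"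
    unfolding P_def by (rule besselI_imaginary_axis_primitive[OF F])
  ultimately have "of_real pi * besselI (\<i> * of_real x) = of_real pi * of_real (2 * Re X)" by simp
  hence "besselI (\<i> * of_real x) = of_real (2 * Re X)" by simp
  thus ?thesis using besselI_even[of "\<i> * of_real x"] unfolding complex_add_cnj by simp
qed

section \<open>Asymptotic expansion of the product of the modified Bessel functions\<close>

lemma besselI_of_real: "besselI (of_real y) = of_real (LINT t|unit_interval. exp (y * cos (2 * pi * t)))"
proof -
  have "besselI (of_real y) = (LINT t|unit_interval. complex_of_real (exp (y * cos (2 * pi * t))))"
    unfolding besselI_def by (simp add: exp_of_real[symmetric])
  thus ?thesis by simp
qed

lemma sin_ge_half: "0 \<le> x \<Longrightarrow> x \<le> pi / 2 \<Longrightarrow> x / 2 \<le> sin x"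
proof -
  assume x: "0 \<le> x" "x \<le> pi / 2"
  have "\<bar>sin x - (\<Sum>m<3. sin_coeff m * x ^ m)\<bar> \<le> inverse (fact 3) * \<bar>x\<bar> ^ 3"
    by (rule Maclaurin_sin_bound)
  hence "\<bar>sin x - x\<bar> \<le> x ^ 3 / 6"
    using x by (simp add: eval_nat_numeral sin_coeff_def lessThan_Suc)
  hence "sin x \<ge> x - x ^ 3 / 6" by linarith
  moreover have "x ^ 3 / 6 \<le> x / 2"
  proof -
    have "pi / 2 \<le> 8/5" using pi_approx by simp
    hence "x \<le> 8/5" using x by linarith
    hence "x * x \<le> (8/5) * (8/5)" using x by (intro mult_mono) auto
    hence "x * (x * x) \<le> x * 3" using x by (intro mult_left_mono) auto
    thus ?thesis by (simp add: power3_eq_cube mult.assoc)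
  qed
  ultimately show "x / 2 \<le> sin x" by linarith
qed

lemma cos_2pi_le:
  assumes "0 \<le> t" "t \<le> 1/2"
  shows "cos (2 * pi * t) \<le> 1 - 2 * t\<^sup>2"
proof -
  have "t \<le> pi * t / 2" using pi_ge_two assms mult_right_mono[of 2 pi t] by simp
  also have "pi * t / 2 \<le> sin (pi * t)" using assms by (intro sin_ge_half) (auto simp: field_simps)
  finally have "t\<^sup>2 \<le> (sin (pi * t))\<^sup>2" using assms by (intro power_mono) auto
  thus ?thesis using cos_double_sin[of "pi * t"] by (simp add: mult_ac)
qed

text \<open>The exponent \<open>cos (2 pi t)\<close> falls off quadratically from its maximum, so Laplace's
  method with a Gaussian majorant gives the factor \<open>y powr (-1/2)\<close>.\<close>
lemma norm_besselI_of_real_le: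
  assumes y: "y > 0"
  shows "norm (besselI (of_real y)) \<le> 2 * gauss_moment (1/2) * exp y * y powr (- (1/2))"
proof -
  let ?f = "\<lambda>t. exp (- (2 * y) * t\<^sup>2)"
  have fi: "integrable lborel (\<lambda>t. indicator {0<..} t *\<^sub>R ?f t)"
    using integrable_gauss[of "2 * y"] y unfolding set_integrable_def by simp
  have val: "(LINT t|lborel. indicator {0<..} t *\<^sub>R ?f t) = gauss_moment (1/2) * (2 * y) powr (- (1/2))"
  proof -
    have "(LINT t:{0<..}|lborel. ?f t) = (LINT t:{0<..}|lborel. exp (- (2 * y) * t\<^sup>2) * t powr (2 * (1/2) - 1))"
      by (rule set_lebesgue_integral_cong) auto
    also have "\<dots> = gauss_moment (1/2) * (2 * y) powr (- (1/2))" using y by (intro gauss_moment) auto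
    finally show ?thesis unfolding set_lebesgue_integral_def .
  qed
  have fi': "integrable lborel (\<lambda>t. indicator {0<..} (1 - t) *\<^sub>R ?f (1 - t))"
    using lborel_integrable_real_affine[OF fi, of "-1" 1] by simp
  have val': "(LINT t|lborel. indicator {0<..} (1 - t) *\<^sub>R ?f (1 - t)) = gauss_moment (1/2) * (2 * y) powr (- (1/2))"
    using lborel_integral_real_affine[of "-1" "\<lambda>t. indicator {0<..} t *\<^sub>R ?f t" 1] val by simp
  have "(LINT t|unit_interval. exp (y * cos (2 * pi * t))) = (LINT t|lborel. indicator {0..1} t *\<^sub>R exp (y * cos (2 * pi * t)))"
    unfolding unit_interval_integral set_lebesgue_integral_def ..
  also have "\<dots> = (LINT t|lborel. indicator {0<..<1} t *\<^sub>R exp (y * cos (2 * pi * t)))"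
  proof (rule Bochner_Integration.integral_cong_AE)
    show "AE t in lborel. indicat_real {0..1} t *\<^sub>R exp (y * cos (2 * pi * t)) = indicat_real {0<..<1} t *\<^sub>R exp (y * cos (2 * pi * t))"
      using AE_lborel_singleton[of "0::real"] AE_lborel_singleton[of "1::real"]
      by eventually_elim (auto simp: indicator_def)
  qed measurable
  also have "\<dots> \<le> (LINT t|lborel. exp y * (indicator {0<..} t *\<^sub>R ?f t) + exp y * (indicator {0<..} (1 - t) *\<^sub>R ?f (1 - t)))"
  proof (rule integral_mono')
    show "integrable lborel (\<lambda>t. exp y * (indicator {0<..} t *\<^sub>R ?f t) + exp y * (indicator {0<..} (1 - t) *\<^sub>R ?f (1 - t)))"
      using fi fi' by simp
    fix t :: real
    show "indicator {0<..<1} t *\<^sub>R exp (y * cos (2 * pi * t)) \<le>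
      exp y * (indicator {0<..} t *\<^sub>R ?f t) + exp y * (indicator {0<..} (1 - t) *\<^sub>R ?f (1 - t))"
    proof (cases "0 < t \<and> t < 1")
      case True
      have *: "exp (y * cos (2 * pi * s)) \<le> exp y * ?f s" if "0 \<le> s" "s \<le> 1/2" for s
      proof -
        have "y * cos (2 * pi * s) \<le> y * (1 - 2 * s\<^sup>2)" using y cos_2pi_le[OF that] by (intro mult_left_mono) auto
        also have "\<dots> = y + (- (2 * y) * s\<^sup>2)" by (simp add: algebra_simps)
        finally show ?thesis by (simp flip: exp_add)
      qed
      have c: "cos (2 * pi * (1 - t)) = cos (2 * pi * t)" by (simp add: algebra_simps cos_diff)
      have "exp (y * cos (2 * pi * t)) \<le> exp y * ?f t + exp y * ?f (1 - t)"
      proof (cases "t \<le> 1/2")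
        case True thus ?thesis using *[of t] \<open>0 < t \<and> t < 1\<close> by (intro add_increasing2) auto
      next
        case False thus ?thesis using *[of "1 - t", unfolded c] \<open>0 < t \<and> t < 1\<close> by (intro add_increasing) auto
      qed
      thus ?thesis using True by simp
    qed auto
  qed simp
  also have "\<dots> = 2 * (exp y * (gauss_moment (1/2) * (2 * y) powr (- (1/2))))"
    using fi fi' val val' by simp
  also have "\<dots> \<le> 2 * (exp y * (gauss_moment (1/2) * y powr (- (1/2))))"
    using y gauss_moment_nonneg by (intro mult_left_mono powr_mono2') auto
  finally have "(LINT t|unit_interval. exp (y * cos (2 * pi * t))) \<le> 2 * gauss_moment (1/2) * exp y * y powr (- (1/2))"
    by (simp add: mult_ac)
  moreover have "(LINT t|unit_interval. exp (y * cos (2 * pi * t))) \<ge> 0" by simp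
  ultimately show ?thesis unfolding besselI_of_real norm_of_real by simp
qed

lemma norm_besselI_le_real: "norm (besselI w) \<le> norm (besselI (of_real (Re w)))"
proof -
  have "norm (besselI w) \<le> (LINT t|unit_interval. norm (exp (w * complex_of_real (cos (2 * pi * t)))))"
    unfolding besselI_def by (rule integral_norm_bound)
  also have "\<dots> = norm (besselI (of_real (Re w)))"
    unfolding besselI_of_real norm_of_real by (simp add: norm_exp_eq_Re)
  finally show ?thesis .
qed

text \<open>The Euler operator. Unlike differentiation it preserves boundedness on sectors.\<close>
definition theta :: "(complex \<Rightarrow> complex) \<Rightarrow> complex \<Rightarrow> complex" where
  "theta f z = z * deriv f z"

text \<open>Boundedness is required on every smaller sector \<open>|Im z| \<le> a * Re z\<close>, with a
  bound depending on the sector. This class is stable under the Euler operator, by Cauchy's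
  estimate on discs with radius proportional to the distance from 0.\<close>
definition sector_bounded :: "(complex \<Rightarrow> complex) \<Rightarrow> bool" where
  "sector_bounded f \<longleftrightarrow> f holomorphic_on {z. Re z > 0} \<and>
     (\<forall>a\<ge>0. \<exists>B. \<forall>z. Re z > 0 \<longrightarrow> \<bar>Im z\<bar> \<le> a * Re z \<longrightarrow> norm (f z) \<le> B)"

text \<open>A disc about \<open>z\<close> whose radius is a fraction of \<open>Re z\<close> lies in a
  slightly larger sector; Cauchy's estimate on it bounds \<open>z * deriv f z\<close>.\<close>
lemma sector_bounded_theta:
  assumes f: "sector_bounded f"
  shows "sector_bounded (theta f)"
  unfolding sector_bounded_def
proof (intro conjI allI impI)
  have hol: "f holomorphic_on {z. Re z > 0}" using f by (simp add: sector_bounded_def)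
  show "theta f holomorphic_on {z. Re z > 0}"
    unfolding theta_def[abs_def]
    by (intro holomorphic_intros holomorphic_deriv[OF hol]) (simp add: open_halfspace_Re_gt)
  fix a :: real assume a: "a \<ge> 0"
  then obtain B where B: "\<And>z. Re z > 0 \<Longrightarrow> \<bar>Im z\<bar> \<le> (2 * a + 1) * Re z \<Longrightarrow> norm (f z) \<le> B"
    using f unfolding sector_bounded_def by (metis add_nonneg_nonneg mult_nonneg_nonneg zero_le_numeral zero_le_one)
  show "\<exists>B. \<forall>z. Re z > 0 \<longrightarrow> \<bar>Im z\<bar> \<le> a * Re z \<longrightarrow> norm (theta f z) \<le> B"
  proof (intro exI allI impI)
    fix z assume z: "Re z > 0" "\<bar>Im z\<bar> \<le> a * Re z"
    define r where "r = Re z / 2"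
    have r: "r > 0" using z by (simp add: r_def)
    have sub: "Re w > 0 \<and> \<bar>Im w\<bar> \<le> (2 * a + 1) * Re w" if "w \<in> cball z r" for w
    proof -
      have "norm (w - z) \<le> r" using that by (simp add: dist_norm norm_minus_commute)
      hence *: "\<bar>Re w - Re z\<bar> \<le> r" "\<bar>Im w - Im z\<bar> \<le> r"
        using abs_Re_le_cmod[of "w - z"] abs_Im_le_cmod[of "w - z"] by auto
      have Re: "Re w \<ge> r" using *(1) unfolding r_def by linarith
      have "\<bar>Im w\<bar> \<le> a * Re z + r" using *(2) z(2) by linarith
      also have "\<dots> = (2 * a + 1) * r" by (simp add: r_def algebra_simps)
      also have "\<dots> \<le> (2 * a + 1) * Re w" using Re a by (intro mult_left_mono) auto
      finally show ?thesis using Re r by simp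
    qed
    have "cball z r \<subseteq> {z. Re z > 0}" using sub by auto
    hence hc: "f holomorphic_on cball z r" using hol by (rule holomorphic_on_subset[rotated])
    have "norm ((deriv ^^ 1) f z) \<le> fact 1 * B / r ^ 1"
    proof (rule Cauchy_inequality[OF _ _ r])
      show "f holomorphic_on ball z r" using hc by (rule holomorphic_on_subset) auto
      show "continuous_on (cball z r) f" using hc by (rule holomorphic_on_imp_continuous_on)
      show "norm (f x) \<le> B" if "norm (z - x) = r" for x
        using sub[of x] that B[of x] by (simp add: dist_norm)
    qed
    hence "norm (deriv f z) \<le> B / r" by simp
    moreover have "norm z \<le> (1 + a) * Re z" using cmod_le[of z] z by (simp add: algebra_simps)
    ultimately have "norm (theta f z) \<le> ((1 + a) * Re z) * (B / r)"
      unfolding theta_def norm_mult using z a by (intro mult_mono) auto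
    also have "\<dots> = (1 + a) * B * 2" using z by (simp add: r_def)
    finally show "norm (theta f z) \<le> (1 + a) * B * 2" .
  qed
qed

lemma theta_cong:
  assumes "\<And>z. Re z > 0 \<Longrightarrow> f z = g z" "Re z > 0"
  shows "theta f z = theta g z"
proof -
  have "eventually (\<lambda>w. w \<in> {w. Re w > 0}) (nhds z)"
    using assms(2) by (intro eventually_nhds_in_open) (auto simp: open_halfspace_Re_gt)
  hence "eventually (\<lambda>w. f w = g w) (nhds z)" by eventually_elim (use assms(1) in auto)
  thus ?thesis unfolding theta_def by (simp add: deriv_cong_ev)
qed

definition besselv :: "complex \<Rightarrow> complex" where "besselv z = z * besselI z * besselK z"

lemma besselK_has_deriv: "Re z > 0 \<Longrightarrow> (besselK has_field_derivative besselK' z) (at z)"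
  by (rule has_field_derivative_transform_within_open[OF besselK_right_derivs(1), of _ "{z. Re z > 0}"])
     (auto simp: open_halfspace_Re_gt besselK_eq_right)

text \<open>The product of two solutions of a linear differential equation of order two satisfies one of
  order three. Written with the Euler operator it expresses the first iterate through iterates
  divided by \<open>z^2\<close>, which is what drives the expansion in powers of \<open>1 /
  z^2\<close>.\<close>
lemma besselv_euler:
  assumes "Re z > 0"
  shows "theta besselv z = ((theta ^^ 3) besselv z - 3 * (theta ^^ 2) besselv z + 3 * theta besselv z - besselv z) / (4 * z\<^sup>2)"
proof -
  define A where "A z = besselI z * besselK z" for z
  define S where "S z = besselI' z * besselK z + besselI z * besselK' z" for z
  define P where "P z = besselI' z * besselK' z" for z
  have z0: "z \<noteq> 0" if "Re z > 0" for z using that by auto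
  have K2: "(besselK' has_field_derivative (besselK z - besselK' z / z)) (at z)" if "Re z > 0" for z
    using besselK_right_derivs(2)[OF that] that by (simp add: besselK_eq_right)
  have dA: "(A has_field_derivative S z) (at z)" if z: "Re z > 0" for z
    unfolding A_def[abs_def] S_def
    by (rule derivative_eq_intros besselI_deriv besselK_has_deriv[OF z] refl)+ (simp add: algebra_simps)
  have dS: "(S has_field_derivative (2 * A z + 2 * P z - S z / z)) (at z)" if z: "Re z > 0" for z
    unfolding A_def S_def[abs_def] P_def
    by (rule derivative_eq_intros besselI_deriv besselK_has_deriv[OF z] besselI'_deriv[OF z0[OF z]] K2[OF z] refl)+
       (simp add: algebra_simps add_divide_distrib)
  have dP: "(P has_field_derivative (S z - 2 * P z / z)) (at z)" if z: "Re z > 0" for z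
    unfolding S_def P_def[abs_def]
    by (rule derivative_eq_intros besselI'_deriv[OF z0[OF z]] K2[OF z] refl)+
       (simp add: algebra_simps add_divide_distrib)
  have t1: "theta besselv z = z * A z + z^2 * S z" if z: "Re z > 0" for z
  proof -
    have "((\<lambda>z. z * A z) has_field_derivative (A z + z * S z)) (at z)"
      by (rule derivative_eq_intros dA[OF z] refl)+ simp
    moreover have "besselv = (\<lambda>z. z * A z)" by (simp add: besselv_def A_def fun_eq_iff mult.assoc)
    ultimately have "deriv besselv z = A z + z * S z" by (simp add: DERIV_imp_deriv)
    thus ?thesis by (simp add: theta_def algebra_simps power2_eq_square)
  qed
  have t2: "theta (theta besselv) z = z * A z + 2 * z^2 * S z + 2 * z^3 * A z + 2 * z^3 * P z" if z: "Re z > 0" for z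
  proof -
    have "((\<lambda>z. z * A z + z^2 * S z) has_field_derivative (A z + z * S z + 2 * z * S z + z^2 * (2 * A z + 2 * P z - S z / z))) (at z)"
      by (rule derivative_eq_intros dA[OF z] dS[OF z] refl)+ (simp add: algebra_simps)
    hence "theta (\<lambda>z. z * A z + z^2 * S z) z = z * (A z + z * S z + 2 * z * S z + z^2 * (2 * A z + 2 * P z - S z / z))"
      by (simp add: theta_def DERIV_imp_deriv)
    also have "\<dots> = z * A z + 2 * z^2 * S z + 2 * z^3 * A z + 2 * z^3 * P z"
      using z0[OF z] by (simp add: field_simps power2_eq_square power3_eq_cube)
    finally show ?thesis using theta_cong[OF t1 z] by simp
  qed
  have t3: "theta (theta (theta besselv)) z = z * A z + 3 * z^2 * S z + 10 * z^3 * A z + 6 * z^3 * P z + 4 * z^4 * S z"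
    if z: "Re z > 0" for z
  proof -
    have "((\<lambda>z. z * A z + 2 * z^2 * S z + 2 * z^3 * A z + 2 * z^3 * P z) has_field_derivative 
       (A z + z * S z + 4 * z * S z + 2 * z^2 * (2 * A z + 2 * P z - S z / z) + 6 * z^2 * A z + 2 * z^3 * S z
         + 6 * z^2 * P z + 2 * z^3 * (S z - 2 * P z / z))) (at z)"
      by (rule derivative_eq_intros dA[OF z] dS[OF z] dP[OF z] refl)+ (simp add: algebra_simps)
    hence "theta (\<lambda>z. z * A z + 2 * z^2 * S z + 2 * z^3 * A z + 2 * z^3 * P z) z = z * 
       (A z + z * S z + 4 * z * S z + 2 * z^2 * (2 * A z + 2 * P z - S z / z) + 6 * z^2 * A z + 2 * z^3 * S z
         + 6 * z^2 * P z + 2 * z^3 * (S z - 2 * P z / z))"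
      by (simp add: theta_def DERIV_imp_deriv)
    also have "\<dots> = z * A z + 3 * z^2 * S z + 10 * z^3 * A z + 6 * z^3 * P z + 4 * z^4 * S z"
      using z0[OF z] by (simp add: field_simps power2_eq_square power3_eq_cube power4_eq_xxxx)
    finally show ?thesis using theta_cong[OF t2 z] by simp
  qed
  have 3: "(theta ^^ 3) besselv z = theta (theta (theta besselv)) z" "(theta ^^ 2) besselv z = theta (theta besselv) z"
    by (simp_all add: eval_nat_numeral)
  have "besselv z = z * A z" by (simp add: besselv_def A_def)
  thus ?thesis unfolding 3 t1[OF assms] t2[OF assms] t3[OF assms] using z0[OF assms]
    by (simp add: field_simps power2_eq_square power3_eq_cube power4_eq_xxxx)
qed

text \<open>The exponential growth of one factor cancels the exponential decay of the other, and the two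
  factors \<open>|z| powr (-1/2)\<close> cancel the factor \<open>z\<close>. On a sector,
  \<open>|z|\<close> and \<open>Re z\<close> are comparable.\<close>
lemma sector_bounded_besselv: "sector_bounded besselv"
  unfolding sector_bounded_def
proof (intro conjI allI impI)
  have "besselI holomorphic_on UNIV" unfolding holomorphic_on_def using besselI_deriv
    by (auto simp: field_differentiable_def)
  hence "besselI holomorphic_on {z. Re z > 0}" by (rule holomorphic_on_subset) simp
  moreover have "besselK holomorphic_on {z. Re z > 0}" using besselK_holomorphic by (rule holomorphic_on_subset) auto
  ultimately show "besselv holomorphic_on {z. Re z > 0}"
    unfolding besselv_def[abs_def] by (intro holomorphic_intros)
  fix a :: real assume a: "a \<ge> 0"
  show "\<exists>B. \<forall>z. Re z > 0 \<longrightarrow> \<bar>Im z\<bar> \<le> a * Re z \<longrightarrow> norm (besselv z) \<le> B"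
  proof (intro exI allI impI)
    fix z assume z: "Re z > 0" "\<bar>Im z\<bar> \<le> a * Re z"
    let ?g = "gauss_moment (1/2)" and ?p = "Re z powr (- (1/2))"
    have "norm z \<le> (1 + a) * Re z" using cmod_le[of z] z by (simp add: algebra_simps)
    moreover have "norm (besselI z) \<le> 2 * ?g * exp (Re z) * ?p"
      using norm_besselI_le_real[of z] norm_besselI_of_real_le[OF z(1)] by linarith
    moreover have "norm (besselK z) \<le> 2 * ?g * exp (- Re z) * ?p"
      using norm_besselK_right_le[of "1/2" z] z by (simp add: besselK_eq_right)
    ultimately have "norm (besselv z) \<le> ((1 + a) * Re z) * (2 * ?g * exp (Re z) * ?p) * (2 * ?g * exp (- Re z) * ?p)"
      unfolding besselv_def norm_mult using z a gauss_moment_nonneg by (intro mult_mono) auto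
    also have "\<dots> = (1 + a) * (4 * ?g * ?g) * (exp (Re z) * exp (- Re z)) * (Re z * (?p * ?p))" by (simp add: algebra_simps)
    also have "?p * ?p = 1 / Re z" using z by (simp add: powr_minus_divide flip: powr_add)
    also have "exp (Re z) * exp (- Re z) = 1" by (simp flip: exp_add)
    finally show "norm (besselv z) \<le> (1 + a) * (4 * ?g * ?g)" using z by simp
  qed
qed

text \<open>All iterates of the Euler operator on this function are bounded, and by the differential
  equation each of them from the first on is a combination of iterates divided by
  \<open>z^2\<close>. Dividing by \<open>z^2\<close> and by the further \<open>y\<close> in
  \<open>deriv f y = theta f y / y\<close> and then integrating raises the order of the
  expansion by two, for all iterates at once.\<close>
theorem even_asym_besselv: "even_asym L (\<lambda>y. besselv (of_real y))"
proof -
  let ?v = "\<lambda>k. (theta ^^ k) besselv"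
  have sb: "sector_bounded (?v k)" for k
    by (induction k) (auto intro: sector_bounded_theta sector_bounded_besselv)
  have hol: "?v k field_differentiable at z" if "Re z > 0" for k z
  proof (rule holomorphic_on_imp_differentiable_at)
    show "?v k holomorphic_on {z. Re z > 0}" using sb[of k] by (simp add: sector_bounded_def)
  qed (use that in \<open>auto simp: open_halfspace_Re_gt\<close>)
  have span: "\<exists>c. \<forall>z. Re z > 0 \<longrightarrow> ?v (Suc k) z = (\<Sum>i\<le>k + 3. c i * ?v i z) / z\<^sup>2" for k
  proof (induction k)
    case 0
    define c :: "nat \<Rightarrow> complex" where "c = (\<lambda>i. if i = 0 then - (1/4) else if i = 1 then 3/4 else if i = 2 then - (3/4) else 1/4)"
    have "?v (Suc 0) z = (\<Sum>i\<le>0 + 3. c i * ?v i z) / z\<^sup>2" if "Re z > 0" for z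
    proof -
      have "(\<Sum>i\<le>0 + 3. c i * ?v i z) = - (1/4) * besselv z + 3/4 * theta besselv z - 3/4 * ?v 2 z + 1/4 * ?v 3 z"
        unfolding c_def by (simp add: numeral_3_eq_3 numeral_2_eq_2 atMost_Suc)
      also have "\<dots> = (?v 3 z - 3 * ?v 2 z + 3 * theta besselv z - besselv z) / 4" by (simp add: field_simps)
      finally have "(\<Sum>i\<le>0 + 3. c i * ?v i z) / z\<^sup>2 = (?v 3 z - 3 * ?v 2 z + 3 * theta besselv z - besselv z) / (4 * z\<^sup>2)"
        by (simp only: divide_divide_eq_left)
      moreover have "?v (Suc 0) z = theta besselv z" by simp
      ultimately show ?thesis using besselv_euler[OF that] by (simp only:)
    qed
    thus ?case by blast
  next
    case (Suc k)
    then obtain c where c: "\<And>z. Re z > 0 \<Longrightarrow> ?v (Suc k) z = (\<Sum>i\<le>k + 3. c i * ?v i z) / z\<^sup>2" by blast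
    define c' where "c' i = (if i = 0 then 0 else c (i - 1)) - 2 * (if i \<le> k + 3 then c i else 0)" for i
    have "?v (Suc (Suc k)) z = (\<Sum>i\<le>Suc k + 3. c' i * ?v i z) / z\<^sup>2" if z: "Re z > 0" for z
    proof -
      have z0: "z \<noteq> 0" using z by auto
      have dv: "(?v i has_field_derivative ?v (Suc i) z / z) (at z)" for i
        using field_differentiable_derivI[OF hol[OF z, of i]] z0 by (simp add: theta_def)
      have "((\<lambda>z. (\<Sum>i\<le>k + 3. c i * ?v i z) / z\<^sup>2) has_field_derivative
         ((\<Sum>i\<le>k + 3. c i * (?v (Suc i) z / z)) * z\<^sup>2 - (\<Sum>i\<le>k + 3. c i * ?v i z) * (2 * z)) / (z\<^sup>2 * z\<^sup>2)) (at z)"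
        by (intro DERIV_divide DERIV_sum DERIV_cmult dv) (use z0 in \<open>auto intro!: derivative_eq_intros\<close>)
      hence "theta (\<lambda>z. (\<Sum>i\<le>k + 3. c i * ?v i z) / z\<^sup>2) z = 
         z * (((\<Sum>i\<le>k + 3. c i * (?v (Suc i) z / z)) * z\<^sup>2 - (\<Sum>i\<le>k + 3. c i * ?v i z) * (2 * z)) / (z\<^sup>2 * z\<^sup>2))"
        by (simp only: theta_def DERIV_imp_deriv)
      also have "(\<Sum>i\<le>k + 3. c i * (?v (Suc i) z / z)) = (\<Sum>i\<le>k + 3. c i * ?v (Suc i) z) / z"
        by (simp add: sum_divide_distrib)
      also have "z * ((((\<Sum>i\<le>k + 3. c i * ?v (Suc i) z) / z) * z\<^sup>2 - (\<Sum>i\<le>k + 3. c i * ?v i z) * (2 * z)) / (z\<^sup>2 * z\<^sup>2)) =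
         ((\<Sum>i\<le>k + 3. c i * ?v (Suc i) z) - 2 * (\<Sum>i\<le>k + 3. c i * ?v i z)) / z\<^sup>2"
        using z0 by (simp add: divide_simps power2_eq_square) (simp add: algebra_simps)
      also have "(\<Sum>i\<le>k + 3. c i * ?v (Suc i) z) = (\<Sum>i\<le>Suc k + 3. (if i = 0 then 0 else c (i - 1)) * ?v i z)"
        unfolding add_Suc by (subst sum.atMost_Suc_shift) simp
      also have "(\<Sum>i\<le>k + 3. c i * ?v i z) = (\<Sum>i\<le>Suc k + 3. (if i \<le> k + 3 then c i else 0) * ?v i z)"
        unfolding add_Suc by (subst sum.atMost_Suc) simp
      also have "(\<Sum>i\<le>Suc k + 3. (if i = 0 then 0 else c (i - 1)) * ?v i z) - 2 * (\<Sum>i\<le>Suc k + 3. (if i \<le> k + 3 then c i else 0) * ?v i z)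
          = (\<Sum>i\<le>Suc k + 3. c' i * ?v i z)"
        unfolding c'_def by (simp only: sum_distrib_left left_diff_distrib sum_subtractf mult.assoc)
      finally show ?thesis using theta_cong[OF c z] by simp
    qed
    thus ?case by blast
  qed
  have sum_asym: "even_asym L (\<lambda>y. \<Sum>i\<in>A. c i * ?v i (of_real y))"
    if "\<And>i. even_asym L (\<lambda>y. ?v i (of_real y))" for L c and A :: "nat set"
  proof (induction A rule: infinite_finite_induct)
    case (insert x F)
    show ?case using even_asym_add[OF even_asym_cmult[OF that] insert.IH] insert.hyps by simp
  qed (simp_all add: even_asym_const)
  have "even_asym L (\<lambda>y. ?v k (of_real y))" for k
  proof (induction L arbitrary: k)
    case 0
    obtain B where B: "\<And>z. Re z > 0 \<Longrightarrow> \<bar>Im z\<bar> \<le> 0 * Re z \<Longrightarrow> norm (?v k z) \<le> B"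
      using sb[of k] unfolding sector_bounded_def by blast
    show ?case by (rule even_asym_0[of _ B]) (auto intro!: B)
  next
    case (Suc L)
    show ?case
    proof (cases k)
      case (Suc k')
      obtain c where c: "\<And>z. Re z > 0 \<Longrightarrow> ?v (Suc k') z = (\<Sum>i\<le>k' + 3. c i * ?v i z) / z\<^sup>2" using span by blast
      have "even_asym (Suc L) (\<lambda>y. (\<Sum>i\<le>k' + 3. c i * ?v i (of_real y)) / of_real (y\<^sup>2))"
        by (intro even_asym_div_square sum_asym Suc.IH)
      thus ?thesis unfolding Suc by (subst even_asym_cong[OF c]) auto
    next
      case 0
      obtain c where c: "\<And>z. Re z > 0 \<Longrightarrow> ?v (Suc 0) z = (\<Sum>i\<le>0 + 3. c i * ?v i z) / z\<^sup>2" using span by blast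
      show ?thesis unfolding 0
      proof (rule even_asym_integrate)
        show "even_asym L (\<lambda>y. \<Sum>i\<le>0 + 3. c i * ?v i (of_real y))" by (intro sum_asym Suc.IH)
        fix y :: real assume y: "y \<ge> 1"
        have dv: "(?v 0 has_field_derivative ?v (Suc 0) (of_real y) / of_real y) (at (of_real y))"
          using field_differentiable_derivI[OF hol[of "of_real y" 0]] y by (simp add: theta_def)
        from has_vector_derivative_real_field[OF this]
        show "((\<lambda>y. ?v 0 (of_real y)) has_vector_derivative (\<Sum>i\<le>0 + 3. c i * ?v i (of_real y)) / of_real (y ^ 3)) (at y)"
          using c[of "of_real y"] y by (simp add: power2_eq_square power3_eq_cube)
      qed
    qed
  qed
  from this[of 0] show ?thesis by simp
qed

section \<open>Ramble integrals as Mellin transforms\<close>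

lemma measure_unit_interval [simp]: "measure unit_interval {0..1} = 1"
  using prob_space.prob_space[OF prob_space_unit_interval] by (simp add: space_restrict_space)

lemma besselI_holomorphic: "besselI holomorphic_on A"
  unfolding holomorphic_on_def using besselI_deriv
  by (auto simp: field_differentiable_def intro: has_field_derivative_at_within)

lemma continuous_on_besselI: "continuous_on A f \<Longrightarrow> continuous_on A (\<lambda>x. besselI (f x))"
  by (rule continuous_on_compose2[OF holomorphic_on_imp_continuous_on[OF besselI_holomorphic[of UNIV]]]) auto

text \<open>The Bessel function of the first kind of order 0.\<close>
definition besselJ :: "real \<Rightarrow> complex" where "besselJ x = besselI (\<i> * of_real x)"

lemma continuous_on_besselJ [continuous_intros]: "continuous_on A f \<Longrightarrow> continuous_on A (\<lambda>x. besselJ (f x))"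
  unfolding besselJ_def by (intro continuous_on_besselI continuous_intros)

lemma besselJ_0 [simp]: "besselJ 0 = 1"
  using besselI_sums[of 0] sums_unique2[OF _ powser_sums_zero[of "\<lambda>m. 1 / (fact m)\<^sup>2 :: complex"]]
  unfolding besselJ_def by (simp add: besselI_def prob_space.prob_space[OF prob_space_unit_interval])

lemma norm_besselJ_le: "norm (besselJ x) \<le> 1"
  using norm_besselI_le[of "\<i> * of_real x"] by (simp add: besselJ_def)

lemma besselJ_measurable [measurable]: "besselJ \<in> borel_measurable borel"
  by (intro borel_measurable_continuous_onI continuous_on_besselJ continuous_on_id)

lemma norm_besselI_minus_one_le: "norm (besselI w - 1) \<le> (norm w)\<^sup>2 * exp (norm w)"
proof -
  let ?c = "\<lambda>t::real. complex_of_real (cos (2 * pi * t))"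
  have i1: "integrable unit_interval (\<lambda>t. exp (w * ?c t))" by (intro unit_interval_integrable continuous_intros)
  have i2: "integrable unit_interval ?c" by (intro unit_interval_integrable continuous_intros)
  have "(LINT t|unit_interval. exp (w * ?c t) - 1 - w * ?c t) = besselI w - 1"
    using cos_moments(2)[of 0] i1 i2
    by (simp add: besselI_def unit_interval_integrable continuous_intros
          prob_space.prob_space[OF prob_space_unit_interval])
  hence "norm (besselI w - 1) \<le> (LINT t|unit_interval. norm (exp (w * ?c t) - 1 - w * ?c t))"
    using integral_norm_bound[of unit_interval "\<lambda>t. exp (w * ?c t) - 1 - w * ?c t"] by simp
  also have "\<dots> \<le> (LINT t|unit_interval. (norm w)\<^sup>2 * exp (norm w))"
  proof (intro integral_mono unit_interval_integrable continuous_intros)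
    fix t
    have le: "norm (w * ?c t) \<le> norm w" by (simp add: norm_mult mult_left_le)
    have "norm (exp (w * ?c t) - 1 - w * ?c t) \<le> (norm (w * ?c t))\<^sup>2 * exp (norm (w * ?c t))"
      by (rule exp_sub_linear_bound)
    also have "\<dots> \<le> (norm w)\<^sup>2 * exp (norm w)"
      using le by (intro mult_mono power_mono) auto
    finally show "norm (exp (w * ?c t) - 1 - w * ?c t) \<le> (norm w)\<^sup>2 * exp (norm w)" .
  qed
  also have "\<dots> = (norm w)\<^sup>2 * exp (norm w)" by (simp add: prob_space.prob_space[OF prob_space_unit_interval])
  finally show ?thesis .
qed

lemma mellin_conv_near_0:
  assumes f: "continuous_on UNIV f" and 0: "\<And>y. 0 < y \<Longrightarrow> y \<le> 1 \<Longrightarrow> norm (f y) \<le> C * y\<^sup>2"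
    and 1: "\<And>y. norm (f y) \<le> D" and s: "0 < \<sigma>" "\<sigma> < 2"
  shows "mellin_conv f \<sigma>"
proof (rule mellin_conv_bound[where C = C and C' = D and p = 2 and q = 0])
  show "set_borel_measurable lborel {0<..} f"
    by (intro set_borel_measurable_cont continuous_on_subset[OF f]) auto
qed (use assms in \<open>auto simp: powr_numeral\<close>)

lemma norm_besselJ_power_minus_one_le:
  assumes "0 < y" "y \<le> 1"
  shows "norm (besselJ y ^ n - 1) \<le> (real n * exp 1) * y\<^sup>2"
proof (induction n)
  case (Suc n)
  have "besselJ y ^ Suc n - 1 = besselJ y * (besselJ y ^ n - 1) + (besselJ y - 1)"
    by (simp add: algebra_simps)
  also have "norm \<dots> \<le> norm (besselJ y) * norm (besselJ y ^ n - 1) + norm (besselJ y - 1)"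
    by (metis norm_mult norm_triangle_ineq)
  also have "\<dots> \<le> 1 * ((real n * exp 1) * y\<^sup>2) + y\<^sup>2 * exp 1"
  proof (intro add_mono mult_mono norm_besselJ_le Suc)
    have "norm (besselJ y - 1) \<le> y\<^sup>2 * exp y"
      using norm_besselI_minus_one_le[of "\<i> * of_real y"] assms by (simp add: besselJ_def norm_mult)
    also have "\<dots> \<le> y\<^sup>2 * exp 1" using assms by (intro mult_left_mono) auto
    finally show "norm (besselJ y - 1) \<le> y\<^sup>2 * exp 1" .
  qed auto
  finally show ?case by (simp add: algebra_simps)
qed simp

lemma norm_besselJ_power_le: "norm (besselJ y ^ n) \<le> 1"
  using norm_besselJ_le by (simp add: norm_power power_le_one)

lemma mellin_conv_besselJ_power:
  assumes "0 < \<sigma>" "\<sigma> < 2"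
  shows "mellin_conv (\<lambda>y. besselJ y ^ n - 1) \<sigma>"
proof (rule mellin_conv_near_0[OF _ norm_besselJ_power_minus_one_le _ assms])
  show "norm (besselJ y ^ n - 1) \<le> 2" for y
    using norm_triangle_ineq4[of "besselJ y ^ n" 1] norm_besselJ_power_le[of y n] by simp
qed (intro continuous_intros)

lemma mellin_scale:
  assumes c: "c > 0" and f: "mellin_conv f (Re s)"
  shows "mellin (\<lambda>y. f (c * y)) s = of_real c powr s * mellin f s"
    and "set_integrable lborel {0<..} (\<lambda>y. f (c * y) * of_real y powr (- s - 1))"
proof -
  let ?F = "\<lambda>y::real. f y * of_real y powr (- s - 1)"
  have eq: "f (c * y) * of_real y powr (- s - 1) = of_real c powr (s + 1) * ?F (c * y)" if "y > 0" for y :: real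
  proof -
    have "of_real (c * y) powr (- s - 1) = complex_of_real c powr (- s - 1) * of_real y powr (- s - 1)"
      using c that by (simp add: powr_times_real)
    moreover have "of_real c powr (s + 1) * complex_of_real c powr (- s - 1) = 1"
      using c by (simp flip: powr_add)
    ultimately show ?thesis by (simp add: mult_ac)
  qed
  have int: "set_integrable lborel {0<..} (\<lambda>y. ?F (c * y))"
    by (rule set_integral_scale(2)[OF c mellin_integrable[OF f]])
  hence "set_integrable lborel {0<..} (\<lambda>y. of_real c powr (s + 1) * ?F (c * y))"
    by (rule set_integrable_mult_right)
  moreover have "set_integrable lborel {0<..} (\<lambda>y. f (c * y) * of_real y powr (- s - 1)) =
      set_integrable lborel {0<..} (\<lambda>y. of_real c powr (s + 1) * ?F (c * y))"
    by (rule set_integrable_cong) (simp_all only: greaterThan_iff eq)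
  ultimately show "set_integrable lborel {0<..} (\<lambda>y. f (c * y) * of_real y powr (- s - 1))" by simp
  have "mellin (\<lambda>y. f (c * y)) s = (LINT y:{0<..}|lborel. of_real c powr (s + 1) * ?F (c * y))"
    unfolding mellin_def
  proof (rule set_lebesgue_integral_cong)
    show "\<forall>y. y \<in> {0<..} \<longrightarrow> f (c * y) * of_real y powr (- s - 1) = of_real c powr (s + 1) * ?F (c * y)"
      using eq by blast
  qed simp
  also have "\<dots> = of_real c powr (s + 1) * (mellin f s /\<^sub>R c)"
    unfolding mellin_def set_integral_scale(1)[OF c, of ?F, symmetric] by (rule set_integral_mult_right)
  also have "of_real c powr (s + 1) = of_real c powr s * complex_of_real c" using c by (simp add: powr_add)
  finally show "mellin (\<lambda>y. f (c * y)) s = of_real c powr s * mellin f s"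
    using c by (simp add: scaleR_conv_of_real)
qed

text \<open>Fubini: scaling the argument of \<open>h\<close> by a random factor multiplies its Mellin
  transform by a moment of that factor. Used with the length of the walk and, to find the
  transform of the Bessel function, with the square root of an exponential variable.\<close>
theorem mellin_expectation_scale:
  fixes r :: "'a \<Rightarrow> real" and h :: "real \<Rightarrow> complex"
  assumes M: "prob_space M" and r [measurable]: "r \<in> borel_measurable M" and r0: "\<And>x. r x \<ge> 0"
    and rint: "integrable M (\<lambda>x. r x powr Re s)"
    and h [measurable]: "h \<in> borel_measurable borel" and h0: "h 0 = 0" and hc: "mellin_conv h (Re s)"
  shows "(LINT x|M. of_real (r x) powr s) * mellin h s = mellin (\<lambda>y. LINT x|M. h (r x * y)) s"
proof -
  interpret M: prob_space M by fact
  interpret pair_sigma_finite M lborel by standard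
  define f where "f x y = indicator {0<..} y *\<^sub>R (h (r x * y) * of_real y powr (- s - 1))" for x and y :: real
  have pm [measurable]: "(\<lambda>y. indicator {0<..} y *\<^sub>R (complex_of_real y powr (- s - 1))) \<in> borel_measurable borel"
  proof -
    have "set_borel_measurable lborel {0<..} (\<lambda>y::real. complex_of_real y powr (- s - 1))"
      by (intro set_borel_measurable_cont continuous_intros) (auto simp: complex_nonpos_Reals_iff)
    thus ?thesis by (simp add: set_borel_measurable_def)
  qed
  have feq: "f x y = h (r x * y) * (indicator {0<..} y *\<^sub>R (complex_of_real y powr (- s - 1)))" for x y
    by (simp add: f_def)
  have fm: "case_prod f \<in> borel_measurable (M \<Otimes>\<^sub>M lborel)" unfolding feq by measurable
  have zero: "f x y = 0" if "r x = 0" for x y using that by (simp add: f_def h0)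
  have hcn: "mellin_conv (\<lambda>y. of_real (norm (h y))) (Re s)"
    using hc set_borel_measurable_norm[of lborel "{0<..}" h] unfolding mellin_conv_def
    by (auto simp: set_borel_measurable_def scaleR_conv_of_real simp flip: of_real_mult intro: borel_measurable_of_real)
  define K where "K = (LINT y:{0<..}|lborel. norm (h y) * y powr (- Re s - 1))"
  have fint: "integrable lborel (f x)" for x
  proof (cases "r x = 0")
    case False
    hence "r x > 0" using r0[of x] by simp
    from mellin_scale(2)[OF this hc] show ?thesis unfolding f_def set_integrable_def by simp
  next
    case True
    hence "f x = (\<lambda>_. 0)" using zero by (auto simp: fun_eq_iff)
    thus ?thesis by simp
  qed
  have fnorm: "(LINT y|lborel. norm (f x y)) = K * r x powr Re s" for x
  proof (cases "r x = 0")
    case False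
    hence rx: "r x > 0" using r0[of x] by simp
    have nf: "complex_of_real (norm (f x y)) = indicator {0<..} y *\<^sub>R (of_real (norm (h (r x * y))) * of_real y powr (- of_real (Re s) - 1))" for y
      by (auto simp: f_def indicator_def norm_mult norm_powr_real_powr powr_of_real[symmetric])
    have "complex_of_real (LINT y|lborel. norm (f x y)) = (LINT y|lborel. complex_of_real (norm (f x y)))"
      by simp
    also have "\<dots> = mellin (\<lambda>y. of_real (norm (h (r x * y)))) (of_real (Re s))"
      unfolding nf mellin_def set_lebesgue_integral_def ..
    also have "\<dots> = of_real (r x) powr (of_real (Re s)) * mellin (\<lambda>y. of_real (norm (h y))) (of_real (Re s))"
      using hcn by (intro mellin_scale(1) rx) simp
    also have "mellin (\<lambda>y. of_real (norm (h y))) (of_real (Re s)) = (LINT y:{0<..}|lborel. complex_of_real (norm (h y) * y powr (- Re s - 1)))"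
      unfolding mellin_def by (rule set_lebesgue_integral_cong) (auto simp: powr_of_real[symmetric])
    also have "\<dots> = of_real K" unfolding K_def by (rule set_integral_complex_of_real)
    also have "complex_of_real (r x) powr (of_real (Re s)) * of_real K = of_real (K * r x powr Re s)"
      using rx by (simp add: powr_of_real)
    finally show ?thesis by (simp only: of_real_eq_iff)
  qed (simp add: zero)
  have "integrable (M \<Otimes>\<^sub>M lborel) (case_prod f)"
  proof (rule Fubini_integrable[OF fm])
    show "integrable M (\<lambda>x. LINT y|lborel. norm (case_prod f (x, y)))" using rint by (simp add: fnorm)
    show "AE x in M. integrable lborel (\<lambda>y. case_prod f (x, y))" using fint by simp
  qed
  from Fubini_integral[OF this]
  have "(LINT y|lborel. LINT x|M. f x y) = (LINT x|M. LINT y|lborel. f x y)" .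
  moreover have "(LINT y|lborel. f x y) = of_real (r x) powr s * mellin h s" for x
  proof (cases "r x = 0")
    case False
    hence "r x > 0" using r0[of x] by simp
    from mellin_scale(1)[OF this hc] show ?thesis
      unfolding f_def mellin_def set_lebesgue_integral_def by simp
  qed (simp add: zero)
  moreover have "(LINT y|lborel. LINT x|M. f x y) = mellin (\<lambda>y. LINT x|M. h (r x * y)) s"
    unfolding feq mellin_def set_lebesgue_integral_def by (simp add: mult_ac)
  ultimately show ?thesis by simp
qed

text \<open>The reciprocal of the Mellin transform of \<open>besselJ y - 1\<close>. With
  \<open>rGamma\<close> in place of a quotient the only poles are those of the first gamma
  factor, at the negative even integers.\<close>
definition mellin_factor :: "complex \<Rightarrow> complex" where
  "mellin_factor s = - s * 2 powr s * Gamma (1 + s / 2) * rGamma (1 - s / 2)"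

text \<open>In the variable \<open>x^2 / 4\<close> this is a gamma integral.\<close>
lemma gaussian_first_moment:
  assumes s: "Re s < 2"
  shows "set_integrable lborel {0<..} (\<lambda>x. of_real x * complex_of_real x powr (- s) * complex_of_real (exp (- x\<^sup>2 / 4)))"
    and "(LINT x:{0<..}|lborel. of_real x * complex_of_real x powr (- s) * complex_of_real (exp (- x\<^sup>2 / 4))) = 2 * 2 powr (- s) * Gamma (1 - s / 2)"
proof -
  let ?p = "\<lambda>y::real. complex_of_real y powr (- s)"
  have gab: "(\<lambda>t. complex_of_real t powr ((1 - s / 2) - 1) / of_real (exp t)) absolutely_integrable_on {0<..}"
    using s by (intro absolutely_integrable_Gamma_integral') simp
  have gint: "integral {0<..} (\<lambda>t. complex_of_real t powr ((1 - s / 2) - 1) / of_real (exp t)) = Gamma (1 - s / 2)"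
    using s by (intro integral_unique Gamma_integral_complex') simp
  have img: "(\<lambda>x::real. x\<^sup>2 / 4) ` {0<..} = {0<..}"
  proof safe
    fix x :: real assume "x > 0"
    hence "x = (2 * sqrt x)\<^sup>2 / 4" "2 * sqrt x \<in> {0<..}" by (auto simp: power_mult_distrib)
    thus "x \<in> (\<lambda>x. x\<^sup>2 / 4) ` {0<..}" by blast
  qed auto
  let ?G = "\<lambda>x::real. \<bar>x / 2\<bar> *\<^sub>R (complex_of_real (x\<^sup>2 / 4) powr ((1 - s / 2) - 1) / of_real (exp (x\<^sup>2 / 4)))"
  have "?G absolutely_integrable_on {0<..} \<and> integral {0<..} ?G = Gamma (1 - s / 2)"
  proof (subst has_absolute_integral_change_of_variables_real[where g = "\<lambda>x. x\<^sup>2 / 4" and h = "\<lambda>x. x / 2" and S = "{0<..}"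
           and f = "\<lambda>t. complex_of_real t powr ((1 - s / 2) - 1) / of_real (exp t)"])
    show "inj_on (\<lambda>x::real. x\<^sup>2 / 4) {0<..}" by (auto simp: inj_on_def power2_eq_iff)
  qed (use gab gint img in \<open>auto intro!: derivative_eq_intros\<close>)
  note G = conjunct1[OF this] conjunct2[OF this]
  have Geq: "?G x = (2 powr s / 2) * (of_real x * ?p x * of_real (exp (- x\<^sup>2 / 4)))" if x: "x > 0" for x
  proof -
    have "complex_of_real (x\<^sup>2 / 4) = of_real (x / 2) * of_real (x / 2)" by (simp add: power2_eq_square)
    hence "complex_of_real (x\<^sup>2 / 4) powr ((1 - s / 2) - 1) = (of_real (x / 2) powr (- s / 2)) * (of_real (x / 2) powr (- s / 2))"
      using x by (simp add: powr_times_real del: of_real_divide)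
    also have "\<dots> = of_real (x / 2) powr (- s)" by (simp flip: powr_add)
    also have "\<dots> = ?p x * of_real (1 / 2) powr (- s)"
      using x powr_times_real[of "of_real x" "of_real (1 / 2)" "- s"] by simp
    also have "complex_of_real (1 / 2) powr (- s) = 2 powr s"
    proof -
      have "complex_of_real (1 / 2) = inverse 2" by simp
      moreover have "Ln (inverse (2 :: complex)) = - Ln 2"
        by (rule Ln_inverse) (simp add: complex_nonpos_Reals_iff)
      ultimately show ?thesis by (simp only: powr_def) simp
    qed
    finally have E: "complex_of_real (x\<^sup>2 / 4) powr ((1 - s / 2) - 1) = ?p x * 2 powr s" .
    have e: "complex_of_real (exp (- x\<^sup>2 / 4)) = inverse (of_real (exp (x\<^sup>2 / 4)))"
      unfolding of_real_inverse[symmetric] exp_minus[symmetric] by simp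
    have ab: "\<bar>x / 2\<bar> *\<^sub>R z = of_real x / 2 * z" for z :: complex using x by (simp add: scaleR_conv_of_real)
    have alg: "a / 2 * (p * u / q) = u / 2 * (a * p * inverse q)" for a p u q :: complex
      unfolding divide_inverse by (simp only: mult_ac)
    show ?thesis unfolding ab E e by (rule alg)
  qed
  have meas: "set_borel_measurable lborel {0<..} (\<lambda>x::real. of_real x * ?p x * of_real (exp (- x\<^sup>2 / 4)))"
    by (intro set_borel_measurable_cont continuous_intros) (auto simp: complex_nonpos_Reals_iff)
  have "(\<lambda>x. (2 powr s / 2) * (of_real x * ?p x * of_real (exp (- x\<^sup>2 / 4)))) absolutely_integrable_on {0<..}"
    using G(1) by (rule set_integrable_cong[THEN iffD1, rotated -1]) (use Geq in auto)
  hence "(\<lambda>x. of_real x * ?p x * complex_of_real (exp (- x\<^sup>2 / 4))) absolutely_integrable_on {0<..}"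
    by (subst (asm) set_integrable_mult_right_iff) auto
  thus int: "set_integrable lborel {0<..} (\<lambda>x. of_real x * ?p x * complex_of_real (exp (- x\<^sup>2 / 4)))"
    using meas unfolding set_integrable_def set_borel_measurable_def
    by (subst (asm) integrable_completion) auto
  show "(LINT x:{0<..}|lborel. of_real x * ?p x * complex_of_real (exp (- x\<^sup>2 / 4))) = 2 * 2 powr (- s) * Gamma (1 - s / 2)"
  proof -
    have "(LINT x:{0<..}|lborel. of_real x * ?p x * complex_of_real (exp (- x\<^sup>2 / 4))) =
          integral {0<..} (\<lambda>x. of_real x * ?p x * complex_of_real (exp (- x\<^sup>2 / 4)))"
      by (rule set_borel_integral_eq_integral(2)[OF int])
    moreover have "integral {0<..} ?G = integral {0<..} (\<lambda>x. (2 powr s / 2) * (of_real x * ?p x * of_real (exp (- x\<^sup>2 / 4))))"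
      by (rule integral_cong) (use Geq in auto)
    moreover have "\<dots> = (2 powr s / 2) * integral {0<..} (\<lambda>x. of_real x * ?p x * of_real (exp (- x\<^sup>2 / 4)))"
      by (rule integral_mult_right)
    ultimately have E: "(2 powr s / 2) * (LINT x:{0<..}|lborel. of_real x * ?p x * complex_of_real (exp (- x\<^sup>2 / 4))) = Gamma (1 - s / 2)"
      using G(2) by metis
    have "2 * 2 powr (- s) * ((2 powr s / 2) * z) = z" for z :: complex
      by (simp add: powr_minus)
    thus ?thesis unfolding E[symmetric] by (rule sym)
  qed
qed

text \<open>Integration by parts: subtracting 1 makes the integral converge to the right of the imaginary
  axis, and the derivative of the Gaussian leads back to a gamma integral.\<close>
lemma mellin_gaussian:
  assumes s: "0 < Re s" "Re s < 2"
  shows "mellin (\<lambda>y. of_real (exp (- y\<^sup>2 / 4)) - 1) s = - (2 powr (- s)) / s * Gamma (1 - s / 2)"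
proof -
  let ?h = "\<lambda>y::real. complex_of_real (exp (- y\<^sup>2 / 4)) - 1"
  let ?p = "\<lambda>y::real. complex_of_real y powr (- s)"
  have s0: "s \<noteq> 0" using s by auto
  have hb: "norm (?h y) \<le> 1 * y\<^sup>2" for y
  proof -
    have "1 - y\<^sup>2 \<le> exp (- y\<^sup>2 / 4)" using exp_ge_add_one_self[of "- y\<^sup>2 / 4"] zero_le_power2[of y] by linarith
    moreover have "exp (- y\<^sup>2 / 4) \<le> 1" by simp
    ultimately have "\<bar>exp (- y\<^sup>2 / 4) - 1\<bar> \<le> y\<^sup>2" by (simp add: abs_le_iff)
    thus ?thesis by (metis mult_1 norm_of_real of_real_1 of_real_diff)
  qed
  have hb2: "norm (?h y) \<le> 2" for y
  proof -
    have "norm (?h y) \<le> norm (complex_of_real (exp (- y\<^sup>2 / 4))) + norm (1 :: complex)" by (rule norm_triangle_ineq4)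
    also have "\<dots> \<le> 1 + 1" by (intro add_mono) (simp_all del: of_real_exp)
    finally show ?thesis by simp
  qed
  have hc: "mellin_conv ?h (Re s)"
    by (rule mellin_conv_near_0[OF _ hb hb2 s]) (auto intro!: continuous_intros)
  note int = gaussian_first_moment(1)[OF s(2)] and I = gaussian_first_moment(2)[OF s(2)]
  define F where "F y = ?h y * (- ?p y / s)" for y
  have d: "(F has_vector_derivative (?h y * of_real y powr (- s - 1) + (of_real y * ?p y * of_real (exp (- y\<^sup>2 / 4))) / (2 * s))) (at y)"
    if y: "y > 0" for y
  proof -
    have 1: "((\<lambda>z. exp (- z\<^sup>2 / 4) - 1) has_field_derivative (exp (- z\<^sup>2 / 4) * (- z / 2))) (at z)" for z :: complex
      by (rule derivative_eq_intros refl | simp)+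
    have "((\<lambda>z. z powr (- s)) has_field_derivative (- s) * of_real y powr (- s - 1)) (at (of_real y))"
      using y by (intro has_field_derivative_powr) (auto simp: complex_nonpos_Reals_iff)
    from DERIV_cdivide[OF DERIV_minus[OF this], of s]
    have 2: "((\<lambda>z. - (z powr (- s)) / s) has_field_derivative of_real y powr (- s - 1)) (at (of_real y))"
      using s0 by simp
    have "((\<lambda>z. (exp (- z\<^sup>2 / 4) - 1) * (- (z powr (- s)) / s)) has_field_derivative
        (exp (- (of_real y)\<^sup>2 / 4) * (- of_real y / 2)) * (- ?p y / s) + of_real y powr (- s - 1) * (exp (- (of_real y)\<^sup>2 / 4) - 1)) (at (of_real y))"
      by (rule DERIV_mult[OF 1 2])
    from has_vector_derivative_real_field[OF this]
    have *: "((\<lambda>y. (exp (- (of_real y)\<^sup>2 / 4) - 1) * (- ?p y / s)) has_vector_derivative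
        (exp (- (of_real y)\<^sup>2 / 4) * (- of_real y / 2)) * (- ?p y / s) + of_real y powr (- s - 1) * (exp (- (of_real y)\<^sup>2 / 4) - 1)) (at y)" .
    have e: "exp (- (complex_of_real y)\<^sup>2 / 4) = of_real (exp (- y\<^sup>2 / 4))" for y
      by (simp flip: exp_of_real)
    show ?thesis using * unfolding F_def e by (simp add: mult_ac add_ac)
  qed
  have dint: "set_integrable lborel {0<..} (\<lambda>y. ?h y * of_real y powr (- s - 1) + (of_real y * ?p y * of_real (exp (- y\<^sup>2 / 4))) / (2 * s))"
    using mellin_integrable[OF hc] int by (intro set_integral_add) auto
  have nF: "norm (F y) \<le> norm (?h y) * y powr (- Re s) / norm s" if "y > 0" for y
    using that by (simp add: F_def norm_mult norm_divide norm_powr_real_powr)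
  have "(LINT y:{0<..}|lborel. ?h y * of_real y powr (- s - 1) + (of_real y * ?p y * of_real (exp (- y\<^sup>2 / 4))) / (2 * s)) = 0 - 0"
  proof (rule half_line_FTC[OF d _ dint])
    show "isCont (\<lambda>y. ?h y * of_real y powr (- s - 1) + (of_real y * ?p y * of_real (exp (- y\<^sup>2 / 4))) / (2 * s)) y" if "y > 0" for y
      using that s0 by (intro continuous_intros) (auto simp: complex_nonpos_Reals_iff)
    show "(F \<longlongrightarrow> 0) (at_right 0)"
    proof (rule Lim_null_comparison)
      show "\<forall>\<^sub>F y in at_right 0. norm (F y) \<le> (1 / norm s) * y powr (2 - Re s)"
        using eventually_at_right_less[of "0::real"]
      proof eventually_elim
        case (elim y)
        have "norm (F y) \<le> y\<^sup>2 * y powr (- Re s) / norm s"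
          using nF[OF elim] mult_right_mono[OF hb[of y], of "y powr (- Re s) / norm s"] elim by simp
        also have "y\<^sup>2 = y powr 2" using elim by (simp add: powr_numeral)
        finally show ?case by (simp flip: powr_add)
      qed
      have "((\<lambda>R. R powr (2 - Re s)) \<longlongrightarrow> 0 powr (2 - Re s)) (at_right 0)"
        using s by (intro tendsto_powr' tendsto_intros) (auto simp: eventually_at_filter)
      thus "((\<lambda>y. (1 / norm s) * y powr (2 - Re s)) \<longlongrightarrow> 0) (at_right 0)"
        using s by (intro tendsto_mult_right_zero) simp
    qed
    show "(F \<longlongrightarrow> 0) at_top"
    proof (rule Lim_null_comparison)
      show "\<forall>\<^sub>F y in at_top. norm (F y) \<le> (2 / norm s) * y powr (- Re s)"
        using eventually_gt_at_top[of "0::real"]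
      proof eventually_elim
        case (elim y)
        thus ?case using nF[OF elim] mult_right_mono[OF hb2[of y], of "y powr (- Re s) / norm s"] by simp
      qed
      show "((\<lambda>y. (2 / norm s) * y powr (- Re s)) \<longlongrightarrow> 0) at_top"
        using s by (intro tendsto_mult_right_zero tendsto_neg_powr filterlim_ident) auto
    qed
  qed
  hence "mellin ?h s + (2 * 2 powr (- s) * Gamma (1 - s / 2)) / (2 * s) = 0"
    using mellin_integrable[OF hc] int I unfolding mellin_def
    by (subst (asm) set_integral_add) (auto simp: set_integral_divide_zero)
  thus ?thesis using s0 by (simp add: add_eq_0_iff field_simps)
qed

lemma exponential_weight_powr:
  assumes z: "Re z > 0"
  shows "set_integrable lborel {0<..} (\<lambda>u. of_real (exp (- u)) * complex_of_real u powr (z - 1))"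
    and "(LINT u:{0<..}|lborel. of_real (exp (- u)) * complex_of_real u powr (z - 1)) = Gamma z"
proof -
  have eq: "complex_of_real t powr (z - 1) / of_real (exp t) = of_real (exp (- t)) * complex_of_real t powr (z - 1)" for t
    by (simp add: exp_minus divide_inverse)
  have a: "(\<lambda>u. of_real (exp (- u)) * complex_of_real u powr (z - 1)) absolutely_integrable_on {0<..}"
    using absolutely_integrable_Gamma_integral'[OF z] unfolding eq .
  have "set_borel_measurable lborel {0<..} (\<lambda>u. of_real (exp (- u)) * complex_of_real u powr (z - 1))"
    by (intro set_borel_measurable_cont continuous_intros) (auto simp: complex_nonpos_Reals_iff)
  thus int: "set_integrable lborel {0<..} (\<lambda>u. of_real (exp (- u)) * complex_of_real u powr (z - 1))"
    using a unfolding set_integrable_def set_borel_measurable_def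
    by (subst (asm) integrable_completion) auto
  show "(LINT u:{0<..}|lborel. of_real (exp (- u)) * complex_of_real u powr (z - 1)) = Gamma z"
    using set_borel_integral_eq_integral(2)[OF int] integral_unique[OF Gamma_integral_complex'[OF z]] unfolding eq by simp
qed

abbreviation exp_law :: "real measure" where
  "exp_law \<equiv> density lborel (\<lambda>u. ennreal (indicator {0<..} u * exp (- u)))"

lemma exp_law_integral:
  fixes f :: "real \<Rightarrow> complex"
  assumes [measurable]: "f \<in> borel_measurable borel"
  shows "(LINT u|exp_law. f u) = (LINT u:{0<..}|lborel. of_real (exp (- u)) * f u)"
    and "integrable exp_law f \<longleftrightarrow> set_integrable lborel {0<..} (\<lambda>u. of_real (exp (- u)) * f u)"
proof -
  have "(LINT u|exp_law. f u) = (LINT u|lborel. (indicator {0<..} u * exp (- u)) *\<^sub>R f u)"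
    by (rule integral_density) auto
  thus "(LINT u|exp_law. f u) = (LINT u:{0<..}|lborel. of_real (exp (- u)) * f u)"
    unfolding set_lebesgue_integral_def by (simp add: scaleR_conv_of_real mult.assoc)
  have "integrable exp_law f \<longleftrightarrow> integrable lborel (\<lambda>u. (indicator {0<..} u * exp (- u)) *\<^sub>R f u)"
    by (rule integrable_density) auto
  thus "integrable exp_law f \<longleftrightarrow> set_integrable lborel {0<..} (\<lambda>u. of_real (exp (- u)) * f u)"
    unfolding set_integrable_def by (simp add: scaleR_conv_of_real mult.assoc)
qed

lemma exp_law_moment:
  "integrable exp_law (\<lambda>u. complex_of_real (u ^ m))" "(LINT u|exp_law. complex_of_real (u ^ m)) = fact m"
proof -
  have z: "Re (of_nat m + 1 :: complex) > 0" by simp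
  have e: "of_real (exp (- u)) * complex_of_real (u ^ m) = of_real (exp (- u)) * complex_of_real u powr ((of_nat m + 1) - 1)" 
    if "u > 0" for u using that by (simp add: powr_nat')
  have 1: "set_integrable lborel {0<..} (\<lambda>u. of_real (exp (- u)) * complex_of_real (u ^ m))"
    using exponential_weight_powr(1)[OF z] by (rule set_integrable_cong[THEN iffD1, rotated -1]) (use e in auto)
  have 2: "(LINT u:{0<..}|lborel. of_real (exp (- u)) * complex_of_real (u ^ m)) =
     (LINT u:{0<..}|lborel. of_real (exp (- u)) * complex_of_real u powr ((of_nat m + 1) - 1))"
    by (rule set_lebesgue_integral_cong) (use e in auto)
  show "integrable exp_law (\<lambda>u. complex_of_real (u ^ m))" using 1 by (subst exp_law_integral(2)) auto
  show "(LINT u|exp_law. complex_of_real (u ^ m)) = fact m"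
    using 2 exponential_weight_powr(2)[OF z] by (subst exp_law_integral(1)) (auto simp: Gamma_fact add.commute)
qed

lemma prob_space_exp_law: "prob_space exp_law"
proof (rule prob_spaceI)
  have "integrable lborel (\<lambda>u. indicator {0<..} u * exp (- u) :: real)"
    using exp_law_moment(1)[of 0] integrable_Re[of lborel "\<lambda>u. indicator {0<..} u *\<^sub>R complex_of_real (exp (- u))"]
    by (subst (asm) exp_law_integral(2)) (auto simp: set_integrable_def)
  hence "emeasure exp_law (space exp_law) = ennreal (LINT u|lborel. indicator {0<..} u * exp (- u))"
    by (subst emeasure_density) (auto simp: nn_integral_eq_integral)
  also have "(LINT u|lborel. indicator {0<..} (u::real) * exp (- u)) = (1::real)"
  proof -
    have "(LINT u|exp_law. complex_of_real (u ^ 0)) = (LINT u:{0<..}|lborel. of_real (exp (- u)) * complex_of_real (u ^ 0))"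
      by (rule exp_law_integral(1)) simp
    also have "\<dots> = (LINT u|lborel. complex_of_real (indicator {0<..} u * exp (- u)))"
      unfolding set_lebesgue_integral_def by (simp add: scaleR_conv_of_real)
    also have "\<dots> = complex_of_real (LINT u|lborel. indicator {0<..} u * exp (- u))" by (rule integral_complex_of_real)
    finally have "complex_of_real (LINT u|lborel. indicator {0<..} u * exp (- u)) = fact 0"
      unfolding exp_law_moment(2) by (rule sym)
    thus ?thesis by (simp only: fact_0 of_real_eq_1_iff)
  qed
  finally show "emeasure exp_law (space exp_law) = 1" by simp
qed

text \<open>Termwise integration of the power series: the moment \<open>fact m\<close> of the exponential
  law cancels one of the two factorials, leaving the exponential series. In terms of walks, a
  plane vector with exponential squared length and uniform direction is Gaussian.\<close>
lemma exp_law_besselJ: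
  "(LINT u|exp_law. besselJ (sqrt u * y) - 1) = of_real (exp (- y\<^sup>2 / 4)) - 1"
proof -
  interpret prob_space exp_law by (rule prob_space_exp_law)
  define t where "t m u = complex_of_real (u ^ m) * (of_real ((- y\<^sup>2 / 4) ^ m / (fact m)\<^sup>2))" for m u
  have AEpos: "AE u in exp_law. u > 0"
    by (subst AE_density) (auto simp: indicator_def intro!: AE_I2)
  have besselJ_series: "(\<lambda>m. t m u) sums besselJ (sqrt u * y)" if "u > 0" for u
  proof -
    have "(\<lambda>m. (\<i> * of_real (sqrt u * y) / 2) ^ (2 * m) / (fact m)\<^sup>2) sums besselJ (sqrt u * y)"
      unfolding besselJ_def by (rule besselI_sums)
    moreover have "(\<i> * of_real (sqrt u * y) / 2) ^ (2 * m) / (fact m)\<^sup>2 = t m u" for m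
    proof -
      have "(\<i> * of_real (sqrt u * y) / 2)\<^sup>2 = complex_of_real (- (sqrt u)\<^sup>2 * y\<^sup>2 / 4)"
        by (simp add: power_divide power_mult_distrib del: real_sqrt_pow2_iff real_sqrt_pow2 real_sqrt_power)
           (simp flip: of_real_power)?
      also have "- (sqrt u)\<^sup>2 * y\<^sup>2 / 4 = u * (- y\<^sup>2 / 4)" using that by simp
      finally have "(\<i> * of_real (sqrt u * y) / 2) ^ (2 * m) = complex_of_real ((u * (- y\<^sup>2 / 4)) ^ m)"
        by (simp only: power_mult of_real_power)
      thus ?thesis unfolding t_def power_mult_distrib by simp
    qed
    ultimately show ?thesis by simp
  qed
  have tint: "integrable exp_law (t m)" for m
    unfolding t_def[abs_def] by (intro integrable_mult_left exp_law_moment)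
  have tval: "(LINT u|exp_law. t m u) = of_real ((- y\<^sup>2 / 4) ^ m / fact m)" for m
    unfolding t_def integral_mult_left_zero exp_law_moment(2) by (simp add: power2_eq_square)
  have tnorm: "(LINT u|exp_law. norm (t m u)) = (y\<^sup>2 / 4) ^ m / fact m" for m
  proof -
    have "complex_of_real (LINT u|exp_law. norm (t m u)) = (LINT u|exp_law. complex_of_real (norm (t m u)))" by simp
    also have "\<dots> = (LINT u|exp_law. complex_of_real (u ^ m) * of_real ((y\<^sup>2 / 4) ^ m / (fact m)\<^sup>2))"
    proof (rule Bochner_Integration.integral_cong_AE)
      show "AE u in exp_law. complex_of_real (norm (t m u)) = complex_of_real (u ^ m) * of_real ((y\<^sup>2 / 4) ^ m / (fact m)\<^sup>2)"
        using AEpos by eventually_elim (simp add: t_def norm_mult norm_power norm_divide power_abs abs_mult abs_divide)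
    qed (auto simp: t_def)
    also have "\<dots> = of_real ((y\<^sup>2 / 4) ^ m / fact m)"
      unfolding integral_mult_left_zero exp_law_moment(2) by (simp add: power2_eq_square)
    finally show ?thesis by (simp only: of_real_eq_iff)
  qed
  have s1: "(\<lambda>m. LINT u|exp_law. t m u) sums (LINT u|exp_law. (\<Sum>m. t m u))"
  proof (rule sums_integral[OF tint])
    show "AE u in exp_law. summable (\<lambda>m. norm (t m u))"
      using AEpos
    proof eventually_elim
      case (elim u)
      have "summable (\<lambda>m. (u * y\<^sup>2 / 4) ^ m /\<^sub>R fact m)" by (rule summable_exp_generic)
      thus ?case
      proof (rule summable_comparison_test[rotated], intro exI allI impI)
        fix m
        have "norm (t m u) = (u * y\<^sup>2 / 4) ^ m / (fact m)\<^sup>2"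
          using elim by (simp add: t_def norm_mult norm_power norm_divide power_abs abs_mult abs_divide power_mult_distrib power_divide)
        also have "\<dots> \<le> (u * y\<^sup>2 / 4) ^ m / fact m"
          using elim by (intro divide_left_mono) (auto simp: power2_eq_square)
        finally show "norm (norm (t m u)) \<le> (u * y\<^sup>2 / 4) ^ m /\<^sub>R fact m"
          by (simp only: real_norm_def abs_norm_cancel real_scaleR_def divide_inverse_commute)
      qed
    qed
    show "summable (\<lambda>m. LINT u|exp_law. norm (t m u))"
      unfolding tnorm using summable_exp_generic[of "y\<^sup>2 / 4"]
      by (simp only: divide_inverse_commute real_scaleR_def)
  qed
  have s2: "(LINT u|exp_law. (\<Sum>m. t m u)) = (LINT u|exp_law. besselJ (sqrt u * y))"
  proof (rule Bochner_Integration.integral_cong_AE)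
    show "AE u in exp_law. (\<Sum>m. t m u) = besselJ (sqrt u * y)"
      using AEpos by eventually_elim (use besselJ_series sums_unique in metis)
  qed (auto simp: t_def)
  have s3: "(\<lambda>m. LINT u|exp_law. t m u) sums of_real (exp (- y\<^sup>2 / 4))"
  proof -
    have "(\<lambda>m. (- y\<^sup>2 / 4) ^ m / fact m) sums exp (- y\<^sup>2 / 4)"
      using exp_converges[of "- y\<^sup>2 / 4"] by (simp only: divide_inverse_commute real_scaleR_def)
    thus ?thesis unfolding tval by (rule sums_of_real)
  qed
  have "(LINT u|exp_law. besselJ (sqrt u * y)) = of_real (exp (- y\<^sup>2 / 4))"
    using sums_unique2[OF s1 s3] unfolding s2 .
  moreover have "integrable exp_law (\<lambda>u. besselJ (sqrt u * y))"
    by (rule integrable_const_bound[of _ 1]) (auto simp: norm_besselJ_le)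
  moreover have "prob UNIV = 1" using prob_space by simp
  ultimately show ?thesis by simp
qed

text \<open>The transform of the Bessel function is found without evaluating an oscillating integral:
  averaging over an exponential law multiplies it by a gamma value and yields the transform of a
  Gaussian.\<close>
theorem mellin_besselJ:
  assumes s: "0 < Re s" "Re s < 2"
  shows "mellin_factor s * mellin (\<lambda>y. besselJ y - 1) s = 1"
proof -
  have s0: "s \<noteq> 0" using s by auto
  have z: "Re (1 + s / 2) > 0" using s by simp
  have sq: "complex_of_real (sqrt u) powr s = of_real u powr ((1 + s / 2) - 1)" if "u > 0" for u
  proof -
    have "complex_of_real u powr (s / 2) = (of_real (sqrt u) * of_real (sqrt u)) powr (s / 2)"
      using that by (simp flip: of_real_mult)
    also have "\<dots> = of_real (sqrt u) powr s" using that by (simp add: powr_times_real flip: powr_add)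
    finally show ?thesis by simp
  qed
  have "(LINT u|exp_law. of_real (sqrt \<bar>u\<bar>) powr s) * mellin (\<lambda>y. besselJ y - 1) s =
     mellin (\<lambda>y. LINT u|exp_law. besselJ (sqrt \<bar>u\<bar> * y) - 1) s"
  proof (rule mellin_expectation_scale[OF prob_space_exp_law])
    show "mellin_conv (\<lambda>y. besselJ y - 1) (Re s)" using mellin_conv_besselJ_power[of "Re s" 1] s by simp
    have z': "Re (of_real (1 + Re s / 2)) > 0" using s by simp
    have "set_integrable lborel {0<..} (\<lambda>u. of_real (exp (- u)) * complex_of_real (sqrt \<bar>u\<bar> powr Re s))"
      using exponential_weight_powr(1)[OF z']
    proof (rule set_integrable_cong[THEN iffD1, rotated -1])
      fix u :: real assume u: "u \<in> {0<..}"
      have "sqrt u powr Re s = u powr (Re s / 2)"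
        using u by (simp add: powr_half_sqrt[symmetric] powr_powr)
      thus "of_real (exp (- u)) * complex_of_real u powr (of_real (1 + Re s / 2) - 1) = of_real (exp (- u)) * complex_of_real (sqrt \<bar>u\<bar> powr Re s)"
        using u by (simp add: powr_of_real[symmetric])
    qed auto
    hence "integrable exp_law (\<lambda>u. complex_of_real (sqrt \<bar>u\<bar> powr Re s))" by (subst exp_law_integral(2)) auto
    thus "integrable exp_law (\<lambda>u. sqrt \<bar>u\<bar> powr Re s)" using integrable_Re by fastforce
  qed auto
  also have "(\<lambda>y. LINT u|exp_law. besselJ (sqrt \<bar>u\<bar> * y) - 1) = (\<lambda>y. of_real (exp (- y\<^sup>2 / 4)) - 1)"
  proof
    fix y
    have "(LINT u|exp_law. besselJ (sqrt \<bar>u\<bar> * y) - 1) = (LINT u|exp_law. besselJ (sqrt u * y) - 1)"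
    proof (rule Bochner_Integration.integral_cong_AE)
      show "AE u in exp_law. besselJ (sqrt \<bar>u\<bar> * y) - 1 = besselJ (sqrt u * y) - 1"
        by (subst AE_density) (auto simp: indicator_def intro!: AE_I2)
    qed auto
    thus "(LINT u|exp_law. besselJ (sqrt \<bar>u\<bar> * y) - 1) = of_real (exp (- y\<^sup>2 / 4)) - 1" by (simp only: exp_law_besselJ)
  qed
  also have "mellin \<dots> s = - (2 powr (- s)) / s * Gamma (1 - s / 2)" by (rule mellin_gaussian[OF s])
  also have "(LINT u|exp_law. of_real (sqrt \<bar>u\<bar>) powr s) = Gamma (1 + s / 2)"
  proof -
    have "(LINT u|exp_law. complex_of_real (sqrt \<bar>u\<bar>) powr s) = (LINT u:{0<..}|lborel. of_real (exp (- u)) * complex_of_real (sqrt \<bar>u\<bar>) powr s)"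
      by (rule exp_law_integral(1)) measurable
    also have "\<dots> = (LINT u:{0<..}|lborel. of_real (exp (- u)) * complex_of_real u powr ((1 + s / 2) - 1))"
      by (rule set_lebesgue_integral_cong) (use sq in auto)
    also have "\<dots> = Gamma (1 + s / 2)" by (rule exponential_weight_powr(2)[OF z])
    finally show ?thesis .
  qed
  finally have E: "Gamma (1 + s / 2) * mellin (\<lambda>y. besselJ y - 1) s = - (2 powr (- s)) / s * Gamma (1 - s / 2)" .
  have "1 - s / 2 \<notin> \<int>\<^sub>\<le>\<^sub>0" using s by (auto elim!: nonpos_Ints_cases simp: complex_eq_iff)
  hence "Gamma (1 - s / 2) * rGamma (1 - s / 2) = 1" by (simp add: rGamma_inverse_Gamma Gamma_eq_zero_iff)
  moreover have "(2::complex) powr s * 2 powr (- s) = 1" by (simp flip: powr_add)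
  moreover have "mellin_factor s * mellin (\<lambda>y. besselJ y - 1) s =
     - s * 2 powr s * rGamma (1 - s / 2) * (Gamma (1 + s / 2) * mellin (\<lambda>y. besselJ y - 1) s)"
    by (simp add: mellin_factor_def mult_ac)
  moreover have "- s * 2 powr s * rGamma (1 - s / 2) * (- (2 powr (- s)) / s * Gamma (1 - s / 2)) =
    (2 powr s * 2 powr (- s)) * (Gamma (1 - s / 2) * rGamma (1 - s / 2))" using s0 by simp
  ultimately show ?thesis unfolding E by simp
qed

text \<open>The average over a full period does not depend on where the period starts. Here this is a
  statement about entire primitives, valid for complex \<open>w\<close>.\<close>
lemma besselI_phase_shift:
  "(LINT t|unit_interval. exp (w * of_real (cos (2 * pi * t + \<alpha>)))) = besselI w"
proof -
  let ?g = "\<lambda>z::complex. exp (w * cos (2 * of_real pi * z))"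
  have "?g holomorphic_on UNIV" by (intro holomorphic_intros)
  then obtain F where "\<And>z. (F has_field_derivative ?g z) (at z)"
    using holomorphic_convex_primitive'[of UNIV ?g] by auto
  note F = this
  define a where "a = complex_of_real (\<alpha> / (2 * pi))"
  have d1: "((\<lambda>z. F (z + 1)) has_field_derivative ?g z) (at z)" for z
  proof -
    have "((\<lambda>z. F (z + 1)) has_field_derivative ?g (z + 1) * 1) (at z)"
      by (rule DERIV_chain2[where f = F and g = "\<lambda>z. z + 1", OF F]) (auto intro!: derivative_eq_intros)
    moreover have "cos (2 * of_real pi * (z + 1)) = cos (2 * of_real pi * z)"
    proof -
      have "2 * of_real pi * (z + 1) = 2 * of_real pi * z + of_real (2 * pi)" by (simp add: algebra_simps)
      thus ?thesis by (simp only: cos_add cos_of_real sin_of_real) simp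
    qed
    ultimately show ?thesis by simp
  qed
  have d2: "((\<lambda>z. F (z + a)) has_field_derivative ?g (z + a)) (at z)" for z
  proof -
    have "((\<lambda>z. F (z + a)) has_field_derivative ?g (z + a) * 1) (at z)"
      by (rule DERIV_chain2[where f = F and g = "\<lambda>z. z + a", OF F]) (auto intro!: derivative_eq_intros)
    thus ?thesis by simp
  qed
  have "(LINT t|unit_interval. ?g (of_real t + a)) = F (1 + a) - F (0 + a)"
    by (rule unit_interval_FTC[OF d2]) (intro continuous_intros)
  also have "\<dots> = F (0 + 1) - F 0"
    using entire_primitives_differ_by_constant[OF d1 F, of a 0] by (simp add: add.commute)
  also have "\<dots> = (LINT t|unit_interval. ?g (of_real t))"
    by (subst unit_interval_FTC[OF F]) (auto intro!: continuous_intros)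
  also have "\<dots> = besselI w" unfolding besselI_def trig_2pi_of_real ..
  also have "(\<lambda>t. ?g (of_real t + a)) = (\<lambda>t. exp (w * of_real (cos (2 * pi * t + \<alpha>))))"
  proof
    fix t
    have "2 * of_real pi * (of_real t + a) = complex_of_real (2 * pi * t + \<alpha>)" by (simp add: a_def field_simps)
    thus "?g (of_real t + a) = exp (w * of_real (cos (2 * pi * t + \<alpha>)))" by (simp only: cos_of_real)
  qed
  finally show ?thesis .
qed

abbreviation steps_law :: "nat \<Rightarrow> (nat \<Rightarrow> real) measure" where
  "steps_law n \<equiv> Pi\<^sub>M {1..n} (\<lambda>_. unit_interval)"

definition walk :: "nat \<Rightarrow> (nat \<Rightarrow> real) \<Rightarrow> complex" where
  "walk n t = (\<Sum>k = 1..n. exp (2 * of_real pi * \<i> * complex_of_real (t k)))"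

lemma prob_space_steps_law: "prob_space (steps_law n)"
  by (intro prob_space_PiM prob_space_unit_interval)

lemma measurable_ident_unit_interval: "(\<lambda>x. x) \<in> borel_measurable unit_interval"
  by (rule unit_interval_measurable) simp

lemma measurable_step: "k \<in> {1..n} \<Longrightarrow> (\<lambda>t. t k) \<in> borel_measurable (steps_law n)"
proof -
  assume "k \<in> {1..n}"
  hence "(\<lambda>t. t k) \<in> measurable (steps_law n) unit_interval" by (rule measurable_component_singleton)
  from measurable_compose[OF this measurable_ident_unit_interval] show ?thesis .
qed

lemma measurable_walk [measurable]: "walk n \<in> borel_measurable (steps_law n)"
  unfolding walk_def[abs_def]
proof (rule borel_measurable_sum)
  fix k assume k: "k \<in> {1..n}"
  note [measurable] = measurable_step[OF k]
  show "(\<lambda>t. exp (2 * of_real pi * \<i> * complex_of_real (t k))) \<in> borel_measurable (steps_law n)"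
    by measurable
qed

lemmas measurable_walk' [measurable] = measurable_walk[unfolded One_nat_def]

lemma norm_walk_le: "norm (walk n t) \<le> real n"
proof -
  have "norm (walk n t) \<le> (\<Sum>k = 1..n. norm (exp (2 * of_real pi * \<i> * complex_of_real (t k))))"
    unfolding walk_def by (rule norm_sum)
  also have "\<dots> = real n" by (simp add: norm_exp_eq_Re)
  finally show ?thesis .
qed

lemma ramble_integral_eq_walk:
  "ramble_integral n s = (LINT t|steps_law n. of_real (norm (walk n t)) powr s)"
  unfolding ramble_integral_def walk_def ..

lemma norm_walk_powr_integrable:
  assumes "\<sigma> > 0"
  shows "integrable (steps_law n) (\<lambda>t. norm (walk n t) powr \<sigma>)"
proof -
  interpret prob_space "steps_law n" by (rule prob_space_steps_law)
  show ?thesis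
    by (rule integrable_const_bound[of _ "real n powr \<sigma>"])
       (use assms norm_walk_le[of n] in \<open>auto intro!: powr_mono2\<close>)
qed

text \<open>Multiply the walk by a further independent uniform direction: its inner product with a fixed
  vector is a sum of cosines with shifted phases. By the shift invariance the expectation
  factors over the steps, and the average over the further direction produces the Bessel
  function of the length.\<close>
lemma walk_besselJ_expectation:
  "(LINT t|steps_law n. besselJ (norm (walk n t) * y)) = besselJ y ^ n"
proof -
  interpret P: prob_space "steps_law n" by (rule prob_space_steps_law)
  interpret U: prob_space unit_interval by (rule prob_space_unit_interval)
  interpret PU: pair_prob_space "steps_law n" unit_interval ..
  interpret prod: product_sigma_finite "\<lambda>_. unit_interval" ..
  define f where "f t \<phi> = (\<Prod>k=1..n. exp (\<i> * of_real y * of_real (cos (2 * pi * t k + 2 * pi * \<phi>))))" for t :: "nat \<Rightarrow> real" and \<phi> :: real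
  have fm: "case_prod f \<in> borel_measurable (steps_law n \<Otimes>\<^sub>M unit_interval)"
    unfolding f_def case_prod_beta
  proof (rule borel_measurable_prod)
    fix k assume k: "k \<in> {1..n}"
    note [measurable] = measurable_step[OF k]
    have [measurable]: "(\<lambda>x. fst x k) \<in> borel_measurable (steps_law n \<Otimes>\<^sub>M unit_interval)"
      "(\<lambda>x. snd x) \<in> borel_measurable (steps_law n \<Otimes>\<^sub>M unit_interval)"
      using measurable_compose[OF measurable_fst measurable_step[OF k]]
        measurable_compose[OF measurable_snd measurable_ident_unit_interval] by blast+
    show "(\<lambda>x. exp (\<i> * of_real y * complex_of_real (cos (2 * pi * fst x k + 2 * pi * snd x))))
       \<in> borel_measurable (steps_law n \<Otimes>\<^sub>M unit_interval)" by measurable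
  qed
  have fn: "norm (f t \<phi>) = 1" for t \<phi>
    unfolding f_def prod_norm[symmetric] by (simp add: norm_exp_eq_Re)
  have fi: "integrable (steps_law n \<Otimes>\<^sub>M unit_interval) (case_prod f)"
    by (rule PU.integrable_const_bound[of _ 1]) (use fm fn in \<open>auto simp: case_prod_beta\<close>)
  have inner: "(LINT \<phi>|unit_interval. f t \<phi>) = besselJ (norm (walk n t) * y)" for t
  proof -
    have re: "(\<Sum>k=1..n. cos (2 * pi * t k + 2 * pi * \<phi>)) = norm (walk n t) * cos (2 * pi * \<phi> + Arg (walk n t))" for \<phi>
    proof -
      have "(\<Sum>k=1..n. cos (2 * pi * t k + 2 * pi * \<phi>)) = Re (walk n t * cis (2 * pi * \<phi>))"
      proof -
        have "walk n t * cis (2 * pi * \<phi>) = (\<Sum>k=1..n. cis (2 * pi * t k + 2 * pi * \<phi>))"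
          unfolding walk_def sum_distrib_right
          by (intro sum.cong refl) (simp add: cis_conv_exp exp_add[symmetric] algebra_simps)
        thus ?thesis by (simp add: Re_sum)
      qed
      also have "walk n t = rcis (norm (walk n t)) (Arg (walk n t))" by (simp add: rcis_cmod_Arg)
      hence "walk n t * cis (2 * pi * \<phi>) = rcis (norm (walk n t)) (2 * pi * \<phi> + Arg (walk n t))"
        by (metis add.commute cis_mult mult.assoc rcis_def)
      finally show ?thesis by (simp add: Re_rcis)
    qed
    have "f t \<phi> = exp ((\<i> * of_real (norm (walk n t) * y)) * of_real (cos (2 * pi * \<phi> + Arg (walk n t))))" for \<phi>
    proof -
      have "f t \<phi> = exp (\<Sum>k=1..n. \<i> * of_real y * of_real (cos (2 * pi * t k + 2 * pi * \<phi>)))"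
        unfolding f_def by (rule exp_sum[symmetric]) simp
      also have "(\<Sum>k=1..n. \<i> * of_real y * complex_of_real (cos (2 * pi * t k + 2 * pi * \<phi>))) =
         \<i> * of_real y * of_real (\<Sum>k=1..n. cos (2 * pi * t k + 2 * pi * \<phi>))"
        by (simp add: sum_distrib_left)
      finally show ?thesis unfolding re by (simp add: mult_ac)
    qed
    thus ?thesis by (simp only: besselI_phase_shift besselJ_def)
  qed
  have outer: "(LINT t|steps_law n. f t \<phi>) = besselJ y ^ n" for \<phi>
  proof -
    have "(LINT t|steps_law n. f t \<phi>) = (\<Prod>k=1..n. LINT x|unit_interval. exp (\<i> * of_real y * of_real (cos (2 * pi * x + 2 * pi * \<phi>))))"
      unfolding f_def
      by (rule prod.product_integral_prod) (auto intro!: unit_interval_integrable continuous_intros)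
    thus ?thesis by (simp add: besselI_phase_shift besselJ_def)
  qed
  have "(LINT \<phi>|unit_interval. LINT t|steps_law n. f t \<phi>) = (LINT t|steps_law n. LINT \<phi>|unit_interval. f t \<phi>)"
    by (rule PU.Fubini_integral[OF fi])
  thus ?thesis unfolding inner outer by (simp add: U.prob_space del: One_nat_def)
qed

text \<open>The expectation of \<open>J(|S| * y) - 1\<close> is a power of \<open>J\<close> minus 1. Scaling
  by the random length multiplies the transform of \<open>J - 1\<close> by the moment, and
  \<open>mellin_factor\<close> is the reciprocal of that transform.\<close>
theorem ramble_integral_mellin:
  assumes s: "0 < Re s" "Re s < 2"
  shows "ramble_integral n s = mellin_factor s * mellin (\<lambda>y. besselJ y ^ n - 1) s"
proof -
  interpret P: prob_space "steps_law n" by (rule prob_space_steps_law)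
  have "ramble_integral n s * mellin (\<lambda>y. besselJ y - 1) s = mellin (\<lambda>y. LINT t|steps_law n. besselJ (norm (walk n t) * y) - 1) s"
    unfolding ramble_integral_eq_walk
  proof (rule mellin_expectation_scale[OF prob_space_steps_law])
    show "mellin_conv (\<lambda>y. besselJ y - 1) (Re s)" using mellin_conv_besselJ_power[of "Re s" 1] s by simp
    show "integrable (steps_law n) (\<lambda>t. norm (walk n t) powr Re s)" using s by (intro norm_walk_powr_integrable)
  qed auto
  also have "(\<lambda>y. LINT t|steps_law n. besselJ (norm (walk n t) * y) - 1) = (\<lambda>y. besselJ y ^ n - 1)"
  proof
    fix y
    have "integrable (steps_law n) (\<lambda>t. besselJ (norm (walk n t) * y))"
      by (rule P.integrable_const_bound[of _ 1]) (auto simp: norm_besselJ_le)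
    thus "(LINT t|steps_law n. besselJ (norm (walk n t) * y) - 1) = besselJ y ^ n - 1"
      by (simp add: walk_besselJ_expectation P.prob_space del: One_nat_def)
  qed
  finally have "ramble_integral n s * (mellin_factor s * mellin (\<lambda>y. besselJ y - 1) s) = mellin_factor s * mellin (\<lambda>y. besselJ y ^ n - 1) s"
    by (simp add: mult_ac)
  thus ?thesis by (simp add: mellin_besselJ[OF s])
qed

text \<open>The length of the walk is bounded, so its moments of positive order form an exponential integral
  in the logarithm of the length.\<close>
lemma ramble_integral_holomorphic: "ramble_integral n holomorphic_on {s. Re s > 0}"
proof -
  define g where "g t = (if walk n t = 0 then 0 else 1 :: complex)" for t
  define l where "l t = ln (norm (walk n t))" for t
  have gm [measurable]: "g \<in> borel_measurable (steps_law n)" unfolding g_def by measurable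
  have lm [measurable]: "l \<in> borel_measurable (steps_law n)" unfolding l_def by measurable
  have i: "integrable (steps_law n) (\<lambda>t. norm (g t) * exp (a * l t))" if "a > 0" for a
  proof -
    have "(\<lambda>t. norm (g t) * exp (a * l t)) = (\<lambda>t. norm (walk n t) powr a)"
      by (auto simp: g_def l_def powr_def fun_eq_iff)
    thus ?thesis using norm_walk_powr_integrable[OF that] by simp
  qed
  have eq: "ramble_integral n = (\<lambda>s. LINT t|steps_law n. g t * exp (s * of_real (l t)))"
    unfolding ramble_integral_eq_walk[abs_def]
    by (intro ext Bochner_Integration.integral_cong refl) (auto simp: g_def l_def powr_def Ln_of_real)
  show ?thesis
    unfolding holomorphic_on_def eq
  proof safe
    fix s :: complex assume "Re s > 0"
    hence "((\<lambda>s. LINT t|steps_law n. g t * exp (s * of_real (l t))) has_field_derivative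
       (LINT t|steps_law n. g t * of_real (l t) * exp (s * of_real (l t)))) (at s)"
      by (intro exp_integral_has_derivative[OF gm lm i[of "Re s / 2"] i[of "Re s + 1"]]) auto
    thus "(\<lambda>s. LINT t|steps_law n. g t * exp (s * of_real (l t))) field_differentiable at s within {s. Re s > 0}"
      using field_differentiable_def field_differentiable_at_within by blast
  qed
qed

text \<open>To the left of the imaginary axis the Gaussian alone has a convergent transform. Together with
  the formula on the right this describes the jump of the transform across the axis.\<close>
lemma mellin_gaussian_left:
  assumes "Re s < 0"
  shows "mellin (\<lambda>y. of_real (exp (- y\<^sup>2 / 4))) s = 2 powr (- s) / 2 * Gamma (- s / 2)"
proof -
  have s: "Re (s + 2) < 2" using assms by simp
  have "mellin (\<lambda>y. of_real (exp (- y\<^sup>2 / 4))) s =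
     (LINT x:{0<..}|lborel. of_real x * complex_of_real x powr (- (s + 2)) * complex_of_real (exp (- x\<^sup>2 / 4)))"
    unfolding mellin_def
  proof (rule set_lebesgue_integral_cong, simp, intro allI impI)
    fix x :: real assume "x \<in> {0<..}"
    have e: "- s - 1 = 1 + - (s + 2)" by simp
    have "of_real x powr (- s - 1) = complex_of_real x powr 1 * complex_of_real x powr (- (s + 2))"
      unfolding e by (rule powr_add)
    thus "complex_of_real (exp (- x\<^sup>2 / 4)) * of_real x powr (- s - 1) =
       of_real x * complex_of_real x powr (- (s + 2)) * complex_of_real (exp (- x\<^sup>2 / 4))"
      using \<open>x \<in> {0<..}\<close> by (simp add: mult_ac)
  qed
  also have "\<dots> = 2 * 2 powr (- (s + 2)) * Gamma (1 - (s + 2) / 2)" by (rule gaussian_first_moment(2)[OF s])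
  also have "1 - (s + 2) / 2 = - s / 2" by (simp add: field_simps)
  also have "2 * 2 powr (- (s + 2)) = (2 powr (- s) / 2 :: complex)"
  proof -
    have a: "2 powr (- (s + 2)) = (2 powr (- s) * 2 powr (- 2) :: complex)"
      unfolding powr_add[symmetric] by simp
    have b: "(2 powr (- 2) :: complex) = 1 / 4"
      using powr_nat'[of 2 2] powr_minus[of "2::complex" 2] by simp
    show ?thesis unfolding a b by (simp add: field_simps)
  qed
  finally show ?thesis .
qed

section \<open>Rotation of the Mellin integrals of Bessel powers\<close>

text \<open>Half of a Hankel function, in the coordinate turned by a right angle: on the negative imaginary
  axis it and its conjugate add up to the Bessel function, and on the positive axis it is
  imaginary and decays.\<close>
definition hankelX :: "complex \<Rightarrow> complex" where
  "hankelX w = - \<i> * besselK w / of_real pi"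

text \<open>The terms of the binomial expansion of \<open>(X + (I - X))^(2j + 1)\<close> with more factors
  \<open>X\<close> than \<open>I - X\<close>. On the negative imaginary axis the other terms are
  their conjugates. An odd exponent has no middle term, so the two halves exhaust the expansion.\<close>
definition hankel_part :: "nat \<Rightarrow> complex \<Rightarrow> complex" where
  "hankel_part j w = (\<Sum>a = j + 1..2 * j + 1. of_nat ((2 * j + 1) choose a) * hankelX w ^ a * (besselI w - hankelX w) ^ (2 * j + 1 - a))"

lemma besselJ_eq_hankelX:
  assumes "x > 0"
  shows "besselJ x = hankelX (- \<i> * of_real x) + cnj (hankelX (- \<i> * of_real x))"
  using besselI_eq_besselK_imaginary[OF assms] besselI_even[of "\<i> * of_real x"]
  unfolding besselJ_def hankelX_def by simp

lemma cnj_besselJ: "x > 0 \<Longrightarrow> cnj (besselJ x) = besselJ x"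
  by (simp add: besselJ_eq_hankelX add.commute)

text \<open>Reversing the order of summation exchanges the two halves of the binomial expansion, and
  conjugation exchanges \<open>X\<close> and \<open>I - X\<close>.\<close>
lemma besselJ_power_split:
  assumes x: "x > 0"
  shows "besselJ x ^ (2 * j + 1) = hankel_part j (- \<i> * of_real x) + cnj (hankel_part j (- \<i> * of_real x))"
proof -
  define X where "X = hankelX (- \<i> * of_real x)"
  let ?n = "2 * j + 1"
  let ?t = "\<lambda>a. of_nat (?n choose a) * X ^ a * cnj X ^ (?n - a)"
  have J: "besselJ x = X + cnj X" using besselJ_eq_hankelX[OF x] by (simp add: X_def)
  have I: "besselI (- \<i> * of_real x) = X + cnj X" using besselI_even[of "\<i> * of_real x"] J by (simp add: besselJ_def)
  have h: "hankel_part j (- \<i> * of_real x) = (\<Sum>a = j + 1..?n. ?t a)"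
    unfolding hankel_part_def I X_def[symmetric] by simp
  have "cnj (\<Sum>a = j + 1..?n. ?t a) = (\<Sum>a = j + 1..?n. of_nat (?n choose a) * cnj X ^ a * X ^ (?n - a))"
    by simp
  also have "\<dots> = (\<Sum>a\<le>j. ?t a)"
  proof (rule sum.reindex_bij_witness[of _ "\<lambda>a. ?n - a" "\<lambda>a. ?n - a"])
    fix a assume "a \<in> {j + 1..?n}"
    thus "of_nat (?n choose (?n - a)) * X ^ (?n - a) * cnj X ^ (?n - (?n - a)) = of_nat (?n choose a) * cnj X ^ a * X ^ (?n - a)"
      using binomial_symmetric[of a ?n] by simp
  qed auto
  finally have c: "cnj (hankel_part j (- \<i> * of_real x)) = (\<Sum>a\<le>j. ?t a)" unfolding h .
  have "besselJ x ^ ?n = (\<Sum>a\<le>?n. ?t a)" unfolding J by (rule binomial_ring)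
  also have "{..?n} = {..j} \<union> {j + 1..?n}" by auto
  also have "(\<Sum>a\<in>\<dots>. ?t a) = (\<Sum>a\<le>j. ?t a) + (\<Sum>a = j + 1..?n. ?t a)"
    by (rule sum.union_disjoint) auto
  finally show ?thesis by (subst c, subst h) (simp only: add.commute)
qed

lemma hankelX_bound:
  assumes "0 < e" "e \<le> 1/2"
  obtains c where "c \<ge> 0" "\<And>w. Re w \<ge> 0 \<Longrightarrow> Im w \<le> 0 \<Longrightarrow> w \<noteq> 0 \<Longrightarrow> norm (hankelX w) \<le> c * exp (- Re w) * norm w powr (- e)"
proof (rule that[of "4 * gauss_moment e / pi"])
  show "4 * gauss_moment e / pi \<ge> 0" using gauss_moment_nonneg by simp
  fix w assume "Re w \<ge> 0" "Im w \<le> 0" "w \<noteq> 0"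
  from divide_right_mono[OF norm_besselK_le[OF assms this], of pi]
  show "norm (hankelX w) \<le> 4 * gauss_moment e / pi * exp (- Re w) * norm w powr (- e)"
    by (simp add: hankelX_def norm_divide norm_mult)
qed

lemma norm_hankel_part_le:
  assumes x: "norm (hankelX w) \<le> x" and y: "norm (besselI w - hankelX w) \<le> y"
    and b: "\<And>a. j + 1 \<le> a \<Longrightarrow> a \<le> 2 * j + 1 \<Longrightarrow> x ^ a * y ^ (2 * j + 1 - a) \<le> B"
  shows "norm (hankel_part j w) \<le> 2 ^ (2 * j + 1) * B"
proof -
  let ?n = "2 * j + 1"
  have x0: "x \<ge> 0" using x norm_ge_zero order_trans by blast
  have y0: "y \<ge> 0" using y norm_ge_zero order_trans by blast
  have B0: "B \<ge> 0" using b[of "j + 1"] x0 y0 by (auto intro: order_trans[rotated])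
  have "norm (hankel_part j w) \<le> (\<Sum>a = j + 1..?n. real (?n choose a) * B)"
    unfolding hankel_part_def
  proof (rule sum_norm_le)
    fix a assume a: "a \<in> {j + 1..?n}"
    have "norm (of_nat (?n choose a) * hankelX w ^ a * (besselI w - hankelX w) ^ (?n - a)) =
      real (?n choose a) * (norm (hankelX w) ^ a * norm (besselI w - hankelX w) ^ (?n - a))"
      by (simp add: norm_mult norm_power)
    also have "\<dots> \<le> real (?n choose a) * (x ^ a * y ^ (?n - a))"
      using x y x0 y0 by (intro mult_left_mono mult_mono power_mono) auto
    also have "\<dots> \<le> real (?n choose a) * B" using b[of a] a by (intro mult_left_mono) auto
    finally show "norm (of_nat (?n choose a) * hankelX w ^ a * (besselI w - hankelX w) ^ (?n - a)) \<le> real (?n choose a) * B" .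
  qed
  also have "\<dots> \<le> (\<Sum>a\<le>?n. real (?n choose a) * B)" using B0 by (intro sum_mono2) auto
  also have "\<dots> = 2 ^ ?n * B"
    unfolding sum_distrib_right[symmetric] of_nat_sum[symmetric] choose_row_sum by simp
  finally show ?thesis .
qed

text \<open>Each term contains at least one more decaying factor than growing ones, so the exponentials
  leave a surplus \<open>exp (- Re w)\<close>. The square-root decay of two factors gives
  \<open>1 / |w|\<close>.\<close>
lemma hankel_part_infinity_bound:
  assumes j: "j > 0"
  obtains C where "C \<ge> 0" "\<And>w. Re w \<ge> 0 \<Longrightarrow> Im w \<le> 0 \<Longrightarrow> norm w \<ge> 1 \<Longrightarrow>
    norm (hankel_part j w) \<le> C * exp (- Re w) * norm w powr (- 1)"
proof -
  obtain c where c: "c \<ge> 0" "\<And>w. Re w \<ge> 0 \<Longrightarrow> Im w \<le> 0 \<Longrightarrow> w \<noteq> 0 \<Longrightarrow> norm (hankelX w) \<le> c * exp (- Re w) * norm w powr (- (1/2))"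
    using hankelX_bound[of "1/2"] by auto
  let ?n = "2 * j + 1"
  show ?thesis
  proof (rule that[of "2 ^ ?n * (c + 1) ^ ?n"])
    fix w assume w: "Re w \<ge> 0" "Im w \<le> 0" "norm w \<ge> 1"
    define r where "r = norm w powr (- (1/2))"
    define E where "E = exp (Re w)"
    have r: "0 \<le> r" "r \<le> 1"
      using w ge_one_powr_ge_zero[of "norm w" "1/2"] by (auto simp: r_def powr_minus inverse_le_1_iff)
    have r2: "r\<^sup>2 = norm w powr (- 1)" unfolding r_def power2_eq_square powr_add[symmetric] by simp
    have E: "E \<ge> 1" "exp (- Re w) = 1 / E" using w by (auto simp: E_def exp_minus divide_inverse)
    have X: "norm (hankelX w) \<le> (c + 1) * (r / E)"
    proof -
      have "norm (hankelX w) \<le> c * (r / E)" using c(2)[OF w(1,2)] w(3) E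
        by (cases "w = 0") (simp_all add: r_def)
      also have "\<dots> \<le> (c + 1) * (r / E)" using r E by (intro mult_right_mono) auto
      finally show ?thesis .
    qed
    have Y: "norm (besselI w - hankelX w) \<le> (c + 1) * E"
    proof -
      have "norm (besselI w - hankelX w) \<le> norm (besselI w) + norm (hankelX w)" by (rule norm_triangle_ineq4)
      also have "\<dots> \<le> E + c * E"
      proof (intro add_mono)
        show "norm (besselI w) \<le> E" using norm_besselI_le[of w] w by (simp add: E_def)
        have "norm (hankelX w) \<le> c * (r / E)" using c(2)[OF w(1,2)] w(3) E
        by (cases "w = 0") (simp_all add: r_def)
        also have "r / E \<le> E / 1" using r E by (intro frac_le) auto
        hence "c * (r / E) \<le> c * E" using c by (intro mult_left_mono) auto
        finally show "norm (hankelX w) \<le> c * E" .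
      qed
      finally show ?thesis by (simp add: algebra_simps)
    qed
    have "norm (hankel_part j w) \<le> 2 ^ ?n * ((c + 1) ^ ?n * (r\<^sup>2 / E))"
    proof (rule norm_hankel_part_le[OF X Y])
      fix a assume a: "j + 1 \<le> a" "a \<le> ?n"
      define b where "b = ?n - a"
      have ab: "a = b + (a - b)" "a - b \<ge> 1" "a \<ge> 2" "a + b = ?n" using a j by (auto simp: b_def)
      have "((c + 1) * (r / E)) ^ a * ((c + 1) * E) ^ b = (c + 1) ^ (a + b) * (r ^ a * (E ^ b / E ^ a))"
        by (simp add: power_mult_distrib power_add power_divide)
      also have "E ^ b / E ^ a = 1 / E ^ (a - b)" using E ab(1) by (metis (no_types) divide_divide_eq_left div_self power_add power_not_zero zero_neq_one not_one_le_zero)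
      also have "(c + 1) ^ (a + b) * (r ^ a * (1 / E ^ (a - b))) \<le> (c + 1) ^ (a + b) * (r\<^sup>2 * (1 / E))"
      proof (intro mult_left_mono mult_mono)
        show "r ^ a \<le> r\<^sup>2" using r ab by (intro power_decreasing) auto
        have "E ^ 1 \<le> E ^ (a - b)" using E ab by (intro power_increasing) auto
        thus "1 / E ^ (a - b) \<le> 1 / E" using E by (intro divide_left_mono) auto
      qed (use r E c in auto)
      finally show "((c + 1) * (r / E)) ^ a * ((c + 1) * E) ^ (?n - a) \<le> (c + 1) ^ ?n * (r\<^sup>2 / E)"
        using ab by (simp add: b_def)
    qed
    thus "norm (hankel_part j w) \<le> 2 ^ ?n * (c + 1) ^ ?n * exp (- Re w) * norm w powr (- 1)"
      unfolding E(2) r2[symmetric] by (simp add: mult_ac)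
  qed (use c in auto)
qed

text \<open>Only powers of the logarithm occur at 0.\<close>
lemma hankel_part_zero_bound:
  assumes d: "\<delta> > 0"
  obtains C where "C \<ge> 0" "\<And>w. Re w \<ge> 0 \<Longrightarrow> Im w \<le> 0 \<Longrightarrow> w \<noteq> 0 \<Longrightarrow> norm w \<le> 1 \<Longrightarrow>
    norm (hankel_part j w) \<le> C * norm w powr (- \<delta>)"
proof -
  let ?n = "2 * j + 1"
  define e where "e = min (1/2) (\<delta> / real ?n)"
  have e: "0 < e" "e \<le> 1/2" "real ?n * e \<le> \<delta>"
  proof -
    show "0 < e" using d by (auto simp: e_def)
    show "e \<le> 1/2" unfolding e_def by (rule min.cobounded1)
    have "real ?n * e \<le> real ?n * (\<delta> / real ?n)" unfolding e_def by (intro mult_left_mono) auto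
    thus "real ?n * e \<le> \<delta>" by simp
  qed
  obtain c where c: "c \<ge> 0" "\<And>w. Re w \<ge> 0 \<Longrightarrow> Im w \<le> 0 \<Longrightarrow> w \<noteq> 0 \<Longrightarrow> norm (hankelX w) \<le> c * exp (- Re w) * norm w powr (- e)"
    using hankelX_bound[OF e(1,2)] by blast
  define M where "M = c + exp 1"
  have M0: "M \<ge> 0" using c by (simp add: M_def)
  show ?thesis
  proof (rule that[of "2 ^ ?n * M ^ ?n"])
    fix w assume w: "Re w \<ge> 0" "Im w \<le> 0" "w \<noteq> 0" "norm w \<le> 1"
    define q where "q = norm w powr (- e)"
    have q: "q \<ge> 1"
    proof -
      have "norm w powr e \<le> 1" using w e by (intro powr_le1) auto
      thus ?thesis using w by (simp add: q_def powr_minus one_le_inverse)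
    qed
    have Xc: "norm (hankelX w) \<le> c * q"
    proof -
      have "norm (hankelX w) \<le> c * exp (- Re w) * q" using c(2)[of w] w by (simp add: q_def)
      also have "\<dots> \<le> c * 1 * q" using w c q by (intro mult_right_mono mult_left_mono) auto
      finally show ?thesis by simp
    qed
    have X: "norm (hankelX w) \<le> M * q"
      using Xc q by (simp add: M_def distrib_right add_increasing2)
    have Y: "norm (besselI w - hankelX w) \<le> M * q"
    proof -
      have "Re w \<le> 1" using complex_Re_le_cmod[of w] w by linarith
      hence "norm (besselI w) \<le> exp 1" using norm_besselI_le[of w] w by (smt (verit) exp_le_cancel_iff)
      also have "\<dots> \<le> exp 1 * q" using q by simp
      finally have "norm (besselI w) + norm (hankelX w) \<le> exp 1 * q + c * q" using Xc by linarith
      thus ?thesis using norm_triangle_ineq4[of "besselI w" "hankelX w"] by (simp add: M_def algebra_simps)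
    qed
    have "norm (hankel_part j w) \<le> 2 ^ ?n * (M ^ ?n * norm w powr (- \<delta>))"
    proof (rule norm_hankel_part_le[OF X Y])
      fix a assume a: "j + 1 \<le> a" "a \<le> ?n"
      have "(M * q) ^ a * (M * q) ^ (?n - a) = M ^ ?n * q ^ ?n"
        using a by (subst power_add[symmetric]) (simp add: power_mult_distrib)
      also have "q ^ ?n = norm w powr (- (real ?n * e))"
        using w unfolding q_def by (subst powr_power) (auto simp: mult_ac)
      also have "\<dots> \<le> norm w powr (- \<delta>)" using w e by (intro powr_mono') auto
      hence "M ^ ?n * norm w powr (- (real ?n * e)) \<le> M ^ ?n * norm w powr (- \<delta>)"
        using M0 by (intro mult_left_mono) auto
      finally show "(M * q) ^ a * (M * q) ^ (?n - a) \<le> M ^ ?n * norm w powr (- \<delta>)" .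
    qed
    thus "norm (hankel_part j w) \<le> 2 ^ ?n * M ^ ?n * norm w powr (- \<delta>)" by (simp add: mult_ac)
  qed (use M0 in auto)
qed

lemma hankel_part_holomorphic: "hankel_part j holomorphic_on {w. Re w > Im w}"
proof -
  have "besselK holomorphic_on {w. Re w > Im w}"
    using besselK_holomorphic by (rule holomorphic_on_subset) auto
  hence "hankelX holomorphic_on {w. Re w > Im w}"
    unfolding hankelX_def[abs_def] by (intro holomorphic_intros) auto
  thus ?thesis unfolding hankel_part_def[abs_def] by (intro holomorphic_intros besselI_holomorphic)
qed

lemma norm_powr_le:
  assumes "w \<noteq> 0"
  shows "norm (w powr z) \<le> exp (\<bar>Im z\<bar> * pi) * norm w powr Re z"
proof -
  have "norm (w powr z) = exp (Re z * ln (norm w) - Im z * Arg w)"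
    using assms by (simp add: powr_def norm_exp_eq_Re Arg_eq_Im_Ln)
  also have "- (Im z * Arg w) \<le> \<bar>Im z\<bar> * pi"
  proof -
    have "\<bar>Arg w\<bar> \<le> pi" using Arg_bounded[of w] by (auto simp: abs_le_iff)
    hence "\<bar>Im z\<bar> * \<bar>Arg w\<bar> \<le> \<bar>Im z\<bar> * pi" by (intro mult_left_mono) auto
    thus ?thesis by (metis abs_ge_minus_self abs_mult order_trans)
  qed
  hence "exp (Re z * ln (norm w) - Im z * Arg w) \<le> exp (Re z * ln (norm w) + \<bar>Im z\<bar> * pi)" by simp
  also have "\<dots> = exp (\<bar>Im z\<bar> * pi) * norm w powr Re z" using assms by (simp add: exp_add powr_def)
  finally show ?thesis .
qed

text \<open>In the fourth quadrant the surplus exponential decay of the kernel balances the growth of one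
  further factor \<open>besselI\<close>, and algebraic decay remains, so the negative imaginary
  ray can be rotated to the positive one. The phase is that of \<open>y powr (- s - 1)\<close>
  times the differential.\<close>
lemma mellin_hankel_rotation:
  assumes j: "j > 0" and e: "e \<le> (1::nat)" and s: "-1 < Re s" "Re s < 0"
  shows "mellin (\<lambda>y. hankel_part j (of_real y) * besselI (of_real y) ^ e) s =
    exp (\<i> * of_real (pi / 2) * s) * mellin (\<lambda>x. hankel_part j (- \<i> * of_real x) * besselJ x ^ e) s"
    and "set_integrable lborel {0<..} (\<lambda>x. hankel_part j (- \<i> * of_real x) * besselJ x ^ e * of_real x powr (- s - 1))"
proof -
  define f where "f w = hankel_part j w * besselI w ^ e * w powr (- s - 1)" for w
  obtain C1 where C1: "C1 \<ge> 0" "\<And>w. Re w \<ge> 0 \<Longrightarrow> Im w \<le> 0 \<Longrightarrow> norm w \<ge> 1 \<Longrightarrow>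
    norm (hankel_part j w) \<le> C1 * exp (- Re w) * norm w powr (- 1)" using hankel_part_infinity_bound[OF j] by blast
  define d where "d = - Re s / 2"
  have d: "d > 0" using s by (simp add: d_def)
  obtain C0 where C0: "C0 \<ge> 0" "\<And>w. Re w \<ge> 0 \<Longrightarrow> Im w \<le> 0 \<Longrightarrow> w \<noteq> 0 \<Longrightarrow> norm w \<le> 1 \<Longrightarrow>
    norm (hankel_part j w) \<le> C0 * norm w powr (- d)" using hankel_part_zero_bound[OF d] by blast
  define P where "P = exp (\<bar>Im s\<bar> * pi)"
  define C where "C = (C0 + C1) * exp 1 * P"
  have P: "P \<ge> 0" by (simp add: P_def)
  have pw: "norm (w powr (- s - 1)) \<le> P * norm w powr (- Re s - 1)" if "w \<noteq> 0" for w
    using norm_powr_le[OF that, of "- s - 1"] by (simp add: P_def)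
  have Ie: "norm (besselI w ^ e) \<le> exp (Re w)" if "Re w \<ge> 0" for w
  proof (cases "e = 0")
    case False
    hence "e = 1" using e by simp
    thus ?thesis using norm_besselI_le[of w] that by simp
  qed (use that in simp)
  have S: "convex {w. Re w > Im w}" "open {w. Re w > Im w}"
  proof -
    have eq: "{w. Re w > Im w} = {w. inner (Complex 1 (- 1)) w > 0}" by (auto simp: inner_complex_def)
    show "convex {w. Re w > Im w}" "open {w. Re w > Im w}"
      unfolding eq by (rule convex_halfspace_gt, rule open_halfspace_gt)
  qed
  have hol: "f holomorphic_on {w. Re w > Im w}"
    unfolding f_def by (intro holomorphic_intros hankel_part_holomorphic besselI_holomorphic) (auto simp: complex_nonpos_Reals_iff)
  have pt: "Re (of_real a + of_real b * (- \<i>)) = a" "Im (of_real a + of_real b * (- \<i>)) = - b" for a b :: real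
    by simp_all
  have bnd: "(norm (of_real a + of_real b * (- \<i>)) \<ge> 1 \<longrightarrow>
       norm (f (of_real a + of_real b * (- \<i>))) \<le> C * norm (of_real a + of_real b * (- \<i>)) powr (- (Re s + 2))) \<and>
     (a + b > 0 \<longrightarrow> norm (of_real a + of_real b * (- \<i>)) \<le> 1 \<longrightarrow>
       norm (f (of_real a + of_real b * (- \<i>))) \<le> C * norm (of_real a + of_real b * (- \<i>)) powr (- (Re s / 2 + 1)))"
    if ab: "a \<ge> 0" "b \<ge> 0" for a b :: real
  proof (intro conjI impI)
    let ?w = "of_real a + of_real b * (- \<i>) :: complex"
    have q: "Re ?w \<ge> 0" "Im ?w \<le> 0" using ab by simp_all
    show "norm (f ?w) \<le> C * norm ?w powr (- (Re s + 2))" if n: "norm ?w \<ge> 1"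
    proof -
      have w0: "?w \<noteq> 0" using n by (metis norm_zero not_one_le_zero)
      have "norm (f ?w) \<le> (C1 * exp (- Re ?w) * norm ?w powr (- 1)) * exp (Re ?w) * (P * norm ?w powr (- Re s - 1))"
        unfolding f_def norm_mult using C1(2)[OF q n] Ie[OF q(1)] pw[OF w0] C1(1)
        by (intro mult_mono) auto
      also have "\<dots> = C1 * P * (exp (- Re ?w) * exp (Re ?w)) * (norm ?w powr (- 1) * norm ?w powr (- Re s - 1))" by (simp only: mult_ac)
      also have "norm ?w powr (- 1) * norm ?w powr (- Re s - 1) = norm ?w powr (- (Re s + 2))"
        unfolding powr_add[symmetric] by (simp add: algebra_simps)
      also have "exp (- Re ?w) * exp (Re ?w) = 1" by (simp flip: exp_add)
      also have "C1 * P * 1 * norm ?w powr (- (Re s + 2)) \<le> C * norm ?w powr (- (Re s + 2))"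
      proof (rule mult_right_mono)
        have "C1 * P \<le> (C0 + C1) * exp 1 * P"
          using C0(1) C1(1) P by (intro mult_right_mono) (auto intro: order_trans[of _ "C0 + C1"] simp: mult_le_cancel_left1)
        thus "C1 * P * 1 \<le> C" by (simp add: C_def)
      qed simp
      finally show ?thesis .
    qed
    show "norm (f ?w) \<le> C * norm ?w powr (- (Re s / 2 + 1))" if "a + b > 0" and n: "norm ?w \<le> 1"
    proof -
      have w0: "?w \<noteq> 0" using that(1) ab by (auto simp: complex_eq_iff)
      have "Re ?w \<le> 1" using complex_Re_le_cmod[of ?w] n by linarith
      hence Ie1: "norm (besselI ?w ^ e) \<le> exp 1" using Ie[OF q(1)] by (smt (verit) exp_le_cancel_iff)
      have "norm (f ?w) \<le> (C0 * norm ?w powr (- d)) * exp 1 * (P * norm ?w powr (- Re s - 1))"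
        unfolding f_def norm_mult using C0(2)[OF q w0 n] Ie1 pw[OF w0] C0(1)
        by (intro mult_mono) auto
      also have "\<dots> = C0 * exp 1 * P * (norm ?w powr (- d) * norm ?w powr (- Re s - 1))" by (simp only: mult_ac)
      also have "norm ?w powr (- d) * norm ?w powr (- Re s - 1) = norm ?w powr (- (Re s / 2 + 1))"
        unfolding powr_add[symmetric] d_def by (rule arg_cong2[where f = "(powr)"]) (simp_all add: field_simps)
      also have "C0 * exp 1 * P * norm ?w powr (- (Re s / 2 + 1)) \<le> C * norm ?w powr (- (Re s / 2 + 1))"
        unfolding C_def using C0(1) C1(1) P by (intro mult_right_mono) auto
      finally show ?thesis .
    qed
  qed
  have rot: "set_integrable lborel {0<..} (\<lambda>x. f (- \<i> * of_real x)) \<and> (LINT x:{0<..}|lborel. f (of_real x)) = - \<i> * (LINT x:{0<..}|lborel. f (- \<i> * of_real x))"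
    using s bnd
    by (intro conjI ray_rotation(2,3)[OF S hol, where C = C and \<alpha> = "Re s + 2" and \<beta> = "Re s / 2 + 1"]) simp_all
  have fx: "f (- \<i> * of_real x) = (\<i> * exp (\<i> * of_real (pi / 2) * s)) * (hankel_part j (- \<i> * of_real x) * besselJ x ^ e * of_real x powr (- s - 1))"
    if x: "x > 0" for x
  proof -
    have "besselI (- \<i> * of_real x) = besselJ x" using besselI_even[of "\<i> * of_real x"] by (simp add: besselJ_def)
    moreover have "(- \<i> * of_real x) powr (- s - 1) = (\<i> * exp (\<i> * of_real (pi / 2) * s)) * of_real x powr (- s - 1)"
    proof -
      have "Ln (- \<i> * of_real x) = of_real (ln x) - \<i> * of_real (pi / 2)"
        using Ln_times_of_real[OF x, of "- \<i>"] x by (simp add: mult.commute Ln_of_real)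
      hence "(- \<i> * of_real x) powr (- s - 1) = exp ((- s - 1) * (of_real (ln x) - \<i> * of_real (pi / 2)))"
        using x by (simp add: powr_def)
      also have "(- s - 1) * (of_real (ln x) - \<i> * of_real (pi / 2)) = \<i> * of_real (pi / 2) + (\<i> * of_real (pi / 2) * s + (- s - 1) * of_real (ln x))"
        by (simp add: field_simps)
      also have "exp \<dots> = exp (\<i> * of_real (pi / 2)) * (exp (\<i> * of_real (pi / 2) * s) * exp ((- s - 1) * of_real (ln x)))"
        by (simp only: exp_add)
      also have "exp (\<i> * of_real (pi / 2)) = \<i>" by (simp only: cis_conv_exp[symmetric] cis_pi_half)
      also have "exp ((- s - 1) * of_real (ln x)) = of_real x powr (- s - 1)" using x by (simp add: powr_def Ln_of_real)
      finally show ?thesis by (simp only: mult.assoc)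
    qed
    ultimately show ?thesis unfolding f_def by (simp only: mult_ac)
  qed
  have "set_integrable lborel {0<..} (\<lambda>x. (\<i> * exp (\<i> * of_real (pi / 2) * s)) * (hankel_part j (- \<i> * of_real x) * besselJ x ^ e * of_real x powr (- s - 1)))"
    using rot fx by (subst set_integrable_cong[OF refl refl, symmetric, where f = "\<lambda>x. f (- \<i> * of_real x)"]) auto
  thus "set_integrable lborel {0<..} (\<lambda>x. hankel_part j (- \<i> * of_real x) * besselJ x ^ e * of_real x powr (- s - 1))"
    by (subst (asm) set_integrable_mult_right_iff) auto
  have "(LINT x:{0<..}|lborel. f (- \<i> * of_real x)) = (\<i> * exp (\<i> * of_real (pi / 2) * s)) * mellin (\<lambda>x. hankel_part j (- \<i> * of_real x) * besselJ x ^ e) s"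
    unfolding mellin_def set_integral_mult_right[symmetric]
    by (rule set_lebesgue_integral_cong) (use fx in auto)
  with rot show "mellin (\<lambda>y. hankel_part j (of_real y) * besselI (of_real y) ^ e) s =
    exp (\<i> * of_real (pi / 2) * s) * mellin (\<lambda>x. hankel_part j (- \<i> * of_real x) * besselJ x ^ e) s"
    unfolding mellin_def f_def
    by (simp only: mult.assoc[symmetric] mult_minus_left i_squared minus_minus) (simp add: mult_ac)
qed

lemma mellin_cnj: "mellin (\<lambda>y. cnj (f y)) s = cnj (mellin f (cnj s))"
proof -
  have "cnj (mellin f (cnj s)) = (LINT y|lborel. cnj (indicat_real {0<..} y *\<^sub>R (f y * of_real y powr (- cnj s - 1))))"
    unfolding mellin_def set_lebesgue_integral_def by (rule Bochner_Integration.integral_cnj[symmetric])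
  also have "\<dots> = (LINT y:{0<..}|lborel. cnj (f y * of_real y powr (- cnj s - 1)))"
    unfolding set_lebesgue_integral_def by (simp only: complex_cnj_scaleR)
  also have "\<dots> = mellin (\<lambda>y. cnj (f y)) s"
    unfolding mellin_def
  proof (rule set_lebesgue_integral_cong, simp, intro allI impI)
    fix y :: real assume "y \<in> {0<..}"
    hence "cnj (of_real y powr (- cnj s - 1)) = of_real y powr (- s - 1)"
      using cnj_powr[of "of_real y" "- cnj s - 1"] by (simp add: complex_nonpos_Reals_iff)
    thus "cnj (f y * of_real y powr (- cnj s - 1)) = cnj (f y) * of_real y powr (- s - 1)" by simp
  qed
  finally show ?thesis ..
qed

text \<open>Here \<open>e\<close> is 0 or 1, according to whether the power of the Bessel function is odd or
  even.\<close>
definition rotated_mellin :: "nat \<Rightarrow> nat \<Rightarrow> complex \<Rightarrow> complex" where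
  "rotated_mellin j e s =
     exp (- \<i> * of_real (pi / 2) * s) * mellin (\<lambda>y. hankel_part j (of_real y) * besselI (of_real y) ^ e) s +
     exp (\<i> * of_real (pi / 2) * s) * mellin (\<lambda>y. cnj (hankel_part j (of_real y)) * besselI (of_real y) ^ e) s"

lemma cnj_besselI_real: "cnj (besselI (of_real y)) = besselI (of_real y)"
  unfolding besselI_of_real by simp

text \<open>One half of the odd power is rotated to the positive axis directly and the other half by
  conjugation. After the rotation the oscillating Bessel factor has become a modified one with
  positive Taylor coefficients.\<close>
theorem mellin_besselJ_power_rotated:
  assumes j: "j > 0" and e: "e \<le> (1::nat)" and s: "-1 < Re s" "Re s < 0"
  shows "mellin (\<lambda>x. besselJ x ^ (2 * j + 1 + e)) s = rotated_mellin j e s"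
proof -
  let ?h = "\<lambda>x. hankel_part j (- \<i> * of_real x) * besselJ x ^ e"
  have s': "-1 < Re (cnj s)" "Re (cnj s) < 0" using s by auto
  have m1: "mellin ?h z = exp (- \<i> * of_real (pi / 2) * z) * mellin (\<lambda>y. hankel_part j (of_real y) * besselI (of_real y) ^ e) z"
    if z: "-1 < Re z" "Re z < 0" for z
  proof -
    have "exp (- \<i> * of_real (pi / 2) * z) * exp (\<i> * of_real (pi / 2) * z) = 1" by (simp flip: exp_add)
    thus ?thesis unfolding mellin_hankel_rotation(1)[OF j e z] by (simp flip: mult.assoc)
  qed
  have "mellin (\<lambda>x. cnj (?h x)) s = cnj (exp (- \<i> * of_real (pi / 2) * cnj s) * mellin (\<lambda>y. hankel_part j (of_real y) * besselI (of_real y) ^ e) (cnj s))"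
    unfolding mellin_cnj m1[OF s'] ..
  also have "\<dots> = exp (\<i> * of_real (pi / 2) * s) * mellin (\<lambda>y. cnj (hankel_part j (of_real y) * besselI (of_real y) ^ e)) s"
    unfolding mellin_cnj by (simp add: exp_cnj)
  also have "(\<lambda>y. cnj (hankel_part j (of_real y) * besselI (of_real y) ^ e)) = (\<lambda>y. cnj (hankel_part j (of_real y)) * besselI (of_real y) ^ e)"
    by (simp add: cnj_besselI_real)
  finally have m2: "mellin (\<lambda>x. cnj (?h x)) s = exp (\<i> * of_real (pi / 2) * s) * mellin (\<lambda>y. cnj (hankel_part j (of_real y)) * besselI (of_real y) ^ e) s" .
  have i1: "set_integrable lborel {0<..} (\<lambda>x. ?h x * of_real x powr (- s - 1))" by (rule mellin_hankel_rotation(2)[OF j e s])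
  have i2: "set_integrable lborel {0<..} (\<lambda>x. cnj (?h x) * of_real x powr (- s - 1))"
  proof -
    have "integrable lborel (\<lambda>x. cnj (indicator {0<..} x *\<^sub>R (?h x * of_real x powr (- cnj s - 1))))"
      using mellin_hankel_rotation(2)[OF j e s'] unfolding set_integrable_def by (simp only: complex_integrable_cnj)
    also have "(\<lambda>x. cnj (indicator {0<..} x *\<^sub>R (?h x * of_real x powr (- cnj s - 1)))) = (\<lambda>x. indicator {0<..} x *\<^sub>R (cnj (?h x) * of_real x powr (- s - 1)))"
    proof
      fix x :: real
      show "cnj (indicator {0<..} x *\<^sub>R (?h x * of_real x powr (- cnj s - 1))) = indicator {0<..} x *\<^sub>R (cnj (?h x) * of_real x powr (- s - 1))"
        using cnj_powr[of "of_real x" "- cnj s - 1"] by (auto simp: indicator_def complex_nonpos_Reals_iff)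
    qed
    finally show ?thesis unfolding set_integrable_def .
  qed
  have "mellin (\<lambda>x. besselJ x ^ (2 * j + 1 + e)) s = (LINT x:{0<..}|lborel. ?h x * of_real x powr (- s - 1) + cnj (?h x) * of_real x powr (- s - 1))"
    unfolding mellin_def
  proof (rule set_lebesgue_integral_cong, simp, intro allI impI)
    fix x :: real assume "x \<in> {0<..}"
    hence x: "x > 0" by simp
    show "besselJ x ^ (2 * j + 1 + e) * of_real x powr (- s - 1) = ?h x * of_real x powr (- s - 1) + cnj (?h x) * of_real x powr (- s - 1)"
      unfolding power_add[of _ "2 * j + 1"] besselJ_power_split[OF x] by (simp add: cnj_besselJ[OF x] algebra_simps)
  qed
  also have "\<dots> = mellin ?h s + mellin (\<lambda>x. cnj (?h x)) s" unfolding mellin_def by (rule set_integral_add(2)[OF i1 i2])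
  finally show ?thesis unfolding m1[OF s] m2 rotated_mellin_def .
qed

section \<open>Growth of the rotated integrands\<close>

lemma mellin_holomorphic_on_strip:
  assumes T: "open T" and c: "\<And>\<sigma>. \<sigma> \<in> T \<Longrightarrow> mellin_conv f \<sigma>"
  shows "mellin f holomorphic_on {s. Re s \<in> T}"
proof -
  have "mellin f analytic_on {s}" if s: "Re s \<in> T" for s
  proof -
    obtain d where d: "d > 0" "cball (Re s) d \<subseteq> T" using T s open_contains_cball by blast
    have "Re s - d \<in> cball (Re s) d" "Re s + d \<in> cball (Re s) d" using d(1) by (auto simp: dist_real_def)
    hence "mellin f holomorphic_on {z. Re s - d < Re z \<and> Re z < Re s + d}"
      using d(2) by (intro mellin_holomorphic c) auto
    moreover have "open {z. Re s - d < Re z \<and> Re z < Re s + d}"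
      by (intro open_Collect_conj open_halfspace_Re_gt open_halfspace_Re_lt)
    ultimately show ?thesis using d(1) unfolding analytic_at by force
  qed
  hence "mellin f analytic_on {s. Re s \<in> T}" by (subst analytic_on_analytic_at) blast
  thus ?thesis by (rule analytic_imp_holomorphic)
qed

lemma exp_minus_le_powr:
  obtains C where "C \<ge> 0" "\<And>y::real. y \<ge> 1 \<Longrightarrow> exp (- y) \<le> C * y powr q"
proof -
  obtain m :: nat where m: "- q \<le> real m" using real_arch_simple by blast
  show ?thesis
  proof (rule that[of "fact m"])
    fix y :: real assume y: "y \<ge> 1"
    have "(\<Sum>k\<in>{m}. y ^ k /\<^sub>R fact k) \<le> exp y"
      unfolding sums_unique[OF exp_converges[of y]]
      by (rule sum_le_suminf[OF sums_summable[OF exp_converges[of y]]]) (use y in auto)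
    hence "y ^ m / fact m \<le> exp y" by (simp add: divide_inverse_commute)
    hence "y ^ m \<le> fact m * exp y" by (simp add: field_simps)
    hence "exp (- y) \<le> fact m / y ^ m" using y by (simp add: exp_minus field_simps)
    also have "\<dots> = fact m * y powr (- real m)" using y by (simp add: powr_minus powr_realpow divide_inverse)
    also have "\<dots> \<le> fact m * y powr q" using y m by (intro mult_left_mono powr_mono) auto
    finally show "exp (- y) \<le> fact m * y powr q" .
  qed simp
qed

lemma continuous_hankel_part_real: "continuous_on {0<..} (\<lambda>y. hankel_part j (complex_of_real y))"
  by (rule continuous_on_compose2[OF holomorphic_on_imp_continuous_on[OF hankel_part_holomorphic]])
     (auto intro!: continuous_intros)

lemma continuous_hankelX_real: "continuous_on {0<..} (\<lambda>y. hankelX (complex_of_real y))"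
proof -
  have "continuous_on {0<..} (\<lambda>y. besselK (complex_of_real y))"
    by (rule continuous_on_compose2[OF holomorphic_on_imp_continuous_on[OF besselK_holomorphic]])
       (auto intro!: continuous_intros)
  thus ?thesis unfolding hankelX_def by (intro continuous_intros) auto
qed

text \<open>The constant is common to the three estimates so that products of powers can be bounded
  uniformly.\<close>
lemma bessel_real_axis_bounds:
  obtains M where "M \<ge> 1"
    "\<And>y. y > 0 \<Longrightarrow> norm (hankelX (of_real y)) \<le> M * (y powr (- (1/2)) / exp y)"
    "\<And>y. y > 0 \<Longrightarrow> norm (besselI (of_real y)) \<le> M * (y powr (- (1/2)) * exp y)"
    "\<And>y. y > 0 \<Longrightarrow> norm (besselI (of_real y) - hankelX (of_real y)) \<le> M * (y powr (- (1/2)) * exp y)"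
proof -
  obtain c where c: "c \<ge> 0" "\<And>w. Re w \<ge> 0 \<Longrightarrow> Im w \<le> 0 \<Longrightarrow> w \<noteq> 0 \<Longrightarrow> norm (hankelX w) \<le> c * exp (- Re w) * norm w powr (- (1/2))"
    using hankelX_bound[of "1/2"] by auto
  define g where "g = 2 * gauss_moment (1/2)"
  have g: "g \<ge> 0" using gauss_moment_nonneg by (simp add: g_def)
  have X: "norm (hankelX (of_real y)) \<le> c * (y powr (- (1/2)) / exp y)" if "y > 0" for y
    using c(2)[of "of_real y"] that by (simp add: exp_minus field_simps)
  have I: "norm (besselI (of_real y)) \<le> g * (y powr (- (1/2)) * exp y)" if "y > 0" for y
    using norm_besselI_of_real_le[OF that] by (simp add: g_def mult_ac)
  show ?thesis
  proof (rule that[of "c + g + 1"])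
    fix y :: real assume y: "y > 0"
    let ?r = "y powr (- (1/2))"
    have "?r / exp y \<le> ?r / 1" using y by (intro divide_left_mono) auto
    also have "\<dots> \<le> ?r * exp y" using y by simp
    finally have le: "?r / exp y \<le> ?r * exp y" .
    have "c * (?r / exp y) \<le> (c + g + 1) * (?r / exp y)" using g by (intro mult_right_mono) auto
    thus "norm (hankelX (of_real y)) \<le> (c + g + 1) * (?r / exp y)" using X[OF y] by linarith
    have "g * (?r * exp y) \<le> (c + g + 1) * (?r * exp y)" using c by (intro mult_right_mono) auto
    thus "norm (besselI (of_real y)) \<le> (c + g + 1) * (?r * exp y)" using I[OF y] by linarith
    have "norm (besselI (of_real y) - hankelX (of_real y)) \<le> g * (?r * exp y) + c * (?r / exp y)"
      using norm_triangle_ineq4[of "besselI (of_real y)" "hankelX (of_real y)"] X[OF y] I[OF y] by linarith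
    also have "\<dots> \<le> g * (?r * exp y) + c * (?r * exp y)" using le c by (intro add_left_mono mult_left_mono) auto
    also have "\<dots> \<le> (c + g + 1) * (?r * exp y)" by (simp add: algebra_simps)
    finally show "norm (besselI (of_real y) - hankelX (of_real y)) \<le> (c + g + 1) * (?r * exp y)" .
  qed (use c g in auto)
qed

text \<open>Of the \<open>2j + 1\<close> factors more decay than grow. Multiplication with one further
  growing factor can cancel the exponential, but the \<open>2j + 2\<close> square roots remain.\<close>
lemma hankel_part_real_decay:
  assumes j: "j > 0"
  obtains C where "C \<ge> 0" "\<And>y. y \<ge> 1 \<Longrightarrow> norm (hankel_part j (of_real y)) \<le> C * exp (- y)"
    "\<And>y. y \<ge> 1 \<Longrightarrow> norm (hankel_part j (of_real y) * besselI (of_real y)) \<le> C * y powr (- real (j + 1))"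
proof -
  obtain M where M: "M \<ge> 1"
    "\<And>y. y > 0 \<Longrightarrow> norm (hankelX (of_real y)) \<le> M * (y powr (- (1/2)) / exp y)"
    "\<And>y. y > 0 \<Longrightarrow> norm (besselI (of_real y)) \<le> M * (y powr (- (1/2)) * exp y)"
    "\<And>y. y > 0 \<Longrightarrow> norm (besselI (of_real y) - hankelX (of_real y)) \<le> M * (y powr (- (1/2)) * exp y)"
    using bessel_real_axis_bounds by metis
  let ?n = "2 * j + 1"
  define C where "C = 2 ^ ?n * M ^ (?n + 1)"
  have h: "norm (hankel_part j (of_real y)) \<le> 2 ^ ?n * (M ^ ?n * ((y powr (- (1/2))) ^ ?n * exp (- y)))" if y: "y \<ge> 1" for y
  proof (rule norm_hankel_part_le[OF M(2) M(4)])
    fix a assume a: "j + 1 \<le> a" "a \<le> ?n"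
    define b where "b = ?n - a"
    define r where "r = y powr (- (1/2))"
    define E where "E = exp y"
    have r: "r \<ge> 0" by (simp add: r_def)
    have E: "E \<ge> 1" "exp (- y) = 1 / E" using y by (auto simp: E_def exp_minus divide_inverse)
    have ab: "a = b + (a - b)" "a - b \<ge> 1" "a + b = ?n" using a j by (auto simp: b_def)
    have "(M * (r / E)) ^ a * (M * (r * E)) ^ b = M ^ (a + b) * (r ^ (a + b) * (E ^ b / E ^ a))"
      by (simp add: power_mult_distrib power_add power_divide)
    also have "E ^ b / E ^ a = 1 / E ^ (a - b)" using E ab(1) by (metis (no_types) divide_divide_eq_left div_self power_add power_not_zero zero_neq_one not_one_le_zero)
    also have "M ^ (a + b) * (r ^ (a + b) * (1 / E ^ (a - b))) \<le> M ^ (a + b) * (r ^ (a + b) * (1 / E))"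
    proof (intro mult_left_mono)
      have "E ^ 1 \<le> E ^ (a - b)" using E ab by (intro power_increasing) auto
      thus "1 / E ^ (a - b) \<le> 1 / E" using E by (intro divide_left_mono) auto
    qed (use r M in auto)
    finally show "(M * (y powr (- (1/2)) / exp y)) ^ a * (M * (y powr (- (1/2)) * exp y)) ^ (?n - a) \<le>
        M ^ ?n * ((y powr (- (1/2))) ^ ?n * exp (- y))"
      using ab E by (simp add: b_def r_def E_def)
  qed (use y in auto)
  show ?thesis
  proof (rule that[of C])
    show "C \<ge> 0" using M by (simp add: C_def)
    fix y :: real assume y: "y \<ge> 1"
    define r where "r = y powr (- (1/2))"
    have r: "0 \<le> r" "r \<le> 1" using y ge_one_powr_ge_zero[of y "1/2"] by (auto simp: r_def powr_minus inverse_le_1_iff)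
    have "norm (hankel_part j (of_real y)) \<le> 2 ^ ?n * (M ^ ?n * (r ^ ?n * exp (- y)))" using h[OF y] by (simp only: r_def)
    also have "\<dots> \<le> 2 ^ ?n * (M ^ (?n + 1) * (1 * exp (- y)))"
      using M r by (intro mult_left_mono mult_mono power_increasing power_le_one) auto
    finally show "norm (hankel_part j (of_real y)) \<le> C * exp (- y)" by (simp add: C_def mult_ac)
    have "norm (hankel_part j (of_real y) * besselI (of_real y)) \<le> (2 ^ ?n * (M ^ ?n * (r ^ ?n * exp (- y)))) * (M * (r * exp y))"
      unfolding norm_mult using h[OF y] M(3)[of y] y M(1) by (intro mult_mono) (auto simp: r_def)
    also have "\<dots> = 2 ^ ?n * (M ^ ?n * M) * (r ^ ?n * r) * (exp (- y) * exp y)" by (simp only: mult_ac)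
    also have "M ^ ?n * M = M ^ (?n + 1)" by simp
    also have "exp (- y) * exp y = 1" by (simp flip: exp_add)
    also have "r ^ ?n * r = y powr (- real (j + 1))"
    proof -
      have "r ^ ?n * r = r ^ (2 * (j + 1))" by simp
      also have "\<dots> = y powr (- (1/2) * real (2 * (j + 1)))" using y by (simp only: r_def powr_power) (simp add: powr_power mult_ac)
      also have "- (1/2) * real (2 * (j + 1)) = - real (j + 1)" by (simp add: field_simps)
      finally show ?thesis .
    qed
    finally show "norm (hankel_part j (of_real y) * besselI (of_real y)) \<le> C * y powr (- real (j + 1))" by (simp add: C_def)
  qed
qed

text \<open>The term of \<open>hankel_part\<close> with the least exponential decay, with \<open>I -
  X\<close> replaced by \<open>I\<close>. After multiplication by \<open>I\<close> it becomes a
  power of the product of both Bessel functions, which has an asymptotic expansion.\<close>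
definition hankel_lead :: "nat \<Rightarrow> complex \<Rightarrow> complex" where
  "hankel_lead j w = of_nat ((2 * j + 1) choose (j + 1)) * hankelX w ^ (j + 1) * besselI w ^ j"

text \<open>Replacing \<open>I - X\<close> by \<open>I\<close> costs a factor \<open>X / I\<close>, and
  every other term of the sum has a decaying factor \<open>X\<close> in place of a growing one
  of the leading term. Either way exponential decay survives the multiplication by
  \<open>I\<close>.\<close>
lemma hankel_remainder_decay:
  assumes j: "j > 0"
  obtains C where "C \<ge> 0"
    "\<And>y. y \<ge> 1 \<Longrightarrow> norm ((hankel_part j (of_real y) - hankel_lead j (of_real y)) * besselI (of_real y)) \<le> C * exp (- y)"
proof -
  obtain M where M: "M \<ge> 1"
    "\<And>y. y > 0 \<Longrightarrow> norm (hankelX (of_real y)) \<le> M * (y powr (- (1/2)) / exp y)"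
    "\<And>y. y > 0 \<Longrightarrow> norm (besselI (of_real y)) \<le> M * (y powr (- (1/2)) * exp y)"
    "\<And>y. y > 0 \<Longrightarrow> norm (besselI (of_real y) - hankelX (of_real y)) \<le> M * (y powr (- (1/2)) * exp y)"
    using bessel_real_axis_bounds by metis
  let ?n = "2 * j + 1"
  define S where "S = (\<Sum>a = j + 2..?n. real (?n choose a))"
  define C0 where "C0 = real (?n choose (j + 1)) * real j"
  show ?thesis
  proof (rule that[of "(C0 + S) * M ^ (?n + 1)"])
    show "(C0 + S) * M ^ (?n + 1) \<ge> 0" using M by (simp add: C0_def S_def sum_nonneg)
    fix y :: real assume y: "y \<ge> 1"
    define X where "X = hankelX (of_real y)"
    define I where "I = besselI (of_real y)"
    define E where "E = exp y"
    have E: "E \<ge> 1" "exp (- y) = 1 / E" using y by (auto simp: E_def exp_minus divide_inverse)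
    have r: "0 \<le> y powr (- (1/2))" "y powr (- (1/2)) \<le> 1"
      using y ge_one_powr_ge_zero[of y "1/2"] by (auto simp: powr_minus inverse_le_1_iff)
    have nX: "norm X \<le> M / E"
    proof -
      have "norm X \<le> M * (y powr (- (1/2)) / E)" using M(2)[of y] y by (simp add: X_def E_def)
      also have "\<dots> \<le> M * (1 / E)" using r E M by (intro mult_left_mono divide_right_mono) auto
      finally show ?thesis by simp
    qed
    have nI: "norm I \<le> M * E"
    proof -
      have "norm I \<le> M * (y powr (- (1/2)) * E)" using M(3)[of y] y by (simp add: I_def E_def)
      also have "\<dots> \<le> M * (1 * E)" using r E M by (intro mult_left_mono mult_right_mono) auto
      finally show ?thesis by simp
    qed
    have nY: "norm (I - X) \<le> M * E"
    proof -
      have "norm (I - X) \<le> M * (y powr (- (1/2)) * E)" using M(4)[of y] y by (simp add: I_def X_def E_def)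
      also have "\<dots> \<le> M * (1 * E)" using r E M by (intro mult_left_mono mult_right_mono) auto
      finally show ?thesis by simp
    qed
    let ?t = "\<lambda>a. of_nat (?n choose a) * X ^ a * (I - X) ^ (?n - a)"
    have "hankel_part j (of_real y) = ?t (j + 1) + (\<Sum>a = j + 2..?n. ?t a)"
      unfolding hankel_part_def X_def[symmetric] I_def[symmetric] using j
      by (subst sum.atLeast_Suc_atMost) auto
    also have "?n - (j + 1) = j" by simp
    finally have split: "hankel_part j (of_real y) - hankel_lead j (of_real y) =
       of_nat (?n choose (j + 1)) * X ^ (j + 1) * ((I - X) ^ j - I ^ j) + (\<Sum>a = j + 2..?n. ?t a)"
      unfolding hankel_lead_def X_def[symmetric] I_def[symmetric] by (simp add: algebra_simps)
    have pow: "norm ((I - X) ^ j - I ^ j) \<le> real j * (M / E) * (M * E) ^ (j - 1)"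
    proof -
      have eq: "(I - X) ^ j - I ^ j = - X * (\<Sum>i<j. I ^ (j - Suc i) * (I - X) ^ i)"
        using power_diff_sumr2[of "I - X" j I] by simp
      have "norm (\<Sum>i<j. I ^ (j - Suc i) * (I - X) ^ i) \<le> (\<Sum>i<j. (M * E) ^ (j - 1))"
      proof (rule sum_norm_le)
        fix i assume "i \<in> {..<j}"
        hence ij: "(j - Suc i) + i = j - 1" by simp
        have "norm (I ^ (j - Suc i) * (I - X) ^ i) \<le> (M * E) ^ (j - Suc i) * (M * E) ^ i"
          unfolding norm_mult norm_power using nI nY M E by (intro mult_mono power_mono) auto
        also have "\<dots> = (M * E) ^ (j - 1)" unfolding power_add[symmetric] ij ..
        finally show "norm (I ^ (j - Suc i) * (I - X) ^ i) \<le> (M * E) ^ (j - 1)" .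
      qed
      hence "norm (\<Sum>i<j. I ^ (j - Suc i) * (I - X) ^ i) \<le> real j * (M * E) ^ (j - 1)" by simp
      hence "norm (- X) * norm (\<Sum>i<j. I ^ (j - Suc i) * (I - X) ^ i) \<le> (M / E) * (real j * (M * E) ^ (j - 1))"
        using nX M E by (intro mult_mono) auto
      thus ?thesis unfolding eq norm_mult by (simp add: mult_ac)
    qed
    have E0: "E \<noteq> 0" "E > 0" "M > 0" using E M by auto
    have first: "norm (of_nat (?n choose (j + 1)) * X ^ (j + 1) * ((I - X) ^ j - I ^ j)) \<le> C0 * (M ^ ?n / E ^ 3)"
    proof -
      have "norm (of_nat (?n choose (j + 1)) * X ^ (j + 1) * ((I - X) ^ j - I ^ j)) \<le>
         real (?n choose (j + 1)) * (M / E) ^ (j + 1) * (real j * (M / E) * (M * E) ^ (j - 1))"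
        unfolding norm_mult norm_power norm_of_nat using nX pow M E by (intro mult_mono power_mono) auto
      also have "\<dots> = C0 * ((M / E) ^ (j + 2) * (M * E) ^ (j - 1))" by (simp add: C0_def mult_ac)
      also have "(M / E) ^ (j + 2) * (M * E) ^ (j - 1) = M ^ ?n / E ^ 3"
      proof -
        obtain i where i: "j = Suc i" using j by (cases j) auto
        have "(M / E) ^ (i + 3) * (M * E) ^ i = M ^ (2 * i + 3) * (E ^ i / E ^ (i + 3))"
        proof -
          have e: "2 * i + 3 = (i + 3) + i" by simp
          show ?thesis unfolding e power_add[of M "i + 3" i] power_mult_distrib power_divide by simp
        qed
        also have "E ^ i / E ^ (i + 3) = 1 / E ^ 3" using E0 by (simp add: power_add)
        finally show ?thesis unfolding i by (simp add: eval_nat_numeral)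
      qed
      finally show ?thesis .
    qed
    have "norm (\<Sum>a = j + 2..?n. ?t a) \<le> (\<Sum>a = j + 2..?n. real (?n choose a) * (M ^ ?n / E ^ 3))"
    proof (rule sum_norm_le)
      fix a assume a: "a \<in> {j + 2..?n}"
      define b where "b = ?n - a"
      have ab: "a = b + (a - b)" "a - b \<ge> 3" "a + b = ?n" using a by (auto simp: b_def)
      have "norm (?t a) \<le> real (?n choose a) * (M / E) ^ a * (M * E) ^ b"
        unfolding norm_mult norm_power norm_of_nat b_def using nX nY M E by (intro mult_mono power_mono) auto
      also have "\<dots> = real (?n choose a) * (M ^ (a + b) * (E ^ b / E ^ a))"
        by (simp add: power_mult_distrib power_add power_divide)
      also have "E ^ b / E ^ a = 1 / E ^ (a - b)" using E ab(1) by (metis (no_types) divide_divide_eq_left div_self power_add power_not_zero zero_neq_one not_one_le_zero)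
      also have "real (?n choose a) * (M ^ (a + b) * (1 / E ^ (a - b))) \<le> real (?n choose a) * (M ^ (a + b) * (1 / E ^ 3))"
      proof (intro mult_left_mono)
        have "E ^ 3 \<le> E ^ (a - b)" using E ab by (intro power_increasing) auto
        thus "1 / E ^ (a - b) \<le> 1 / E ^ 3" using E0 by (intro divide_left_mono) auto
      qed (use M in auto)
      finally show "norm (?t a) \<le> real (?n choose a) * (M ^ ?n / E ^ 3)" using ab by simp
    qed
    also have "\<dots> = S * (M ^ ?n / E ^ 3)" unfolding S_def sum_distrib_right ..
    finally have second: "norm (\<Sum>a = j + 2..?n. ?t a) \<le> S * (M ^ ?n / E ^ 3)" .
    have "norm (hankel_part j (of_real y) - hankel_lead j (of_real y)) \<le> (C0 + S) * (M ^ ?n / E ^ 3)"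
      unfolding split distrib_right by (rule order_trans[OF norm_triangle_ineq add_mono[OF first second]])
    hence "norm ((hankel_part j (of_real y) - hankel_lead j (of_real y)) * I) \<le> ((C0 + S) * (M ^ ?n / E ^ 3)) * (M * E)"
      unfolding norm_mult using nI M E by (intro mult_mono) (auto intro: order_trans[OF norm_ge_zero])
    also have "\<dots> = (C0 + S) * M ^ (?n + 1) * (1 / E\<^sup>2)" using E0 by (simp add: field_simps eval_nat_numeral)
    also have "\<dots> \<le> (C0 + S) * M ^ (?n + 1) * (1 / E)"
    proof (rule mult_left_mono)
      have "E ^ 1 \<le> E\<^sup>2" using E by (intro power_increasing) auto
      thus "1 / E\<^sup>2 \<le> 1 / E" using E0 by (intro divide_left_mono) auto
      show "0 \<le> (C0 + S) * M ^ (?n + 1)" using M by (simp add: C0_def S_def sum_nonneg)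
    qed
    finally show "norm ((hankel_part j (of_real y) - hankel_lead j (of_real y)) * besselI (of_real y)) \<le> (C0 + S) * M ^ (?n + 1) * exp (- y)"
      using E by (simp add: I_def)
  qed
qed

lemma hankel_lead_zero_bound:
  assumes d: "\<delta> > 0"
  obtains C where "C \<ge> 0" "\<And>y. 0 < y \<Longrightarrow> y \<le> 1 \<Longrightarrow> norm (hankel_lead j (of_real y)) \<le> C * y powr (- \<delta>)"
proof -
  define e where "e = min (1/2) (\<delta> / real (j + 1))"
  have e: "0 < e" "e \<le> 1/2" "real (j + 1) * e \<le> \<delta>"
  proof -
    show "0 < e" using d by (auto simp: e_def)
    show "e \<le> 1/2" unfolding e_def by (rule min.cobounded1)
    have "real (j + 1) * e \<le> real (j + 1) * (\<delta> / real (j + 1))" unfolding e_def by (intro mult_left_mono) auto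
    thus "real (j + 1) * e \<le> \<delta>" by simp
  qed
  obtain c where c: "c \<ge> 0" "\<And>w. Re w \<ge> 0 \<Longrightarrow> Im w \<le> 0 \<Longrightarrow> w \<noteq> 0 \<Longrightarrow> norm (hankelX w) \<le> c * exp (- Re w) * norm w powr (- e)"
    using hankelX_bound[OF e(1,2)] by blast
  let ?B = "real ((2 * j + 1) choose (j + 1))"
  show ?thesis
  proof (rule that[of "?B * c ^ (j + 1) * exp 1 ^ j"])
    fix y :: real assume y: "0 < y" "y \<le> 1"
    have X: "norm (hankelX (of_real y)) \<le> c * y powr (- e)"
    proof -
      have "norm (hankelX (of_real y)) \<le> c * exp (- y) * y powr (- e)" using c(2)[of "of_real y"] y by simp
      also have "\<dots> \<le> c * 1 * y powr (- e)" using y c by (intro mult_right_mono mult_left_mono) auto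
      finally show ?thesis by simp
    qed
    have I: "norm (besselI (of_real y)) \<le> exp 1"
      using norm_besselI_le[of "of_real y"] y by (auto intro: order_trans)
    have "norm (hankel_lead j (of_real y)) \<le> ?B * (c * y powr (- e)) ^ (j + 1) * exp 1 ^ j"
      unfolding hankel_lead_def norm_mult norm_power norm_of_nat using X I c by (intro mult_mono power_mono) auto
    also have "(c * y powr (- e)) ^ (j + 1) = c ^ (j + 1) * y powr (- (real (j + 1) * e))"
      unfolding power_mult_distrib using y by (simp add: powr_power mult_ac del: power_Suc)
    also have "?B * (c ^ (j + 1) * y powr (- (real (j + 1) * e))) * exp 1 ^ j \<le> ?B * (c ^ (j + 1) * y powr (- \<delta>)) * exp 1 ^ j"
      using y e c by (intro mult_right_mono mult_left_mono powr_mono') auto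
    finally show "norm (hankel_lead j (of_real y)) \<le> ?B * c ^ (j + 1) * exp 1 ^ j * y powr (- \<delta>)" by (simp add: mult_ac)
  qed (use c in auto)
qed

text \<open>A real function, because its terms are nonnegative on the positive axis; that is what allows
  domination of the partial sums by the limit.\<close>
definition besselI_tail :: "nat \<Rightarrow> real \<Rightarrow> real" where
  "besselI_tail L y = Re (besselI (of_real y)) - (\<Sum>m<L. (y / 2) ^ (2 * m) / (fact m)\<^sup>2)"

lemma besselI_tail_sums:
  "(\<lambda>m. (y / 2) ^ (2 * (m + L)) / (fact (m + L))\<^sup>2) sums besselI_tail L y"
proof -
  have "(\<lambda>m. complex_of_real ((y / 2) ^ (2 * m) / (fact m)\<^sup>2)) sums besselI (of_real y)"
    using besselI_sums[of "of_real y"] by simp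
  hence "(\<lambda>m. (y / 2) ^ (2 * m) / (fact m)\<^sup>2) sums Re (besselI (of_real y))"
    by (metis (no_types, lifting) Re_complex_of_real sums_Re sums_cong)
  from sums_split_initial_segment[OF this, of L] show ?thesis unfolding besselI_tail_def .
qed

lemma besselI_tail_0: "of_real (besselI_tail 0 y) = besselI (of_real y)"
  unfolding besselI_tail_def besselI_of_real by simp

lemma besselI_tail_bounds:
  assumes y: "y > 0"
  shows "besselI_tail L y \<ge> 0" "besselI_tail L y \<le> norm (besselI (of_real y))"
    and "y \<le> 1 \<Longrightarrow> besselI_tail L y \<le> besselI_tail L 1 * y powr (2 * real L)"
proof -
  show nn: "besselI_tail L y \<ge> 0"
    by (rule sums_le[OF _ sums_zero besselI_tail_sums]) (use y in simp)
  have "(\<Sum>m<L. (y / 2) ^ (2 * m) / (fact m)\<^sup>2) \<ge> 0" using y by (intro sum_nonneg) auto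
  thus "besselI_tail L y \<le> norm (besselI (of_real y))"
    unfolding besselI_tail_def using complex_Re_le_cmod[of "besselI (of_real y)"] by linarith
  assume y1: "y \<le> 1"
  show "besselI_tail L y \<le> besselI_tail L 1 * y powr (2 * real L)"
  proof (rule sums_le[OF _ besselI_tail_sums sums_mult2[OF besselI_tail_sums]])
    fix m
    have "y ^ (2 * (m + L)) \<le> y ^ (2 * L)" using y y1 by (intro power_decreasing) auto
    also have "y ^ (2 * L) = y powr (2 * real L)" using y powr_realpow[of y "2 * L"] by simp
    finally have "(1 / 2) ^ (2 * (m + L)) / (fact (m + L))\<^sup>2 * y ^ (2 * (m + L)) \<le> (1 / 2) ^ (2 * (m + L)) / (fact (m + L))\<^sup>2 * y powr (2 * real L)"
      by (intro mult_left_mono) auto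
    thus "(y / 2) ^ (2 * (m + L)) / (fact (m + L))\<^sup>2 \<le> (1 / 2) ^ (2 * (m + L)) / (fact (m + L))\<^sup>2 * y powr (2 * real L)"
      by (simp add: power_divide)
  qed
qed

lemma mellin_conv_cnj: "mellin_conv f \<sigma> \<Longrightarrow> mellin_conv (\<lambda>y. cnj (f y)) \<sigma>"
  unfolding mellin_conv_def set_borel_measurable_def
proof safe
  assume "(\<lambda>x. indicat_real {0<..} x *\<^sub>R f x) \<in> borel_measurable lborel"
  hence "(\<lambda>x. cnj (indicat_real {0<..} x *\<^sub>R f x)) \<in> borel_measurable lborel"
    by (rule measurable_compose[OF _ borel_measurable_continuous_onI[of cnj]]) (intro continuous_intros)
  thus "(\<lambda>x. indicat_real {0<..} x *\<^sub>R cnj (f x)) \<in> borel_measurable lborel" by simp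
qed simp

lemma continuous_besselI_tail: "continuous_on A (besselI_tail L)"
  unfolding besselI_tail_def[abs_def]
  by (intro continuous_intros continuous_on_besselI) auto

lemma mellin_conv_hankel_part:
  assumes j: "j > 0" and s: "\<sigma> < 0"
  shows "mellin_conv (\<lambda>y. hankel_part j (of_real y)) \<sigma>"
proof -
  obtain C0 where C0: "C0 \<ge> 0" "\<And>w. Re w \<ge> 0 \<Longrightarrow> Im w \<le> 0 \<Longrightarrow> w \<noteq> 0 \<Longrightarrow> norm w \<le> 1 \<Longrightarrow>
    norm (hankel_part j w) \<le> C0 * norm w powr (- (- \<sigma> / 2))" using hankel_part_zero_bound[of "- \<sigma> / 2"] s by auto
  obtain C where C: "C \<ge> 0" "\<And>y. y \<ge> 1 \<Longrightarrow> norm (hankel_part j (of_real y)) \<le> C * exp (- y)"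
    using hankel_part_real_decay[OF j] by metis
  obtain D where D: "D \<ge> 0" "\<And>y::real. y \<ge> 1 \<Longrightarrow> exp (- y) \<le> D * y powr (\<sigma> - 1)" using exp_minus_le_powr by blast
  show ?thesis
  proof (rule mellin_conv_bound[where C = C0 and C' = "C * D" and p = "\<sigma> / 2" and q = "\<sigma> - 1"])
    show "norm (hankel_part j (of_real y)) \<le> C * D * y powr (\<sigma> - 1)" if "y \<ge> 1" for y
      using C(2)[OF that] mult_left_mono[OF D(2)[OF that] C(1)] by (simp add: mult_ac)
    show "norm (hankel_part j (of_real y)) \<le> C0 * y powr (\<sigma> / 2)" if "0 < y" "y \<le> 1" for y
      using C0(2)[of "of_real y"] that by simp
  qed (use s in \<open>auto intro!: set_borel_measurable_cont continuous_hankel_part_real\<close>)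
qed

text \<open>Removing the first \<open>L\<close> Taylor terms gains a factor \<open>y^(2L)\<close> at 0 and
  so extends the convergence to the right; at infinity the tail is no larger than the whole
  function.\<close>
lemma mellin_conv_hankel_part_tail:
  assumes j: "j > 0" and s: "- (real j + 1) < \<sigma>" "\<sigma> < 2 * real L"
  shows "mellin_conv (\<lambda>y. hankel_part j (of_real y) * of_real (besselI_tail L y)) \<sigma>"
proof -
  define d where "d = (2 * real L - \<sigma>) / 2"
  have d: "d > 0" "2 * real L - d > \<sigma>" using s by (auto simp: d_def field_simps)
  obtain C0 where C0: "C0 \<ge> 0" "\<And>w. Re w \<ge> 0 \<Longrightarrow> Im w \<le> 0 \<Longrightarrow> w \<noteq> 0 \<Longrightarrow> norm w \<le> 1 \<Longrightarrow>
    norm (hankel_part j w) \<le> C0 * norm w powr (- d)" using hankel_part_zero_bound[OF d(1)] by blast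
  obtain C where C: "C \<ge> 0"  "\<And>y. y \<ge> 1 \<Longrightarrow> norm (hankel_part j (of_real y) * besselI (of_real y)) \<le> C * y powr (- real (j + 1))"
    using hankel_part_real_decay[OF j] by metis
  show ?thesis
  proof (rule mellin_conv_bound[where C = "C0 * besselI_tail L 1" and C' = C and p = "2 * real L - d" and q = "- real (j + 1)"])
    show "norm (hankel_part j (of_real y) * of_real (besselI_tail L y)) \<le> C * y powr (- real (j + 1))" if "y \<ge> 1" for y
    proof -
      have "norm (hankel_part j (of_real y) * of_real (besselI_tail L y)) \<le> norm (hankel_part j (of_real y)) * norm (besselI (of_real y))"
        unfolding norm_mult using besselI_tail_bounds(1,2)[of y L] that by (intro mult_left_mono) auto
      thus ?thesis using C(2)[OF that] by (simp add: norm_mult)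
    qed
    show "norm (hankel_part j (of_real y) * of_real (besselI_tail L y)) \<le> C0 * besselI_tail L 1 * y powr (2 * real L - d)" if "0 < y" "y \<le> 1" for y
    proof -
      have "norm (hankel_part j (of_real y) * of_real (besselI_tail L y)) \<le> (C0 * y powr (- d)) * (besselI_tail L 1 * y powr (2 * real L))"
        unfolding norm_mult using C0(1) C0(2)[of "of_real y"] besselI_tail_bounds(1,3)[of y L] that by (intro mult_mono) auto
      also have "\<dots> = C0 * besselI_tail L 1 * (y powr (2 * real L) * y powr (- d))" by (simp only: mult_ac)
      also have "y powr (2 * real L) * y powr (- d) = y powr (2 * real L - d)" unfolding powr_add[symmetric] by simp
      finally show ?thesis .
    qed
    show "set_borel_measurable lborel {0<..} (\<lambda>y. hankel_part j (of_real y) * of_real (besselI_tail L y))"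
      by (intro set_borel_measurable_cont continuous_intros continuous_hankel_part_real continuous_besselI_tail) auto
  qed (use s d in auto)
qed

lemma mellin_conv_hankel_remainder:
  assumes j: "j > 0" and s: "\<sigma> < 0"
  shows "mellin_conv (\<lambda>y. (hankel_part j (of_real y) - hankel_lead j (of_real y)) * besselI (of_real y)) \<sigma>"
proof -
  have d: "- \<sigma> / 2 > 0" using s by simp
  obtain C0 where C0: "C0 \<ge> 0" "\<And>w. Re w \<ge> 0 \<Longrightarrow> Im w \<le> 0 \<Longrightarrow> w \<noteq> 0 \<Longrightarrow> norm w \<le> 1 \<Longrightarrow>
    norm (hankel_part j w) \<le> C0 * norm w powr (- (- \<sigma> / 2))" using hankel_part_zero_bound[OF d] by blast
  obtain C1 where C1: "C1 \<ge> 0" "\<And>y. 0 < y \<Longrightarrow> y \<le> 1 \<Longrightarrow> norm (hankel_lead j (of_real y)) \<le> C1 * y powr (- (- \<sigma> / 2))"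
    using hankel_lead_zero_bound[OF d] by blast
  obtain C where C: "C \<ge> 0" "\<And>y. y \<ge> 1 \<Longrightarrow> norm ((hankel_part j (of_real y) - hankel_lead j (of_real y)) * besselI (of_real y)) \<le> C * exp (- y)"
    using hankel_remainder_decay[OF j] by blast
  obtain D where D: "D \<ge> 0" "\<And>y::real. y \<ge> 1 \<Longrightarrow> exp (- y) \<le> D * y powr (\<sigma> - 1)" using exp_minus_le_powr by blast
  show ?thesis
  proof (rule mellin_conv_bound[where C = "(C0 + C1) * exp 1" and C' = "C * D" and p = "\<sigma> / 2" and q = "\<sigma> - 1"])
    show "norm ((hankel_part j (of_real y) - hankel_lead j (of_real y)) * besselI (of_real y)) \<le> C * D * y powr (\<sigma> - 1)" if "y \<ge> 1" for y
      using C(2)[OF that] mult_left_mono[OF D(2)[OF that] C(1)] by (simp add: mult_ac)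
    show "norm ((hankel_part j (of_real y) - hankel_lead j (of_real y)) * besselI (of_real y)) \<le> (C0 + C1) * exp 1 * y powr (\<sigma> / 2)" if y: "0 < y" "y \<le> 1" for y
    proof -
      have "norm (hankel_part j (of_real y) - hankel_lead j (of_real y)) \<le> C0 * y powr (\<sigma> / 2) + C1 * y powr (\<sigma> / 2)"
        using C0(2)[of "of_real y"] C1(2)[OF y] y norm_triangle_ineq4[of "hankel_part j (of_real y)" "hankel_lead j (of_real y)"] by simp
      moreover have "norm (besselI (of_real y)) \<le> exp 1"
        using norm_besselI_le[of "of_real y"] y by (auto intro: order_trans)
      ultimately have "norm ((hankel_part j (of_real y) - hankel_lead j (of_real y)) * besselI (of_real y)) \<le> (C0 * y powr (\<sigma> / 2) + C1 * y powr (\<sigma> / 2)) * exp 1"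
        unfolding norm_mult by (intro mult_mono) (auto intro: order_trans[OF norm_ge_zero])
      thus ?thesis by (simp add: algebra_simps)
    qed
    have "continuous_on {0<..} (\<lambda>y. hankel_lead j (complex_of_real y))"
      unfolding hankel_lead_def by (intro continuous_intros continuous_hankelX_real continuous_on_besselI)
    thus "set_borel_measurable lborel {0<..} (\<lambda>y. (hankel_part j (of_real y) - hankel_lead j (of_real y)) * besselI (of_real y))"
      by (intro set_borel_measurable_cont continuous_intros continuous_hankel_part_real continuous_on_besselI) auto
  qed (use s in auto)
qed

section \<open>Continuation of the ramble integrals\<close>

lemma neg_even_iff: "1 + s / 2 \<in> \<int>\<^sub>\<le>\<^sub>0 \<longleftrightarrow> s \<in> neg_even"
proof
  assume "1 + s / 2 \<in> \<int>\<^sub>\<le>\<^sub>0"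
  then obtain n :: nat where n: "1 + s / 2 = - of_nat n" by (auto elim!: nonpos_Ints_cases')
  have "s = 2 * (1 + s / 2) - 2" by (simp add: field_simps)
  also have "\<dots> = - 2 * of_nat (Suc n)" unfolding n by simp
  finally have "s = - 2 * of_nat (Suc n)" .
  thus "s \<in> neg_even" unfolding neg_even_def by blast
next
  assume "s \<in> neg_even"
  then obtain k :: nat where k: "k > 0" "s = - 2 * of_nat k" by (auto simp: neg_even_def)
  then obtain n where n: "k = Suc n" by (cases k) auto
  have s: "s = 2 * (- of_nat n - 1)" unfolding k(2) n by (simp add: algebra_simps)
  have s2: "s / 2 = - of_nat n - 1" unfolding s by (rule nonzero_mult_div_cancel_left) simp
  have "1 + s / 2 = - of_nat n" unfolding s2 by simp
  thus "1 + s / 2 \<in> \<int>\<^sub>\<le>\<^sub>0" by simp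
qed

lemma neg_even_Re: "s \<in> neg_even \<Longrightarrow> Re s \<le> -2"
  by (auto simp: neg_even_def)

lemma eventually_notin_neg_even:
  assumes "z \<notin> neg_even"
  shows "eventually (\<lambda>w. w \<notin> neg_even) (nhds z)"
proof -
  have "neg_even \<subseteq> \<int>" by (auto simp: neg_even_def)
  hence "closed neg_even" by (rule closed_subset_Ints)
  thus ?thesis using eventually_nhds_in_open[of "- neg_even" z] assms by (auto simp: open_Compl)
qed

lemma analytic_Gamma_half: "s \<notin> neg_even \<Longrightarrow> (\<lambda>s. Gamma (1 + s / 2)) analytic_on {s}"
  by (rule analytic_on_compose_gen[of "\<lambda>s. 1 + s / 2" _ Gamma "- \<int>\<^sub>\<le>\<^sub>0", unfolded o_def])
     (auto intro!: analytic_intros analytic_Gamma simp: neg_even_iff)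

lemma mellin_factor_analytic:
  assumes "s \<notin> neg_even"
  shows "mellin_factor analytic_on {s}"
proof -
  have "(\<lambda>s. rGamma (1 - s / 2)) analytic_on {s}"
    by (rule analytic_on_compose[of "\<lambda>s. 1 - s / 2" _ rGamma, unfolded o_def]) (auto intro!: analytic_intros analytic_rGamma)
  moreover have "(\<lambda>s. 2 powr s :: complex) analytic_on {s}"
    unfolding powr_def by (auto intro!: analytic_intros)
  ultimately show ?thesis unfolding mellin_factor_def[abs_def]
    by (intro analytic_on_mult analytic_on_neg analytic_on_ident analytic_Gamma_half[OF assms])
qed

lemma mellin_factor_meromorphic: "mellin_factor meromorphic_on A"
proof -
  have r: "(\<lambda>s. rGamma (1 - s / 2)) meromorphic_on A" "(\<lambda>s. rGamma (1 + s / 2)) meromorphic_on A"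
    by (intro analytic_on_imp_meromorphic_on analytic_on_compose[of "\<lambda>s. 1 - s / 2" _ rGamma, unfolded o_def]
         analytic_on_compose[of "\<lambda>s. 1 + s / 2" _ rGamma, unfolded o_def] analytic_rGamma; auto intro!: analytic_intros)+
  have p: "(\<lambda>s. - s * 2 powr s :: complex) meromorphic_on A"
    unfolding powr_def by (auto intro!: analytic_on_imp_meromorphic_on analytic_intros)
  have eq: "mellin_factor = (\<lambda>s. - s * 2 powr s * inverse (rGamma (1 + s / 2)) * rGamma (1 - s / 2))"
    by (auto simp: mellin_factor_def rGamma_inverse_Gamma)
  show ?thesis unfolding eq by (intro meromorphic_on_mult meromorphic_on_inverse r p)
qed

lemma mellin_factor_alt: "mellin_factor s = 2 * 2 powr s * Gamma (1 + s / 2) * rGamma (- s / 2)"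
proof -
  have "rGamma (- s / 2) = (- s / 2) * rGamma (1 - s / 2)"
    using rGamma_plus1[of "- s / 2"] by (simp add: add.commute)
  thus ?thesis by (simp add: mellin_factor_def)
qed

text \<open>A Gaussian takes the value 1 at 0 like every power of the Bessel function, and its Mellin
  transform is elementary on both sides of the imaginary axis. With the Gaussian subtracted
  instead of the constant 1 the integral converges across that axis.\<close>
definition ramble_strip :: "nat \<Rightarrow> complex \<Rightarrow> complex" where
  "ramble_strip N s = mellin_factor s * mellin (\<lambda>y. besselJ y ^ N - of_real (exp (- y\<^sup>2 / 4))) s + Gamma (1 + s / 2)"

text \<open>Each factor decays like \<open>y powr (-1/2)\<close>, so two of them suffice.\<close>
lemma besselJ_power_decay:
  assumes N: "N \<ge> 2"
  obtains C where "C \<ge> 0" "\<And>y. y \<ge> 1 \<Longrightarrow> norm (besselJ y ^ N) \<le> C * y powr (- 1)"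
proof -
  obtain c where c: "c \<ge> 0" "\<And>w. Re w \<ge> 0 \<Longrightarrow> Im w \<le> 0 \<Longrightarrow> w \<noteq> 0 \<Longrightarrow> norm (hankelX w) \<le> c * exp (- Re w) * norm w powr (- (1/2))"
    using hankelX_bound[of "1/2"] by auto
  show ?thesis
  proof (rule that[of "(2 * c)\<^sup>2"])
    fix y :: real assume y: "y \<ge> 1"
    let ?w = "- \<i> * of_real y"
    have "norm (hankelX ?w) \<le> c * y powr (- (1/2))" using c(2)[of ?w] y by (simp add: norm_mult)
    moreover have "norm (besselJ y) \<le> norm (hankelX ?w) + norm (hankelX ?w)"
      using besselJ_eq_hankelX[of y] y norm_triangle_ineq[of "hankelX ?w" "cnj (hankelX ?w)"] by simp
    ultimately have J: "norm (besselJ y) \<le> 2 * c * y powr (- (1/2))" by linarith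
    have "norm (besselJ y ^ N) \<le> norm (besselJ y) ^ 2"
      unfolding norm_power using N norm_besselJ_le by (intro power_decreasing) auto
    also have "\<dots> \<le> (2 * c * y powr (- (1/2)))\<^sup>2" using J by (intro power_mono) auto
    also have "\<dots> = (2 * c)\<^sup>2 * (y powr (- (1/2)) * y powr (- (1/2)))" by (simp add: power2_eq_square)
    also have "y powr (- (1/2)) * y powr (- (1/2)) = y powr (- 1)" unfolding powr_add[symmetric] by simp
    finally show "norm (besselJ y ^ N) \<le> (2 * c)\<^sup>2 * y powr (- 1)" .
  qed simp
qed

lemma gaussian_le_inverse: "y > 0 \<Longrightarrow> exp (- y\<^sup>2 / 4) \<le> 1 / (y::real)"
proof -
  assume y: "y > 0"
  have "y \<le> 1 + y\<^sup>2 / 4" using zero_le_power2[of "1 - y / 2"] by (simp add: power2_eq_square field_simps)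
  also have "\<dots> \<le> exp (y\<^sup>2 / 4)" by (rule exp_ge_add_one_self)
  finally show ?thesis using y by (simp add: exp_minus field_simps)
qed

lemma continuous_besselJ: "continuous_on A besselJ"
  unfolding besselJ_def[abs_def] by (intro continuous_on_besselI continuous_intros)

lemma mellin_conv_ramble_strip:
  assumes N: "N \<ge> 2" and s: "-1 < \<sigma>" "\<sigma> < 2"
  shows "mellin_conv (\<lambda>y. besselJ y ^ N - of_real (exp (- y\<^sup>2 / 4))) \<sigma>"
proof -
  obtain C where C: "C \<ge> 0" "\<And>y. y \<ge> 1 \<Longrightarrow> norm (besselJ y ^ N) \<le> C * y powr (- 1)" using besselJ_power_decay[OF N] by metis
  show ?thesis
  proof (rule mellin_conv_bound[where C = "real N * exp 1 + 1" and C' = "C + 1" and p = 2 and q = "- 1"])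
    fix y :: real
    show "norm (besselJ y ^ N - of_real (exp (- y\<^sup>2 / 4))) \<le> (real N * exp 1 + 1) * y powr 2" if y: "0 < y" "y \<le> 1"
    proof -
      have "1 - exp (- y\<^sup>2 / 4) \<le> y\<^sup>2" using exp_ge_add_one_self[of "- y\<^sup>2 / 4"] zero_le_power2[of y] by linarith
      hence "norm (1 - complex_of_real (exp (- y\<^sup>2 / 4))) \<le> y\<^sup>2"
        using norm_of_real[of "1 - exp (- y\<^sup>2 / 4)", where 'a = complex] by simp
      moreover have "norm (besselJ y ^ N - of_real (exp (- y\<^sup>2 / 4))) \<le> norm (besselJ y ^ N - 1) + norm (1 - complex_of_real (exp (- y\<^sup>2 / 4)))"
        using norm_triangle_ineq[of "besselJ y ^ N - 1" "1 - complex_of_real (exp (- y\<^sup>2 / 4))"] by simp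
      ultimately have "norm (besselJ y ^ N - of_real (exp (- y\<^sup>2 / 4))) \<le> real N * exp 1 * y\<^sup>2 + y\<^sup>2"
        using norm_besselJ_power_minus_one_le[OF y, of N] by linarith
      thus ?thesis using y by (simp add: algebra_simps)
    qed
    show "norm (besselJ y ^ N - of_real (exp (- y\<^sup>2 / 4))) \<le> (C + 1) * y powr (- 1)" if y: "1 \<le> y"
    proof -
      have "norm (complex_of_real (exp (- y\<^sup>2 / 4))) \<le> y powr (- 1)"
        using gaussian_le_inverse[of y] y by (simp add: powr_minus_divide)
      thus ?thesis unfolding distrib_right mult_1
        using C(2)[OF y] norm_triangle_ineq4[of "besselJ y ^ N" "of_real (exp (- y\<^sup>2 / 4))"] by linarith
    qed
  qed (use s in \<open>auto intro!: set_borel_measurable_cont continuous_intros continuous_besselJ\<close>)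
qed

lemma ramble_strip_analytic:
  assumes N: "N \<ge> 2" and s: "-1 < Re s" "Re s < 2"
  shows "ramble_strip N analytic_on {s}"
proof -
  have ne: "s \<notin> neg_even" using s neg_even_Re by force
  have o: "open {s. -1 < Re s \<and> Re s < 2}"
    by (intro open_Collect_conj open_halfspace_Re_gt open_halfspace_Re_lt)
  have "mellin (\<lambda>y. besselJ y ^ N - of_real (exp (- y\<^sup>2 / 4))) holomorphic_on {s. Re s \<in> {-1<..<2}}"
    by (intro mellin_holomorphic_on_strip mellin_conv_ramble_strip[OF N]) auto
  hence "mellin (\<lambda>y. besselJ y ^ N - of_real (exp (- y\<^sup>2 / 4))) analytic_on {s. -1 < Re s \<and> Re s < 2}"
    using o by (simp add: analytic_on_open)
  hence "mellin (\<lambda>y. besselJ y ^ N - of_real (exp (- y\<^sup>2 / 4))) analytic_on {s}"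
    by (rule analytic_on_subset) (use s in auto)
  thus ?thesis unfolding ramble_strip_def[abs_def]
    by (intro analytic_on_add analytic_on_mult mellin_factor_analytic[OF ne] analytic_Gamma_half[OF ne])
qed

lemma Gamma_mult_rGamma: "z \<notin> \<int>\<^sub>\<le>\<^sub>0 \<Longrightarrow> Gamma z * rGamma z = (1::complex)"
  by (simp add: rGamma_inverse_Gamma Gamma_eq_zero_iff)

lemma nonpos_Ints_Re: "z \<in> \<int>\<^sub>\<le>\<^sub>0 \<Longrightarrow> Re z \<le> 0"
  by (auto elim!: nonpos_Ints_cases')

text \<open>The formula for the Gaussian on this side accounts for the difference between subtracting 1 and
  subtracting the Gaussian.\<close>
lemma ramble_strip_right:
  assumes N: "N \<ge> 2" and s: "0 < Re s" "Re s < 2"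
  shows "ramble_integral N s = ramble_strip N s"
proof -
  let ?h = "\<lambda>y. besselJ y ^ N - complex_of_real (exp (- y\<^sup>2 / 4))"
  have c1: "mellin_conv (\<lambda>y. besselJ y ^ N - 1) (Re s)" by (rule mellin_conv_besselJ_power[OF s])
  have c2: "mellin_conv ?h (Re s)" using s by (intro mellin_conv_ramble_strip[OF N]) auto
  have c3: "mellin_conv (\<lambda>y. complex_of_real (exp (- y\<^sup>2 / 4)) - 1) (Re s)"
    using mellin_conv_add[OF c1 mellin_conv_minus[OF c2]] by simp
  have "mellin (\<lambda>y. besselJ y ^ N - 1) s = mellin ?h s + mellin (\<lambda>y. complex_of_real (exp (- y\<^sup>2 / 4)) - 1) s"
    using mellin_add[OF c2 c3] by simp
  also have "mellin_factor s * \<dots> = ramble_strip N s"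
  proof -
    have s0: "s \<noteq> 0" using s by auto
    have "1 - s / 2 \<notin> \<int>\<^sub>\<le>\<^sub>0" using nonpos_Ints_Re[of "1 - s / 2"] s by auto
    hence G: "Gamma (1 - s / 2) * rGamma (1 - s / 2) = 1" by (rule Gamma_mult_rGamma)
    have P: "2 powr s * 2 powr (- s) = (1::complex)" unfolding powr_add[symmetric] by simp
    have "mellin_factor s * (- (2 powr (- s)) / s * Gamma (1 - s / 2)) =
      (2 powr s * 2 powr (- s)) * Gamma (1 + s / 2) * (Gamma (1 - s / 2) * rGamma (1 - s / 2))"
      using s0 by (simp add: mellin_factor_def)
    thus ?thesis unfolding mellin_gaussian[OF s] ramble_strip_def distrib_left G P by simp
  qed
  finally show ?thesis using ramble_integral_mellin[OF s] by simp
qed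

text \<open>On this side neither function needs a subtraction, so the Gaussian may be added back to the
  integral. The same gamma value results as on the other side.\<close>
lemma ramble_strip_left:
  assumes N: "N \<ge> 2" and s: "-1 < Re s" "Re s < 0"
  shows "ramble_strip N s = mellin_factor s * mellin (\<lambda>y. besselJ y ^ N) s"
proof -
  let ?h = "\<lambda>y. besselJ y ^ N - complex_of_real (exp (- y\<^sup>2 / 4))"
  have c2: "mellin_conv ?h (Re s)" using s by (intro mellin_conv_ramble_strip[OF N]) auto
  have c3: "mellin_conv (\<lambda>y. complex_of_real (exp (- y\<^sup>2 / 4))) (Re s)"
  proof (rule mellin_conv_bound[where C = 1 and C' = 1 and p = 0 and q = "- 1"])
    show "norm (complex_of_real (exp (- y\<^sup>2 / 4))) \<le> 1 * y powr (- 1)" if "1 \<le> y" for y :: real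
      using gaussian_le_inverse[of y] that by (simp add: powr_minus_divide)
    show "set_borel_measurable lborel {0<..} (\<lambda>y. complex_of_real (exp (- y\<^sup>2 / 4)))"
      by (intro set_borel_measurable_cont continuous_intros) auto
  qed (use s in auto)
  have "mellin (\<lambda>y. besselJ y ^ N) s = mellin ?h s + mellin (\<lambda>y. complex_of_real (exp (- y\<^sup>2 / 4))) s"
    using mellin_add[OF c2 c3] by simp
  also have "mellin_factor s * \<dots> = ramble_strip N s"
  proof -
    have "- s / 2 \<notin> \<int>\<^sub>\<le>\<^sub>0" using nonpos_Ints_Re[of "- s / 2"] s by auto
    hence G: "Gamma (- s / 2) * rGamma (- s / 2) = 1" by (rule Gamma_mult_rGamma)
    have P: "2 powr s * 2 powr (- s) = (1::complex)" unfolding powr_add[symmetric] by simp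
    have "mellin_factor s * (2 powr (- s) / 2 * Gamma (- s / 2)) =
      (2 powr s * 2 powr (- s)) * Gamma (1 + s / 2) * (Gamma (- s / 2) * rGamma (- s / 2))"
      unfolding mellin_factor_alt by simp
    thus ?thesis unfolding mellin_gaussian_left[OF s(2)] ramble_strip_def distrib_left G P by simp
  qed
  finally show ?thesis ..
qed

text \<open>Three expressions overlap pairwise: the moment itself on the right half plane, the integral with
  the Gaussian subtracted on a strip about the imaginary axis, and an arbitrary meromorphic
  continuation \<open>R\<close> of the Mellin transform of the power on the left half plane.
  Their union is a meromorphic function on the plane.\<close>
theorem ramble_continuation:
  assumes N: "N \<ge> 2" and R: "R meromorphic_on {s. Re s < 0}"
    and JR: "\<And>s. -1 < Re s \<Longrightarrow> Re s < 0 \<Longrightarrow> mellin (\<lambda>y. besselJ y ^ N) s = R s"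
  shows "Re s > 0 \<Longrightarrow> ramble N s = ramble_integral N s"
    and "Re s > -1 \<Longrightarrow> ramble N analytic_on {s}"
    and "Re s < 0 \<Longrightarrow> s \<notin> neg_even \<Longrightarrow> R analytic_on {s} \<Longrightarrow>
      ramble N analytic_on {s} \<and> ramble N s = mellin_factor s * R s"
proof -
  define f where "f s = (if Re s > 0 then ramble_integral N s else if Re s > -1 then ramble_strip N s
     else mellin_factor s * R s)" for s
  have f1: "eventually (\<lambda>w. f w = ramble_integral N w) (nhds z)" if "Re z > 0" for z
    by (rule eventually_mono[OF eventually_nhds_in_open[OF open_halfspace_Re_gt[of 0]]]) (use that in \<open>auto simp: f_def\<close>)
  have f2: "eventually (\<lambda>w. f w = ramble_strip N w) (nhds z)" if "Re z > -1" "Re z < 2" for z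
  proof -
    have "eventually (\<lambda>w. w \<in> {w. -1 < Re w \<and> Re w < 2}) (nhds z)"
      using that by (intro eventually_nhds_in_open open_Collect_conj open_halfspace_Re_gt open_halfspace_Re_lt) auto
    thus ?thesis by eventually_elim (auto simp: f_def ramble_strip_right[OF N])
  qed
  have f3: "eventually (\<lambda>w. f w = mellin_factor w * R w) (nhds z)" if "Re z < 0" for z
    by (rule eventually_mono[OF eventually_nhds_in_open[OF open_halfspace_Re_lt[of 0]]])
       (use that in \<open>auto simp: f_def ramble_strip_left[OF N] JR\<close>)
  have an1: "ramble_integral N analytic_on {z}" if "Re z > 0" for z
    by (rule analytic_on_subset[of _ "{s. Re s > 0}"])
       (use ramble_integral_holomorphic that in \<open>auto simp: analytic_on_open open_halfspace_Re_gt\<close>)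
  have fa: "f analytic_on {z}" if "Re z > -1" for z
  proof (cases "Re z > 0")
    case True
    thus ?thesis using an1 analytic_at_cong[OF f1] by blast
  next
    case False
    thus ?thesis using ramble_strip_analytic[OF N] analytic_at_cong[OF f2] that by force
  qed
  have "f meromorphic_on {z}" for z
  proof (cases "Re z < 0")
    case True
    have "f meromorphic_on {z} \<longleftrightarrow> (\<lambda>w. mellin_factor w * R w) meromorphic_on {z}"
      using eventually_nhds_conv_at[of _ z] f3[OF True] by (intro meromorphic_on_cong) auto
    moreover have "R meromorphic_on {z}" by (rule meromorphic_on_subset[OF R]) (use True in auto)
    ultimately show ?thesis using mellin_factor_meromorphic by (auto intro!: meromorphic_intros)
  qed (use fa analytic_on_imp_meromorphic_on in force)
  hence mer: "f meromorphic_on UNIV" using meromorphic_on_meromorphic_at by blast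
  have eq: "ramble N = remove_sings f"
    unfolding ramble_def
    by (rule meromorphic_continuation_eqI[OF mer ramble_integral_holomorphic]) (simp add: f_def)
  have ev: "eventually (\<lambda>w. ramble N w = f w) (nhds z)" if a: "f analytic_on {z}" for z
  proof -
    obtain S where S: "open S" "z \<in> S" "f holomorphic_on S" using a unfolding analytic_at by blast
    have "f analytic_on S" using S by (simp add: analytic_on_open)
    hence "ramble N w = f w" if "w \<in> S" for w
      using that analytic_on_subset[of f S "{w}"] unfolding eq by simp
    thus ?thesis by (rule eventually_mono[OF eventually_nhds_in_open[OF S(1,2)]])
  qed
  have ran: "ramble N analytic_on {z} \<and> ramble N z = f z" if "f analytic_on {z}" for z
    using analytic_at_cong[OF ev[OF that] refl] that eventually_nhds_x_imp_x[OF ev[OF that]] by blast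
  show "ramble N s = ramble_integral N s" if "Re s > 0" using ran[OF fa[of s]] that by (simp add: f_def)
  show "ramble N analytic_on {s}" if "Re s > -1" using ran[OF fa[of s]] that by simp
  show "ramble N analytic_on {s} \<and> ramble N s = mellin_factor s * R s"
    if s: "Re s < 0" "s \<notin> neg_even" "R analytic_on {s}"
  proof -
    have "(\<lambda>w. mellin_factor w * R w) analytic_on {s}"
      using s by (intro analytic_on_mult mellin_factor_analytic)
    hence "f analytic_on {s}" using analytic_at_cong[OF f3[OF s(1)] refl] by blast
    from ran[OF this] show ?thesis using eventually_nhds_x_imp_x[OF f3[OF s(1)]] by simp
  qed
qed

text \<open>The kernel decays exponentially, so there is no obstruction to the left.\<close>
lemma rotated_mellin_0_holomorphic:
  assumes j: "j > 0"
  shows "rotated_mellin j 0 holomorphic_on {s. Re s < 0}"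
proof -
  have "mellin (\<lambda>y. hankel_part j (of_real y)) holomorphic_on {s. Re s \<in> {..<0}}"
    "mellin (\<lambda>y. cnj (hankel_part j (of_real y))) holomorphic_on {s. Re s \<in> {..<0}}"
    by (intro mellin_holomorphic_on_strip mellin_conv_cnj mellin_conv_hankel_part[OF j]; simp)+
  thus ?thesis unfolding rotated_mellin_def[abs_def] by (auto intro!: holomorphic_intros)
qed

lemma ramble_odd:
  assumes j: "j > 0"
  shows "Re s > -1 \<Longrightarrow> ramble (2 * j + 1) analytic_on {s}"
    and "Re s < 0 \<Longrightarrow> s \<notin> neg_even \<Longrightarrow> ramble (2 * j + 1) s = mellin_factor s * rotated_mellin j 0 s"
proof -
  have an: "rotated_mellin j 0 analytic_on {s. Re s < 0}"
    using rotated_mellin_0_holomorphic[OF j] by (simp add: analytic_on_open open_halfspace_Re_lt)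
  have N: "2 \<le> 2 * j + 1" using j by simp
  have JR: "mellin (\<lambda>y. besselJ y ^ (2 * j + 1)) s = rotated_mellin j 0 s" if "-1 < Re s" "Re s < 0" for s
    using mellin_besselJ_power_rotated[OF j _ that, of 0] by simp
  note c = ramble_continuation[OF N analytic_on_imp_meromorphic_on[OF an] JR]
  show "ramble (2 * j + 1) analytic_on {s}" if "Re s > -1" by (rule c(2)) (use that in auto)
  show "ramble (2 * j + 1) s = mellin_factor s * rotated_mellin j 0 s" if "Re s < 0" "s \<notin> neg_even"
    using c(3)[of s] that analytic_on_subset[OF an, of "{s}"] by auto
qed

section \<open>Continuation for an even number of steps\<close>

text \<open>The kernel obtained from both halves after rotation. The phases depend on the Mellin argument; a
  shift of it by \<open>2m\<close> only changes the sign by \<open>(-1)^m\<close>.\<close>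
definition hankel_mix :: "nat \<Rightarrow> complex \<Rightarrow> real \<Rightarrow> complex" where
  "hankel_mix j \<nu> y = exp (- \<i> * of_real (pi / 2) * \<nu>) * hankel_part j (of_real y) +
     exp (\<i> * of_real (pi / 2) * \<nu>) * cnj (hankel_part j (of_real y))"

text \<open>On the positive axis the leading term and its conjugate differ only by their phase.\<close>
lemma hankel_lead_times_besselI:
  fixes j :: nat
  assumes y: "y > 0"
  defines "q \<equiv> of_nat ((2 * j + 1) choose (j + 1)) / of_real pi ^ (j + 1) * (besselK (of_real y) * besselI (of_real y)) ^ (j + 1)"
  shows "hankel_lead j (of_real y) * besselI (of_real y) = (- \<i>) ^ (j + 1) * q"
    and "cnj (hankel_lead j (of_real y)) * besselI (of_real y) = \<i> ^ (j + 1) * q"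
proof -
  have K: "cnj (besselK (of_real y)) = besselK (of_real y)"
    using besselK_real[OF y] by (simp add: Reals_cnj_iff)
  have q: "cnj q = q" unfolding q_def by (simp add: K cnj_besselI_real)
  show 1: "hankel_lead j (of_real y) * besselI (of_real y) = (- \<i>) ^ (j + 1) * q"
    unfolding hankel_lead_def hankelX_def q_def power_mult_distrib power_divide
    by (simp add: power_add mult_ac)
  have "cnj (hankel_lead j (of_real y)) * besselI (of_real y) = cnj (hankel_lead j (of_real y) * besselI (of_real y))"
    by (simp add: cnj_besselI_real)
  also have "\<dots> = \<i> ^ (j + 1) * q" unfolding 1 by (simp add: q)
  finally show "cnj (hankel_lead j (of_real y)) * besselI (of_real y) = \<i> ^ (j + 1) * q" .
qed

lemma mellin_conv_cong:
  assumes "\<And>y. y > 0 \<Longrightarrow> f y = g y"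
  shows "mellin_conv f \<sigma> \<longleftrightarrow> mellin_conv g \<sigma>"
proof -
  have e: "indicat_real {0<..} y *\<^sub>R f y = indicat_real {0<..} y *\<^sub>R g y"
    "indicat_real {0<..} y *\<^sub>R (norm (f y) * y powr (- \<sigma> - 1)) = indicat_real {0<..} y *\<^sub>R (norm (g y) * y powr (- \<sigma> - 1))" for y
    using assms[of y] by (auto simp: indicator_def)
  show ?thesis unfolding mellin_conv_def set_borel_measurable_def set_integrable_def e ..
qed

lemma mellin_cong:
  assumes "\<And>y. y > 0 \<Longrightarrow> f y = g y"
  shows "mellin f s = mellin g s"
  unfolding mellin_def by (rule set_lebesgue_integral_cong) (use assms in auto)

lemma mellin_conv_cut:
  assumes f: "mellin_conv f \<sigma>"
  shows "mellin_conv (\<lambda>y. if y \<ge> 1 then f y else 0) \<sigma>" "mellin_conv (\<lambda>y. if y \<ge> 1 then 0 else f y) \<sigma>"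
proof -
  have m: "set_borel_measurable lborel {0<..} f"
    and i: "set_integrable lborel {0<..} (\<lambda>y. norm (f y) * y powr (- \<sigma> - 1))" using f by (auto simp: mellin_conv_def)
  have a: "set_borel_measurable lborel {0<..} (\<lambda>y. indicat_real A y *\<^sub>R f y) \<and>
     set_integrable lborel {0<..} (\<lambda>y. norm (indicat_real A y *\<^sub>R f y) * y powr (- \<sigma> - 1))" if A: "A \<in> sets borel" for A
  proof
    have "(\<lambda>y. indicat_real A y *\<^sub>R (indicat_real {0<..} y *\<^sub>R f y)) \<in> borel_measurable lborel"
      by (intro borel_measurable_scaleR borel_measurable_indicator m[unfolded set_borel_measurable_def]) (simp add: A)
    thus "set_borel_measurable lborel {0<..} (\<lambda>y. indicat_real A y *\<^sub>R f y)"
      unfolding set_borel_measurable_def by (simp add: mult.commute)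
    have "integrable lborel (\<lambda>y. indicat_real A y *\<^sub>R (indicat_real {0<..} y *\<^sub>R (norm (f y) * y powr (- \<sigma> - 1))))"
      by (rule integrable_mult_indicator[OF _ i[unfolded set_integrable_def]]) (simp add: A)
    thus "set_integrable lborel {0<..} (\<lambda>y. norm (indicat_real A y *\<^sub>R f y) * y powr (- \<sigma> - 1))"
      unfolding set_integrable_def by (simp add: mult_ac)
  qed
  have e: "(if y \<ge> 1 then f y else 0) = indicat_real {1..} y *\<^sub>R f y"
    "(if y \<ge> 1 then 0 else f y) = indicat_real (- {1..}) y *\<^sub>R f y" for y by (auto simp: indicator_def)
  show "mellin_conv (\<lambda>y. if y \<ge> 1 then f y else 0) \<sigma>" "mellin_conv (\<lambda>y. if y \<ge> 1 then 0 else f y) \<sigma>"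
    unfolding mellin_conv_def e using a[of "{1..}"] a[of "- {1..}"] by auto
qed

lemma mellin_conv_shift:
  assumes "mellin_conv f (\<sigma> - real k)"
  shows "mellin_conv (\<lambda>y. f y * of_real y ^ k) \<sigma>"
proof -
  have m: "set_borel_measurable lborel {0<..} f"
    and i: "set_integrable lborel {0<..} (\<lambda>y. norm (f y) * y powr (- (\<sigma> - real k) - 1))" using assms by (auto simp: mellin_conv_def)
  have "(\<lambda>y. (indicat_real {0<..} y *\<^sub>R f y) * of_real y ^ k) \<in> borel_measurable lborel"
    using m unfolding set_borel_measurable_def by measurable
  hence "set_borel_measurable lborel {0<..} (\<lambda>y. f y * of_real y ^ k)"
    unfolding set_borel_measurable_def by (simp only: mult_scaleR_left)
  moreover have "set_integrable lborel {0<..} (\<lambda>y. norm (f y * of_real y ^ k) * y powr (- \<sigma> - 1))"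
  proof -
    have "norm (f y) * y powr (- (\<sigma> - real k) - 1) = norm (f y * of_real y ^ k) * y powr (- \<sigma> - 1)" if "y > 0" for y
    proof -
      have "- (\<sigma> - real k) - 1 = real k + (- \<sigma> - 1)" by simp
      hence "y powr (- (\<sigma> - real k) - 1) = y ^ k * y powr (- \<sigma> - 1)"
        using that by (simp only: powr_add) (simp add: powr_realpow)
      thus ?thesis using that by (simp add: norm_mult norm_power)
    qed
    thus ?thesis using i set_integrable_cong[OF refl refl, of "{0<..}" "\<lambda>y. norm (f y) * y powr (- (\<sigma> - real k) - 1)"
        "\<lambda>y. norm (f y * of_real y ^ k) * y powr (- \<sigma> - 1)" lborel] by auto
  qed
  ultimately show ?thesis by (simp add: mellin_conv_def)
qed

text \<open>For odd \<open>j\<close> and odd negative arguments the two phases of the leading term are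
  opposite. This is why such arguments are exceptional: no power-type contribution is left.\<close>
lemma even_phase_cancels:
  assumes "odd j"
  shows "exp (- \<i> * of_real (pi / 2) * (- of_nat (2 * k + 1))) * (- \<i>) ^ (j + 1) +
    exp (\<i> * of_real (pi / 2) * (- of_nat (2 * k + 1))) * \<i> ^ (j + 1) = 0"
proof -
  have e: "exp (\<i> * of_real (pi / 2)) = \<i>" by (simp only: cis_conv_exp[symmetric] cis_pi_half)
  have e': "exp (- (\<i> * of_real (pi / 2))) = - \<i>" unfolding exp_minus e by simp
  have 1: "exp (- \<i> * of_real (pi / 2) * (- of_nat (2 * k + 1))) = \<i> ^ (2 * k + 1)"
  proof -
    have "- \<i> * of_real (pi / 2) * (- of_nat (2 * k + 1)) = of_nat (2 * k + 1) * (\<i> * of_real (pi / 2))" by (simp add: algebra_simps)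
    thus ?thesis by (simp only: exp_of_nat_mult e)
  qed
  have 2: "exp (\<i> * of_real (pi / 2) * (- of_nat (2 * k + 1))) = (- \<i>) ^ (2 * k + 1)"
  proof -
    have "\<i> * of_real (pi / 2) * (- of_nat (2 * k + 1)) = of_nat (2 * k + 1) * (- (\<i> * of_real (pi / 2)))" by (simp add: algebra_simps)
    thus ?thesis by (simp only: exp_of_nat_mult e')
  qed
  have 3: "(- \<i>) ^ (j + 1) = \<i> ^ (j + 1)" using assms by (intro power_minus_even) auto
  have 4: "(- \<i>) ^ (2 * k + 1) = - (\<i> ^ (2 * k + 1))" by (rule power_minus_odd) simp
  show ?thesis unfolding 1 2 3 4 by simp
qed

text \<open>The rotated integral converges only for \<open>Re s > - (j + 1)\<close>, because the leading
  part of the integrand decays like a power. This part is continued through the asymptotic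
  expansion of a power of \<open>y * I y * K y\<close>, with poles only at \<open>- (j + 1) -
  2l\<close>; the rest of the integrand decays exponentially. At the exceptional arguments the
  coefficient of the leading part vanishes, so the integral of the combined kernel converges
  even where those of its halves diverge.\<close>
theorem ramble_even:
  assumes j: "j > 0" 
  shows "Re s > 0 \<Longrightarrow> ramble (2 * j + 2) s = ramble_integral (2 * j + 2) s"
    and "Re s > -1 \<Longrightarrow> ramble (2 * j + 2) analytic_on {s}"
    and "Re s < 0 \<Longrightarrow> s \<in> ramble_series_domain j \<Longrightarrow> ramble (2 * j + 2) analytic_on {s} \<and>
      mellin_conv (\<lambda>y. hankel_mix j s y * besselI (of_real y)) (Re s) \<and>
      ramble (2 * j + 2) s = mellin_factor s * mellin (\<lambda>y. hankel_mix j s y * besselI (of_real y)) s"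
proof -
  define B :: complex where "B = of_nat ((2 * j + 1) choose (j + 1)) / of_real pi ^ (j + 1)"
  define q where "q y = B * (besselK (of_real y) * besselI (of_real y)) ^ (j + 1)" for y
  define E where "E y = hankel_part j (of_real y) - hankel_lead j (of_real y)" for y
  let ?I = "\<lambda>y. besselI (complex_of_real y)"
  let ?em = "\<lambda>s. exp (- \<i> * of_real (pi / 2) * s)" and ?ep = "\<lambda>s. exp (\<i> * of_real (pi / 2) * s)"
  define \<tau> where "\<tau> s = ?em s * (- \<i>) ^ (j + 1) + ?ep s * \<i> ^ (j + 1)" for s
  have lead: "hankel_lead j (of_real y) * ?I y = (- \<i>) ^ (j + 1) * q y"
    "cnj (hankel_lead j (of_real y)) * ?I y = \<i> ^ (j + 1) * q y" if "y > 0" for y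
    using hankel_lead_times_besselI[OF that, of j] by (simp_all only: q_def B_def)
  have convE: "mellin_conv (\<lambda>y. E y * ?I y) \<sigma>" "mellin_conv (\<lambda>y. cnj (E y) * ?I y) \<sigma>" if "\<sigma> < 0" for \<sigma>
  proof -
    show 1: "mellin_conv (\<lambda>y. E y * ?I y) \<sigma>" unfolding E_def by (rule mellin_conv_hankel_remainder[OF j that])
    show "mellin_conv (\<lambda>y. cnj (E y) * ?I y) \<sigma>" using mellin_conv_cnj[OF 1] by (simp add: cnj_besselI_real)
  qed
  have convP: "mellin_conv (\<lambda>y. hankel_part j (of_real y) * ?I y) \<sigma>" if "- (real j + 1) < \<sigma>" "\<sigma> < 0" for \<sigma>
    using mellin_conv_hankel_part_tail[OF j, of \<sigma> 0] that by (simp add: besselI_tail_0)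
  have i4: "\<i> ^ (j + 1) * (- \<i>) ^ (j + 1) = 1" unfolding power_mult_distrib[symmetric] by simp
  have convq: "mellin_conv q \<sigma>" if "- (real j + 1) < \<sigma>" "\<sigma> < 0" for \<sigma>
  proof -
    have "mellin_conv (\<lambda>y. \<i> ^ (j + 1) * (hankel_part j (of_real y) * ?I y + - (E y * ?I y))) \<sigma>"
      using that by (intro mellin_conv_cmult mellin_conv_add mellin_conv_minus convP convE)
    moreover have "\<i> ^ (j + 1) * (hankel_part j (of_real y) * ?I y + - (E y * ?I y)) = q y" if "y > 0" for y
    proof -
      have "hankel_part j (of_real y) * ?I y + - (E y * ?I y) = (- \<i>) ^ (j + 1) * q y"
        unfolding lead[OF that, symmetric] by (simp add: E_def algebra_simps)
      thus ?thesis using i4 by (simp only: mult.assoc[symmetric]) simp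
    qed
    ultimately show ?thesis by (subst (asm) mellin_conv_cong) auto
  qed
  define q0 where "q0 y = (if y \<ge> 1 then 0 else q y)" for y :: real
  define q1 where "q1 y = (if y \<ge> 1 then q y else 0)" for y :: real
  have convq1: "mellin_conv q1 \<sigma>" if "- (real j + 1) < \<sigma>" "\<sigma> < 0" for \<sigma>
    unfolding q1_def by (rule mellin_conv_cut(1)[OF convq[OF that]])
  have convq0: "mellin_conv q0 \<sigma>" if s: "\<sigma> < 0" for \<sigma>
  proof -
    have d: "- \<sigma> / 2 > 0" using s by simp
    obtain C where C: "C \<ge> 0" "\<And>y. 0 < y \<Longrightarrow> y \<le> 1 \<Longrightarrow> norm (hankel_lead j (of_real y)) \<le> C * y powr (- (- \<sigma> / 2))"
      using hankel_lead_zero_bound[OF d] by blast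
    have m: "set_borel_measurable lborel {0<..} q0"
      using mellin_conv_cut(2)[OF convq[of "-1/2"]] j unfolding q0_def mellin_conv_def by auto
    show ?thesis
    proof (rule mellin_conv_bound[OF m, where C = "C * exp 1" and C' = 0 and p = "\<sigma> / 2" and q = "\<sigma> - 1"])
      fix y :: real assume y: "0 < y" "y \<le> 1"
      have "norm (q y) = norm (hankel_lead j (of_real y)) * norm (?I y)"
        unfolding norm_mult[symmetric] lead[OF y(1)] by (simp add: norm_mult norm_power)
      also have "\<dots> \<le> (C * y powr (\<sigma> / 2)) * exp 1"
        using C(2)[OF y] C(1) norm_besselI_le[of "of_real y"] y by (intro mult_mono) (auto intro: order_trans)
      finally show "norm (q0 y) \<le> C * exp 1 * y powr (\<sigma> / 2)" using C(1) by (simp add: q0_def mult_ac)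
    qed (use s in \<open>auto simp: q0_def\<close>)
  qed
  have "continuous_on {0<..} (\<lambda>y. besselv (complex_of_real y) ^ (j + 1))"
  proof -
    have "continuous_on {0<..} (\<lambda>y. besselK (complex_of_real y))"
      by (rule continuous_on_compose2[OF holomorphic_on_imp_continuous_on[OF besselK_holomorphic]])
         (auto intro!: continuous_intros)
    thus ?thesis unfolding besselv_def
      by (intro continuous_on_power continuous_on_mult continuous_on_besselI continuous_intros)
  qed
  hence mv: "set_borel_measurable lborel {0<..} (\<lambda>y. besselv (complex_of_real y) ^ (j + 1))"
    by (rule set_borel_measurable_cont) auto
  obtain T where T: "T meromorphic_on UNIV" "T analytic_on - {- (2 * of_nat l) |l. True}"
    "\<And>s. Re s > 0 \<Longrightarrow> T s = mellin (\<lambda>y. if y \<ge> 1 then besselv (of_real y) ^ (j + 1) else 0) s"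
    using even_asym_tail_continuation[OF mv even_asym_power[OF even_asym_besselv]] by blast
  have Tq: "B * T (s + of_nat (j + 1)) = mellin q1 s" if "Re s > - (real j + 1)" for s
  proof -
    have "T (s + of_nat (j + 1)) = mellin (\<lambda>y. if y \<ge> 1 then besselv (of_real y) ^ (j + 1) else 0) (s + of_nat (j + 1))"
      using that by (intro T(3)) simp
    also have "(\<lambda>y. if y \<ge> 1 then besselv (of_real y) ^ (j + 1) else 0) =
       (\<lambda>y. (if y \<ge> 1 then (besselK (of_real y) * ?I y) ^ (j + 1) else 0) * of_real y ^ (j + 1))"
      by (rule ext) (simp only: besselv_def power_mult_distrib mult_ac split: if_split, simp)
    also have "mellin \<dots> (s + of_nat (j + 1)) = mellin (\<lambda>y. if y \<ge> 1 then (besselK (of_real y) * ?I y) ^ (j + 1) else 0) s"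
      unfolding mellin_shift by simp
    also have "B * \<dots> = mellin q1 s" unfolding mellin_cmult[symmetric]
      by (intro arg_cong2[where f = mellin] ext) (auto simp: q1_def q_def)
    finally show ?thesis .
  qed
  define R where "R s = ?em s * mellin (\<lambda>y. E y * ?I y) s + ?ep s * mellin (\<lambda>y. cnj (E y) * ?I y) s +
     \<tau> s * (mellin q0 s + B * T (s + of_nat (j + 1)))" for s
  have Ehol: "mellin (\<lambda>y. E y * ?I y) analytic_on {s. Re s < 0}" "mellin (\<lambda>y. cnj (E y) * ?I y) analytic_on {s. Re s < 0}"
    "mellin q0 analytic_on {s. Re s < 0}"
    using mellin_holomorphic_on_strip[of "{..<0}" "\<lambda>y. E y * ?I y"] convE
      mellin_holomorphic_on_strip[of "{..<0}" "\<lambda>y. cnj (E y) * ?I y"] mellin_holomorphic_on_strip[of "{..<0}" q0] convq0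
    by (auto simp: analytic_on_open open_halfspace_Re_lt)
  have ph: "?em analytic_on A" "?ep analytic_on A" "\<tau> analytic_on A" for A
    unfolding \<tau>_def[abs_def] by (auto intro!: analytic_intros)
  have sh: "(\<lambda>s. s + of_nat (j + 1) :: complex) analytic_on A" for A by (intro analytic_intros)
  have Rmer: "R meromorphic_on {s. Re s < 0}"
    unfolding R_def[abs_def]
    by (intro meromorphic_on_add meromorphic_on_mult meromorphic_on_const analytic_on_imp_meromorphic_on[OF ph(1)]
          analytic_on_imp_meromorphic_on[OF ph(2)] analytic_on_imp_meromorphic_on[OF ph(3)]
          Ehol[THEN analytic_on_imp_meromorphic_on] meromorphic_on_compose[OF T(1) sh]) auto
  have Ran: "R analytic_on {s}" if s: "Re s < 0" "s + of_nat (j + 1) \<notin> {- (2 * of_nat l) |l. True}" for s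
  proof -
    have "(\<lambda>s. T (s + of_nat (j + 1))) analytic_on {s}"
      by (rule analytic_on_compose_gen[OF sh T(2), unfolded o_def]) (use s in auto)
    thus ?thesis unfolding R_def[abs_def]
      by (intro analytic_on_add analytic_on_mult analytic_on_const ph) (use Ehol s in \<open>auto intro: analytic_on_subset\<close>)
  qed
  have mixE: "hankel_mix j s y * ?I y = (?em s * (E y * ?I y) + ?ep s * (cnj (E y) * ?I y)) + \<tau> s * q y" if "y > 0" for s y
  proof -
    have "\<tau> s * q y = ?em s * (hankel_lead j (of_real y) * ?I y) + ?ep s * (cnj (hankel_lead j (of_real y)) * ?I y)"
      unfolding lead[OF that] \<tau>_def by (simp add: algebra_simps)
    thus ?thesis by (simp add: hankel_mix_def E_def algebra_simps)
  qed
  have mEconv: "mellin_conv (\<lambda>y. ?em s * (E y * ?I y) + ?ep s * (cnj (E y) * ?I y)) (Re s)" 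
    and mE: "mellin (\<lambda>y. ?em s * (E y * ?I y) + ?ep s * (cnj (E y) * ?I y)) s =
      ?em s * mellin (\<lambda>y. E y * ?I y) s + ?ep s * mellin (\<lambda>y. cnj (E y) * ?I y) s" if "Re s < 0" for s
    using convE[OF that] by (auto intro!: mellin_conv_add mellin_conv_cmult simp: mellin_add mellin_conv_cmult mellin_cmult)
  have R1: "mellin_conv (\<lambda>y. hankel_mix j s y * ?I y) (Re s) \<and> mellin (\<lambda>y. hankel_mix j s y * ?I y) s = R s"
    if s: "Re s < 0" "Re s > - (real j + 1)" for s
  proof
    let ?g = "\<lambda>y. (?em s * (E y * ?I y) + ?ep s * (cnj (E y) * ?I y)) + \<tau> s * q y"
    have cq: "mellin_conv (\<lambda>y. \<tau> s * q y) (Re s)" using convq s by (intro mellin_conv_cmult) auto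
    have "mellin_conv ?g (Re s)" by (intro mellin_conv_add[OF mEconv cq] s)
    thus "mellin_conv (\<lambda>y. hankel_mix j s y * ?I y) (Re s)" by (subst mellin_conv_cong[OF mixE])
    have "q = (\<lambda>y. q0 y + q1 y)" by (auto simp: q0_def q1_def)
    hence "mellin q s = mellin q0 s + mellin q1 s" using mellin_add[of q0 s q1] convq0[of "Re s"] convq1[of "Re s"] s by simp
    hence q: "mellin q s = mellin q0 s + B * T (s + of_nat (j + 1))" using Tq[of s] s by simp
    have "mellin (\<lambda>y. hankel_mix j s y * ?I y) s = mellin ?g s" by (rule mellin_cong[OF mixE])
    also have "\<dots> = R s" unfolding mellin_add[OF mEconv[OF s(1)] cq] mE[OF s(1)] mellin_cmult q R_def ..
    finally show "mellin (\<lambda>y. hankel_mix j s y * ?I y) s = R s" .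
  qed
  have R2: "mellin_conv (\<lambda>y. hankel_mix j s y * ?I y) (Re s) \<and> mellin (\<lambda>y. hankel_mix j s y * ?I y) s = R s"
    if s: "Re s < 0" "\<tau> s = 0" for s
  proof
    have m: "hankel_mix j s y * ?I y = ?em s * (E y * ?I y) + ?ep s * (cnj (E y) * ?I y)" if "y > 0" for y
      unfolding mixE[OF that] s(2) by simp
    show "mellin_conv (\<lambda>y. hankel_mix j s y * ?I y) (Re s)" by (subst mellin_conv_cong[OF m]) (assumption, rule mEconv[OF s(1)])
    have "mellin (\<lambda>y. hankel_mix j s y * ?I y) s = mellin (\<lambda>y. ?em s * (E y * ?I y) + ?ep s * (cnj (E y) * ?I y)) s"
      by (rule mellin_cong[OF m])
    also have "\<dots> = R s" unfolding mE[OF s(1)] R_def s(2) by simp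
    finally show "mellin (\<lambda>y. hankel_mix j s y * ?I y) s = R s" .
  qed
  have JR: "mellin (\<lambda>y. besselJ y ^ (2 * j + 2)) s = R s" if s: "-1 < Re s" "Re s < 0" for s
  proof -
    have s': "- (real j + 1) < Re s" using s by simp
    have cP: "mellin_conv (\<lambda>y. hankel_part j (of_real y) * ?I y) (Re s)" by (rule convP[OF s' s(2)])
    have cC: "mellin_conv (\<lambda>y. cnj (hankel_part j (of_real y)) * ?I y) (Re s)"
      using mellin_conv_cnj[OF cP] by (simp add: cnj_besselI_real)
    have "mellin (\<lambda>y. besselJ y ^ (2 * j + 2)) s = rotated_mellin j 1 s"
      using mellin_besselJ_power_rotated[OF j _ s, of 1] by simp
    also have "\<dots> = mellin (\<lambda>y. ?em s * (hankel_part j (of_real y) * ?I y) + ?ep s * (cnj (hankel_part j (of_real y)) * ?I y)) s"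
      unfolding rotated_mellin_def power_one_right
      by (simp only: mellin_add[OF mellin_conv_cmult[OF cP] mellin_conv_cmult[OF cC]] mellin_cmult)
    also have "\<dots> = mellin (\<lambda>y. hankel_mix j s y * ?I y) s"
      by (rule mellin_cong) (simp add: hankel_mix_def algebra_simps)
    also have "\<dots> = R s" using R1[OF s(2) s'] by blast
    finally show ?thesis .
  qed
  have N: "2 \<le> 2 * j + 2" by simp
  note c = ramble_continuation[OF N Rmer JR]
  show "ramble (2 * j + 2) s = ramble_integral (2 * j + 2) s" if "Re s > 0" by (rule c(1)) (use that in auto)
  show "ramble (2 * j + 2) analytic_on {s}" if "Re s > -1" by (rule c(2)) (use that in auto)
  show "ramble (2 * j + 2) analytic_on {s} \<and>
      mellin_conv (\<lambda>y. hankel_mix j s y * ?I y) (Re s) \<and>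
      ramble (2 * j + 2) s = mellin_factor s * mellin (\<lambda>y. hankel_mix j s y * ?I y) s"
    if s: "Re s < 0" "s \<in> ramble_series_domain j"
  proof -
    have ne: "s \<notin> neg_even" and cases: "Re s > - (real j + 1) \<or> (odd j \<and> (\<exists>k::nat. s = - of_nat (2 * k + 1)))"
      using s(2) by (auto simp: ramble_series_domain_def)
    have *: "s + of_nat (j + 1) \<notin> {- (2 * of_nat l) |l. True} \<and>
      mellin_conv (\<lambda>y. hankel_mix j s y * ?I y) (Re s) \<and> mellin (\<lambda>y. hankel_mix j s y * ?I y) s = R s"
      using cases
    proof
      assume r: "Re s > - (real j + 1)"
      have p: "Re (s + of_nat (j + 1)) > 0" using r by simp
      have "s + of_nat (j + 1) \<noteq> - (2 * of_nat l)" for l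
      proof
        assume "s + of_nat (j + 1) = - (2 * of_nat l)"
        thus False using p by (simp only:) simp
      qed
      thus ?thesis using R1[OF s(1) r] by blast
    next
      assume o: "odd j \<and> (\<exists>k::nat. s = - of_nat (2 * k + 1))"
      then obtain k where k: "s = - of_nat (2 * k + 1)" by blast
      have "\<tau> s = 0" unfolding \<tau>_def k by (rule even_phase_cancels) (use o in auto)
      moreover have "s + of_nat (j + 1) \<noteq> - (2 * of_nat l)" for l
      proof
        assume "s + of_nat (j + 1) = - (2 * of_nat l)"
        hence "of_nat (j + 1 + 2 * l) = (of_nat (2 * k + 1) :: complex)" unfolding k by (simp add: algebra_simps)
        hence "j + 1 + 2 * l = 2 * k + 1" by (simp only: of_nat_eq_iff)
        hence "even j" by presburger
        thus False using o by simp
      qed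
      ultimately show ?thesis using R2[OF s(1)] by auto
    qed
    show ?thesis using c(3)[OF _ _ s(1) ne Ran[OF s(1)]] * by auto
  qed
qed

section \<open>The series over the shifted arguments\<close>

text \<open>This is the reflection formula for shifted arguments. Derived from the recurrence of
  \<open>rGamma\<close> it holds without excluding any \<open>a\<close>.\<close>
lemma rGamma_shift_pair:
  "rGamma (a - of_nat m + 1) * rGamma (of_nat m - a) = (-1) ^ m * (rGamma (a + 1) * rGamma (- a :: complex))"
proof (induction m)
  case (Suc m)
  have 1: "rGamma (a - of_nat m) = (a - of_nat m) * rGamma (a - of_nat m + 1)" by (rule rGamma_plus1[symmetric])
  have 2: "(of_nat m - a) * rGamma (of_nat m - a + 1) = rGamma (of_nat m - a)" by (rule rGamma_plus1)
  have "rGamma (a - of_nat (Suc m) + 1) * rGamma (of_nat (Suc m) - a) = rGamma (a - of_nat m) * rGamma (of_nat m - a + 1)"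
    by (simp add: algebra_simps)
  also have "\<dots> = - (rGamma (a - of_nat m + 1) * ((of_nat m - a) * rGamma (of_nat m - a + 1)))"
    unfolding 1 by (simp add: algebra_simps)
  also have "\<dots> = - (rGamma (a - of_nat m + 1) * rGamma (of_nat m - a))" unfolding 2 ..
  also have "\<dots> = (-1) ^ Suc m * (rGamma (a + 1) * rGamma (- a))" unfolding Suc.IH by simp
  finally show ?case .
qed simp

text \<open>The Taylor coefficients of the Bessel function \<open>J\<close> in the variable
  \<open>y^2\<close>: those of \<open>I\<close> with the sign from the phases.\<close>
definition series_weight :: "nat \<Rightarrow> complex" where
  "series_weight m = (-1) ^ m / (4 ^ m * (fact m)\<^sup>2)"

text \<open>The quotient of the factors at \<open>\<nu> - 2m\<close> and at \<open>\<nu>\<close> is a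
  product of gamma values that the squared binomial coefficient reduces to \<open>series_weight
  m\<close>. If \<open>\<nu> - 2m\<close> is a negative even integer, where the odd ramble
  function may have a pole, then \<open>\<nu>\<close> is a nonnegative even integer and both
  sides vanish.\<close>
lemma ramble_term_eq:
  assumes j: "j > 0" and \<nu>: "\<nu> \<notin> neg_even" "Re (\<nu> - 2 * of_nat m) < 0"
  shows "ramble_term j \<nu> m = mellin_factor \<nu> * (series_weight m * rotated_mellin j 0 (\<nu> - 2 * of_nat m))"
proof (cases "\<nu> - 2 * of_nat m \<in> neg_even")
  case True
  hence p: "1 + (\<nu> - 2 * of_nat m) / 2 \<in> \<int>\<^sub>\<le>\<^sub>0" by (simp add: neg_even_iff)
  have e: "\<nu> / 2 - of_nat m + 1 = 1 + (\<nu> - 2 * of_nat m) / 2" by (simp add: field_simps)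
  have "rGamma (\<nu> / 2 - of_nat m + 1) = 0" unfolding e using p by (simp add: rGamma_eq_zero_iff)
  moreover have "rGamma (- \<nu> / 2) = 0"
  proof -
    obtain k :: nat where "\<nu> - 2 * of_nat m = - 2 * of_nat k" using True by (auto simp: neg_even_def)
    hence k: "\<nu> = of_int (2 * (int m - int k))" by (simp add: algebra_simps)
    have "\<not> k > m"
    proof
      assume km: "k > m"
      hence "\<nu> = - 2 * of_nat (k - m)" unfolding k by (simp add: of_nat_diff)
      thus False using \<nu>(1) km unfolding neg_even_def by fastforce
    qed
    hence "- \<nu> / 2 = - of_nat (m - k)" unfolding k by (simp add: of_nat_diff field_simps)
    thus ?thesis by (simp add: rGamma_eq_zero_iff)
  qed
  ultimately show ?thesis by (simp add: ramble_term_def mellin_factor_alt)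
next
  case False
  define a where "a = \<nu> / 2"
  have \<nu>a: "\<nu> = 2 * a" by (simp add: a_def)
  let ?z = "a - of_nat m + 1"
  have z: "?z \<notin> \<int>\<^sub>\<le>\<^sub>0"
  proof -
    have e: "1 + (\<nu> - 2 * of_nat m) / 2 = ?z" by (simp add: \<nu>a field_simps)
    show ?thesis using False unfolding neg_even_iff[symmetric] e .
  qed
  have G1: "Gamma ?z * rGamma ?z = 1" by (rule Gamma_mult_rGamma[OF z])
  have "a + 1 \<notin> \<int>\<^sub>\<le>\<^sub>0" using \<nu>(1) neg_even_iff[of \<nu>] by (simp add: a_def add.commute)
  hence G2: "Gamma (a + 1) * rGamma (a + 1) = 1" by (rule Gamma_mult_rGamma)
  have F: "rGamma (of_nat m + 1) = 1 / (fact m :: complex)"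
    using Gamma_fact[of m, where 'a = complex] by (simp add: rGamma_inverse_Gamma divide_inverse add.commute)
  have P: "2 powr (2 * a - 2 * of_nat m) = (2 powr (2 * a) / 4 ^ m :: complex)"
  proof -
    have "2 powr (2 * a - 2 * of_nat m) = (2 powr (2 * a) / 2 powr (of_nat (2 * m)) :: complex)"
      unfolding powr_diff[symmetric] by simp
    also have "(2 powr (of_nat (2 * m)) :: complex) = 2 ^ (2 * m)" by (rule powr_nat') simp
    finally show ?thesis by (simp add: power_mult)
  qed
  have c: "mellin_factor (2 * a - 2 * of_nat m) = 2 * (2 powr (2 * a) / 4 ^ m) * Gamma ?z * rGamma (of_nat m - a)"
  proof -
    have e: "1 + (2 * a - 2 * of_nat m) / 2 = ?z" "- (2 * a - 2 * of_nat m) / 2 = of_nat m - a" by (simp_all add: field_simps)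
    show ?thesis unfolding mellin_factor_alt P e ..
  qed
  have c0: "mellin_factor (2 * a) = 2 * 2 powr (2 * a) * Gamma (a + 1) * rGamma (- a)"
    unfolding mellin_factor_alt by (simp add: add.commute)
  have "(Gamma (a + 1) * (1 / fact m * rGamma ?z))\<^sup>2 * mellin_factor (2 * a - 2 * of_nat m) =
    2 * 2 powr (2 * a) / (4 ^ m * (fact m)\<^sup>2) * (Gamma (a + 1))\<^sup>2 * (Gamma ?z * rGamma ?z) * (rGamma ?z * rGamma (of_nat m - a))"
    unfolding c by (simp add: power2_eq_square mult_ac)
  also have "\<dots> = 2 * 2 powr (2 * a) * (Gamma (a + 1) * rGamma (a + 1)) * Gamma (a + 1) * rGamma (- a) * series_weight m"
    unfolding G1 rGamma_shift_pair series_weight_def by (simp add: power2_eq_square mult_ac)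
  also have "\<dots> = mellin_factor (2 * a) * series_weight m" unfolding G2 c0 by simp
  finally have main: "(Gamma (a + 1) * (1 / fact m * rGamma ?z))\<^sup>2 * mellin_factor (2 * a - 2 * of_nat m) = mellin_factor (2 * a) * series_weight m" .
  have "ramble_term j \<nu> m = (Gamma (a + 1) * (1 / fact m * rGamma ?z))\<^sup>2 * ramble (2 * j + 1) (2 * a - 2 * of_nat m)"
    unfolding ramble_term_def F by (simp add: \<nu>a)
  also have "ramble (2 * j + 1) (2 * a - 2 * of_nat m) = mellin_factor (2 * a - 2 * of_nat m) * rotated_mellin j 0 (2 * a - 2 * of_nat m)"
    by (rule ramble_odd(2)[OF j]) (use \<nu>(2) False \<nu>a in auto)
  also have "(Gamma (a + 1) * (1 / fact m * rGamma ?z))\<^sup>2 * \<dots> = mellin_factor (2 * a) * series_weight m * rotated_mellin j 0 (2 * a - 2 * of_nat m)"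
    using main by (simp only: mult.assoc[symmetric])
  finally show ?thesis unfolding \<nu>a by (simp only: mult.assoc)
qed

text \<open>Where \<open>\<nu> - 2m\<close> lies to the left of the imaginary axis, the previous formula
  removes the pole of the odd ramble function; elsewhere each factor is analytic by itself.\<close>
lemma ramble_term_analytic:
  assumes j: "j > 0" and \<nu>: "\<nu> \<notin> neg_even"
  shows "(\<lambda>z. ramble_term j z m) analytic_on {\<nu>}"
proof (cases "Re (\<nu> - 2 * of_nat m) < 0")
  case True
  have "eventually (\<lambda>z. Re z < 2 * real m) (nhds \<nu>)"
    using eventually_nhds_in_open[OF open_halfspace_Re_lt[of "2 * real m"], of \<nu>] True by simp
  hence ev: "eventually (\<lambda>z. ramble_term j z m = mellin_factor z * (series_weight m * rotated_mellin j 0 (z - 2 * of_nat m))) (nhds \<nu>)"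
    using eventually_notin_neg_even[OF \<nu>] by eventually_elim (simp add: ramble_term_eq[OF j])
  have "rotated_mellin j 0 analytic_on {s. Re s < 0}"
    using rotated_mellin_0_holomorphic[OF j] by (simp add: analytic_on_open open_halfspace_Re_lt)
  hence "(\<lambda>z. rotated_mellin j 0 (z - 2 * of_nat m)) analytic_on {\<nu>}"
    by (rule analytic_on_compose_gen[of "\<lambda>z. z - 2 * of_nat m", unfolded o_def, rotated]) (use True in \<open>auto intro!: analytic_intros\<close>)
  hence "(\<lambda>z. mellin_factor z * (series_weight m * rotated_mellin j 0 (z - 2 * of_nat m))) analytic_on {\<nu>}"
    by (intro analytic_on_mult mellin_factor_analytic[OF \<nu>] analytic_on_const)
  thus ?thesis using analytic_at_cong[OF ev refl] by blast
next
  case False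
  have r: "ramble (2 * j + 1) analytic_on {s. Re s > -1}"
    using ramble_odd(1)[OF j] by (subst analytic_on_analytic_at) auto
  have "(\<lambda>z. ramble (2 * j + 1) (z - 2 * of_nat m)) analytic_on {\<nu>}"
    by (rule analytic_on_compose_gen[OF _ r, unfolded o_def]) (use False in \<open>auto intro!: analytic_intros\<close>)
  moreover have "(\<lambda>z. rGamma (z / 2 - of_nat m + 1)) analytic_on {\<nu>}"
    by (rule analytic_on_compose[of "\<lambda>z. z / 2 - of_nat m + 1" _ rGamma, unfolded o_def]) (auto intro!: analytic_intros analytic_rGamma)
  moreover have "(\<lambda>z. Gamma (z / 2 + 1)) analytic_on {\<nu>}"
    using analytic_Gamma_half[OF \<nu>] by (simp only: add.commute)
  ultimately show ?thesis unfolding ramble_term_def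
    by (intro analytic_on_mult analytic_on_power analytic_on_const)
qed

text \<open>With nonnegative \<open>a m y\<close> the partial sums are dominated by the limit, so
  convergence of the single integral with \<open>A\<close> suffices.\<close>
theorem mellin_sums:
  fixes a :: "nat \<Rightarrow> real \<Rightarrow> real"
  assumes a: "\<And>m y. y > 0 \<Longrightarrow> a m y \<ge> 0" "\<And>y. y > 0 \<Longrightarrow> (\<lambda>m. a m y) sums A y"
    and c: "mellin_conv (\<lambda>y. f y * of_real (A y)) (Re s)" "\<And>m. mellin_conv (\<lambda>y. f y * of_real (a m y)) (Re s)"
  shows "(\<lambda>m. mellin (\<lambda>y. f y * of_real (a m y)) s) sums mellin (\<lambda>y. f y * of_real (A y)) s"
proof -
  define S where "S n y = indicat_real {0<..} y *\<^sub>R ((\<Sum>m<n. f y * of_real (a m y)) * of_real y powr (- s - 1))" for n y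
  define F where "F y = indicat_real {0<..} y *\<^sub>R (f y * of_real (A y) * of_real y powr (- s - 1))" for y
  have part: "mellin (\<lambda>y. \<Sum>m<n. f y * of_real (a m y)) s = (\<Sum>m<n. mellin (\<lambda>y. f y * of_real (a m y)) s)"
    "mellin_conv (\<lambda>y. \<Sum>m<n. f y * of_real (a m y)) (Re s)" for n
    using mellin_sum[of "{..<n}" "\<lambda>m y. f y * of_real (a m y)" s] c(2) by auto
  have iF: "integrable lborel F"
    using mellin_integrable[OF c(1)] unfolding set_integrable_def F_def .
  have mS: "S n \<in> borel_measurable lborel" for n
    using borel_measurable_integrable[OF mellin_integrable[OF part(2)[of n], unfolded set_integrable_def]]
    unfolding S_def[abs_def] .
  have "(\<lambda>n. integral\<^sup>L lborel (S n)) \<longlonglongrightarrow> integral\<^sup>L lborel F"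
  proof (rule integral_dominated_convergence[where w = "\<lambda>y. norm (F y)"])
    show "F \<in> borel_measurable lborel" using iF by (rule borel_measurable_integrable)
    show "integrable lborel (\<lambda>y. norm (F y))" using iF by (rule integrable_norm)
    show "AE y in lborel. (\<lambda>n. S n y) \<longlonglongrightarrow> F y"
    proof (rule AE_I2)
      fix y :: real
      show "(\<lambda>n. S n y) \<longlonglongrightarrow> F y"
      proof (cases "y > 0")
        case True
        have "(\<lambda>n. \<Sum>m<n. a m y) \<longlonglongrightarrow> A y" using a(2)[OF True] by (simp add: sums_def)
        hence "(\<lambda>n. f y * of_real (\<Sum>m<n. a m y)) \<longlonglongrightarrow> f y * of_real (A y)"
          by (intro tendsto_mult tendsto_const tendsto_of_real)
        hence "(\<lambda>n. \<Sum>m<n. f y * of_real (a m y)) \<longlonglongrightarrow> f y * of_real (A y)"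
          by (simp add: sum_distrib_left)
        thus ?thesis unfolding S_def F_def by (intro tendsto_scaleR tendsto_mult tendsto_const)
      qed (simp add: S_def F_def)
    qed
    show "AE y in lborel. norm (S n y) \<le> norm (F y)" for n
    proof (rule AE_I2)
      fix y :: real
      show "norm (S n y) \<le> norm (F y)"
      proof (cases "y > 0")
        case True
        have le: "(\<Sum>m<n. a m y) \<le> A y" and nn: "(\<Sum>m<n. a m y) \<ge> 0"
          using sum_le_suminf[OF sums_summable[OF a(2)[OF True]], of "{..<n}"] a(1)[OF True]
            sums_unique[OF a(2)[OF True]] by (auto intro: sum_nonneg)
        have e: "(\<Sum>m<n. f y * of_real (a m y)) = f y * of_real (\<Sum>m<n. a m y)" by (simp add: sum_distrib_left)
        have le2: "norm (f y * complex_of_real (\<Sum>m<n. a m y)) \<le> norm (f y * complex_of_real (A y))"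
          unfolding norm_mult norm_of_real using le nn by (intro mult_left_mono) auto
        show ?thesis unfolding S_def F_def e norm_scaleR norm_mult[of _ "of_real y powr (- s - 1)"]
          by (intro mult_left_mono mult_right_mono le2) auto
      qed (simp add: S_def F_def)
    qed
  qed (use mS in auto)
  moreover have "integral\<^sup>L lborel (S n) = (\<Sum>m<n. mellin (\<lambda>y. f y * of_real (a m y)) s)" for n
    by (subst part(1)[symmetric]) (simp only: mellin_def set_lebesgue_integral_def S_def[abs_def])
  moreover have "integral\<^sup>L lborel F = mellin (\<lambda>y. f y * of_real (A y)) s"
    by (simp only: mellin_def set_lebesgue_integral_def F_def[abs_def])
  ultimately show ?thesis unfolding sums_def by simp
qed

lemma mellin_conv_hankel_mix:
  assumes "j > 0" "\<sigma> < 0"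
  shows "mellin_conv (hankel_mix j \<nu>) \<sigma>"
  unfolding hankel_mix_def[abs_def]
  by (intro mellin_conv_add mellin_conv_cmult mellin_conv_cnj mellin_conv_hankel_part[OF assms])

text \<open>The monomial shifts the argument by \<open>2m\<close>, and adapting the phases of the kernel to
  the shifted argument produces the sign \<open>(-1)^m\<close>.\<close>
lemma mellin_hankel_mix_moment:
  assumes j: "j > 0" and \<nu>: "Re \<nu> - 2 * real m < 0"
  shows "mellin_conv (\<lambda>y. hankel_mix j \<nu> y * of_real ((y / 2) ^ (2 * m) / (fact m)\<^sup>2)) (Re \<nu>)"
    and "mellin (\<lambda>y. hankel_mix j \<nu> y * of_real ((y / 2) ^ (2 * m) / (fact m)\<^sup>2)) \<nu> =
      series_weight m * rotated_mellin j 0 (\<nu> - 2 * of_nat m)"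
proof -
  define k :: complex where "k = 1 / (4 ^ m * (fact m)\<^sup>2)"
  have eq: "(\<lambda>y. hankel_mix j \<nu> y * of_real ((y / 2) ^ (2 * m) / (fact m)\<^sup>2)) = (\<lambda>y. k * (hankel_mix j \<nu> y * of_real y ^ (2 * m)))"
    by (rule ext) (simp add: k_def power_divide power_mult)
  have s: "Re \<nu> - real (2 * m) < 0" using \<nu> by simp
  show "mellin_conv (\<lambda>y. hankel_mix j \<nu> y * of_real ((y / 2) ^ (2 * m) / (fact m)\<^sup>2)) (Re \<nu>)"
    unfolding eq by (intro mellin_conv_cmult mellin_conv_shift mellin_conv_hankel_mix[OF j s])
  let ?z = "\<nu> - 2 * of_nat m"
  have z: "Re ?z < 0" using \<nu> by simp
  have c: "mellin_conv (\<lambda>y. hankel_part j (of_real y)) (Re ?z)" "mellin_conv (\<lambda>y. cnj (hankel_part j (of_real y))) (Re ?z)"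
    by (intro mellin_conv_hankel_part[OF j z] mellin_conv_cnj)+
  have ei: "exp (\<i> * of_real pi * of_nat m) = (-1) ^ m"
    by (simp only: mult.commute[of _ "of_nat m"] exp_of_nat_mult) simp
  have e1: "exp (- \<i> * of_real (pi / 2) * \<nu>) = (-1) ^ m * exp (- \<i> * of_real (pi / 2) * ?z)"
  proof -
    have "- \<i> * of_real (pi / 2) * ?z = - \<i> * of_real (pi / 2) * \<nu> + \<i> * of_real pi * of_nat m" by (simp add: field_simps)
    hence "exp (- \<i> * of_real (pi / 2) * ?z) = exp (- \<i> * of_real (pi / 2) * \<nu>) * (-1) ^ m" by (simp only: exp_add ei)
    moreover have "(-1) ^ m * (x * (-1) ^ m) = x" for x :: complex by (simp add: mult_ac flip: power_mult_distrib)
    ultimately show ?thesis by simp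
  qed
  have e2: "exp (\<i> * of_real (pi / 2) * \<nu>) = (-1) ^ m * exp (\<i> * of_real (pi / 2) * ?z)"
  proof -
    have "\<i> * of_real (pi / 2) * \<nu> = \<i> * of_real (pi / 2) * ?z + \<i> * of_real pi * of_nat m" by (simp add: field_simps)
    hence "exp (\<i> * of_real (pi / 2) * \<nu>) = exp (\<i> * of_real (pi / 2) * ?z) * (-1) ^ m" by (simp only: exp_add ei)
    thus ?thesis by (rule trans[OF _ mult.commute])
  qed
  have "mellin (\<lambda>y. hankel_mix j \<nu> y * of_real ((y / 2) ^ (2 * m) / (fact m)\<^sup>2)) \<nu> = k * mellin (hankel_mix j \<nu>) ?z"
    unfolding eq mellin_cmult mellin_shift by simp
  also have "mellin (hankel_mix j \<nu>) ?z = exp (- \<i> * of_real (pi / 2) * \<nu>) * mellin (\<lambda>y. hankel_part j (of_real y)) ?z +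
     exp (\<i> * of_real (pi / 2) * \<nu>) * mellin (\<lambda>y. cnj (hankel_part j (of_real y))) ?z"
    unfolding hankel_mix_def[abs_def]
    by (simp only: mellin_add[OF mellin_conv_cmult[OF c(1)] mellin_conv_cmult[OF c(2)]] mellin_cmult)
  also have "\<dots> = (-1) ^ m * rotated_mellin j 0 ?z"
    unfolding e1 e2 rotated_mellin_def by (simp add: algebra_simps)
  finally show "mellin (\<lambda>y. hankel_mix j \<nu> y * of_real ((y / 2) ^ (2 * m) / (fact m)\<^sup>2)) \<nu> =
      series_weight m * rotated_mellin j 0 ?z"
    by (simp add: k_def series_weight_def)
qed

text \<open>Up to the common factor the terms are the Mellin integrals of the Taylor terms of
  \<open>besselI\<close>.\<close>
theorem ramble_term_tail_sums:
  assumes j: "j > 0" and \<nu>: "\<nu> \<notin> neg_even" "Re \<nu> < 2 * real L"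
    and c: "mellin_conv (\<lambda>y. hankel_mix j \<nu> y * of_real (besselI_tail L y)) (Re \<nu>)"
  shows "(\<lambda>m. ramble_term j \<nu> (m + L)) sums (mellin_factor \<nu> * mellin (\<lambda>y. hankel_mix j \<nu> y * of_real (besselI_tail L y)) \<nu>)"
proof -
  have neg: "Re \<nu> - 2 * real (m + L) < 0" for m using \<nu>(2) by simp
  have "(\<lambda>m. mellin (\<lambda>y. hankel_mix j \<nu> y * of_real ((y / 2) ^ (2 * (m + L)) / (fact (m + L))\<^sup>2)) \<nu>) sums
     mellin (\<lambda>y. hankel_mix j \<nu> y * of_real (besselI_tail L y)) \<nu>"
    by (rule mellin_sums) (use c mellin_hankel_mix_moment(1)[OF j neg] besselI_tail_sums in auto)
  hence "(\<lambda>m. mellin_factor \<nu> * (series_weight (m + L) * rotated_mellin j 0 (\<nu> - 2 * of_nat (m + L)))) sums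
     (mellin_factor \<nu> * mellin (\<lambda>y. hankel_mix j \<nu> y * of_real (besselI_tail L y)) \<nu>)"
    unfolding mellin_hankel_mix_moment(2)[OF j neg] by (rule sums_mult)
  moreover have "ramble_term j \<nu> (m + L) = mellin_factor \<nu> * (series_weight (m + L) * rotated_mellin j 0 (\<nu> - 2 * of_nat (m + L)))" for m
    by (rule ramble_term_eq[OF j \<nu>(1)]) (use neg[of m] in simp)
  ultimately show ?thesis by simp
qed

lemma mellin_conv_hankel_mix_tail:
  assumes j: "j > 0" and s: "- (real j + 1) < \<sigma>" "\<sigma> < 2 * real L"
  shows "mellin_conv (\<lambda>y. hankel_mix j \<nu> y * of_real (besselI_tail L y)) \<sigma>"
    and "Re z = \<sigma> \<Longrightarrow> mellin (\<lambda>y. hankel_mix j \<nu> y * of_real (besselI_tail L y)) z =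
      exp (- \<i> * of_real (pi / 2) * \<nu>) * mellin (\<lambda>y. hankel_part j (of_real y) * of_real (besselI_tail L y)) z +
      exp (\<i> * of_real (pi / 2) * \<nu>) * mellin (\<lambda>y. cnj (hankel_part j (of_real y) * of_real (besselI_tail L y))) z"
proof -
  note c1 = mellin_conv_hankel_part_tail[OF j s]
  note c2 = mellin_conv_cnj[OF c1]
  have eq: "(\<lambda>y. hankel_mix j \<nu> y * of_real (besselI_tail L y)) =
    (\<lambda>y. exp (- \<i> * of_real (pi / 2) * \<nu>) * (hankel_part j (of_real y) * of_real (besselI_tail L y)) +
      exp (\<i> * of_real (pi / 2) * \<nu>) * cnj (hankel_part j (of_real y) * of_real (besselI_tail L y)))"
    by (rule ext) (simp add: hankel_mix_def algebra_simps)
  show "mellin_conv (\<lambda>y. hankel_mix j \<nu> y * of_real (besselI_tail L y)) \<sigma>"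
    unfolding eq by (intro mellin_conv_add mellin_conv_cmult c1 c2)
  assume z: "Re z = \<sigma>"
  show "mellin (\<lambda>y. hankel_mix j \<nu> y * of_real (besselI_tail L y)) z =
      exp (- \<i> * of_real (pi / 2) * \<nu>) * mellin (\<lambda>y. hankel_part j (of_real y) * of_real (besselI_tail L y)) z +
      exp (\<i> * of_real (pi / 2) * \<nu>) * mellin (\<lambda>y. cnj (hankel_part j (of_real y) * of_real (besselI_tail L y))) z"
    unfolding eq mellin_add[OF mellin_conv_cmult[OF c1[folded z]] mellin_conv_cmult[OF c2[folded z]]] mellin_cmult ..
qed

text \<open>Here no Taylor term has to be removed, so the sum is the rotated integral for an even number of
  steps.\<close>
lemma ramble_term_sums_left:
  assumes j: "j > 0" and \<nu>: "\<nu> \<in> ramble_series_domain j" "Re \<nu> < 0"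
  shows "ramble_term j \<nu> sums ramble (2 * j + 2) \<nu>"
proof -
  have ne: "\<nu> \<notin> neg_even" using \<nu> by (simp add: ramble_series_domain_def)
  show ?thesis
    using ramble_term_tail_sums[OF j ne, of 0] ramble_even(3)[OF j \<nu>(2,1)] \<nu>(2)
    by (simp add: besselI_tail_0)
qed

text \<open>To the right of the imaginary axis the first \<open>L\<close> terms are split off. The remaining
  sum is an integral that is holomorphic on a strip reaching from the left half plane to
  \<open>\<nu>\<close>, and the identity theorem carries the formula along the strip.\<close>
theorem ramble_term_sums:
  assumes j: "j > 0" and \<nu>: "\<nu> \<in> ramble_series_domain j"
  shows "ramble_term j \<nu> sums ramble (2 * j + 2) \<nu>"
proof (cases "Re \<nu> < 0")
  case False
  obtain L :: nat where L: "Re \<nu> < 2 * real L" using reals_Archimedean2[of "Re \<nu> / 2"] by (auto simp: field_simps)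
  define Tl where "Tl z = mellin_factor z * mellin (\<lambda>y. hankel_mix j z y * of_real (besselI_tail L y)) z" for z
  define g where "g z = (\<Sum>m<L. ramble_term j z m) + Tl z" for z
  define S where "S = {z. -1 < Re z \<and> Re z < 2 * real L}"
  have S: "open S" "connected S"
  proof -
    show "open S" unfolding S_def by (intro open_Collect_conj open_halfspace_Re_gt open_halfspace_Re_lt)
    have "S = {z. -1 < Re z} \<inter> {z. Re z < 2 * real L}" by (auto simp: S_def)
    thus "connected S" by (auto intro!: convex_connected convex_Int convex_halfspace_Re_gt convex_halfspace_Re_lt)
  qed
  have ne: "z \<notin> neg_even" if "z \<in> S" for z using neg_even_Re[of z] that by (auto simp: S_def)
  have sg: "ramble_term j z sums g z" if z: "z \<in> S" for z
  proof -
    have "mellin_conv (\<lambda>y. hankel_mix j z y * of_real (besselI_tail L y)) (Re z)"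
      by (rule mellin_conv_hankel_mix_tail(1)[OF j]) (use z in \<open>auto simp: S_def\<close>)
    from ramble_term_tail_sums[OF j ne[OF z] _ this] have "(\<lambda>m. ramble_term j z (m + L)) sums Tl z"
      using z by (simp add: S_def Tl_def)
    thus ?thesis unfolding g_def by (subst (asm) sums_iff_shift) (simp add: add.commute)
  qed
  have "mellin (\<lambda>y. hankel_part j (of_real y) * of_real (besselI_tail L y)) holomorphic_on {s. Re s \<in> {- (real j + 1)<..<2 * real L}}"
    "mellin (\<lambda>y. cnj (hankel_part j (of_real y) * of_real (besselI_tail L y))) holomorphic_on {s. Re s \<in> {- (real j + 1)<..<2 * real L}}"
    by (intro mellin_holomorphic_on_strip mellin_conv_cnj mellin_conv_hankel_part_tail[OF j]; simp)+
  moreover have "S \<subseteq> {s. Re s \<in> {- (real j + 1)<..<2 * real L}}" by (auto simp: S_def)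
  ultimately have M: "mellin (\<lambda>y. hankel_part j (of_real y) * of_real (besselI_tail L y)) holomorphic_on S"
    "mellin (\<lambda>y. cnj (hankel_part j (of_real y) * of_real (besselI_tail L y))) holomorphic_on S"
    by (blast intro: holomorphic_on_subset)+
  have "mellin_factor analytic_on S" using mellin_factor_analytic[OF ne] by (subst analytic_on_analytic_at) blast
  hence F: "mellin_factor holomorphic_on S" by (rule analytic_imp_holomorphic)
  have Tlhol: "Tl holomorphic_on S"
  proof (rule holomorphic_transform)
    show "(\<lambda>z. mellin_factor z * (exp (- \<i> * of_real (pi / 2) * z) * mellin (\<lambda>y. hankel_part j (of_real y) * of_real (besselI_tail L y)) z +
      exp (\<i> * of_real (pi / 2) * z) * mellin (\<lambda>y. cnj (hankel_part j (of_real y) * of_real (besselI_tail L y))) z)) holomorphic_on S"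
      by (intro holomorphic_on_mult holomorphic_on_add F M) (auto intro!: holomorphic_intros)
    fix z assume "z \<in> S"
    hence "- (real j + 1) < Re z" "Re z < 2 * real L" by (auto simp: S_def)
    from mellin_conv_hankel_mix_tail(2)[OF j this refl]
    show "mellin_factor z * (exp (- \<i> * of_real (pi / 2) * z) * mellin (\<lambda>y. hankel_part j (of_real y) * of_real (besselI_tail L y)) z +
      exp (\<i> * of_real (pi / 2) * z) * mellin (\<lambda>y. cnj (hankel_part j (of_real y) * of_real (besselI_tail L y))) z) = Tl z"
      unfolding Tl_def by simp
  qed
  have "(\<lambda>z. ramble_term j z m) analytic_on S" for m
    using ramble_term_analytic[OF j ne] by (subst analytic_on_analytic_at) blast
  hence ghol: "g holomorphic_on S"
    unfolding g_def[abs_def] by (intro holomorphic_on_add holomorphic_on_sum Tlhol analytic_imp_holomorphic)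
  have "ramble (2 * j + 2) analytic_on S" using ramble_even(2)[OF j] by (subst analytic_on_analytic_at) (auto simp: S_def)
  hence rhol: "ramble (2 * j + 2) holomorphic_on S" by (rule analytic_imp_holomorphic)
  have "ramble (2 * j + 2) \<nu> = g \<nu>"
  proof (rule analytic_continuation_open[OF _ S(1) _ S(2) _ rhol ghol])
    show "open (S \<inter> {z. Re z < 0})" using S(1) by (intro open_Int open_halfspace_Re_lt)
    have "- (1/2) \<in> S \<inter> {z. Re z < 0}" using L False by (auto simp: S_def)
    thus "S \<inter> {z. Re z < 0} \<noteq> {}" by blast
    show "\<nu> \<in> S" using L False by (simp add: S_def)
    fix z assume z: "z \<in> S \<inter> {z. Re z < 0}"
    hence "z \<in> ramble_series_domain j" using ne j by (auto simp: ramble_series_domain_def S_def)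
    thus "ramble (2 * j + 2) z = g z" using ramble_term_sums_left[OF j] sg z sums_unique2 by blast
  qed auto
  thus ?thesis using sg[of \<nu>] L False by (simp add: S_def)
qed (rule ramble_term_sums_left[OF assms])

theorem theorem5p3:
  fixes j :: nat
  assumes "j > 0"
  shows "(\<forall>\<nu> \<in> ramble_series_domain j.
            (\<lambda>m. ramble_term j \<nu> m) sums ramble (2 * j + 2) \<nu>
            \<and> isCont (ramble (2 * j + 2)) \<nu>)
       \<and> (\<forall>\<nu>. \<nu> \<notin> neg_even \<longrightarrow>
            ramble (2 * j + 2) \<nu> = meromorphic_continuation (\<lambda>z. \<Sum>m. ramble_term j z m) \<nu>
            \<and> (\<forall>m. isCont (\<lambda>z. ramble_term j z m) \<nu>))
       \<and> (\<forall>\<nu> k. \<nu> / 2 = of_nat k \<longrightarrow>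
            (\<forall>m > k. ramble_term j \<nu> m = 0)
            \<and> ramble (2 * j + 2) \<nu> = (\<Sum>m\<le>k. ramble_term j \<nu> m))"
proof -
  note j = assms
  have ne: "\<nu> \<notin> neg_even" if "\<nu> \<in> ramble_series_domain j" for \<nu>
    using that by (simp add: ramble_series_domain_def)
  have right: "\<nu> \<in> ramble_series_domain j" if "\<nu> \<notin> neg_even" "Re \<nu> > - 1" for \<nu>
    using that by (simp add: ramble_series_domain_def)
  have P1: "ramble_term j \<nu> sums ramble (2 * j + 2) \<nu> \<and> isCont (ramble (2 * j + 2)) \<nu>"
    if \<nu>: "\<nu> \<in> ramble_series_domain j" for \<nu>
  proof
    show "ramble_term j \<nu> sums ramble (2 * j + 2) \<nu>" by (rule ramble_term_sums[OF j \<nu>])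
    have "ramble (2 * j + 2) analytic_on {\<nu>}"
    proof (cases "Re \<nu> < 0")
      case True
      thus ?thesis using ramble_even(3)[OF j True \<nu>] by blast
    next
      case False
      thus ?thesis by (intro ramble_even(2)[OF j]) simp
    qed
    thus "isCont (ramble (2 * j + 2)) \<nu>" by (rule analytic_at_imp_isCont)
  qed
  have F: "(\<Sum>m. ramble_term j z m) = ramble_integral (2 * j + 2) z" if z: "Re z > 0" for z
  proof -
    have "z \<notin> neg_even" using neg_even_Re[of z] z by auto
    hence "z \<in> ramble_series_domain j" using z by (intro right) auto
    thus ?thesis using P1[of z] ramble_even(1)[OF j z] by (simp add: sums_iff)
  qed
  \<comment> \<open>The continuation depends only on the values in the right half-plane, where the series converges.\<close>
  have P2: "ramble (2 * j + 2) = meromorphic_continuation (\<lambda>z. \<Sum>m. ramble_term j z m)"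
  proof -
    have "(\<forall>s. Re s > 0 \<longrightarrow> g s = ramble_integral (2 * j + 2) s) \<longleftrightarrow> (\<forall>s. Re s > 0 \<longrightarrow> g s = (\<Sum>m. ramble_term j s m))" for g
      using F by auto
    thus ?thesis unfolding ramble_def meromorphic_continuation_def by simp
  qed
  have P3: "(\<forall>m > k. ramble_term j \<nu> m = 0) \<and> ramble (2 * j + 2) \<nu> = (\<Sum>m\<le>k. ramble_term j \<nu> m)"
    if k: "\<nu> / 2 = of_nat k" for \<nu> k
  proof -
    have \<nu>: "\<nu> = of_nat (2 * k)" using k by (simp add: field_simps)
    have z: "ramble_term j \<nu> m = 0" if m: "m > k" for m
    proof -
      have "of_nat k - of_nat m + 1 = (- of_nat (m - k - 1) :: complex)" using m by (simp add: of_nat_diff)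
      hence "rGamma (\<nu> / 2 - of_nat m + 1) = 0" unfolding k by (simp add: rGamma_eq_zero_iff)
      thus ?thesis by (simp add: ramble_term_def)
    qed
    have "Re \<nu> \<ge> 0" unfolding \<nu> by simp
    hence "\<nu> \<in> ramble_series_domain j" using neg_even_Re[of \<nu>] by (intro right) auto
    hence "ramble_term j \<nu> sums ramble (2 * j + 2) \<nu>" using P1 by blast
    moreover have "ramble_term j \<nu> sums (\<Sum>m\<le>k. ramble_term j \<nu> m)" using z by (intro sums_finite) auto
    ultimately show ?thesis using z sums_unique2 by blast
  qed
  have P4: "isCont (\<lambda>z. ramble_term j z m) \<nu>" if "\<nu> \<notin> neg_even" for \<nu> m
    by (rule analytic_at_imp_isCont[OF ramble_term_analytic[OF j that]])
  show ?thesis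
    by (intro conjI ballI allI impI)
       (rule P1[THEN conjunct1] P1[THEN conjunct2] fun_cong[OF P2] P4 P3[THEN conjunct1, rule_format] P3[THEN conjunct2]; assumption)+
qed

end
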